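(* Let $A$ be a quadri-biserial algebra. Let $P$ be a biserial projective module in $\mathrm{mod}\,A$ with $\mathrm{rad}\,P=S\oplus M$, where $S$ is simple and $M$ is uniserial of length two such that $I_{\mathrm{top}\,M}$ is uniserial. Then there are two almost split sequences in $\mathrm{mod}\,A$ of the following forms: (1) $0\to \mathrm{top}\,M\to \mathrm{top}^2P\to P/M\to 0$; (2) $0\to \mathrm{top}^2P\to P/\mathrm{soc}\,P\oplus P/M\to \mathrm{top}\,P\to 0$.
   Context: $A$ is an artin algebra with Jacobson radical $J$; $\mathrm{mod}\,A$ is the category of finitely generated left $A$-modules; $A^\circ$ is the opposite algebra, and $\mathrm{mod}\,A^\circ$ is identified with the category of finitely generated right $A$-modules. $\mathrm{top}\,X=X/\mathrm{rad}\,X$ and $\mathrm{top}^2X=X/\mathrm{rad}^2X$, where $\mathrm{rad}^iX=J^iX$. $I_X$ denotes an injective envelope of $X$ (in the category $\mathrm{mod}\,A$ or $\mathrm{mod}\,A^\circ$ in which $X$ lies). A module is uniserial if any two of its submodules are comparable under inclusion. An indecomposable module $X$ is biserial if it has two non-comparable uniserial submodules $X_1,X_2$ such that (i) $X_1+X_2$ is $X$ or the largest proper submodule of $X$, and (ii) $X_1\cap X_2$ is zero or the smallest nonzero submodule of $X$. An artin algebra $A$ is biserial if every indecomposable non-uniserial projective module in $\mathrm{mod}\,A$ or $\mathrm{mod}\,A^\circ$ is biserial. A biserial artin algebra $A$ is quadri-biserial if every indecomposable projective module $Q$ in $\mathrm{mod}\,A$ and in $\mathrm{mod}\,A^\circ$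 satisfies: (a) the length of $Q$ is at most four; (b) if $\mathrm{top}(\mathrm{rad}\,Q)=S_1\oplus S_2$ with $S_1,S_2$ simple, then $I_{S_1}$ or $I_{S_2}$ is uniserial; (c) if $\mathrm{rad}\,Q=T\oplus U$ with $T$ simple and $U$ uniserial of length two, then $I_T$ and $I_{\mathrm{soc}\,U}$ are uniserial. *)

theory Defs
  imports "HOL-Algebra.Module" "HOL-Algebra.QuotRing" "HOL-Algebra.Ideal_Product"
    "HOL-Algebra.Generated_Groups"
begin

text \<open>
  The locale \<open>module\<close> of HOL-Algebra needs a commutative ring of scalars. The following locale has
  the same axioms over an arbitrary ring. It uses the same record (whose fields \<open>mult\<close> and \<open>one\<close>
  have no meaning for a module) and the library's locale \<open>submodule\<close>.
\<close>

locale lmodule = R?: ring R + M?: abelian_group M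
  for R :: "('a, 'r) ring_scheme" (structure) and M :: "('a, 'b) module" (structure) +
  assumes smult_closed [simp, intro]:
      "\<lbrakk>a \<in> carrier R; x \<in> carrier M\<rbrakk> \<Longrightarrow> a \<odot>\<^bsub>M\<^esub> x \<in> carrier M"
    and smult_l_distr:
      "\<lbrakk>a \<in> carrier R; b \<in> carrier R; x \<in> carrier M\<rbrakk> \<Longrightarrow>
      (a \<oplus> b) \<odot>\<^bsub>M\<^esub> x = a \<odot>\<^bsub>M\<^esub> x \<oplus>\<^bsub>M\<^esub> b \<odot>\<^bsub>M\<^esub> x"
    and smult_r_distr:
      "\<lbrakk>a \<in> carrier R; x \<in> carrier M; y \<in> carrier M\<rbrakk> \<Longrightarrow>
      a \<odot>\<^bsub>M\<^esub> (x \<oplus>\<^bsub>M\<^esub> y) = a \<odot>\<^bsub>M\<^esub> x \<oplus>\<^bsub>M\<^esub> a \<odot>\<^bsub>M\<^esub> y"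
    and smult_assoc1:
      "\<lbrakk>a \<in> carrier R; b \<in> carrier R; x \<in> carrier M\<rbrakk> \<Longrightarrow>
      (a \<otimes> b) \<odot>\<^bsub>M\<^esub> x = a \<odot>\<^bsub>M\<^esub> (b \<odot>\<^bsub>M\<^esub> x)"
    and smult_one [simp]:
      "x \<in> carrier M \<Longrightarrow> \<one> \<odot>\<^bsub>M\<^esub> x = x"

definition submodule_span ::
    "('a, 'r) ring_scheme \<Rightarrow> ('a, 'b) module \<Rightarrow> 'b set \<Rightarrow> 'b set" where
  "submodule_span A M S = \<Inter>{N. submodule N A M \<and> S \<subseteq> N}"

definition fg_module :: "('a, 'r) ring_scheme \<Rightarrow> ('a, 'b) module \<Rightarrow> bool" where
  "fg_module A M \<longleftrightarrow> lmodule A M \<and>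
     (\<exists>S. finite S \<and> S \<subseteq> carrier M \<and> submodule_span A M S = carrier M)"

definition module_hom ::
    "('a, 'r) ring_scheme \<Rightarrow> ('a, 'b) module \<Rightarrow> ('a, 'c) module \<Rightarrow> ('b \<Rightarrow> 'c) set" where
  "module_hom A M N = {f \<in> hom (add_monoid M) (add_monoid N).
     \<forall>a\<in>carrier A. \<forall>x\<in>carrier M. f (a \<odot>\<^bsub>M\<^esub> x) = a \<odot>\<^bsub>N\<^esub> f x}"

text \<open>
  A definition in HOL cannot quantify over the carrier types of modules. Where a definition below
  quantifies over all finitely generated modules, it quantifies over those with carrier type
  \<^typ>\<open>(nat \<Rightarrow> 'a) set\<close>. Nothing is lost: every finitely generated module, on any carrier type, is
  isomorphic to one of these, as a quotient of some \<open>A\<^sup>n\<close> (lemma \<open>fg_module_representative\<close>).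
\<close>

type_synonym 'a fgmod = "('a, (nat \<Rightarrow> 'a) set) module"

lemma (in lmodule) smult_zero_right:
  assumes "a \<in> carrier R" shows "a \<odot>\<^bsub>M\<^esub> \<zero>\<^bsub>M\<^esub> = \<zero>\<^bsub>M\<^esub>"
proof -
  have "a \<odot>\<^bsub>M\<^esub> \<zero>\<^bsub>M\<^esub> \<oplus>\<^bsub>M\<^esub> a \<odot>\<^bsub>M\<^esub> \<zero>\<^bsub>M\<^esub> = a \<odot>\<^bsub>M\<^esub> \<zero>\<^bsub>M\<^esub>"
    using smult_r_distr[OF assms, of "\<zero>\<^bsub>M\<^esub>" "\<zero>\<^bsub>M\<^esub>"] by simp
  then show ?thesis
    using assms by (simp add: M.add.r_cancel_one)
qed

lemma (in lmodule) smult_zero_left: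
  assumes "x \<in> carrier M" shows "\<zero> \<odot>\<^bsub>M\<^esub> x = \<zero>\<^bsub>M\<^esub>"
proof -
  have "\<zero> \<odot>\<^bsub>M\<^esub> x \<oplus>\<^bsub>M\<^esub> \<zero> \<odot>\<^bsub>M\<^esub> x = \<zero> \<odot>\<^bsub>M\<^esub> x"
    using smult_l_distr[of "\<zero>" "\<zero>" x] assms by simp
  then show ?thesis
    using assms by (simp add: M.add.r_cancel_one)
qed

lemma (in lmodule) smult_uminus_one:
  assumes "x \<in> carrier M" shows "(\<ominus> \<one>) \<odot>\<^bsub>M\<^esub> x = \<ominus>\<^bsub>M\<^esub> x"
proof -
  have "(\<ominus> \<one>) \<odot>\<^bsub>M\<^esub> x \<oplus>\<^bsub>M\<^esub> x = ((\<ominus> \<one>) \<oplus> \<one>) \<odot>\<^bsub>M\<^esub> x"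
    using assms by (simp add: smult_l_distr)
  also have "\<dots> = \<zero>\<^bsub>M\<^esub>"
    using assms by (simp add: R.l_neg smult_zero_left)
  finally show ?thesis
    using assms by (simp add: M.minus_equality)
qed

lemma (in lmodule) lsubmoduleI:
  assumes "N \<subseteq> carrier M" "\<zero>\<^bsub>M\<^esub> \<in> N"
    and "\<And>x y. x \<in> N \<Longrightarrow> y \<in> N \<Longrightarrow> x \<oplus>\<^bsub>M\<^esub> y \<in> N"
    and "\<And>a x. a \<in> carrier R \<Longrightarrow> x \<in> N \<Longrightarrow> a \<odot>\<^bsub>M\<^esub> x \<in> N"
  shows "submodule N R M"
proof -
  have "\<ominus>\<^bsub>M\<^esub> x \<in> N" if "x \<in> N" for x
    using assms(4)[of "\<ominus> \<one>" x] smult_uminus_one[of x] that assms(1) by auto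
  then have "subgroup N (add_monoid M)"
    using assms by (intro subgroup.intro) (auto simp flip: a_inv_def)
  then show ?thesis
    using assms(4) by (auto intro!: submodule.intro simp: submodule_axioms_def)
qed

lemma (in lmodule) finsum_smult:
  assumes "finite I" "a \<in> carrier R" "f \<in> I \<rightarrow> carrier M"
  shows "a \<odot>\<^bsub>M\<^esub> finsum M f I = finsum M (\<lambda>i. a \<odot>\<^bsub>M\<^esub> f i) I"
  using assms
proof (induction I rule: finite_induct)
  case (insert j I)
  then have "f \<in> I \<rightarrow> carrier M" "f j \<in> carrier M" "(\<lambda>i. a \<odot>\<^bsub>M\<^esub> f i) \<in> I \<rightarrow> carrier M"
    by auto
  with insert show ?case
    by (simp add: smult_r_distr)
qed (simp add: smult_zero_right)

lemma fg_module_representative: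
  fixes A :: "('a, 'r) ring_scheme" and M :: "('a, 'b) module"
  assumes "fg_module A M"
  shows "\<exists>(N :: 'a fgmod) f. fg_module A N \<and> f \<in> module_hom A M N \<and>
    bij_betw f (carrier M) (carrier N)"
proof -
  interpret lmodule A M
    using assms by (simp add: fg_module_def)
  obtain S where S: "finite S" "S \<subseteq> carrier M" "submodule_span A M S = carrier M"
    using assms by (auto simp: fg_module_def)
  obtain n :: nat and m where m: "S = m ` {..<n}"
    using finite_imp_nat_seg_image_inj_on[OF S(1)] by (auto simp: lessThan_def)
  have mc: "m i \<in> carrier M" if "i < n" for i
    using S(2) m that by auto
  define c where "c v = finsum M (\<lambda>i. v i \<odot>\<^bsub>M\<^esub> m i) {..<n}" for v :: "nat \<Rightarrow> 'a"
  define V where "V = (UNIV :: nat set) \<rightarrow> carrier A"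
  have c_closed: "c v \<in> carrier M" if "v \<in> V" for v
    using that mc by (auto simp: c_def V_def intro!: M.finsum_closed)
  have sub: "submodule (c ` V) A M"
  proof (rule lsubmoduleI)
    show "c ` V \<subseteq> carrier M"
      using c_closed by auto
    have "c (\<lambda>_. \<zero>\<^bsub>A\<^esub>) = finsum M (\<lambda>i. \<zero>\<^bsub>M\<^esub>) {..<n}"
      unfolding c_def using mc by (intro M.finsum_cong') (auto simp: smult_zero_left)
    then have "c (\<lambda>_. \<zero>\<^bsub>A\<^esub>) = \<zero>\<^bsub>M\<^esub>"
      by simp
    then show "\<zero>\<^bsub>M\<^esub> \<in> c ` V"
      by (metis (no_types, lifting) PiE Pi_I R.zero_closed V_def image_eqI)
  next
    fix x y assume "x \<in> c ` V" "y \<in> c ` V"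
    then obtain v w where vw: "v \<in> V" "w \<in> V" "x = c v" "y = c w"
      by auto
    have "x \<oplus>\<^bsub>M\<^esub> y = finsum M (\<lambda>i. v i \<odot>\<^bsub>M\<^esub> m i \<oplus>\<^bsub>M\<^esub> w i \<odot>\<^bsub>M\<^esub> m i) {..<n}"
      using vw mc by (auto simp: c_def V_def intro!: M.finsum_addf[symmetric])
    also have "\<dots> = c (\<lambda>i. v i \<oplus>\<^bsub>A\<^esub> w i)"
      unfolding c_def using vw mc by (intro M.finsum_cong') (auto simp: V_def Pi_iff smult_l_distr)
    finally show "x \<oplus>\<^bsub>M\<^esub> y \<in> c ` V"
      using vw by (auto simp: V_def intro!: image_eqI[where x = "\<lambda>i. v i \<oplus>\<^bsub>A\<^esub> w i"])
  next
    fix a x assume a: "a \<in> carrier A" and "x \<in> c ` V"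
    then obtain v where v: "v \<in> V" "x = c v"
      by auto
    have "a \<odot>\<^bsub>M\<^esub> x = finsum M (\<lambda>i. a \<odot>\<^bsub>M\<^esub> (v i \<odot>\<^bsub>M\<^esub> m i)) {..<n}"
      using v mc a by (auto simp: c_def V_def intro!: finsum_smult)
    also have "\<dots> = c (\<lambda>i. a \<otimes>\<^bsub>A\<^esub> v i)"
      unfolding c_def using v mc a by (intro M.finsum_cong') (auto simp: V_def Pi_iff smult_assoc1)
    finally show "a \<odot>\<^bsub>M\<^esub> x \<in> c ` V"
      using v a by (auto simp: V_def intro!: image_eqI[where x = "\<lambda>i. a \<otimes>\<^bsub>A\<^esub> v i"])
  qed
  have "m j \<in> c ` V" if j: "j < n" for j
  proof -
    let ?e = "\<lambda>i. if i = j then \<one>\<^bsub>A\<^esub> else \<zero>\<^bsub>A\<^esub>"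
    have "c ?e = finsum M (\<lambda>i. if j = i then m i else \<zero>\<^bsub>M\<^esub>) {..<n}"
      unfolding c_def using mc by (intro M.finsum_cong') (auto simp: smult_zero_left)
    also have "\<dots> = m j"
      using mc j by (intro M.finsum_singleton) auto
    finally show ?thesis
      by (auto simp: V_def intro!: image_eqI[where x = ?e])
  qed
  then have "S \<subseteq> c ` V"
    using m by auto
  then have onto: "c ` V = carrier M"
    using S(3) sub c_closed by (auto simp: submodule_span_def)
  define f where "f x = {v \<in> V. c v = x}" for x
  have inj: "inj_on f (carrier M)"
  proof (rule inj_onI)
    fix x y assume "x \<in> carrier M" "f x = f y"
    moreover from this(1) obtain v where "v \<in> V" "c v = x"
      using onto by (metis imageE)
    ultimately show "x = y"
      by (auto simp: f_def)
  qed
  define g where "g = inv_into (carrier M) f"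
  have gf [simp]: "g (f x) = x" if "x \<in> carrier M" for x
    using inj that by (simp add: g_def)
  define N :: "'a fgmod" where
    "N = \<lparr>carrier = f ` carrier M, mult = undefined, one = undefined, zero = f \<zero>\<^bsub>M\<^esub>,
       add = \<lambda>x y. f (g x \<oplus>\<^bsub>M\<^esub> g y), smult = \<lambda>a x. f (a \<odot>\<^bsub>M\<^esub> g x)\<rparr>"
  have [simp]: "carrier N = f ` carrier M" "\<zero>\<^bsub>N\<^esub> = f \<zero>\<^bsub>M\<^esub>" "x \<oplus>\<^bsub>N\<^esub> y = f (g x \<oplus>\<^bsub>M\<^esub> g y)"
    "a \<odot>\<^bsub>N\<^esub> x = f (a \<odot>\<^bsub>M\<^esub> g x)" for x y a
    by (simp_all add: N_def)
  have "abelian_group N"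
  proof (rule abelian_groupI)
    fix x assume "x \<in> carrier N"
    then obtain u where "u \<in> carrier M" "x = f u"
      by auto
    then show "\<exists>y\<in>carrier N. y \<oplus>\<^bsub>N\<^esub> x = \<zero>\<^bsub>N\<^esub>"
      by (auto intro!: bexI[of _ "\<ominus>\<^bsub>M\<^esub> u"] simp: M.l_neg)
  qed (auto simp: M.add.m_ac)
  then have lmod: "lmodule A N"
    by (intro lmodule.intro lmodule_axioms.intro R.ring_axioms)
      (auto simp: smult_l_distr smult_r_distr smult_assoc1)
  interpret N: lmodule A N
    by (fact lmod)
  have "f ` carrier M \<subseteq> L" if L: "submodule L A N" "f ` S \<subseteq> L" for L
  proof -
    interpret L: submodule L A N
      by (fact L(1))
    have "submodule {x \<in> carrier M. f x \<in> L} A M"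
    proof (rule lsubmoduleI)
      fix x y assume "x \<in> {x \<in> carrier M. f x \<in> L}" "y \<in> {x \<in> carrier M. f x \<in> L}"
      then show "x \<oplus>\<^bsub>M\<^esub> y \<in> {x \<in> carrier M. f x \<in> L}"
        using L.m_closed[of "f x" "f y"] by auto
    next
      fix a x assume "a \<in> carrier A" "x \<in> {x \<in> carrier M. f x \<in> L}"
      then show "a \<odot>\<^bsub>M\<^esub> x \<in> {x \<in> carrier M. f x \<in> L}"
        using L.smult_closed[of a "f x"] by auto
    qed (use L.one_closed in auto)
    moreover have "S \<subseteq> {x \<in> carrier M. f x \<in> L}"
      using S(2) L(2) by auto
    ultimately have "submodule_span A M S \<subseteq> {x \<in> carrier M. f x \<in> L}"
      by (auto simp: submodule_span_def)
    then show ?thesis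
      using S(3) by auto
  qed
  moreover have "submodule (carrier N) A N"
    by (rule N.lsubmoduleI) auto
  ultimately have "submodule_span A N (f ` S) = carrier N"
    using S(2) unfolding submodule_span_def
    by (intro equalityI Inter_lower Inter_greatest) (auto simp: image_mono)
  then have "fg_module A N"
    unfolding fg_module_def using lmod S(1,2) by (intro conjI exI[of _ "f ` S"]) auto
  moreover have "f \<in> module_hom A M N"
    by (auto simp: module_hom_def hom_def)
  moreover have "bij_betw f (carrier M) (carrier N)"
    using inj by (simp add: bij_betw_def)
  ultimately show ?thesis
    by blast
qed

definition sub :: "('a, 'b) module \<Rightarrow> 'b set \<Rightarrow> ('a, 'b) module" where
  "sub M N = M\<lparr>carrier := N\<rparr>"

definition quot :: "('a, 'b) module \<Rightarrow> 'b set \<Rightarrow> ('a, 'b set) module" where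
  "quot M N = \<lparr>carrier = a_rcosets\<^bsub>M\<^esub> N, mult = undefined, one = undefined, zero = N,
     add = set_add M, smult = \<lambda>a C. \<Union>x\<in>C. N +>\<^bsub>M\<^esub> (a \<odot>\<^bsub>M\<^esub> x)\<rparr>"

definition dsum :: "('a, 'b) module \<Rightarrow> ('a, 'c) module \<Rightarrow> ('a, 'b \<times> 'c) module" where
  "dsum M N = \<lparr>carrier = carrier M \<times> carrier N, mult = undefined, one = undefined,
     zero = (\<zero>\<^bsub>M\<^esub>, \<zero>\<^bsub>N\<^esub>),
     add = \<lambda>(x, y) (x', y'). (x \<oplus>\<^bsub>M\<^esub> x', y \<oplus>\<^bsub>N\<^esub> y'),
     smult = \<lambda>a (x, y). (a \<odot>\<^bsub>M\<^esub> x, a \<odot>\<^bsub>N\<^esub> y)\<rparr>"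

text \<open>The internal direct sum decomposition \<open>K = N \<oplus> L\<close> with \<open>N\<close>, \<open>L\<close> submodules of \<open>X\<close>.\<close>

definition direct_decomp ::
    "('a, 'r) ring_scheme \<Rightarrow> ('a, 'b) module \<Rightarrow> 'b set \<Rightarrow> 'b set \<Rightarrow> 'b set \<Rightarrow> bool" where
  "direct_decomp A X K N L \<longleftrightarrow> submodule N A X \<and> submodule L A X \<and>
     N \<inter> L = {\<zero>\<^bsub>X\<^esub>} \<and> K = N <+>\<^bsub>X\<^esub> L"

definition indecomposable :: "('a, 'r) ring_scheme \<Rightarrow> ('a, 'b) module \<Rightarrow> bool" where
  "indecomposable A X \<longleftrightarrow> lmodule A X \<and> carrier X \<noteq> {\<zero>\<^bsub>X\<^esub>} \<and>
     (\<forall>N L. direct_decomp A X (carrier X) N L \<longrightarrow> N = {\<zero>\<^bsub>X\<^esub>} \<or> L = {\<zero>\<^bsub>X\<^esub>})"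

definition simple_module :: "('a, 'r) ring_scheme \<Rightarrow> ('a, 'b) module \<Rightarrow> bool" where
  "simple_module A X \<longleftrightarrow> lmodule A X \<and> carrier X \<noteq> {\<zero>\<^bsub>X\<^esub>} \<and>
     (\<forall>N. submodule N A X \<longrightarrow> N = {\<zero>\<^bsub>X\<^esub>} \<or> N = carrier X)"

definition uniserial :: "('a, 'r) ring_scheme \<Rightarrow> ('a, 'b) module \<Rightarrow> bool" where
  "uniserial A X \<longleftrightarrow> lmodule A X \<and>
     (\<forall>N L. submodule N A X \<longrightarrow> submodule L A X \<longrightarrow> N \<subseteq> L \<or> L \<subseteq> N)"

text \<open>\<open>X\<close> has a composition series with \<open>n\<close> factors.\<close>

definition has_length :: "('a, 'r) ring_scheme \<Rightarrow> ('a, 'b) module \<Rightarrow> nat \<Rightarrow> bool" where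
  "has_length A X n \<longleftrightarrow> lmodule A X \<and>
     (\<exists>C. C 0 = {\<zero>\<^bsub>X\<^esub>} \<and> C n = carrier X \<and> (\<forall>i\<le>n. submodule (C i) A X) \<and>
       (\<forall>i<n. C i \<subseteq> C (Suc i) \<and> simple_module A (quot (sub X (C (Suc i))) (C i))))"

definition socle :: "('a, 'r) ring_scheme \<Rightarrow> ('a, 'b) module \<Rightarrow> 'b set" where
  "socle A X = submodule_span A X (\<Union>{N. submodule N A X \<and> simple_module A (sub X N)})"

text \<open>
  The ring \<open>A\<close> as a left module over \<open>k\<close> along \<open>\<phi> : k \<rightarrow> A\<close>. For \<open>\<phi> = id\<close> this is the left regular
  module, whose submodules are the left ideals of \<open>A\<close>.
\<close>

definition scalar_module ::
    "('a, 'r) ring_scheme \<Rightarrow> ('k \<Rightarrow> 'a) \<Rightarrow> ('k, 'a) module" where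
  "scalar_module A \<phi> = \<lparr>carrier = carrier A, mult = mult A, one = one A,
     zero = zero A, add = add A, smult = \<lambda>r x. \<phi> r \<otimes>\<^bsub>A\<^esub> x\<rparr>"

definition maximal_left_ideal :: "'a set \<Rightarrow> ('a, 'r) ring_scheme \<Rightarrow> bool" where
  "maximal_left_ideal I A \<longleftrightarrow> submodule I A (scalar_module A id) \<and> I \<noteq> carrier A \<and>
     (\<forall>K. submodule K A (scalar_module A id) \<longrightarrow> I \<subseteq> K \<longrightarrow> K = I \<or> K = carrier A)"

definition jacobson_radical :: "('a, 'r) ring_scheme \<Rightarrow> 'a set" where
  "jacobson_radical A = carrier A \<inter> \<Inter>{I. maximal_left_ideal I A}"

primrec ideal_pow :: "('a, 'r) ring_scheme \<Rightarrow> 'a set \<Rightarrow> nat \<Rightarrow> 'a set" where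
  "ideal_pow A I 0 = carrier A"
| "ideal_pow A I (Suc n) = ideal_prod A I (ideal_pow A I n)"

text \<open>\<open>rad_pow A i X\<close> is \<open>rad\<^sup>i X = J\<^sup>i X\<close>, and \<open>top_pow A i X\<close> is \<open>top\<^sup>i X = X / rad\<^sup>i X\<close>.\<close>

definition rad_pow :: "('a, 'r) ring_scheme \<Rightarrow> nat \<Rightarrow> ('a, 'b) module \<Rightarrow> 'b set" where
  "rad_pow A i X = generate (add_monoid X)
     {a \<odot>\<^bsub>X\<^esub> x | a x. a \<in> ideal_pow A (jacobson_radical A) i \<and> x \<in> carrier X}"

definition top_pow :: "('a, 'r) ring_scheme \<Rightarrow> nat \<Rightarrow> ('a, 'b) module \<Rightarrow> ('a, 'b set) module" where
  "top_pow A i X = quot X (rad_pow A i X)"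

definition projective_module :: "('a, 'r) ring_scheme \<Rightarrow> ('a, 'b) module \<Rightarrow> bool" where
  "projective_module A Q \<longleftrightarrow> fg_module A Q \<and>
     (\<forall>(X :: 'a fgmod) (Y :: 'a fgmod) g h. fg_module A X \<longrightarrow> fg_module A Y \<longrightarrow>
        g \<in> module_hom A X Y \<longrightarrow> g ` carrier X = carrier Y \<longrightarrow> h \<in> module_hom A Q Y \<longrightarrow>
        (\<exists>t\<in>module_hom A Q X. \<forall>q\<in>carrier Q. g (t q) = h q))"

definition injective_module :: "('a, 'r) ring_scheme \<Rightarrow> ('a, 'b) module \<Rightarrow> bool" where
  "injective_module A E \<longleftrightarrow> fg_module A E \<and>
     (\<forall>(X :: 'a fgmod) (Y :: 'a fgmod) f h. fg_module A X \<longrightarrow> fg_module A Y \<longrightarrow>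
        f \<in> module_hom A X Y \<longrightarrow> inj_on f (carrier X) \<longrightarrow> h \<in> module_hom A X E \<longrightarrow>
        (\<exists>t\<in>module_hom A Y E. \<forall>x\<in>carrier X. t (f x) = h x))"

definition injective_envelope ::
    "('a, 'r) ring_scheme \<Rightarrow> ('a, 'b) module \<Rightarrow> ('a, 'c) module \<Rightarrow> ('b \<Rightarrow> 'c) \<Rightarrow> bool" where
  "injective_envelope A X E f \<longleftrightarrow> injective_module A E \<and>
     f \<in> module_hom A X E \<and> inj_on f (carrier X) \<and>
     (\<forall>N. submodule N A E \<longrightarrow> N \<inter> f ` carrier X = {\<zero>\<^bsub>E\<^esub>} \<longrightarrow> N = {\<zero>\<^bsub>E\<^esub>})"

text \<open>Over an artin algebra injective envelopes exist in this category and are unique up to isomorphism, so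
  it does not matter which envelope \<open>E\<close> is taken.\<close>

definition uniserial_envelope :: "('a, 'r) ring_scheme \<Rightarrow> ('a, 'b) module \<Rightarrow> bool" where
  "uniserial_envelope A X \<longleftrightarrow>
     (\<exists>(E :: 'a fgmod) f. injective_envelope A X E f \<and> uniserial A E)"

definition artinian_cring :: "('k, 's) ring_scheme \<Rightarrow> bool" where
  "artinian_cring k \<longleftrightarrow> cring k \<and>
     (\<forall>I :: nat \<Rightarrow> 'k set. (\<forall>n. ideal (I n) k \<and> I (Suc n) \<subseteq> I n) \<longrightarrow> (\<exists>m. \<forall>n\<ge>m. I n = I m))"

definition artin_algebra ::
    "('k, 's) ring_scheme \<Rightarrow> ('k \<Rightarrow> 'a) \<Rightarrow> ('a, 'r) ring_scheme \<Rightarrow> bool" where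
  "artin_algebra k \<phi> A \<longleftrightarrow> artinian_cring k \<and> ring A \<and> \<phi> \<in> ring_hom k A \<and>
     (\<forall>r\<in>carrier k. \<forall>x\<in>carrier A. \<phi> r \<otimes>\<^bsub>A\<^esub> x = x \<otimes>\<^bsub>A\<^esub> \<phi> r) \<and>
     fg_module k (scalar_module A \<phi>)"

text \<open>Right \<open>A\<close>-modules are treated as left modules over the opposite ring.\<close>

definition op_ring :: "('a, 'r) ring_scheme \<Rightarrow> ('a, 'r) ring_scheme" where
  "op_ring A = A\<lparr>mult := \<lambda>x y. y \<otimes>\<^bsub>A\<^esub> x\<rparr>"

definition biserial_module :: "('a, 'r) ring_scheme \<Rightarrow> ('a, 'b) module \<Rightarrow> bool" where
  "biserial_module A X \<longleftrightarrow> fg_module A X \<and> indecomposable A X \<and>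
     (\<exists>X1 X2. submodule X1 A X \<and> submodule X2 A X \<and>
        uniserial A (sub X X1) \<and> uniserial A (sub X X2) \<and> \<not> X1 \<subseteq> X2 \<and> \<not> X2 \<subseteq> X1 \<and>
        (X1 <+>\<^bsub>X\<^esub> X2 = carrier X \<or>
         (submodule (X1 <+>\<^bsub>X\<^esub> X2) A X \<and> X1 <+>\<^bsub>X\<^esub> X2 \<noteq> carrier X \<and>
          (\<forall>N. submodule N A X \<longrightarrow> N \<noteq> carrier X \<longrightarrow> N \<subseteq> X1 <+>\<^bsub>X\<^esub> X2))) \<and>
        (X1 \<inter> X2 = {\<zero>\<^bsub>X\<^esub>} \<or>
         (submodule (X1 \<inter> X2) A X \<and> X1 \<inter> X2 \<noteq> {\<zero>\<^bsub>X\<^esub>} \<and>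
          (\<forall>N. submodule N A X \<longrightarrow> N \<noteq> {\<zero>\<^bsub>X\<^esub>} \<longrightarrow> X1 \<inter> X2 \<subseteq> N))))"

definition biserial_algebra ::
    "('k, 's) ring_scheme \<Rightarrow> ('k \<Rightarrow> 'a) \<Rightarrow> ('a, 'r) ring_scheme \<Rightarrow> bool" where
  "biserial_algebra k \<phi> A \<longleftrightarrow> artin_algebra k \<phi> A \<and>
     (\<forall>B\<in>{A, op_ring A}. \<forall>Q :: 'a fgmod.
        projective_module B Q \<longrightarrow> indecomposable B Q \<longrightarrow> \<not> uniserial B Q \<longrightarrow> biserial_module B Q)"

definition quadri_biserial ::
    "('k, 's) ring_scheme \<Rightarrow> ('k \<Rightarrow> 'a) \<Rightarrow> ('a, 'r) ring_scheme \<Rightarrow> bool" where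
  "quadri_biserial k \<phi> A \<longleftrightarrow> biserial_algebra k \<phi> A \<and>
     (\<forall>B\<in>{A, op_ring A}. \<forall>Q :: 'a fgmod. projective_module B Q \<longrightarrow> indecomposable B Q \<longrightarrow>
        (\<exists>n\<le>4. has_length B Q n) \<and>
        (let X = top_pow B 1 (sub Q (rad_pow B 1 Q)) in
          \<forall>S1 S2. direct_decomp B X (carrier X) S1 S2 \<longrightarrow>
            simple_module B (sub X S1) \<longrightarrow> simple_module B (sub X S2) \<longrightarrow>
            uniserial_envelope B (sub X S1) \<or> uniserial_envelope B (sub X S2)) \<and>
        (\<forall>T U. direct_decomp B Q (rad_pow B 1 Q) T U \<longrightarrow> simple_module B (sub Q T) \<longrightarrow>
           uniserial B (sub Q U) \<longrightarrow> has_length B (sub Q U) 2 \<longrightarrow>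
           uniserial_envelope B (sub Q T) \<and>
           uniserial_envelope B (sub Q (socle B (sub Q U)))))"

definition split_mono ::
    "('a, 'r) ring_scheme \<Rightarrow> ('a, 'b) module \<Rightarrow> ('a, 'c) module \<Rightarrow> ('b \<Rightarrow> 'c) \<Rightarrow> bool" where
  "split_mono A X Y f \<longleftrightarrow> (\<exists>r\<in>module_hom A Y X. \<forall>x\<in>carrier X. r (f x) = x)"

definition split_epi ::
    "('a, 'r) ring_scheme \<Rightarrow> ('a, 'b) module \<Rightarrow> ('a, 'c) module \<Rightarrow> ('b \<Rightarrow> 'c) \<Rightarrow> bool" where
  "split_epi A Y Z g \<longleftrightarrow> (\<exists>s\<in>module_hom A Z Y. \<forall>z\<in>carrier Z. g (s z) = z)"

definition left_almost_split ::
    "('a, 'r) ring_scheme \<Rightarrow> ('a, 'b) module \<Rightarrow> ('a, 'c) module \<Rightarrow> ('b \<Rightarrow> 'c) \<Rightarrow> bool" where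
  "left_almost_split A X Y f \<longleftrightarrow> f \<in> module_hom A X Y \<and> \<not> split_mono A X Y f \<and>
     (\<forall>(W :: 'a fgmod) h. fg_module A W \<longrightarrow> h \<in> module_hom A X W \<longrightarrow> \<not> split_mono A X W h \<longrightarrow>
        (\<exists>t\<in>module_hom A Y W. \<forall>x\<in>carrier X. t (f x) = h x))"

definition right_almost_split ::
    "('a, 'r) ring_scheme \<Rightarrow> ('a, 'b) module \<Rightarrow> ('a, 'c) module \<Rightarrow> ('b \<Rightarrow> 'c) \<Rightarrow> bool" where
  "right_almost_split A Y Z g \<longleftrightarrow> g \<in> module_hom A Y Z \<and> \<not> split_epi A Y Z g \<and>
     (\<forall>(W :: 'a fgmod) h. fg_module A W \<longrightarrow> h \<in> module_hom A W Z \<longrightarrow> \<not> split_epi A W Z h \<longrightarrow>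
        (\<exists>t\<in>module_hom A W Y. \<forall>w\<in>carrier W. g (t w) = h w))"

text \<open>An almost split sequence \<open>0 \<rightarrow> X \<rightarrow> Y \<rightarrow> Z \<rightarrow> 0\<close> with maps \<open>f\<close> and \<open>g\<close>.\<close>

definition almost_split_sequence ::
    "('a, 'r) ring_scheme \<Rightarrow> ('a, 'b) module \<Rightarrow> ('a, 'c) module \<Rightarrow> ('a, 'd) module \<Rightarrow>
     ('b \<Rightarrow> 'c) \<Rightarrow> ('c \<Rightarrow> 'd) \<Rightarrow> bool" where
  "almost_split_sequence A X Y Z f g \<longleftrightarrow>
     fg_module A X \<and> fg_module A Y \<and> fg_module A Z \<and>
     f \<in> module_hom A X Y \<and> g \<in> module_hom A Y Z \<and>
     inj_on f (carrier X) \<and> f ` carrier X = {y \<in> carrier Y. g y = \<zero>\<^bsub>Z\<^esub>} \<and>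
     g ` carrier Y = carrier Z \<and>
     left_almost_split A X Y f \<and> right_almost_split A Y Z g"

end

theory Submission
  imports Defs
begin

text \<open>
  Write \<open>L = soc M\<close> and \<open>N = top M\<close>, so that \<open>top\<^sup>2P = P/L\<close>. For a sequence \<open>0 \<rightarrow> X \<rightarrow> Y \<rightarrow> Z \<rightarrow> 0\<close> in which every
  endomorphism of \<open>Z\<close> is bijective or has square zero, it is enough to show that \<open>X \<rightarrow> Y\<close> is left almost
  split. Since \<open>I\<^sub>N\<close> is uniserial, every map from \<open>M\<close> into the radical of a module \<open>W\<close> extends to \<open>P\<close>; as a map
  \<open>N \<rightarrow> W\<close> that is not a split monomorphism has its image in \<open>rad W\<close>, the first sequence follows. Condition (c)
  makes \<open>I\<^sub>S\<close> uniserial, so maps from \<open>S\<close> into \<open>rad W\<close> extend to \<open>P\<close> as well. For the second sequence, a map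
  \<open>h : P/L \<rightarrow> W\<close> factors through \<open>P/soc P \<oplus> P/M\<close> as soon as some map \<open>P \<rightarrow> W\<close> kills \<open>M\<close> and agrees with \<open>h\<close> on \<open>S\<close>.
  Such a map is found by extending \<open>h|S\<close> to a radical map out of \<open>P\<close> and correcting it by an endomorphism of \<open>P\<close>,
  or else by lifting a surjection of \<open>W\<close> onto \<open>P/M\<close> along the first sequence.
\<close>

text \<open>The obstacle is that the test module W is an arbitrary finitely generated module, while
  injectivity only produces maps into envelopes. A map from S or M to W is therefore compared with a
  map from P to the envelope E by means of an auxiliary map from W to E. Uniseriality of E forces
  the image of a suitable submodule of W to coincide with the image of P, and projectivity of P
  pulls the map to E back to W. The difference from the given map lands in a smaller submodule, so
  the argument is an induction on submodules of W; what makes the difference small is that S and top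
  M are not isomorphic. The finite length of A, used for these inductions and for the bijectivity of
  surjective endomorphisms, comes from condition (a), since A is a finite sum of images of
  indecomposable projectives. The same condition supplies the number four: a map from P into the
  radical of an indecomposable projective Y that is nonzero on S and on M has image of length at
  least three, which leaves no room between the image, rad Y and Y.\<close>

section \<open>Submodules and homomorphisms\<close>

lemma (in abelian_group) minus_eq_zero_iff [simp]:
  assumes "x \<in> carrier G" "y \<in> carrier G" shows "x \<ominus> y = \<zero> \<longleftrightarrow> x = y"
  using assms by (metis a_minus_def add.inv_closed add.inv_equality minus_minus r_neg)

lemma (in abelian_group) minus_add_cancel [simp]:
  assumes "x \<in> carrier G" "y \<in> carrier G"
  shows "(x \<ominus> y) \<oplus> y = x" "y \<oplus> (x \<ominus> y) = x" "(x \<oplus> y) \<ominus> y = x" "(y \<oplus> x) \<ominus> y = x"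
  using assms by (simp_all add: a_minus_def add.m_ac l_neg r_neg a_lcomm)

lemma (in lmodule) lsub_iff:
  "submodule N R M \<longleftrightarrow> N \<subseteq> carrier M \<and> \<zero>\<^bsub>M\<^esub> \<in> N \<and>
     (\<forall>x\<in>N. \<forall>y\<in>N. x \<oplus>\<^bsub>M\<^esub> y \<in> N) \<and> (\<forall>a\<in>carrier R. \<forall>x\<in>N. a \<odot>\<^bsub>M\<^esub> x \<in> N)"
proof
  assume "submodule N R M"
  then interpret submodule N R M .
  show "N \<subseteq> carrier M \<and> \<zero>\<^bsub>M\<^esub> \<in> N \<and>
     (\<forall>x\<in>N. \<forall>y\<in>N. x \<oplus>\<^bsub>M\<^esub> y \<in> N) \<and> (\<forall>a\<in>carrier R. \<forall>x\<in>N. a \<odot>\<^bsub>M\<^esub> x \<in> N)"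
    using subset one_closed m_closed smult_closed by auto
qed (auto intro: lsubmoduleI)

lemma (in lmodule) lsub_uminus:
  assumes "submodule N R M" "x \<in> N" shows "\<ominus>\<^bsub>M\<^esub> x \<in> N"
  using assms smult_uminus_one[of x] unfolding lsub_iff by (metis R.add.inv_closed R.one_closed subsetD)

lemma (in lmodule) lsub_minus:
  assumes "submodule N R M" "x \<in> N" "y \<in> N" shows "x \<ominus>\<^bsub>M\<^esub> y \<in> N"
  using assms lsub_uminus unfolding lsub_iff a_minus_def by blast

lemma mem_set_add: "z \<in> X <+>\<^bsub>W\<^esub> Y \<longleftrightarrow> (\<exists>x\<in>X. \<exists>y\<in>Y. z = x \<oplus>\<^bsub>W\<^esub> y)"
  by (auto simp: set_add_def set_mult_def)

context lmodule
begin

lemma lsub_subset: "submodule N R M \<Longrightarrow> N \<subseteq> carrier M"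
  by (simp add: lsub_iff)

lemma lsub_carrier: "submodule N R M \<Longrightarrow> x \<in> N \<Longrightarrow> x \<in> carrier M"
  using lsub_subset by auto

lemma lsub_zero: "submodule N R M \<Longrightarrow> \<zero>\<^bsub>M\<^esub> \<in> N"
  by (simp add: lsub_iff)

lemma lsub_add: "submodule N R M \<Longrightarrow> x \<in> N \<Longrightarrow> y \<in> N \<Longrightarrow> x \<oplus>\<^bsub>M\<^esub> y \<in> N"
  by (simp add: lsub_iff)

lemma lsub_smult: "submodule N R M \<Longrightarrow> a \<in> carrier R \<Longrightarrow> x \<in> N \<Longrightarrow> a \<odot>\<^bsub>M\<^esub> x \<in> N"
  by (simp add: lsub_iff)

lemma lsub_top: "submodule (carrier M) R M"
  by (simp add: lsub_iff)

lemma lsub_bot: "submodule {\<zero>\<^bsub>M\<^esub>} R M"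
  by (simp add: lsub_iff smult_zero_right)

lemma lsub_inter: "submodule N R M \<Longrightarrow> submodule K R M \<Longrightarrow> submodule (N \<inter> K) R M"
  by (auto simp: lsub_iff)

lemma lsub_sum:
  assumes "submodule N R M" "submodule K R M"
  shows "submodule (N <+>\<^bsub>M\<^esub> K) R M"
proof (rule lsubmoduleI)
  note c = lsub_carrier[OF assms(1)] lsub_carrier[OF assms(2)]
  show "N <+>\<^bsub>M\<^esub> K \<subseteq> carrier M"
    using c by (auto simp: mem_set_add)
  show "\<zero>\<^bsub>M\<^esub> \<in> N <+>\<^bsub>M\<^esub> K"
    using assms[THEN lsub_zero] by (auto simp: mem_set_add intro!: bexI[of _ "\<zero>\<^bsub>M\<^esub>"])
  fix x y assume "x \<in> N <+>\<^bsub>M\<^esub> K" "y \<in> N <+>\<^bsub>M\<^esub> K"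
  then obtain a b a' b' where *: "a \<in> N" "b \<in> K" "x = a \<oplus>\<^bsub>M\<^esub> b" "a' \<in> N" "b' \<in> K" "y = a' \<oplus>\<^bsub>M\<^esub> b'"
    by (auto simp: mem_set_add)
  then have "x \<oplus>\<^bsub>M\<^esub> y = (a \<oplus>\<^bsub>M\<^esub> a') \<oplus>\<^bsub>M\<^esub> (b \<oplus>\<^bsub>M\<^esub> b')"
    using c by (simp add: M.add.m_ac)
  then show "x \<oplus>\<^bsub>M\<^esub> y \<in> N <+>\<^bsub>M\<^esub> K"
    using * assms by (auto simp: mem_set_add intro!: bexI lsub_add)
next
  note c = lsub_carrier[OF assms(1)] lsub_carrier[OF assms(2)]
  fix a x assume a: "a \<in> carrier R" and "x \<in> N <+>\<^bsub>M\<^esub> K"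
  then obtain u v where *: "u \<in> N" "v \<in> K" "x = u \<oplus>\<^bsub>M\<^esub> v"
    by (auto simp: mem_set_add)
  then have "a \<odot>\<^bsub>M\<^esub> x = a \<odot>\<^bsub>M\<^esub> u \<oplus>\<^bsub>M\<^esub> a \<odot>\<^bsub>M\<^esub> v"
    using c a by (simp add: smult_r_distr)
  then show "a \<odot>\<^bsub>M\<^esub> x \<in> N <+>\<^bsub>M\<^esub> K"
    using * a assms by (auto simp: mem_set_add intro!: bexI lsub_smult)
qed

lemma lsum_upper1: "submodule N R M \<Longrightarrow> submodule K R M \<Longrightarrow> N \<subseteq> N <+>\<^bsub>M\<^esub> K"
  unfolding subset_iff mem_set_add by (metis M.r_zero lsub_carrier lsub_zero)

lemma lsum_upper2: "submodule N R M \<Longrightarrow> submodule K R M \<Longrightarrow> K \<subseteq> N <+>\<^bsub>M\<^esub> K"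
  unfolding subset_iff mem_set_add by (metis M.l_zero lsub_carrier lsub_zero)

lemma lsum_least:
  "submodule D R M \<Longrightarrow> N \<subseteq> D \<Longrightarrow> K \<subseteq> D \<Longrightarrow> N <+>\<^bsub>M\<^esub> K \<subseteq> D"
  unfolding subset_iff mem_set_add using lsub_add by blast

lemma span_submodule:
  assumes "S \<subseteq> carrier M" shows "submodule (submodule_span R M S) R M"
proof -
  have "submodule_span R M S \<subseteq> carrier M"
    using lsub_top assms by (auto simp: submodule_span_def)
  then show ?thesis
    by (auto simp: lsub_iff submodule_span_def)
qed

lemma span_upper: "S \<subseteq> submodule_span R M S"
  by (auto simp: submodule_span_def)

lemma span_least: "submodule N R M \<Longrightarrow> S \<subseteq> N \<Longrightarrow> submodule_span R M S \<subseteq> N"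
  by (auto simp: submodule_span_def)

lemma sub_lmodule:
  assumes "submodule N R M" shows "lmodule R (sub M N)"
proof -
  note c = lsub_carrier[OF assms]
  have "abelian_group (sub M N)"
  proof (rule abelian_groupI)
    fix x assume "x \<in> carrier (sub M N)"
    then show "\<exists>y\<in>carrier (sub M N). y \<oplus>\<^bsub>sub M N\<^esub> x = \<zero>\<^bsub>sub M N\<^esub>"
      using c lsub_uminus[OF assms] by (auto simp: sub_def M.l_neg intro!: bexI[of _ "\<ominus>\<^bsub>M\<^esub> x"])
  qed (use c assms in \<open>auto simp: sub_def M.add.m_ac lsub_add lsub_zero\<close>)
  then show ?thesis
    using c assms by (intro lmodule.intro lmodule_axioms.intro R.ring_axioms)
      (auto simp: sub_def lsub_smult smult_l_distr smult_r_distr smult_assoc1)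
qed

end

lemma sub_simps [simp]:
  "carrier (sub W N) = N" "\<zero>\<^bsub>sub W N\<^esub> = \<zero>\<^bsub>W\<^esub>" "x \<oplus>\<^bsub>sub W N\<^esub> y = x \<oplus>\<^bsub>W\<^esub> y"
  "a \<odot>\<^bsub>sub W N\<^esub> x = a \<odot>\<^bsub>W\<^esub> x" "sub (sub W N) K = sub W K"
  by (simp_all add: sub_def)

lemma sub_carrier [simp]: "sub W (carrier W) = W"
  by (simp add: sub_def)

lemma submodule_sub_iff:
  assumes "lmodule A W" "submodule K A W"
  shows "submodule N A (sub W K) \<longleftrightarrow> submodule N A W \<and> N \<subseteq> K"
  using lmodule.lsub_subset[OF assms]
  unfolding lmodule.lsub_iff[OF assms(1)] lmodule.lsub_iff[OF lmodule.sub_lmodule[OF assms]]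
  by auto

lemma set_add_sub [simp]: "X <+>\<^bsub>sub W K\<^esub> Y = X <+>\<^bsub>W\<^esub> Y"
  by (auto simp: mem_set_add)

lemma span_sub:
  assumes "lmodule A W" "submodule K A W" "S \<subseteq> K"
  shows "submodule_span A (sub W K) S = submodule_span A W S"
proof
  interpret W: lmodule A W by fact
  interpret K: lmodule A "sub W K" by (rule W.sub_lmodule) fact
  have S: "S \<subseteq> carrier W"
    using assms W.lsub_subset by auto
  show "submodule_span A (sub W K) S \<subseteq> submodule_span A W S"
    using W.span_submodule[OF S] W.span_upper W.span_least[OF assms(2,3)]
    by (intro K.span_least) (auto simp: submodule_sub_iff assms)
  show "submodule_span A W S \<subseteq> submodule_span A (sub W K) S"
    using K.span_submodule[of S] K.span_upper assms(3)
    by (intro W.span_least) (auto simp: submodule_sub_iff assms)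
qed

lemma fg_sub_iff:
  assumes "lmodule A W" "submodule K A W"
  shows "fg_module A (sub W K) \<longleftrightarrow> (\<exists>S. finite S \<and> S \<subseteq> K \<and> submodule_span A W S = K)"
  using lmodule.sub_lmodule[OF assms] span_sub[OF assms] by (auto simp: fg_module_def)

lemma fg_lmodule: "fg_module A W \<Longrightarrow> lmodule A W"
  by (simp add: fg_module_def)

section \<open>Homomorphisms and their factorizations\<close>

lemma module_hom_iff:
  "f \<in> module_hom A X Y \<longleftrightarrow> (\<forall>x\<in>carrier X. f x \<in> carrier Y) \<and>
     (\<forall>x\<in>carrier X. \<forall>y\<in>carrier X. f (x \<oplus>\<^bsub>X\<^esub> y) = f x \<oplus>\<^bsub>Y\<^esub> f y) \<and>
     (\<forall>a\<in>carrier A. \<forall>x\<in>carrier X. f (a \<odot>\<^bsub>X\<^esub> x) = a \<odot>\<^bsub>Y\<^esub> f x)"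
  by (auto simp: module_hom_def hom_def)

locale lhom = X: lmodule A X + Y: lmodule A Y
  for A :: "('a, 'r) ring_scheme" and X :: "('a, 'b) module" and Y :: "('a, 'c) module" +
  fixes f :: "'b \<Rightarrow> 'c"
  assumes f: "f \<in> module_hom A X Y"
begin

lemma closed [simp]: "x \<in> carrier X \<Longrightarrow> f x \<in> carrier Y"
  using f by (auto simp: module_hom_iff)

lemma add [simp]: "x \<in> carrier X \<Longrightarrow> y \<in> carrier X \<Longrightarrow> f (x \<oplus>\<^bsub>X\<^esub> y) = f x \<oplus>\<^bsub>Y\<^esub> f y"
  using f by (auto simp: module_hom_iff)

lemma smult [simp]: "a \<in> carrier A \<Longrightarrow> x \<in> carrier X \<Longrightarrow> f (a \<odot>\<^bsub>X\<^esub> x) = a \<odot>\<^bsub>Y\<^esub> f x"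
  using f by (auto simp: module_hom_iff)

lemma zero [simp]: "f \<zero>\<^bsub>X\<^esub> = \<zero>\<^bsub>Y\<^esub>"
proof -
  have "f \<zero>\<^bsub>X\<^esub> \<oplus>\<^bsub>Y\<^esub> f \<zero>\<^bsub>X\<^esub> = f \<zero>\<^bsub>X\<^esub>"
    using add[of "\<zero>\<^bsub>X\<^esub>" "\<zero>\<^bsub>X\<^esub>"] by simp
  then show ?thesis
    by (simp add: Y.M.add.r_cancel_one)
qed

lemma uminus [simp]: "x \<in> carrier X \<Longrightarrow> f (\<ominus>\<^bsub>X\<^esub> x) = \<ominus>\<^bsub>Y\<^esub> f x"
  by (metis X.R.add.inv_closed X.R.one_closed X.smult_uminus_one Y.smult_uminus_one closed smult)

lemma minus [simp]: "x \<in> carrier X \<Longrightarrow> y \<in> carrier X \<Longrightarrow> f (x \<ominus>\<^bsub>X\<^esub> y) = f x \<ominus>\<^bsub>Y\<^esub> f y"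
  by (simp add: a_minus_def)

lemma image_submodule:
  assumes "submodule N A X" shows "submodule (f ` N) A Y"
proof (rule Y.lsubmoduleI)
  note c = X.lsub_carrier[OF assms]
  show "f ` N \<subseteq> carrier Y" using c by auto
  show "\<zero>\<^bsub>Y\<^esub> \<in> f ` N" using X.lsub_zero[OF assms] zero by (metis imageI)
  fix x y assume "x \<in> f ` N" "y \<in> f ` N"
  then obtain u v where "u \<in> N" "v \<in> N" "x = f u" "y = f v" by auto
  then show "x \<oplus>\<^bsub>Y\<^esub> y \<in> f ` N"
    using c X.lsub_add[OF assms, of u v] by (auto simp flip: add)
next
  fix a x assume "a \<in> carrier A" "x \<in> f ` N"
  then show "a \<odot>\<^bsub>Y\<^esub> x \<in> f ` N"
    using X.lsub_carrier[OF assms] X.lsub_smult[OF assms] by (auto simp flip: smult)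
qed

lemma preimage_submodule:
  assumes "submodule N A Y" shows "submodule {x \<in> carrier X. f x \<in> N} A X"
  by (rule X.lsubmoduleI) (auto simp: Y.lsub_zero Y.lsub_add Y.lsub_smult assms)

lemma kernel_submodule: "submodule {x \<in> carrier X. f x = \<zero>\<^bsub>Y\<^esub>} A X"
  using preimage_submodule[OF Y.lsub_bot] by simp

lemma inj_iff: "inj_on f (carrier X) \<longleftrightarrow> (\<forall>x\<in>carrier X. f x = \<zero>\<^bsub>Y\<^esub> \<longrightarrow> x = \<zero>\<^bsub>X\<^esub>)"
proof
  assume "inj_on f (carrier X)"
  then show "\<forall>x\<in>carrier X. f x = \<zero>\<^bsub>Y\<^esub> \<longrightarrow> x = \<zero>\<^bsub>X\<^esub>"
    by (metis X.M.zero_closed inj_onD zero)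
next
  assume *: "\<forall>x\<in>carrier X. f x = \<zero>\<^bsub>Y\<^esub> \<longrightarrow> x = \<zero>\<^bsub>X\<^esub>"
  show "inj_on f (carrier X)"
  proof (rule inj_onI)
    fix x y assume xy: "x \<in> carrier X" "y \<in> carrier X" "f x = f y"
    then have "f (x \<ominus>\<^bsub>X\<^esub> y) = \<zero>\<^bsub>Y\<^esub>"
      by simp
    with * xy have "x \<ominus>\<^bsub>X\<^esub> y = \<zero>\<^bsub>X\<^esub>"
      by auto
    then show "x = y"
      using xy by simp
  qed
qed

lemma image_sum:
  assumes "N \<subseteq> carrier X" "K \<subseteq> carrier X"
  shows "f ` (N <+>\<^bsub>X\<^esub> K) = f ` N <+>\<^bsub>Y\<^esub> f ` K"
proof (intro equalityI subsetI)
  fix y assume "y \<in> f ` (N <+>\<^bsub>X\<^esub> K)"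
  then show "y \<in> f ` N <+>\<^bsub>Y\<^esub> f ` K"
    using assms by (force simp: mem_set_add)
next
  fix y assume "y \<in> f ` N <+>\<^bsub>Y\<^esub> f ` K"
  then obtain u v where "u \<in> N" "v \<in> K" "y = f u \<oplus>\<^bsub>Y\<^esub> f v"
    by (auto simp: mem_set_add)
  then show "y \<in> f ` (N <+>\<^bsub>X\<^esub> K)"
    using assms by (intro image_eqI[of _ _ "u \<oplus>\<^bsub>X\<^esub> v"]) (auto simp: mem_set_add subset_iff)
qed

lemma image_span:
  assumes "S \<subseteq> carrier X"
  shows "f ` submodule_span A X S = submodule_span A Y (f ` S)"
proof
  have fS: "f ` S \<subseteq> carrier Y" using assms by auto
  have "submodule_span A X S \<subseteq> {x \<in> carrier X. f x \<in> submodule_span A Y (f ` S)}"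
    using assms Y.span_upper[of "f ` S"]
    by (intro X.span_least preimage_submodule Y.span_submodule fS) auto
  then show "f ` submodule_span A X S \<subseteq> submodule_span A Y (f ` S)"
    by auto
  show "submodule_span A Y (f ` S) \<subseteq> f ` submodule_span A X S"
    using X.span_upper[of S]
    by (intro Y.span_least image_submodule X.span_submodule assms) auto
qed

end

lemma hom_restrict:
  assumes "lmodule A X" "lmodule A Y" "submodule K A X" "f \<in> module_hom A X Y"
  shows "f \<in> module_hom A (sub X K) Y"
  using assms lmodule.lsub_carrier[OF assms(1,3)] by (auto simp: module_hom_iff)

lemma hom_into_sub:
  assumes "f \<in> module_hom A X Y" "f ` carrier X \<subseteq> K"
  shows "f \<in> module_hom A X (sub Y K)"
  using assms by (auto simp: module_hom_iff)

lemma hom_from_into_sub: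
  assumes "lmodule A Y" "submodule K A Y" "f \<in> module_hom A X (sub Y K)"
  shows "f \<in> module_hom A X Y"
  using assms lmodule.lsub_carrier[OF assms(1,2)] by (auto simp: module_hom_iff)

lemma hom_comp:
  assumes "f \<in> module_hom A X Y" "g \<in> module_hom A Y Z"
  shows "(\<lambda>x. g (f x)) \<in> module_hom A X Z"
  using assms by (auto simp: module_hom_iff)

lemma hom_zero:
  assumes "lmodule A Y" shows "(\<lambda>x. \<zero>\<^bsub>Y\<^esub>) \<in> module_hom A X Y"
proof -
  interpret lmodule A Y by fact
  show ?thesis by (auto simp: module_hom_iff smult_zero_right)
qed

lemma hom_id: "(\<lambda>x. x) \<in> module_hom A X X"
  by (auto simp: module_hom_iff)

lemma hom_inclusion:
  assumes "lmodule A X" "submodule K A X" shows "(\<lambda>x. x) \<in> module_hom A (sub X K) X"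
  using lmodule.lsub_carrier[OF assms] by (auto simp: module_hom_iff)

lemma hom_add:
  assumes "lmodule A Y" "f \<in> module_hom A X Y" "g \<in> module_hom A X Y"
  shows "(\<lambda>x. f x \<oplus>\<^bsub>Y\<^esub> g x) \<in> module_hom A X Y"
proof -
  interpret lmodule A Y by fact
  show ?thesis using assms(2,3) by (auto simp: module_hom_iff smult_r_distr M.add.m_ac)
qed

lemma hom_uminus:
  assumes "lmodule A Y" "f \<in> module_hom A X Y"
  shows "(\<lambda>x. \<ominus>\<^bsub>Y\<^esub> f x) \<in> module_hom A X Y"
proof -
  interpret lmodule A Y by fact
  have "\<ominus>\<^bsub>Y\<^esub> (a \<odot>\<^bsub>Y\<^esub> y) = a \<odot>\<^bsub>Y\<^esub> (\<ominus>\<^bsub>Y\<^esub> y)" if "a \<in> carrier A" "y \<in> carrier Y" for a y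
  proof -
    have "a \<odot>\<^bsub>Y\<^esub> (\<ominus>\<^bsub>Y\<^esub> y) \<oplus>\<^bsub>Y\<^esub> a \<odot>\<^bsub>Y\<^esub> y = \<zero>\<^bsub>Y\<^esub>"
      using that by (simp flip: smult_r_distr add: M.l_neg smult_zero_right)
    then show ?thesis using that by (simp add: M.minus_equality)
  qed
  then show ?thesis using assms(2) by (auto simp: module_hom_iff M.minus_add)
qed

lemma hom_minus:
  assumes "lmodule A Y" "f \<in> module_hom A X Y" "g \<in> module_hom A X Y"
  shows "(\<lambda>x. f x \<ominus>\<^bsub>Y\<^esub> g x) \<in> module_hom A X Y"
  unfolding a_minus_def by (intro hom_add hom_uminus assms)

text \<open>A preimage is picked by \<open>SOME\<close>; the kernel condition makes the value
  independent of the choice, because two preimages differ by an element killed by \<open>g\<close>.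
  Inverses of bijections, maps out of quotients and maps out of internal direct sums are all
  obtained from this.\<close>

lemma hom_factor:
  assumes "lmodule A X" "lmodule A V" "lmodule A Y"
    and g: "g \<in> module_hom A X V" and f: "f \<in> module_hom A X Y"
    and onto: "g ` carrier X = carrier V"
    and ker: "\<And>x. x \<in> carrier X \<Longrightarrow> g x = \<zero>\<^bsub>V\<^esub> \<Longrightarrow> f x = \<zero>\<^bsub>Y\<^esub>"
  obtains h where "h \<in> module_hom A V Y" "\<And>x. x \<in> carrier X \<Longrightarrow> h (g x) = f x"
proof -
  interpret g: lhom A X V g by (simp add: lhom_def lhom_axioms_def assms)
  interpret f: lhom A X Y f by (simp add: lhom_def lhom_axioms_def assms)
  define h where "h v = f (SOME x. x \<in> carrier X \<and> g x = v)" for v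
  have hg: "h (g x) = f x" if x: "x \<in> carrier X" for x
  proof -
    define y where "y = (SOME y. y \<in> carrier X \<and> g y = g x)"
    have y: "y \<in> carrier X" "g y = g x"
      using someI[of "\<lambda>y. y \<in> carrier X \<and> g y = g x" x] x by (auto simp: y_def)
    have "g (y \<ominus>\<^bsub>X\<^esub> x) = \<zero>\<^bsub>V\<^esub>"
      using x y by simp
    then have "f (y \<ominus>\<^bsub>X\<^esub> x) = \<zero>\<^bsub>Y\<^esub>"
      using x y ker by simp
    then have "f y = f x"
      using x y by simp
    then show ?thesis
      by (simp add: h_def y_def)
  qed
  have "h \<in> module_hom A V Y"
    unfolding module_hom_iff onto[symmetric]
    by (auto simp: hg simp flip: g.add g.smult)
  then show ?thesis
    using hg that by blast
qed

lemma hom_inverse: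
  assumes "lmodule A X" "lmodule A Y" "f \<in> module_hom A X Y" "bij_betw f (carrier X) (carrier Y)"
  obtains h where "h \<in> module_hom A Y X" "\<And>x. x \<in> carrier X \<Longrightarrow> h (f x) = x"
    "\<And>y. y \<in> carrier Y \<Longrightarrow> f (h y) = y" "bij_betw h (carrier Y) (carrier X)"
proof -
  interpret lhom A X Y f by (simp add: lhom_def lhom_axioms_def assms)
  have "inj_on f (carrier X)" and onto: "f ` carrier X = carrier Y"
    using assms(4) by (auto simp: bij_betw_def)
  then obtain h where h: "h \<in> module_hom A Y X" "\<And>x. x \<in> carrier X \<Longrightarrow> h (f x) = x"
    using hom_factor[OF assms(1,2,1,3) hom_id onto] by (metis inj_iff)
  have *: "f (h y) = y" if "y \<in> carrier Y" for y
    using that h(2) onto by (metis imageE)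
  have "bij_betw h (carrier Y) (carrier X)"
    using h * onto by (intro bij_betwI[of _ _ _ f]) (auto simp: module_hom_iff)
  then show ?thesis
    using h * that by blast
qed

lemma fg_image:
  assumes "fg_module A X" "lmodule A Y" "f \<in> module_hom A X Y" "f ` carrier X = carrier Y"
  shows "fg_module A Y"
proof -
  interpret lhom A X Y f
    using assms by (simp add: lhom_def lhom_axioms_def fg_module_def)
  obtain S where S: "finite S" "S \<subseteq> carrier X" "submodule_span A X S = carrier X"
    using assms(1) by (auto simp: fg_module_def)
  have "f ` S \<subseteq> carrier Y"
    using S(2) by auto
  moreover have "submodule_span A Y (f ` S) = carrier Y"
    using image_span[OF S(2)] S(3) assms(4) by metis
  ultimately show ?thesis
    using assms(2) S(1) unfolding fg_module_def by (metis finite_imageI)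
qed

section \<open>Cosets and quotient modules\<close>

lemma abelian_subgroup_lsub:
  assumes "lmodule A W" "submodule N A W" shows "abelian_subgroup N W"
proof -
  interpret lmodule A W by fact
  show ?thesis
    using assms(2) by (intro abelian_subgroupI3 M.abelian_group_axioms additive_subgroupI)
      (rule submodule.axioms(1))
qed

lemma coset_eq_iff:
  assumes "lmodule A W" "submodule N A W" "x \<in> carrier W" "y \<in> carrier W"
  shows "N +>\<^bsub>W\<^esub> x = N +>\<^bsub>W\<^esub> y \<longleftrightarrow> x \<ominus>\<^bsub>W\<^esub> y \<in> N"
proof -
  interpret lmodule A W by fact
  interpret N: abelian_subgroup N W by (rule abelian_subgroup_lsub) fact+
  show ?thesis
    using assms(3,4) N.a_rcos_module[of y x] N.a_rcos_self[of x]
      N.a_repr_independence'[of x y] M.a_repr_independence[of x N y] N.is_additive_subgroup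
    by (metis M.minus_eq additive_subgroup.a_subgroup)
qed

lemma quot_simps [simp]:
  "carrier (quot W N) = (\<lambda>x. N +>\<^bsub>W\<^esub> x) ` carrier W" "\<zero>\<^bsub>quot W N\<^esub> = N"
  by (auto simp: quot_def A_RCOSETS_def' )

lemma quot_add:
  assumes "lmodule A W" "submodule N A W" "x \<in> carrier W" "y \<in> carrier W"
  shows "(N +>\<^bsub>W\<^esub> x) \<oplus>\<^bsub>quot W N\<^esub> (N +>\<^bsub>W\<^esub> y) = N +>\<^bsub>W\<^esub> (x \<oplus>\<^bsub>W\<^esub> y)"
proof -
  interpret N: abelian_subgroup N W by (rule abelian_subgroup_lsub) fact+
  show ?thesis using assms by (simp add: quot_def N.a_rcos_sum)
qed

lemma coset_mem:
  assumes "lmodule A W" "submodule N A W" "x \<in> carrier W"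
  shows "y \<in> N +>\<^bsub>W\<^esub> x \<longleftrightarrow> y \<in> carrier W \<and> N +>\<^bsub>W\<^esub> y = N +>\<^bsub>W\<^esub> x"
proof -
  interpret lmodule A W by fact
  interpret N: abelian_subgroup N W by (rule abelian_subgroup_lsub) fact+
  show ?thesis
    using assms(3) N.a_rcos_self N.a_repr_independence' N.a_elemrcos_carrier by metis
qed

text \<open>The action on \<open>quot\<close> is a union of cosets over all representatives. They
  all coincide, since two representatives differ by an element of \<open>N\<close> and
  \<open>N\<close> is stable under \<open>a\<close>.\<close>

lemma quot_smult:
  assumes "lmodule A W" "submodule N A W" "x \<in> carrier W" "a \<in> carrier A"
  shows "a \<odot>\<^bsub>quot W N\<^esub> (N +>\<^bsub>W\<^esub> x) = N +>\<^bsub>W\<^esub> (a \<odot>\<^bsub>W\<^esub> x)"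
proof -
  interpret lmodule A W by fact
  interpret N: abelian_subgroup N W by (rule abelian_subgroup_lsub) fact+
  have *: "N +>\<^bsub>W\<^esub> (a \<odot>\<^bsub>W\<^esub> y) = N +>\<^bsub>W\<^esub> (a \<odot>\<^bsub>W\<^esub> x)" if "y \<in> N +>\<^bsub>W\<^esub> x" for y
  proof -
    have y: "y \<in> carrier W" "y \<ominus>\<^bsub>W\<^esub> x \<in> N"
      using that coset_mem[OF assms(1-3)] coset_eq_iff[OF assms(1,2) _ assms(3)] by auto
    then have "a \<odot>\<^bsub>W\<^esub> (y \<ominus>\<^bsub>W\<^esub> x) \<in> N"
      using assms lsub_smult by blast
    moreover have "a \<odot>\<^bsub>W\<^esub> (y \<ominus>\<^bsub>W\<^esub> x) = a \<odot>\<^bsub>W\<^esub> y \<ominus>\<^bsub>W\<^esub> a \<odot>\<^bsub>W\<^esub> x"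
    proof -
      have "a \<odot>\<^bsub>W\<^esub> y = a \<odot>\<^bsub>W\<^esub> (y \<ominus>\<^bsub>W\<^esub> x) \<oplus>\<^bsub>W\<^esub> a \<odot>\<^bsub>W\<^esub> x"
        using y assms by (simp flip: smult_r_distr)
      then show ?thesis using y assms by simp
    qed
    ultimately show ?thesis
      using y assms coset_eq_iff[OF assms(1,2)] by simp
  qed
  have "x \<in> N +>\<^bsub>W\<^esub> x"
    using assms(3) by (rule N.a_rcos_self)
  then have "(\<Union>y\<in>N +>\<^bsub>W\<^esub> x. N +>\<^bsub>W\<^esub> (a \<odot>\<^bsub>W\<^esub> y)) = N +>\<^bsub>W\<^esub> (a \<odot>\<^bsub>W\<^esub> x)"
    using * by (intro SUP_eq_const) blast+
  then show ?thesis
    by (simp only: quot_def module.simps)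
qed

lemma quot_lmodule:
  assumes "lmodule A W" "submodule N A W"
  shows "lmodule A (quot W N)"
proof -
  interpret lmodule A W by fact
  interpret N: abelian_subgroup N W by (rule abelian_subgroup_lsub) fact+
  note [simp] = quot_add[OF assms] quot_smult[OF assms]
  have z: "N = N +>\<^bsub>W\<^esub> \<zero>\<^bsub>W\<^esub>"
    using M.a_coset_add_zero N.a_subset by simp
  have "abelian_group (quot W N)"
  proof (rule abelian_groupI)
    fix x assume "x \<in> carrier (quot W N)"
    then obtain u where "u \<in> carrier W" "x = N +>\<^bsub>W\<^esub> u" by auto
    then show "\<exists>y\<in>carrier (quot W N). y \<oplus>\<^bsub>quot W N\<^esub> x = \<zero>\<^bsub>quot W N\<^esub>"
      using z by (intro bexI[of _ "N +>\<^bsub>W\<^esub> (\<ominus>\<^bsub>W\<^esub> u)"]) (auto simp: M.l_neg)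
  next
    fix x assume "x \<in> carrier (quot W N)"
    then show "\<zero>\<^bsub>quot W N\<^esub> \<oplus>\<^bsub>quot W N\<^esub> x = x"
      using z quot_add[OF assms M.zero_closed] by auto
  next
    show "\<zero>\<^bsub>quot W N\<^esub> \<in> carrier (quot W N)"
      using z by (metis M.zero_closed image_eqI quot_simps)
  qed (auto simp: M.add.m_ac)
  then show ?thesis
    by (intro lmodule.intro lmodule_axioms.intro R.ring_axioms)
      (auto simp: smult_l_distr smult_r_distr smult_assoc1)
qed

lemma quot_hom:
  assumes "lmodule A W" "submodule N A W"
  shows "(\<lambda>x. N +>\<^bsub>W\<^esub> x) \<in> module_hom A W (quot W N)"
  using quot_add[OF assms] quot_smult[OF assms] by (auto simp: module_hom_iff)

lemma quot_kernel:
  assumes "lmodule A W" "submodule N A W" "x \<in> carrier W"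
  shows "N +>\<^bsub>W\<^esub> x = \<zero>\<^bsub>quot W N\<^esub> \<longleftrightarrow> x \<in> N"
proof -
  interpret lmodule A W by fact
  interpret N: abelian_subgroup N W by (rule abelian_subgroup_lsub) fact+
  have "N = N +>\<^bsub>W\<^esub> \<zero>\<^bsub>W\<^esub>"
    using M.a_coset_add_zero N.a_subset by simp
  then show ?thesis
    using coset_eq_iff[OF assms(1-3), of "\<zero>\<^bsub>W\<^esub>"] assms(3) M.minus_add_cancel(3)[of x "\<zero>\<^bsub>W\<^esub>"] by simp
qed

lemma fg_quot:
  assumes "fg_module A W" "submodule N A W" shows "fg_module A (quot W N)"
  using assms fg_image[OF assms(1) quot_lmodule quot_hom] by (simp add: fg_lmodule)

section \<open>External direct sums and extensions\<close>

lemma dsum_simps [simp]: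
  "carrier (dsum X Y) = carrier X \<times> carrier Y" "\<zero>\<^bsub>dsum X Y\<^esub> = (\<zero>\<^bsub>X\<^esub>, \<zero>\<^bsub>Y\<^esub>)"
  "(x, y) \<oplus>\<^bsub>dsum X Y\<^esub> (x', y') = (x \<oplus>\<^bsub>X\<^esub> x', y \<oplus>\<^bsub>Y\<^esub> y')"
  "a \<odot>\<^bsub>dsum X Y\<^esub> (x, y) = (a \<odot>\<^bsub>X\<^esub> x, a \<odot>\<^bsub>Y\<^esub> y)"
  by (simp_all add: dsum_def)

lemma dsum_lmodule:
  assumes "lmodule A X" "lmodule A Y" shows "lmodule A (dsum X Y)"
proof -
  interpret X: lmodule A X by fact
  interpret Y: lmodule A Y by fact
  have "abelian_group (dsum X Y)"
  proof (rule abelian_groupI)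
    fix z assume "z \<in> carrier (dsum X Y)"
    then show "\<exists>w\<in>carrier (dsum X Y). w \<oplus>\<^bsub>dsum X Y\<^esub> z = \<zero>\<^bsub>dsum X Y\<^esub>"
      by (cases z) (auto intro!: bexI[of _ "(\<ominus>\<^bsub>X\<^esub> fst z, \<ominus>\<^bsub>Y\<^esub> snd z)"] simp: X.M.l_neg Y.M.l_neg)
  qed (auto simp: X.M.add.m_ac Y.M.add.m_ac)
  then show ?thesis
    by (intro lmodule.intro lmodule_axioms.intro X.R.ring_axioms)
      (auto simp: X.smult_l_distr X.smult_r_distr X.smult_assoc1 Y.smult_l_distr Y.smult_r_distr Y.smult_assoc1)
qed

lemma dsum_homs:
  assumes "lmodule A X" "lmodule A Y"
  shows "fst \<in> module_hom A (dsum X Y) X" "snd \<in> module_hom A (dsum X Y) Y"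
    "(\<lambda>x. (x, \<zero>\<^bsub>Y\<^esub>)) \<in> module_hom A X (dsum X Y)" "(\<lambda>y. (\<zero>\<^bsub>X\<^esub>, y)) \<in> module_hom A Y (dsum X Y)"
proof -
  interpret X: lmodule A X by fact
  interpret Y: lmodule A Y by fact
  show "fst \<in> module_hom A (dsum X Y) X" "snd \<in> module_hom A (dsum X Y) Y"
    "(\<lambda>x. (x, \<zero>\<^bsub>Y\<^esub>)) \<in> module_hom A X (dsum X Y)" "(\<lambda>y. (\<zero>\<^bsub>X\<^esub>, y)) \<in> module_hom A Y (dsum X Y)"
    by (auto simp: module_hom_iff X.smult_zero_right Y.smult_zero_right)
qed

lemma hom_pair:
  assumes "f \<in> module_hom A Z X" "g \<in> module_hom A Z Y"
  shows "(\<lambda>z. (f z, g z)) \<in> module_hom A Z (dsum X Y)"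
  using assms by (auto simp: module_hom_iff)

lemma lhomI: "lmodule A X \<Longrightarrow> lmodule A Y \<Longrightarrow> f \<in> module_hom A X Y \<Longrightarrow> lhom A X Y f"
  by (simp add: lhom_def lhom_axioms_def)

text \<open>Generators of \<open>X\<close>, mapped into \<open>Y\<close>, together with preimages of
  generators of \<open>Z\<close> generate \<open>Y\<close>: every element agrees over
  \<open>Z\<close> with some element of the span, and the difference comes from
  \<open>X\<close>.\<close>

lemma fg_extension:
  assumes "fg_module A X" "lmodule A Y" "fg_module A Z"
    and f: "f \<in> module_hom A X Y" and g: "g \<in> module_hom A Y Z" "g ` carrier Y = carrier Z"
    and ex: "\<And>y. y \<in> carrier Y \<Longrightarrow> g y = \<zero>\<^bsub>Z\<^esub> \<Longrightarrow> y \<in> f ` carrier X"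
  shows "fg_module A Y"
proof -
  interpret f: lhom A X Y f by (intro lhomI fg_lmodule assms)
  interpret g: lhom A Y Z g by (intro lhomI fg_lmodule assms)
  obtain S where S: "finite S" "S \<subseteq> carrier X" "submodule_span A X S = carrier X"
    using assms(1) by (auto simp: fg_module_def)
  obtain T where T: "finite T" "T \<subseteq> carrier Z" "submodule_span A Z T = carrier Z"
    using assms(3) by (auto simp: fg_module_def)
  obtain U where U: "U \<subseteq> carrier Y" "finite U" "g ` U = T"
    using finite_subset_image[of T g "carrier Y"] T g(2) by auto
  let ?G = "f ` S \<union> U"
  have G: "?G \<subseteq> carrier Y" using S U by auto
  let ?N = "submodule_span A Y ?G"
  have N: "submodule ?N A Y" by (rule f.Y.span_submodule[OF G])
  have "f ` carrier X = submodule_span A Y (f ` S)"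
    using f.image_span[OF S(2)] S(3) by simp
  also have "\<dots> \<subseteq> ?N"
    using f.Y.span_upper[of ?G] by (intro f.Y.span_least N) auto
  finally have fN: "f ` carrier X \<subseteq> ?N" .
  have "carrier Z = submodule_span A Z (g ` U)" using U T by simp
  also have "\<dots> \<subseteq> g ` ?N"
    using f.Y.span_upper[of ?G] by (intro g.Y.span_least g.image_submodule N) auto
  finally have gN: "carrier Z \<subseteq> g ` ?N" .
  have "carrier Y \<subseteq> ?N"
  proof
    fix y assume y: "y \<in> carrier Y"
    then obtain n where n: "n \<in> ?N" "g n = g y"
      using gN by (metis g.closed imageE subsetD)
    then have nc: "n \<in> carrier Y" using N f.Y.lsub_carrier by blast
    then have "g (y \<ominus>\<^bsub>Y\<^esub> n) = \<zero>\<^bsub>Z\<^esub>" using y n by simp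
    then have "y \<ominus>\<^bsub>Y\<^esub> n \<in> ?N" using ex fN y nc by blast
    then have "(y \<ominus>\<^bsub>Y\<^esub> n) \<oplus>\<^bsub>Y\<^esub> n \<in> ?N" using n N f.Y.lsub_add by blast
    then show "y \<in> ?N" using y nc by simp
  qed
  then have "?N = carrier Y" using f.Y.lsub_subset[OF N] by auto
  then show ?thesis using assms(2) G S(1) U(2) unfolding fg_module_def
    by (intro conjI exI[of _ ?G]) auto
qed

lemma fg_dsum:
  assumes "fg_module A X" "fg_module A Y" shows "fg_module A (dsum X Y)"
proof -
  interpret X: lmodule A X using assms by (simp add: fg_lmodule)
  interpret Y: lmodule A Y using assms by (simp add: fg_lmodule)
  note l = X.lmodule_axioms Y.lmodule_axioms
  show ?thesis
    by (rule fg_extension[OF assms(1) dsum_lmodule[OF l] assms(2) dsum_homs(3)[OF l] dsum_homs(2)[OF l]])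
      (auto simp: image_iff)
qed

text \<open>The definition of projectivity tests only modules with carrier type
  \<open>(nat \<Rightarrow> 'a) set\<close>. Representatives of \<open>X\<close> and
  \<open>Y\<close> carry the lifting property over to arbitrary carrier types, as is needed for
  submodules and quotients.\<close>

lemma projective_lift:
  assumes "projective_module A Q" "fg_module A X" "fg_module A Y"
    and g: "g \<in> module_hom A X Y" "g ` carrier X = carrier Y" and h: "h \<in> module_hom A Q Y"
  obtains t where "t \<in> module_hom A Q X" "\<And>q. q \<in> carrier Q \<Longrightarrow> g (t q) = h q"
proof -
  obtain X' :: "'a fgmod" and fX where X': "fg_module A X'" "fX \<in> module_hom A X X'" "bij_betw fX (carrier X) (carrier X')"
    using fg_module_representative[OF assms(2)] by blast
  obtain Y' :: "'a fgmod" and fY where Y': "fg_module A Y'" "fY \<in> module_hom A Y Y'" "bij_betw fY (carrier Y) (carrier Y')"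
    using fg_module_representative[OF assms(3)] by blast
  obtain hX where hX: "hX \<in> module_hom A X' X" "\<And>x. x \<in> carrier X' \<Longrightarrow> fX (hX x) = x" "bij_betw hX (carrier X') (carrier X)"
    using hom_inverse[OF _ _ X'(2,3)] assms(2) X'(1) fg_lmodule by metis
  have "(\<lambda>x. fY (g (hX x))) \<in> module_hom A X' Y'"
    using hom_comp[OF hom_comp[OF hX(1) g(1)] Y'(2)] .
  moreover have "(\<lambda>x. fY (g (hX x))) ` carrier X' = carrier Y'"
    using hX(3) g(2) Y'(3) unfolding bij_betw_def by (metis image_image)
  moreover have "(\<lambda>q. fY (h q)) \<in> module_hom A Q Y'"
    using hom_comp[OF h Y'(2)] .
  ultimately obtain t where t: "t \<in> module_hom A Q X'" "\<forall>q\<in>carrier Q. fY (g (hX (t q))) = fY (h q)"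
    using assms(1) X'(1) Y'(1) unfolding projective_module_def by metis
  have "g (hX (t q)) = h q" if "q \<in> carrier Q" for q
  proof -
    have "h q \<in> carrier Y" "g (hX (t q)) \<in> carrier Y"
      using that h g(1) hX(1) t(1) by (auto simp: module_hom_iff)
    then show ?thesis
      using t(2) that Y'(3) by (metis bij_betw_imp_inj_on inj_onD)
  qed
  then show ?thesis
    using that hom_comp[OF t(1) hX(1)] by blast
qed

text \<open>The same transport along representatives of \<open>X\<close> and \<open>Y\<close>, so
  that maps on submodules of \<open>P\<close> and of quotients can be extended.\<close>

lemma injective_extend:
  assumes "injective_module A E" "fg_module A X" "fg_module A Y"
    and f: "f \<in> module_hom A X Y" "inj_on f (carrier X)" and h: "h \<in> module_hom A X E"
  obtains t where "t \<in> module_hom A Y E" "\<And>x. x \<in> carrier X \<Longrightarrow> t (f x) = h x"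
proof -
  obtain X' :: "'a fgmod" and fX where X': "fg_module A X'" "fX \<in> module_hom A X X'" "bij_betw fX (carrier X) (carrier X')"
    using fg_module_representative[OF assms(2)] by blast
  obtain Y' :: "'a fgmod" and fY where Y': "fg_module A Y'" "fY \<in> module_hom A Y Y'" "bij_betw fY (carrier Y) (carrier Y')"
    using fg_module_representative[OF assms(3)] by blast
  obtain hX where hX: "hX \<in> module_hom A X' X" "\<And>x. x \<in> carrier X \<Longrightarrow> hX (fX x) = x" "bij_betw hX (carrier X') (carrier X)"
    using hom_inverse[OF _ _ X'(2,3)] assms(2) X'(1) fg_lmodule by metis
  have "(\<lambda>x. fY (f (hX x))) \<in> module_hom A X' Y'"
    using hom_comp[OF hom_comp[OF hX(1) f(1)] Y'(2)] .
  moreover have "inj_on (\<lambda>x. fY (f (hX x))) (carrier X')"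
  proof -
    have "hX x \<in> carrier X \<and> f (hX x) \<in> carrier Y" if "x \<in> carrier X'" for x
      using that hX(1) f(1) by (auto simp: module_hom_iff)
    moreover have "inj_on hX (carrier X')" "inj_on fY (carrier Y)"
      using hX(3) Y'(3) by (simp_all add: bij_betw_def)
    ultimately show ?thesis
      using f(2) by (intro inj_onI) (metis inj_onD)
  qed
  moreover have "(\<lambda>q. h (hX q)) \<in> module_hom A X' E"
    using hom_comp[OF hX(1) h] .
  ultimately obtain t where t: "t \<in> module_hom A Y' E" "\<forall>x\<in>carrier X'. t (fY (f (hX x))) = h (hX x)"
    using assms(1) X'(1) Y'(1) unfolding injective_module_def by metis
  have "t (fY (f x)) = h x" if "x \<in> carrier X" for x
    using t(2) that X'(2) hX(2) by (metis module_hom_iff)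
  then show ?thesis
    using that hom_comp[OF Y'(2) t(1)] by blast
qed

section \<open>Radicals\<close>

text \<open>This is JX, kept as a set inside the ambient module. Radicals of submodules and iterated
  radicals thus stay subsets of one carrier; \<open>rad_pow_1\<close> and \<open>rad_pow_2\<close>
  link it to \<open>rad_pow\<close>.\<close>

definition rd :: "('a, 'r) ring_scheme \<Rightarrow> ('a, 'b) module \<Rightarrow> 'b set \<Rightarrow> 'b set" where
  "rd A W X = submodule_span A W {a \<odot>\<^bsub>W\<^esub> x | a x. a \<in> jacobson_radical A \<and> x \<in> X}"

lemma jac_subset: "jacobson_radical A \<subseteq> carrier A"
  by (auto simp: jacobson_radical_def)

lemma jac_carrier [simp]: "a \<in> jacobson_radical A \<Longrightarrow> a \<in> carrier A"
  by (rule subsetD[OF jac_subset])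

context lmodule
begin

lemma rd_generators:
  "X \<subseteq> carrier M \<Longrightarrow> {a \<odot>\<^bsub>M\<^esub> x | a x. a \<in> jacobson_radical R \<and> x \<in> X} \<subseteq> carrier M"
  using jac_subset by fastforce

lemma rd_submodule: "X \<subseteq> carrier M \<Longrightarrow> submodule (rd R M X) R M"
  unfolding rd_def by (intro span_submodule rd_generators)

lemma rd_mem: "a \<in> jacobson_radical R \<Longrightarrow> x \<in> X \<Longrightarrow> a \<odot>\<^bsub>M\<^esub> x \<in> rd R M X"
  unfolding rd_def by (rule subsetD[OF span_upper]) auto

lemma rd_least:
  "submodule D R M \<Longrightarrow> (\<And>a x. a \<in> jacobson_radical R \<Longrightarrow> x \<in> X \<Longrightarrow> a \<odot>\<^bsub>M\<^esub> x \<in> D) \<Longrightarrow> rd R M X \<subseteq> D"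
  unfolding rd_def by (intro span_least) auto

lemma rd_subset: "submodule X R M \<Longrightarrow> rd R M X \<subseteq> X"
  by (intro rd_least) (auto simp: lsub_smult)

lemma rd_mono: "X \<subseteq> Y \<Longrightarrow> Y \<subseteq> carrier M \<Longrightarrow> rd R M X \<subseteq> rd R M Y"
  by (intro rd_least rd_submodule rd_mem) auto

lemma rd_sum:
  assumes "submodule X R M" "submodule Y R M"
  shows "rd R M (X <+>\<^bsub>M\<^esub> Y) = rd R M X <+>\<^bsub>M\<^esub> rd R M Y"
proof
  note c = lsub_subset[OF assms(1)] lsub_subset[OF assms(2)]
  note s = rd_submodule[OF c(1)] rd_submodule[OF c(2)]
  show "rd R M (X <+>\<^bsub>M\<^esub> Y) \<subseteq> rd R M X <+>\<^bsub>M\<^esub> rd R M Y"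
  proof (rule rd_least[OF lsub_sum[OF s]])
    fix a z assume a: "a \<in> jacobson_radical R" and "z \<in> X <+>\<^bsub>M\<^esub> Y"
    then obtain x y where "x \<in> X" "y \<in> Y" "z = x \<oplus>\<^bsub>M\<^esub> y" by (auto simp: mem_set_add)
    moreover from this have "a \<odot>\<^bsub>M\<^esub> z = a \<odot>\<^bsub>M\<^esub> x \<oplus>\<^bsub>M\<^esub> a \<odot>\<^bsub>M\<^esub> y"
      using c a jac_subset by (metis smult_r_distr subsetD)
    ultimately show "a \<odot>\<^bsub>M\<^esub> z \<in> rd R M X <+>\<^bsub>M\<^esub> rd R M Y"
      unfolding mem_set_add using rd_mem[OF a] by metis
  qed
  show "rd R M X <+>\<^bsub>M\<^esub> rd R M Y \<subseteq> rd R M (X <+>\<^bsub>M\<^esub> Y)"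
    by (intro lsum_least rd_submodule rd_mono lsub_subset[OF lsub_sum[OF assms]]
      lsum_upper1[OF assms] lsum_upper2[OF assms])
qed

end

lemma rd_sub:
  assumes "lmodule A W" "submodule K A W" "X \<subseteq> K"
  shows "rd A (sub W K) X = rd A W X"
proof -
  have "{a \<odot>\<^bsub>W\<^esub> x | a x. a \<in> jacobson_radical A \<and> x \<in> X} \<subseteq> K"
    using assms jac_subset lmodule.lsub_smult[OF assms(1,2)] by fastforce
  then show ?thesis
    unfolding rd_def using span_sub[OF assms(1,2)] by simp
qed

text \<open>As the radical is J times the module, it is functorial. This identity is behind the
  later estimates of images of radicals.\<close>

lemma (in lhom) image_rd:
  assumes "N \<subseteq> carrier X"
  shows "f ` rd A X N = rd A Y (f ` N)"
proof -
  have "f ` {a \<odot>\<^bsub>X\<^esub> x | a x. a \<in> jacobson_radical A \<and> x \<in> N} =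
      {a \<odot>\<^bsub>Y\<^esub> y | a y. a \<in> jacobson_radical A \<and> y \<in> f ` N}" (is "f ` ?G = ?H")
  proof (intro equalityI subsetI)
    fix z assume "z \<in> f ` ?G"
    then obtain a x where "a \<in> jacobson_radical A" "x \<in> N" "z = f (a \<odot>\<^bsub>X\<^esub> x)" by auto
    then show "z \<in> ?H" using assms jac_subset by (auto intro!: exI[of _ a] exI[of _ "f x"])
  next
    fix z assume "z \<in> ?H"
    then obtain a x where *: "a \<in> jacobson_radical A" "x \<in> N" "z = a \<odot>\<^bsub>Y\<^esub> f x" by auto
    then have "z = f (a \<odot>\<^bsub>X\<^esub> x)" using assms jac_subset by (metis smult subsetD)
    then show "z \<in> f ` ?G" using * by auto
  qed
  then show ?thesis
    unfolding rd_def using image_span[OF X.rd_generators[OF assms]] by simp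
qed

section \<open>The regular module and the Jacobson radical\<close>

lemma regular_simps [simp]:
  "carrier (scalar_module A \<phi>) = carrier A" "\<zero>\<^bsub>scalar_module A \<phi>\<^esub> = \<zero>\<^bsub>A\<^esub>"
  "x \<oplus>\<^bsub>scalar_module A \<phi>\<^esub> y = x \<oplus>\<^bsub>A\<^esub> y" "a \<odot>\<^bsub>scalar_module A \<phi>\<^esub> x = \<phi> a \<otimes>\<^bsub>A\<^esub> x"
  by (simp_all add: scalar_module_def)

lemma regular_uminus [simp]:
  "\<ominus>\<^bsub>scalar_module A \<phi>\<^esub> x = \<ominus>\<^bsub>A\<^esub> x" "x \<ominus>\<^bsub>scalar_module A \<phi>\<^esub> y = x \<ominus>\<^bsub>A\<^esub> y"
  by (simp_all add: a_minus_def a_inv_def scalar_module_def m_inv_def)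

lemma regular_lmodule: "ring A \<Longrightarrow> lmodule A (scalar_module A id)"
proof -
  assume "ring A"
  then interpret ring A .
  have "abelian_group (scalar_module A id)"
    by (rule abelian_groupI) (auto simp: add.m_ac intro: bexI[of _ "\<ominus>\<^bsub>A\<^esub> x" for x] l_neg)
  then show ?thesis
    by (intro lmodule.intro lmodule_axioms.intro ring_axioms)
      (auto simp: l_distr r_distr m_assoc)
qed

lemma (in lmodule) orbit_hom:
  "w \<in> carrier M \<Longrightarrow> (\<lambda>a. a \<odot>\<^bsub>M\<^esub> w) \<in> module_hom R (scalar_module R id) M"
  by (auto simp: module_hom_iff smult_l_distr smult_assoc1)

lemma (in lmodule) orbit_lhom:
  "w \<in> carrier M \<Longrightarrow> lhom R (scalar_module R id) M (\<lambda>a. a \<odot>\<^bsub>M\<^esub> w)"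
  by (intro lhomI regular_lmodule R.ring_axioms lmodule_axioms orbit_hom)

text \<open>Expresses that \<open>X/C\<close> is simple without forming a quotient
  (\<open>simple_quot_iff\<close>), so that the property moves easily along submodules and
  isomorphisms.\<close>

definition covered :: "('a, 'r) ring_scheme \<Rightarrow> ('a, 'b) module \<Rightarrow> 'b set \<Rightarrow> 'b set \<Rightarrow> bool" where
  "covered A W C X \<longleftrightarrow> submodule C A W \<and> submodule X A W \<and> C \<subset> X \<and>
     (\<forall>D. submodule D A W \<longrightarrow> C \<subseteq> D \<longrightarrow> D \<subseteq> X \<longrightarrow> D = C \<or> D = X)"

lemma maximal_left_ideal_iff:
  assumes "ring A"
  shows "maximal_left_ideal I A \<longleftrightarrow> covered A (scalar_module A id) I (carrier A)"
proof -
  interpret lmodule A "scalar_module A id" by (rule regular_lmodule) fact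
  show ?thesis
    using lsub_subset lsub_top by (auto simp: maximal_left_ideal_def covered_def)
qed

text \<open>J annihilates simple modules. For \<open>x\<close> outside \<open>C\<close> the left
  ideal of all \<open>b\<close> with \<open>b x\<close> in \<open>C\<close> is maximal: for a larger
  left ideal \<open>K\<close> one gets \<open>C + K x = X\<close>, so \<open>x = c + k x\<close>,
  and \<open>1 - k\<close> lies in the ideal, whence \<open>K\<close> contains 1. By maximality the
  ideal contains J.\<close>

lemma (in lmodule) jac_covered:
  assumes "covered R M C X" "a \<in> jacobson_radical R" "x \<in> X"
  shows "a \<odot>\<^bsub>M\<^esub> x \<in> C"
proof (cases "x \<in> C")
  case True
  then show ?thesis using assms jac_subset lsub_smult by (auto simp: covered_def)
next
  case False
  let ?A = "scalar_module R id"
  have C: "submodule C R M" and X: "submodule X R M" "C \<subseteq> X"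
    and max: "\<And>D. submodule D R M \<Longrightarrow> C \<subseteq> D \<Longrightarrow> D \<subseteq> X \<Longrightarrow> D = C \<or> D = X"
    using assms(1) by (auto simp: covered_def)
  have xc: "x \<in> carrier M" using X assms(3) lsub_carrier by blast
  interpret o: lhom R ?A M "\<lambda>a. a \<odot>\<^bsub>M\<^esub> x" by (rule orbit_lhom[OF xc])
  define I where "I = {b \<in> carrier R. b \<odot>\<^bsub>M\<^esub> x \<in> C}"
  have I: "submodule I R ?A"
    using o.preimage_submodule[OF C] by (simp add: I_def)
  have "I \<noteq> carrier R"
    using False xc R.one_closed smult_one[OF xc] unfolding I_def by (metis (mono_tags, lifting) mem_Collect_eq)
  moreover have "K = I \<or> K = carrier R" if K: "submodule K R ?A" "I \<subseteq> K" for K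
  proof -
    let ?D = "C <+>\<^bsub>M\<^esub> (\<lambda>a. a \<odot>\<^bsub>M\<^esub> x) ` K"
    have oK: "submodule ((\<lambda>a. a \<odot>\<^bsub>M\<^esub> x) ` K) R M" by (rule o.image_submodule[OF K(1)])
    have Kc: "K \<subseteq> carrier R" using o.X.lsub_subset[OF K(1)] by simp
    have "(\<lambda>a. a \<odot>\<^bsub>M\<^esub> x) ` K \<subseteq> X" using Kc X(1) assms(3) lsub_smult by blast
    then consider "?D = C" | "?D = X"
      using max[OF lsub_sum[OF C oK]] lsum_upper1[OF C oK] lsum_least[OF X(1,2)] by blast
    then show ?thesis
    proof cases
      case 1
      then have "(\<lambda>a. a \<odot>\<^bsub>M\<^esub> x) ` K \<subseteq> C" using lsum_upper2[OF C oK] by simp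
      then show ?thesis using Kc K(2) by (auto simp: I_def)
    next
      case 2
      then obtain c k where ck: "c \<in> C" "k \<in> K" "x = c \<oplus>\<^bsub>M\<^esub> k \<odot>\<^bsub>M\<^esub> x"
        using assms(3) by (auto simp: mem_set_add)
      have kc: "k \<in> carrier R" "c \<in> carrier M" using ck Kc C lsub_carrier by auto
      have "(\<one> \<ominus> k) \<odot>\<^bsub>M\<^esub> x = c"
      proof -
        have "(\<one> \<ominus> k) \<odot>\<^bsub>M\<^esub> x \<oplus>\<^bsub>M\<^esub> k \<odot>\<^bsub>M\<^esub> x = x"
          using kc xc by (simp flip: smult_l_distr)
        also have "\<dots> = c \<oplus>\<^bsub>M\<^esub> k \<odot>\<^bsub>M\<^esub> x" by (rule ck(3))
        finally show ?thesis using kc xc by simp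
      qed
      then have "\<one> \<ominus> k \<in> K" using ck(1) kc K(2) by (auto simp: I_def)
      then have "(\<one> \<ominus> k) \<oplus> k \<in> K" using o.X.lsub_add[OF K(1)] ck(2) by simp
      then have one: "\<one> \<in> K" using kc by simp
      have "b \<in> K" if "b \<in> carrier R" for b
        using o.X.lsub_smult[OF K(1) that one] that by simp
      then show ?thesis using Kc by auto
    qed
  qed
  ultimately have "maximal_left_ideal I R"
    unfolding maximal_left_ideal_def using I by blast
  then have "a \<in> I" using assms(2) by (auto simp: jacobson_radical_def)
  then show ?thesis by (simp add: I_def)
qed

lemma (in lmodule) rd_covered: "covered R M C X \<Longrightarrow> rd R M X \<subseteq> C"
  by (intro rd_least jac_covered) (auto simp: covered_def)

lemma jac_left_ideal:
  assumes "ring A" shows "submodule (jacobson_radical A) A (scalar_module A id)"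
proof -
  interpret lmodule A "scalar_module A id" by (rule regular_lmodule) fact
  have "submodule I A (scalar_module A id)" if "maximal_left_ideal I A" for I
    using that by (simp add: maximal_left_ideal_def)
  then show ?thesis
    by (auto simp: lsub_iff jacobson_radical_def)
qed

text \<open>J is defined by maximal left ideals, so stability on the right needs an argument:
  \<open>A/I\<close> is simple for a maximal left ideal \<open>I\<close>, hence J multiplies all of
  \<open>A\<close> into \<open>I\<close>.\<close>

lemma jac_right_ideal:
  assumes "ring A" "a \<in> jacobson_radical A" "b \<in> carrier A"
  shows "a \<otimes>\<^bsub>A\<^esub> b \<in> jacobson_radical A"
proof -
  interpret lmodule A "scalar_module A id" by (rule regular_lmodule) fact
  have "a \<otimes>\<^bsub>A\<^esub> b \<in> I" if "maximal_left_ideal I A" for I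
    using jac_covered[of I "carrier A" a b] that assms by (simp add: maximal_left_ideal_iff)
  moreover have "a \<otimes>\<^bsub>A\<^esub> b \<in> carrier A"
    using assms jac_subset by auto
  ultimately show ?thesis by (simp add: jacobson_radical_def)
qed

lemma (in lmodule) generate_smult_submodule:
  assumes I: "submodule I R (scalar_module R id)" and V: "V \<subseteq> carrier M"
  shows "submodule (generate (add_monoid M) {a \<odot>\<^bsub>M\<^esub> x | a x. a \<in> I \<and> x \<in> V}) R M"
    (is "submodule (generate _ ?G) _ _")
proof (rule lsubmoduleI)
  interpret A: lmodule R "scalar_module R id" by (rule regular_lmodule[OF R.ring_axioms])
  have Ic: "I \<subseteq> carrier R" using A.lsub_subset[OF I] by simp
  have G: "?G \<subseteq> carrier M" using Ic V by auto
  show *: "generate (add_monoid M) ?G \<subseteq> carrier M"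
    using M.add.generate_incl[OF G] .
  show "\<zero>\<^bsub>M\<^esub> \<in> generate (add_monoid M) ?G"
    using generate.one[of "add_monoid M"] by simp
  show "x \<oplus>\<^bsub>M\<^esub> y \<in> generate (add_monoid M) ?G"
    if "x \<in> generate (add_monoid M) ?G" "y \<in> generate (add_monoid M) ?G" for x y
    using generate.eng[OF that] by simp
  fix b x assume b: "b \<in> carrier R" and "x \<in> generate (add_monoid M) ?G"
  have inc: "b \<odot>\<^bsub>M\<^esub> (a \<odot>\<^bsub>M\<^esub> v) \<in> ?G" if "b \<in> carrier R" "a \<in> I" "v \<in> V" for a b v
  proof -
    have "b \<odot>\<^bsub>M\<^esub> (a \<odot>\<^bsub>M\<^esub> v) = (b \<otimes> a) \<odot>\<^bsub>M\<^esub> v" using that b Ic V by (simp add: smult_assoc1 subset_iff)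
    moreover have "b \<otimes> a \<in> I" using A.lsub_smult[OF I that(1,2)] by simp
    ultimately show ?thesis using that by blast
  qed
  from \<open>x \<in> generate (add_monoid M) ?G\<close> show "b \<odot>\<^bsub>M\<^esub> x \<in> generate (add_monoid M) ?G"
  proof (induction x rule: generate.induct)
    case one
    then show ?case using b smult_zero_right generate.one[of "add_monoid M"] by simp
  next
    case (incl h)
    then show ?case using inc[OF b] by (auto intro!: generate.incl)
  next
    case (inv h)
    then obtain a v where av: "a \<in> I" "v \<in> V" "h = a \<odot>\<^bsub>M\<^esub> v" by auto
    then have h: "h \<in> carrier M" using Ic V by auto
    have "inv\<^bsub>add_monoid M\<^esub> h = (\<ominus> \<one>) \<odot>\<^bsub>M\<^esub> h"
      using smult_uminus_one[OF h] by (simp add: a_inv_def)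
    then have "b \<odot>\<^bsub>M\<^esub> (inv\<^bsub>add_monoid M\<^esub> h) = (b \<otimes> (\<ominus> \<one>)) \<odot>\<^bsub>M\<^esub> h"
      using b h by (simp add: smult_assoc1)
    then show ?case using inc[of "b \<otimes> (\<ominus> \<one>)" a v] av b by (auto intro!: generate.incl)
  next
    case (eng x y)
    then have "x \<in> carrier M" "y \<in> carrier M" using * by auto
    then show ?case using eng b generate.eng[of _ "add_monoid M" ?G] by (simp add: smult_r_distr)
  qed
qed

text \<open>\<open>rad_pow\<close> takes the additive subgroup generated by products,
  \<open>rd\<close> takes the span. For a left ideal \<open>I\<close> the set of products is stable
  under scalars, so the two agree.\<close>

lemma (in lmodule) generate_eq_span:
  assumes I: "submodule I R (scalar_module R id)" and V: "V \<subseteq> carrier M"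
  shows "generate (add_monoid M) {a \<odot>\<^bsub>M\<^esub> x | a x. a \<in> I \<and> x \<in> V} =
    submodule_span R M {a \<odot>\<^bsub>M\<^esub> x | a x. a \<in> I \<and> x \<in> V}" (is "generate _ ?G = _")
proof
  interpret A: lmodule R "scalar_module R id" by (rule regular_lmodule[OF R.ring_axioms])
  have Ic: "I \<subseteq> carrier R" using A.lsub_subset[OF I] by simp
  have G: "?G \<subseteq> carrier M" using Ic V by auto
  show "generate (add_monoid M) ?G \<subseteq> submodule_span R M ?G"
    using span_submodule[OF G] span_upper[of ?G]
    by (intro M.add.generate_subgroup_incl) (auto simp: submodule.axioms(1))
  show "submodule_span R M ?G \<subseteq> generate (add_monoid M) ?G"
    by (intro span_least generate_smult_submodule assms) (auto intro: generate.incl)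
qed

text \<open>\<open>ideal_pow\<close> starts from the whole ring, so the exponent 1 literally gives J
  A; this is J because J is stable under right multiplication and \<open>A\<close> has a
  unit.\<close>

lemma ideal_pow_1:
  assumes "ring A" shows "ideal_pow A (jacobson_radical A) 1 = jacobson_radical A"
proof -
  interpret ring A by fact
  interpret L: lmodule A "scalar_module A id" by (rule regular_lmodule) fact
  have "ideal_prod A (jacobson_radical A) (carrier A) \<subseteq> jacobson_radical A"
  proof
    fix x assume "x \<in> ideal_prod A (jacobson_radical A) (carrier A)"
    then show "x \<in> jacobson_radical A"
      using jac_right_ideal[OF assms] L.lsub_add[OF jac_left_ideal[OF assms]]
      by induction auto
  qed
  moreover have "x \<in> ideal_prod A (jacobson_radical A) (carrier A)" if "x \<in> jacobson_radical A" for x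
    using ideal_prod.prod[OF that one_closed, of A] that by simp
  ultimately show ?thesis by auto
qed

context lmodule
begin

lemma rad_pow_1: "rad_pow R 1 M = rd R M (carrier M)"
  using generate_eq_span[OF jac_left_ideal[OF R.ring_axioms] subset_refl]
  by (simp only: rad_pow_def ideal_pow_1[OF R.ring_axioms] rd_def)

lemma rad_pow_2: "rad_pow R 2 M = rd R M (rd R M (carrier M))"
proof -
  interpret A: lmodule R "scalar_module R id" by (rule regular_lmodule[OF R.ring_axioms])
  let ?J = "jacobson_radical R"
  note J = jac_left_ideal[OF R.ring_axioms]
  define J2 where "J2 = ideal_prod R ?J ?J"
  have pow2: "ideal_pow R ?J 2 = J2"
    using ideal_pow_1[OF R.ring_axioms] by (simp add: J2_def numeral_2_eq_2)
  have "submodule J2 R (scalar_module R id)"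
  proof (rule A.lsubmoduleI)
    have "x \<in> carrier R \<and> (\<forall>a\<in>carrier R. a \<otimes> x \<in> J2)" if "x \<in> J2" for x
      using that unfolding J2_def
    proof induction
      case (prod i j)
      then show ?case
        using jac_subset[of R] A.lsub_smult[OF J, of _ i] ideal_prod.prod[of _ ?J j ?J R]
        by (auto simp: subset_iff simp flip: R.m_assoc)
    next
      case (sum s1 s2)
      then show ?case by (auto simp: R.r_distr intro: ideal_prod.sum)
    qed
    then show "J2 \<subseteq> carrier (scalar_module R id)"
      "\<And>a x. a \<in> carrier R \<Longrightarrow> x \<in> J2 \<Longrightarrow> a \<odot>\<^bsub>scalar_module R id\<^esub> x \<in> J2" by auto
    have "\<zero> \<in> ?J" using A.lsub_zero[OF J] by simp
    then show "\<zero>\<^bsub>scalar_module R id\<^esub> \<in> J2"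
      using ideal_prod.prod[of \<zero> ?J \<zero> ?J R] by (simp add: J2_def)
  qed (auto simp: J2_def intro: ideal_prod.sum)
  then have eq: "rad_pow R 2 M = submodule_span R M {a \<odot>\<^bsub>M\<^esub> x | a x. a \<in> J2 \<and> x \<in> carrier M}"
    using generate_eq_span[of J2 "carrier M"] by (simp add: rad_pow_def pow2)
  have rc: "rd R M (carrier M) \<subseteq> carrier M" by (intro lsub_subset rd_submodule subset_refl)
  have r2: "submodule (rd R M (rd R M (carrier M))) R M" by (rule rd_submodule[OF rc])
  have gen: "{a \<odot>\<^bsub>M\<^esub> x | a x. a \<in> J2 \<and> x \<in> carrier M} \<subseteq> rd R M (rd R M (carrier M))"
  proof -
    have "a \<in> carrier R \<and> a \<odot>\<^bsub>M\<^esub> x \<in> rd R M (rd R M (carrier M))" if "x \<in> carrier M" "a \<in> J2" for a x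
      using that(2) unfolding J2_def
    proof induction
      case (prod i j)
      then have "i \<odot>\<^bsub>M\<^esub> (j \<odot>\<^bsub>M\<^esub> x) \<in> rd R M (rd R M (carrier M))"
        by (intro rd_mem that)
      then show ?case using prod jac_subset[of R] that by (simp add: smult_assoc1 subset_iff)
    next
      case (sum s1 s2)
      then show ?case using that by (auto simp: smult_l_distr lsub_add[OF r2])
    qed
    then show ?thesis by auto
  qed
  have Gc: "{a \<odot>\<^bsub>M\<^esub> x | a x. a \<in> J2 \<and> x \<in> carrier M} \<subseteq> carrier M" (is "?G \<subseteq> _")
    using gen lsub_subset[OF r2] by blast
  have "rd R M (rd R M (carrier M)) \<subseteq> submodule_span R M ?G"
  proof (rule rd_least[OF span_submodule[OF Gc]])
    fix a y assume a: "a \<in> ?J" and "y \<in> rd R M (carrier M)"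
    \<comment> \<open>To get J(JW) inside the span of the products from J^2 and W, collect the
      \<open>y\<close> with J y in that span. They form a submodule because J is stable under right
      multiplication, and this submodule contains all products from J and W.\<close>
    let ?D = "{y \<in> carrier M. \<forall>b\<in>?J. b \<odot>\<^bsub>M\<^esub> y \<in> submodule_span R M ?G}"
    note sp = span_submodule[OF Gc]
    have D: "submodule ?D R M"
      using jac_subset[of R] jac_right_ideal[OF R.ring_axioms]
      by (intro lsubmoduleI)
        (auto simp: smult_zero_right smult_r_distr lsub_zero[OF sp] lsub_add[OF sp] subset_iff
          simp flip: smult_assoc1)
    have "rd R M (carrier M) \<subseteq> ?D"
    proof (rule rd_least[OF D])
      fix c x assume c: "c \<in> ?J" "x \<in> carrier M"
      have "b \<odot>\<^bsub>M\<^esub> (c \<odot>\<^bsub>M\<^esub> x) \<in> ?G" if "b \<in> ?J" for b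
        using c that jac_subset[of R] ideal_prod.prod[of b ?J c ?J R]
        by (auto simp: J2_def subset_iff simp flip: smult_assoc1)
      then show "c \<odot>\<^bsub>M\<^esub> x \<in> ?D"
        using c jac_subset[of R] span_upper[of ?G] by auto
    qed
    then show "a \<odot>\<^bsub>M\<^esub> y \<in> submodule_span R M ?G"
      using a \<open>y \<in> rd R M (carrier M)\<close> by auto
  qed
  moreover have "submodule_span R M ?G \<subseteq> rd R M (rd R M (carrier M))"
    by (rule span_least[OF r2 gen])
  ultimately show ?thesis using eq by simp
qed

end

section \<open>Chain conditions and complements modulo the radical\<close>

text \<open>Well-foundedness is used instead of stabilizing chains: it yields minimal elements and
  inductions directly, and it passes to sums by a lexicographic product.\<close>

definition dcc :: "('a, 'r) ring_scheme \<Rightarrow> ('a, 'b) module \<Rightarrow> 'b set \<Rightarrow> bool" where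
  "dcc A W V \<longleftrightarrow> wf {(C, D). submodule C A W \<and> submodule D A W \<and> C \<subset> D \<and> D \<subseteq> V}"

text \<open>Instead of an additive length function, all that is used of finite length is the existence of a
  strictly monotone map from the submodules to the naturals.\<close>

definition fin_len :: "('a, 'r) ring_scheme \<Rightarrow> ('a, 'b) module \<Rightarrow> 'b set \<Rightarrow> bool" where
  "fin_len A W V \<longleftrightarrow> (\<exists>l :: 'b set \<Rightarrow> nat. \<forall>C D. submodule C A W \<longrightarrow> submodule D A W \<longrightarrow>
     C \<subset> D \<longrightarrow> D \<subseteq> V \<longrightarrow> l C < l D)"

lemma dcc_by_wf:
  assumes "wf r"
    and "\<And>C D. submodule C A W \<Longrightarrow> submodule D A W \<Longrightarrow> C \<subset> D \<Longrightarrow> D \<subseteq> V \<Longrightarrow> (h C, h D) \<in> r"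
  shows "dcc A W V"
  unfolding dcc_def by (rule wf_subset[OF wf_inv_image[OF assms(1), of h]]) (simp add: subset_iff assms(2))

context lmodule
begin

text \<open>The modular law: comparable submodules of \<open>X + Y\<close> agree if they have the
  same trace on \<open>X\<close> and their sums with \<open>X\<close> have the same trace on
  \<open>Y\<close>. For \<open>d = x + y\<close> in \<open>D\<close> the second condition gives
  \<open>y = c' + x'\<close>, and the remaining \<open>x + x'\<close> lies in
  \<open>D \<inter> X\<close>, hence in \<open>C\<close>.\<close>

lemma modular_sum:
  assumes C: "submodule C R M" and D: "submodule D R M" and X: "submodule X R M" and Y: "submodule Y R M"
    and "C \<subseteq> D" "D \<subseteq> X <+>\<^bsub>M\<^esub> Y" "C \<inter> X = D \<inter> X" "(C <+>\<^bsub>M\<^esub> X) \<inter> Y = (D <+>\<^bsub>M\<^esub> X) \<inter> Y"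
  shows "C = D"
proof
  show "D \<subseteq> C"
  proof
    fix d assume d: "d \<in> D"
    then obtain x y where xy: "x \<in> X" "y \<in> Y" "d = x \<oplus>\<^bsub>M\<^esub> y" using assms(6) unfolding subset_iff mem_set_add by blast
    have c: "d \<in> carrier M" "x \<in> carrier M" "y \<in> carrier M" using d xy D X Y lsub_carrier by blast+
    have "y = d \<oplus>\<^bsub>M\<^esub> (\<ominus>\<^bsub>M\<^esub> x)" using c xy by (metis M.minus_add_cancel(4) a_minus_def)
    then have "y \<in> (D <+>\<^bsub>M\<^esub> X) \<inter> Y"
      using d xy lsub_uminus[OF X] by (auto simp: mem_set_add)
    then have "y \<in> C <+>\<^bsub>M\<^esub> X" using assms(8) by auto
    then obtain c' x' where cx: "c' \<in> C" "x' \<in> X" "y = c' \<oplus>\<^bsub>M\<^esub> x'" by (auto simp: mem_set_add)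
    have c': "c' \<in> carrier M" "x' \<in> carrier M" using cx C X lsub_carrier by blast+
    have e: "d = c' \<oplus>\<^bsub>M\<^esub> (x \<oplus>\<^bsub>M\<^esub> x')" using xy cx c c' by (simp add: M.add.m_ac)
    then have "x \<oplus>\<^bsub>M\<^esub> x' = d \<ominus>\<^bsub>M\<^esub> c'" using c c' by simp
    then have "x \<oplus>\<^bsub>M\<^esub> x' \<in> D"
      using lsub_minus[OF D d subsetD[OF assms(5) cx(1)]] by simp
    moreover have "x \<oplus>\<^bsub>M\<^esub> x' \<in> X" by (rule lsub_add[OF X xy(1) cx(2)])
    ultimately have "x \<oplus>\<^bsub>M\<^esub> x' \<in> C" using assms(7) by auto
    then show "d \<in> C" using e cx lsub_add[OF C] by auto
  qed
qed fact

lemma sum_mono_left: "C \<subseteq> D \<Longrightarrow> C <+>\<^bsub>M\<^esub> X \<subseteq> D <+>\<^bsub>M\<^esub> X"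
  unfolding subset_iff mem_set_add by blast

text \<open>By \<open>modular_sum\<close> the pair of traces drops in the lexicographic order
  whenever the submodule shrinks.\<close>

lemma dcc_sum:
  assumes X: "submodule X R M" and Y: "submodule Y R M" and "dcc R M X" "dcc R M Y"
  shows "dcc R M (X <+>\<^bsub>M\<^esub> Y)"
proof (rule dcc_by_wf[OF wf_lex_prod[OF assms(3,4)[unfolded dcc_def]]])
  fix C D assume CD: "submodule C R M" "submodule D R M" "C \<subset> D" "D \<subseteq> X <+>\<^bsub>M\<^esub> Y"
  have "submodule (C \<inter> X) R M" "submodule (D \<inter> X) R M"
    "submodule ((C <+>\<^bsub>M\<^esub> X) \<inter> Y) R M" "submodule ((D <+>\<^bsub>M\<^esub> X) \<inter> Y) R M"
    using CD X Y by (auto intro: lsub_inter lsub_sum)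
  moreover have "C \<inter> X \<subseteq> D \<inter> X" "(C <+>\<^bsub>M\<^esub> X) \<inter> Y \<subseteq> (D <+>\<^bsub>M\<^esub> X) \<inter> Y"
    using CD(3) sum_mono_left[of C D X] by auto
  moreover have "\<not> (C \<inter> X = D \<inter> X \<and> (C <+>\<^bsub>M\<^esub> X) \<inter> Y = (D <+>\<^bsub>M\<^esub> X) \<inter> Y)"
    using modular_sum[OF CD(1,2) X Y] CD(3,4) by blast
  ultimately show "((C \<inter> X, (C <+>\<^bsub>M\<^esub> X) \<inter> Y), (D \<inter> X, (D <+>\<^bsub>M\<^esub> X) \<inter> Y)) \<in>
      {(C, D). submodule C R M \<and> submodule D R M \<and> C \<subset> D \<and> D \<subseteq> X} <*lex*>
      {(C, D). submodule C R M \<and> submodule D R M \<and> C \<subset> D \<and> D \<subseteq> Y}"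
    by auto
qed

text \<open>The ranks of the same two traces are added: neither grows and at least one drops when
  the submodule shrinks.\<close>

lemma fin_len_sum:
  assumes X: "submodule X R M" and Y: "submodule Y R M" and "fin_len R M X" "fin_len R M Y"
  shows "fin_len R M (X <+>\<^bsub>M\<^esub> Y)"
proof -
  obtain l1 where l1: "\<And>C D. submodule C R M \<Longrightarrow> submodule D R M \<Longrightarrow> C \<subset> D \<Longrightarrow> D \<subseteq> X \<Longrightarrow> l1 C < (l1 D :: nat)"
    using assms(3) unfolding fin_len_def by blast
  obtain l2 where l2: "\<And>C D. submodule C R M \<Longrightarrow> submodule D R M \<Longrightarrow> C \<subset> D \<Longrightarrow> D \<subseteq> Y \<Longrightarrow> l2 C < (l2 D :: nat)"
    using assms(4) unfolding fin_len_def by blast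
  have "l1 (C \<inter> X) + l2 ((C <+>\<^bsub>M\<^esub> X) \<inter> Y) < l1 (D \<inter> X) + l2 ((D <+>\<^bsub>M\<^esub> X) \<inter> Y)"
    if CD: "submodule C R M" "submodule D R M" "C \<subset> D" "D \<subseteq> X <+>\<^bsub>M\<^esub> Y" for C D
  proof -
    have s: "submodule (C \<inter> X) R M" "submodule (D \<inter> X) R M"
      "submodule ((C <+>\<^bsub>M\<^esub> X) \<inter> Y) R M" "submodule ((D <+>\<^bsub>M\<^esub> X) \<inter> Y) R M"
      using CD X Y by (auto intro: lsub_inter lsub_sum)
    have le: "C \<inter> X \<subseteq> D \<inter> X" "(C <+>\<^bsub>M\<^esub> X) \<inter> Y \<subseteq> (D <+>\<^bsub>M\<^esub> X) \<inter> Y"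
      using CD(3) sum_mono_left[of C D X] by auto
    have n: "\<not> (C \<inter> X = D \<inter> X \<and> (C <+>\<^bsub>M\<^esub> X) \<inter> Y = (D <+>\<^bsub>M\<^esub> X) \<inter> Y)"
      using modular_sum[OF CD(1,2) X Y] CD(3,4) by blast
    have a: "l1 (C \<inter> X) < l1 (D \<inter> X) \<or> C \<inter> X = D \<inter> X"
      using l1[OF s(1,2)] le(1) by blast
    have b: "l2 ((C <+>\<^bsub>M\<^esub> X) \<inter> Y) < l2 ((D <+>\<^bsub>M\<^esub> X) \<inter> Y) \<or> (C <+>\<^bsub>M\<^esub> X) \<inter> Y = (D <+>\<^bsub>M\<^esub> X) \<inter> Y"
      using l2[OF s(3,4)] le(2) by blast
    show ?thesis using a b n by force
  qed
  then show ?thesis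
    unfolding fin_len_def by (intro exI[of _ "\<lambda>C. l1 (C \<inter> X) + l2 ((C <+>\<^bsub>M\<^esub> X) \<inter> Y)"]) blast
qed

lemma dcc_bot: "dcc R M {\<zero>\<^bsub>M\<^esub>}"
proof -
  have "\<not> C \<subset> D" if "submodule C R M" "D \<subseteq> {\<zero>\<^bsub>M\<^esub>}" for C D
    using lsub_zero[OF that(1)] that(2) by auto
  then have *: "{(C, D). submodule C R M \<and> submodule D R M \<and> C \<subset> D \<and> D \<subseteq> {\<zero>\<^bsub>M\<^esub>}} = {}"
    by blast
  show ?thesis unfolding dcc_def * by simp
qed

lemma fin_len_bot: "fin_len R M {\<zero>\<^bsub>M\<^esub>}"
proof -
  have "\<not> C \<subset> D" if "submodule C R M" "D \<subseteq> {\<zero>\<^bsub>M\<^esub>}" for C D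
    using lsub_zero[OF that(1)] that(2) by auto
  then show ?thesis unfolding fin_len_def by blast
qed

lemma dcc_min:
  assumes "dcc R M (carrier M)" "submodule X R M" "Q X"
  obtains Y where "submodule Y R M" "Q Y" "\<And>Z. submodule Z R M \<Longrightarrow> Z \<subset> Y \<Longrightarrow> \<not> Q Z"
proof -
  have "X \<in> {Y. submodule Y R M \<and> Q Y}" using assms by simp
  then obtain Y where Y: "submodule Y R M" "Q Y"
    and min: "\<And>Z. (Z, Y) \<in> {(C, D). submodule C R M \<and> submodule D R M \<and> C \<subset> D \<and> D \<subseteq> carrier M} \<Longrightarrow>
      Z \<notin> {Y. submodule Y R M \<and> Q Y}"
    by (rule wfE_min[OF assms(1)[unfolded dcc_def]]) blast
  have "\<not> Q Z" if "submodule Z R M" "Z \<subset> Y" for Z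
    using min[of Z] that Y(1) lsub_subset[OF Y(1)] by simp
  then show ?thesis using that Y by blast
qed

lemma dcc_induct [consumes 3, case_names less]:
  assumes "dcc R M V" "submodule X R M" "X \<subseteq> V"
    and step: "\<And>X. submodule X R M \<Longrightarrow> X \<subseteq> V \<Longrightarrow>
      (\<And>Y. submodule Y R M \<Longrightarrow> Y \<subset> X \<Longrightarrow> Q Y) \<Longrightarrow> Q X"
  shows "Q X"
  using assms(1)[unfolded dcc_def] assms(2,3)
proof (induction X rule: wf_induct_rule)
  case (less X)
  show ?case
  proof (rule step[OF less.prems])
    fix Y assume "submodule Y R M" "Y \<subset> X"
    then show "Q Y" using less.prems by (intro less.IH) auto
  qed
qed

lemma span_insert:
  assumes "w \<in> carrier M" "F \<subseteq> carrier M"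
  shows "submodule_span R M (insert w F) = (\<lambda>a. a \<odot>\<^bsub>M\<^esub> w) ` carrier R <+>\<^bsub>M\<^esub> submodule_span R M F"
proof
  interpret o: lhom R "scalar_module R id" M "\<lambda>a. a \<odot>\<^bsub>M\<^esub> w" by (rule orbit_lhom[OF assms(1)])
  have o: "submodule ((\<lambda>a. a \<odot>\<^bsub>M\<^esub> w) ` carrier R) R M"
    using o.image_submodule[OF o.X.lsub_top] by simp
  have F: "submodule (submodule_span R M F) R M" by (rule span_submodule[OF assms(2)])
  have wF: "submodule (submodule_span R M (insert w F)) R M" using assms by (intro span_submodule) auto
  have "w \<in> (\<lambda>a. a \<odot>\<^bsub>M\<^esub> w) ` carrier R" using assms(1) by (intro image_eqI[of _ _ \<one>]) auto
  then show "submodule_span R M (insert w F) \<subseteq> (\<lambda>a. a \<odot>\<^bsub>M\<^esub> w) ` carrier R <+>\<^bsub>M\<^esub> submodule_span R M F"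
    using lsum_upper1[OF o F] lsum_upper2[OF o F] span_upper[of F]
    by (intro span_least lsub_sum o F) auto
  have "w \<in> submodule_span R M (insert w F)" using span_upper[of "insert w F"] by auto
  then show "(\<lambda>a. a \<odot>\<^bsub>M\<^esub> w) ` carrier R <+>\<^bsub>M\<^esub> submodule_span R M F \<subseteq> submodule_span R M (insert w F)"
    using lsub_smult[OF wF] span_upper[of "insert w F"] by (intro lsum_least wF span_least) auto
qed

lemma span_empty: "submodule_span R M {} = {\<zero>\<^bsub>M\<^esub>}"
  using span_least[OF lsub_bot] lsub_zero[OF span_submodule[of "{}"]] by auto

lemma orbit_submodule: "w \<in> carrier M \<Longrightarrow> submodule ((\<lambda>a. a \<odot>\<^bsub>M\<^esub> w) ` carrier R) R M"
  using lhom.image_submodule[OF orbit_lhom lmodule.lsub_top[OF regular_lmodule[OF R.ring_axioms]]] by simp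

text \<open>A finitely generated module is a finite sum of cyclic ones. This carries chain
  conditions over from the regular module, of which the cyclic submodules are images.\<close>

lemma fg_induct:
  assumes fg: "fg_module R M"
    and bot: "Q {\<zero>\<^bsub>M\<^esub>}"
    and orb: "\<And>w. w \<in> carrier M \<Longrightarrow> Q ((\<lambda>a. a \<odot>\<^bsub>M\<^esub> w) ` carrier R)"
    and sum: "\<And>X Y. submodule X R M \<Longrightarrow> submodule Y R M \<Longrightarrow> Q X \<Longrightarrow> Q Y \<Longrightarrow> Q (X <+>\<^bsub>M\<^esub> Y)"
  shows "Q (carrier M)"
proof -
  obtain S where S: "finite S" "S \<subseteq> carrier M" "submodule_span R M S = carrier M"
    using fg by (auto simp: fg_module_def)
  from S(1,2) have "Q (submodule_span R M S)"
  proof (induction S rule: finite_induct)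
    case empty
    then show ?case by (simp add: span_empty bot)
  next
    case (insert w F)
    then have "w \<in> carrier M" "F \<subseteq> carrier M" by auto
    with insert show ?case
      by (simp add: span_insert sum orb orbit_submodule span_submodule)
  qed
  then show ?thesis by (simp add: S)
qed

text \<open>\<open>Y\<close> is minimal with \<open>X + Y\<close> the whole module. If a maximal
  submodule \<open>I\<close> missed part of \<open>X \<inter> Y\<close>, then
  \<open>(X \<inter> Y) + I\<close> would be everything, and already
  \<open>X + (I \<inter> Y)\<close> would be everything, against minimality.\<close>

lemma supplement:
  assumes "dcc R M (carrier M)" "submodule X R M"
  obtains Y where "submodule Y R M" "X <+>\<^bsub>M\<^esub> Y = carrier M"
    "\<And>I. covered R M I (carrier M) \<Longrightarrow> X \<inter> Y \<subseteq> I"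
proof -
  have top: "X <+>\<^bsub>M\<^esub> carrier M = carrier M"
    using lsum_upper2[OF assms(2) lsub_top] lsub_subset[OF lsub_sum[OF assms(2) lsub_top]] by auto
  obtain Y where Y: "submodule Y R M" "X <+>\<^bsub>M\<^esub> Y = carrier M"
    and min: "\<And>Z. submodule Z R M \<Longrightarrow> Z \<subset> Y \<Longrightarrow> X <+>\<^bsub>M\<^esub> Z \<noteq> carrier M"
    using dcc_min[where Q = "\<lambda>Y. X <+>\<^bsub>M\<^esub> Y = carrier M", OF assms(1) lsub_top top] by blast
  have "X \<inter> Y \<subseteq> I" if I: "covered R M I (carrier M)" for I
  proof (rule ccontr)
    assume "\<not> X \<inter> Y \<subseteq> I"
    then obtain z where z: "z \<in> X" "z \<in> Y" "z \<notin> I" by auto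
    have Is: "submodule I R M" using I by (simp add: covered_def)
    have XY: "submodule (X \<inter> Y) R M" by (rule lsub_inter[OF assms(2) Y(1)])
    have "(X \<inter> Y) <+>\<^bsub>M\<^esub> I = carrier M"
      using I lsub_sum[OF XY Is] lsum_upper2[OF XY Is] lsum_upper1[OF XY Is] z
        lsub_subset[OF lsub_sum[OF XY Is]] unfolding covered_def by blast
    have IY: "submodule (I \<inter> Y) R M" by (rule lsub_inter[OF Is Y(1)])
    have "y \<in> X <+>\<^bsub>M\<^esub> (I \<inter> Y)" if "y \<in> carrier M" for y
    proof -
      have "y \<in> X <+>\<^bsub>M\<^esub> Y" using that Y(2) by simp
      then obtain x v where xv: "x \<in> X" "v \<in> Y" "y = x \<oplus>\<^bsub>M\<^esub> v" unfolding mem_set_add by blast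
      have vc: "v \<in> carrier M" "x \<in> carrier M" using xv Y(1) assms(2) lsub_carrier by blast+
      then obtain u i where ui: "u \<in> X \<inter> Y" "i \<in> I" "v = u \<oplus>\<^bsub>M\<^esub> i"
        using \<open>(X \<inter> Y) <+>\<^bsub>M\<^esub> I = carrier M\<close> by (metis mem_set_add)
      have uc: "u \<in> carrier M" "i \<in> carrier M" using ui XY Is lsub_carrier by blast+
      have "i = v \<ominus>\<^bsub>M\<^esub> u" using ui uc vc by simp
      then have "i \<in> Y" using lsub_minus[OF Y(1) xv(2), of u] ui(1) by (metis IntD2)
      moreover have "y = (x \<oplus>\<^bsub>M\<^esub> u) \<oplus>\<^bsub>M\<^esub> i" using xv ui uc vc by (simp add: M.add.m_ac)
      moreover have "x \<oplus>\<^bsub>M\<^esub> u \<in> X" using lsub_add[OF assms(2)] xv ui by auto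
      ultimately show ?thesis using ui by (auto simp: mem_set_add)
    qed
    then have "X <+>\<^bsub>M\<^esub> (I \<inter> Y) = carrier M"
      using lsub_subset[OF lsub_sum[OF assms(2) IY]] by auto
    moreover have "I \<inter> Y \<subset> Y" using z by auto
    ultimately show False using min[OF IY] by auto
  qed
  then show ?thesis using that Y by blast
qed

end

lemma dcc_image:
  assumes "lhom A X Y f" "dcc A X (carrier X)" shows "dcc A Y (f ` carrier X)"
proof -
  interpret lhom A X Y f by fact
  show ?thesis
  proof (rule dcc_by_wf[OF assms(2)[unfolded dcc_def]])
    fix C D assume CD: "submodule C A Y" "submodule D A Y" "C \<subset> D" "D \<subseteq> f ` carrier X"
    then have "{x \<in> carrier X. f x \<in> C} \<subset> {x \<in> carrier X. f x \<in> D}" by (fastforce simp: psubset_eq)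
    then show "({x \<in> carrier X. f x \<in> C}, {x \<in> carrier X. f x \<in> D}) \<in>
       {(C, D). submodule C A X \<and> submodule D A X \<and> C \<subset> D \<and> D \<subseteq> carrier X}"
      using preimage_submodule[OF CD(1)] preimage_submodule[OF CD(2)] by auto
  qed
qed

lemma fin_len_image:
  assumes "lhom A X Y f" "fin_len A X (carrier X)" shows "fin_len A Y (f ` carrier X)"
proof -
  interpret lhom A X Y f by fact
  obtain l where l: "\<And>C D. submodule C A X \<Longrightarrow> submodule D A X \<Longrightarrow> C \<subset> D \<Longrightarrow> D \<subseteq> carrier X \<Longrightarrow> l C < (l D :: nat)"
    using assms(2) unfolding fin_len_def by blast
  have "l {x \<in> carrier X. f x \<in> C} < l {x \<in> carrier X. f x \<in> D}"
    if CD: "submodule C A Y" "submodule D A Y" "C \<subset> D" "D \<subseteq> f ` carrier X" for C D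
  proof -
    have "{x \<in> carrier X. f x \<in> C} \<subset> {x \<in> carrier X. f x \<in> D}" using CD by (fastforce simp: psubset_eq)
    then show ?thesis by (intro l preimage_submodule CD) auto
  qed
  then show ?thesis unfolding fin_len_def
    by (intro exI[of _ "\<lambda>C. l {x \<in> carrier X. f x \<in> C}"]) blast
qed

lemma (in lmodule) fg_dcc:
  assumes "fg_module R M" "dcc R (scalar_module R id) (carrier R)"
  shows "dcc R M (carrier M)"
proof (rule fg_induct[OF assms(1)])
  show "dcc R M {\<zero>\<^bsub>M\<^esub>}" by (rule dcc_bot)
  show "dcc R M ((\<lambda>a. a \<odot>\<^bsub>M\<^esub> w) ` carrier R)" if "w \<in> carrier M" for w
    using dcc_image[OF orbit_lhom[OF that]] assms(2) by simp
qed (rule dcc_sum)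

locale left_artinian = ring A for A :: "('a, 'r) ring_scheme" (structure) +
  assumes dcc: "dcc A (scalar_module A id) (carrier A)"

text \<open>\<open>A\<close> is finitely generated over the artinian ring \<open>k\<close>, so its
  \<open>k\<close>-submodules satisfy the descending chain condition, and left ideals of
  \<open>A\<close> are \<open>k\<close>-submodules along \<open>\<phi>\<close>.\<close>

lemma artin_algebra_left_artinian:
  assumes "artin_algebra k \<phi> A" shows "left_artinian A"
proof -
  have k: "cring k" and A: "ring A" and phi: "\<phi> \<in> ring_hom k A" and fg: "fg_module k (scalar_module A \<phi>)"
    and art: "\<And>I :: nat \<Rightarrow> _ set. (\<forall>n. ideal (I n) k \<and> I (Suc n) \<subseteq> I n) \<Longrightarrow> \<exists>m. \<forall>n\<ge>m. I n = I m"
    using assms by (auto simp: artin_algebra_def artinian_cring_def)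
  interpret k: cring k by fact
  interpret A: ring A by fact
  interpret K: lmodule k "scalar_module k id" by (rule regular_lmodule) (rule k.ring_axioms)
  interpret R: lmodule A "scalar_module A id" by (rule regular_lmodule) fact
  interpret L: lmodule k "scalar_module A \<phi>" using fg by (rule fg_lmodule)
  \<comment> \<open>Over a commutative ring the submodules of the regular module are ideals; this
    turns the chain condition on ideals of \<open>k\<close> into \<open>dcc\<close>.\<close>
  have ideal: "ideal I k" if "submodule I k (scalar_module k id)" for I
  proof (rule idealI[OF k.ring_axioms])
    show "subgroup I (add_monoid k)"
      using that K.lsub_uminus[OF that] unfolding K.lsub_iff
      by (intro subgroup.intro) (auto simp flip: a_inv_def)
    fix a x assume "a \<in> I" "x \<in> carrier k"
    then show "x \<otimes>\<^bsub>k\<^esub> a \<in> I" "a \<otimes>\<^bsub>k\<^esub> x \<in> I"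
      using K.lsub_smult[OF that, of x a] K.lsub_carrier[OF that, of a] by (simp_all add: k.m_comm)
  qed
  have "dcc k (scalar_module k id) (carrier k)"
    unfolding dcc_def wf_iff_no_infinite_down_chain
  proof
    assume "\<exists>f. \<forall>i. (f (Suc i), f i) \<in> {(C, D). submodule C k (scalar_module k id) \<and>
        submodule D k (scalar_module k id) \<and> C \<subset> D \<and> D \<subseteq> carrier k}"
    then obtain f where *: "\<forall>i. (f (Suc i), f i) \<in> {(C, D). submodule C k (scalar_module k id) \<and>
        submodule D k (scalar_module k id) \<and> C \<subset> D \<and> D \<subseteq> carrier k}" by blast
    have f: "submodule (f i) k (scalar_module k id)" "f (Suc i) \<subset> f i" for i
      using spec[OF *, of i] by simp_all
    then have "\<forall>n. ideal (f n) k \<and> f (Suc n) \<subseteq> f n" using ideal by blast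
    from art[OF this] obtain m where "\<forall>n\<ge>m. f n = f m" by blast
    then have "f (Suc m) = f m" by (meson le_SucI order_refl)
    then show False using f(2)[of m] by simp
  qed
  then have d: "dcc k (scalar_module A \<phi>) (carrier A)"
    using L.fg_dcc[OF fg] by simp
  have "submodule C k (scalar_module A \<phi>)" if "submodule C A (scalar_module A id)" for C
    using that ring_hom_closed[OF phi] unfolding L.lsub_iff R.lsub_iff by auto
  then have "dcc A (scalar_module A id) (carrier A)"
    using d unfolding dcc_def by (auto elim!: wf_subset)
  then show ?thesis
    using A by (simp add: left_artinian_def left_artinian_axioms_def)
qed

context left_artinian
begin

text \<open>This is \<open>supplement\<close> in the regular module, where the maximal submodules
  are the maximal left ideals, with intersection J.\<close>

lemma left_ideal_supplement:
  assumes "submodule X A (scalar_module A id)"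
  obtains Y where "submodule Y A (scalar_module A id)" "X <+>\<^bsub>A\<^esub> Y = carrier A"
    "X \<inter> Y \<subseteq> jacobson_radical A"
proof -
  interpret R: lmodule A "scalar_module A id" by (rule regular_lmodule) (rule ring_axioms)
  obtain Y where Y: "submodule Y A (scalar_module A id)" "X <+>\<^bsub>scalar_module A id\<^esub> Y = carrier (scalar_module A id)"
    "\<And>I. covered A (scalar_module A id) I (carrier (scalar_module A id)) \<Longrightarrow> X \<inter> Y \<subseteq> I"
    using R.supplement[OF _ assms] dcc by simp blast
  then have "X \<inter> Y \<subseteq> jacobson_radical A"
    using R.lsub_subset[OF assms] by (auto simp: jacobson_radical_def maximal_left_ideal_iff ring_axioms)
  moreover have "X <+>\<^bsub>A\<^esub> Y = carrier A"
    using Y(2) by (simp add: set_eq_iff mem_set_add)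
  ultimately show ?thesis using that Y(1) by blast
qed

text \<open>Semisimplicity of \<open>W\<close> modulo its radical, phrased inside \<open>W\<close>.
  Generators are absorbed one at a time: for \<open>w\<close>, a left ideal \<open>K\<close>
  supplementing the ideal of all \<open>a\<close> with \<open>a w\<close> in \<open>X + Y\<close>
  makes \<open>X + Y + K w\<close> contain \<open>w\<close>, while the overlap of \<open>X\<close>
  with the new complement stays in the radical.\<close>

lemma complement_mod_rd:
  assumes fg: "fg_module A W" and X: "submodule X A W" and rX: "rd A W (carrier W) \<subseteq> X"
  obtains Y where "submodule Y A W" "X <+>\<^bsub>W\<^esub> Y = carrier W" "X \<inter> Y \<subseteq> rd A W (carrier W)"
proof -
  interpret W: lmodule A W using fg by (rule fg_lmodule)
  let ?r = "rd A W (carrier W)"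
  obtain S where S: "finite S" "S \<subseteq> carrier W" "submodule_span A W S = carrier W"
    using fg by (auto simp: fg_module_def)
  from S(1,2) have "\<exists>Y. submodule Y A W \<and> S \<subseteq> X <+>\<^bsub>W\<^esub> Y \<and> X \<inter> Y \<subseteq> ?r"
  proof (induction S rule: finite_induct)
    case empty
    show ?case
      using W.lsub_zero[OF W.rd_submodule[OF subset_refl]] by (intro exI[of _ "{\<zero>\<^bsub>W\<^esub>}"]) (auto simp: W.lsub_bot)
  next
    case (insert w F)
    then obtain Y where Y: "submodule Y A W" "F \<subseteq> X <+>\<^bsub>W\<^esub> Y" "X \<inter> Y \<subseteq> ?r" by auto
    have w: "w \<in> carrier W" using insert by auto
    interpret o: lhom A "scalar_module A id" W "\<lambda>a. a \<odot>\<^bsub>W\<^esub> w" by (rule W.orbit_lhom[OF w])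
    let ?X = "X <+>\<^bsub>W\<^esub> Y"
    have X': "submodule ?X A W" by (rule W.lsub_sum[OF X Y(1)])
    have I: "submodule {a \<in> carrier A. a \<odot>\<^bsub>W\<^esub> w \<in> ?X} A (scalar_module A id)"
      using o.preimage_submodule[OF X'] by simp
    obtain K where K: "submodule K A (scalar_module A id)" "{a \<in> carrier A. a \<odot>\<^bsub>W\<^esub> w \<in> ?X} <+>\<^bsub>A\<^esub> K = carrier A"
      "{a \<in> carrier A. a \<odot>\<^bsub>W\<^esub> w \<in> ?X} \<inter> K \<subseteq> jacobson_radical A"
      using left_ideal_supplement[OF I] by blast
    let ?K = "(\<lambda>a. a \<odot>\<^bsub>W\<^esub> w) ` K"
    have oK: "submodule ?K A W" by (rule o.image_submodule[OF K(1)])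
    have Kc: "K \<subseteq> carrier A" using o.X.lsub_subset[OF K(1)] by simp
    obtain b c where bc: "b \<in> carrier A" "b \<odot>\<^bsub>W\<^esub> w \<in> ?X" "c \<in> K" "\<one> = b \<oplus> c"
      using K(2) one_closed unfolding set_eq_iff mem_set_add by blast
    have "w = b \<odot>\<^bsub>W\<^esub> w \<oplus>\<^bsub>W\<^esub> c \<odot>\<^bsub>W\<^esub> w"
      using bc w Kc by (metis W.smult_l_distr W.smult_one subsetD)
    then have w': "w \<in> ?X <+>\<^bsub>W\<^esub> ?K" using bc unfolding mem_set_add[where z = w and X = ?X] by blast
    have YK: "submodule (Y <+>\<^bsub>W\<^esub> ?K) A W" by (rule W.lsub_sum[OF Y(1) oK])
    have "?X <+>\<^bsub>W\<^esub> ?K \<subseteq> X <+>\<^bsub>W\<^esub> (Y <+>\<^bsub>W\<^esub> ?K)"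
      using W.lsum_upper1[OF X YK] W.lsum_upper2[OF X YK] W.lsum_upper1[OF Y(1) oK] W.lsum_upper2[OF Y(1) oK]
      by (intro W.lsum_least W.lsub_sum X YK) auto
    moreover have "F \<subseteq> ?X <+>\<^bsub>W\<^esub> ?K" using Y(2) W.lsum_upper1[OF X' oK] by auto
    moreover have "X \<inter> (Y <+>\<^bsub>W\<^esub> ?K) \<subseteq> ?r"
    proof
      fix z assume "z \<in> X \<inter> (Y <+>\<^bsub>W\<^esub> ?K)"
      then obtain y a where z: "z \<in> X" "y \<in> Y" "a \<in> K" "z = y \<oplus>\<^bsub>W\<^esub> a \<odot>\<^bsub>W\<^esub> w" by (auto simp: mem_set_add)
      have c: "z \<in> carrier W" "y \<in> carrier W" "a \<odot>\<^bsub>W\<^esub> w \<in> carrier W"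
        using z X Y(1) Kc w W.lsub_carrier by auto
      have "a \<odot>\<^bsub>W\<^esub> w = z \<oplus>\<^bsub>W\<^esub> (\<ominus>\<^bsub>W\<^esub> y)"
        using z c by (metis W.M.minus_add_cancel(4) a_minus_def)
      then have "a \<odot>\<^bsub>W\<^esub> w \<in> ?X" using z W.lsub_uminus[OF Y(1)] by (auto simp: mem_set_add)
      then have "a \<in> jacobson_radical A" using K(3) z Kc by auto
      then have ar: "a \<odot>\<^bsub>W\<^esub> w \<in> ?r" using w by (intro W.rd_mem)
      \<comment> \<open>The radical lies in \<open>X\<close>, so subtracting the part
        \<open>a w\<close> from \<open>z\<close> leaves an element of
        \<open>X \<inter> Y\<close>.\<close>
      have "y = z \<ominus>\<^bsub>W\<^esub> a \<odot>\<^bsub>W\<^esub> w" using z c by simp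
      then have "y \<in> X" using W.lsub_minus[OF X z(1)] ar rX by (metis subsetD)
      then have "y \<in> ?r" using Y(3) z by auto
      then show "z \<in> ?r" using ar z W.lsub_add[OF W.rd_submodule[OF subset_refl]] by auto
    qed
    ultimately show ?case using w' YK by blast
  qed
  then obtain Y where Y: "submodule Y A W" "S \<subseteq> X <+>\<^bsub>W\<^esub> Y" "X \<inter> Y \<subseteq> ?r" by blast
  have "carrier W \<subseteq> X <+>\<^bsub>W\<^esub> Y"
    using W.span_least[OF W.lsub_sum[OF X Y(1)] Y(2)] S(3) by simp
  then have "X <+>\<^bsub>W\<^esub> Y = carrier W" using W.lsub_subset[OF W.lsub_sum[OF X Y(1)]] by auto
  then show ?thesis using that Y by blast
qed

end

section \<open>Indecomposable projectives and lengths\<close>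

lemma direct_decomp_image:
  assumes "lhom A X Y f" "inj_on f (carrier X)" "direct_decomp A X K N L"
  shows "direct_decomp A Y (f ` K) (f ` N) (f ` L)"
proof -
  interpret lhom A X Y f by fact
  have NL: "submodule N A X" "submodule L A X" "N \<inter> L = {\<zero>\<^bsub>X\<^esub>}" "K = N <+>\<^bsub>X\<^esub> L"
    using assms(3) by (auto simp: direct_decomp_def)
  note c = X.lsub_subset[OF NL(1)] X.lsub_subset[OF NL(2)]
  have "f ` N \<inter> f ` L = f ` (N \<inter> L)"
    using inj_on_image_Int[OF assms(2) c] by simp
  then show ?thesis
    using NL by (simp add: direct_decomp_def image_submodule image_sum[OF c])
qed

lemma indecomposable_iso:
  assumes "lhom A X Y f" "bij_betw f (carrier X) (carrier Y)" "indecomposable A X"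
  shows "indecomposable A Y"
proof -
  interpret lhom A X Y f by fact
  obtain h where h: "h \<in> module_hom A Y X" "\<And>x. x \<in> carrier X \<Longrightarrow> h (f x) = x"
    "\<And>y. y \<in> carrier Y \<Longrightarrow> f (h y) = y" "bij_betw h (carrier Y) (carrier X)"
    using hom_inverse[OF X.lmodule_axioms Y.lmodule_axioms f assms(2)] by blast
  interpret h: lhom A Y X h by (intro lhomI X.lmodule_axioms Y.lmodule_axioms h)
  have "carrier Y \<noteq> {\<zero>\<^bsub>Y\<^esub>}"
  proof
    assume "carrier Y = {\<zero>\<^bsub>Y\<^esub>}"
    then have "h ` carrier Y = {\<zero>\<^bsub>X\<^esub>}" by simp
    then show False using h(4) assms(3) by (simp add: indecomposable_def bij_betw_def)
  qed
  moreover have "N = {\<zero>\<^bsub>Y\<^esub>} \<or> L = {\<zero>\<^bsub>Y\<^esub>}" if d: "direct_decomp A Y (carrier Y) N L" for N L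
  proof -
    have "direct_decomp A X (carrier X) (h ` N) (h ` L)"
      using direct_decomp_image[OF h.lhom_axioms _ d] h(4) by (simp add: bij_betw_def)
    then have "h ` N = {\<zero>\<^bsub>X\<^esub>} \<or> h ` L = {\<zero>\<^bsub>X\<^esub>}" using assms(3) by (simp add: indecomposable_def)
    moreover have "f ` h ` K = K" if "submodule K A Y" for K
      using h(3) Y.lsub_carrier[OF that] by (force simp: image_iff)
    ultimately show ?thesis using d unfolding direct_decomp_def by (metis image_empty image_insert zero)
  qed
  ultimately show ?thesis by (simp add: indecomposable_def Y.lmodule_axioms)
qed

lemma projective_iso:
  assumes "lhom A X Y f" "bij_betw f (carrier X) (carrier Y)" "projective_module A X"
  shows "projective_module A Y"
proof -
  interpret lhom A X Y f by fact
  obtain i where i: "i \<in> module_hom A Y X" "\<And>y. y \<in> carrier Y \<Longrightarrow> f (i y) = y"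
    using hom_inverse[OF X.lmodule_axioms Y.lmodule_axioms f assms(2)] by blast
  have fgX: "fg_module A X" using assms(3) by (simp add: projective_module_def)
  have "fg_module A Y"
    using fg_image[OF fgX Y.lmodule_axioms f] assms(2) by (simp add: bij_betw_def)
  moreover have "\<exists>t\<in>module_hom A Y V. \<forall>q\<in>carrier Y. g (t q) = h q"
    if V: "fg_module A V" "fg_module A U" "g \<in> module_hom A V U" "g ` carrier V = carrier U" "h \<in> module_hom A Y U"
    for V U :: "'a fgmod" and g h
  proof -
    obtain t where t: "t \<in> module_hom A X V" "\<And>q. q \<in> carrier X \<Longrightarrow> g (t q) = h (f q)"
      using projective_lift[OF assms(3) V(1-4) hom_comp[OF f V(5)]] by blast
    have "g (t (i y)) = h y" if "y \<in> carrier Y" for y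
      using t(2)[of "i y"] that i by (simp add: module_hom_iff)
    then show ?thesis by (intro bexI[OF _ hom_comp[OF i(1) t(1)]]) simp
  qed
  ultimately show ?thesis unfolding projective_module_def by blast
qed

text \<open>Write \<open>1 = e + e'\<close> along the decomposition. Right multiplication by
  \<open>e\<close> is the identity on \<open>I\<close>, so \<open>I = A e\<close>, and a map
  \<open>h\<close> on \<open>I\<close> is lifted by sending \<open>q\<close> to \<open>q x\<close>,
  where \<open>x\<close> is a preimage of \<open>h e\<close>.\<close>

lemma summand_projective:
  assumes "ring A" "direct_decomp A (scalar_module A id) (carrier A) I K"
  shows "projective_module A (sub (scalar_module A id) I)"
proof -
  interpret ring A by fact
  interpret L: lmodule A "scalar_module A id" by (rule regular_lmodule) fact
  have I: "submodule I A (scalar_module A id)" and K: "submodule K A (scalar_module A id)"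
    and 0: "I \<inter> K = {\<zero>\<^bsub>A\<^esub>}" and "carrier A = I <+>\<^bsub>scalar_module A id\<^esub> K"
    using assms(2) by (auto simp: direct_decomp_def)
  then obtain e e' where e: "e \<in> I" "e' \<in> K" "\<one>\<^bsub>A\<^esub> = e \<oplus>\<^bsub>A\<^esub> e'"
    using one_closed by (auto simp: mem_set_add)
  note c = L.lsub_carrier[OF I, simplified] L.lsub_carrier[OF K, simplified]
  have ae: "a \<otimes>\<^bsub>A\<^esub> e = a" if a: "a \<in> I" for a
  proof -
    have "a = a \<otimes>\<^bsub>A\<^esub> e \<oplus>\<^bsub>A\<^esub> a \<otimes>\<^bsub>A\<^esub> e'"
      using e c a by (metis r_distr r_one)
    then have *: "a \<ominus>\<^bsub>A\<^esub> a \<otimes>\<^bsub>A\<^esub> e = a \<otimes>\<^bsub>A\<^esub> e'"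
      using e c a by (metis minus_add_cancel(4) m_closed)
    have "a \<otimes>\<^bsub>A\<^esub> e \<in> I" "a \<otimes>\<^bsub>A\<^esub> e' \<in> K"
      using L.lsub_smult[OF I _ e(1)] L.lsub_smult[OF K _ e(2)] c a by auto
    moreover from this have "a \<ominus>\<^bsub>A\<^esub> a \<otimes>\<^bsub>A\<^esub> e \<in> I"
      using L.lsub_minus[OF I a] by simp
    ultimately have "a \<ominus>\<^bsub>A\<^esub> a \<otimes>\<^bsub>A\<^esub> e = \<zero>\<^bsub>A\<^esub>" using 0 * by auto
    then show ?thesis using a c e by simp
  qed
  interpret I: lmodule A "sub (scalar_module A id) I" by (rule L.sub_lmodule[OF I])
  have "(\<lambda>a. a \<otimes>\<^bsub>A\<^esub> e) ` carrier A = I"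
  proof (intro equalityI subsetI)
    fix x assume "x \<in> (\<lambda>a. a \<otimes>\<^bsub>A\<^esub> e) ` carrier A"
    then show "x \<in> I" using L.lsub_smult[OF I _ e(1)] by auto
  next
    fix x assume "x \<in> I"
    then show "x \<in> (\<lambda>a. a \<otimes>\<^bsub>A\<^esub> e) ` carrier A" using ae c by (metis image_eqI)
  qed
  moreover have "submodule_span A (scalar_module A id) {e} = (\<lambda>a. a \<otimes>\<^bsub>A\<^esub> e) ` carrier A"
  proof
    show "submodule_span A (scalar_module A id) {e} \<subseteq> (\<lambda>a. a \<otimes>\<^bsub>A\<^esub> e) ` carrier A"
      using L.span_least[OF I, of "{e}"] e calculation by simp
    have "submodule (submodule_span A (scalar_module A id) {e}) A (scalar_module A id)"
      using c e by (intro L.span_submodule) auto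
    from L.lsub_smult[OF this, of _ e] L.span_upper[of "{e}"]
    show "(\<lambda>a. a \<otimes>\<^bsub>A\<^esub> e) ` carrier A \<subseteq> submodule_span A (scalar_module A id) {e}" by auto
  qed
  ultimately have fg: "fg_module A (sub (scalar_module A id) I)"
    unfolding fg_sub_iff[OF L.lmodule_axioms I] using e by (intro exI[of _ "{e}"]) auto
  have "\<exists>t\<in>module_hom A (sub (scalar_module A id) I) X. \<forall>q\<in>I. g (t q) = h q"
    if X: "fg_module A X" and Y: "fg_module A Y" and g: "g \<in> module_hom A X Y" "g ` carrier X = carrier Y"
      and h: "h \<in> module_hom A (sub (scalar_module A id) I) Y"
    for X Y :: "'a fgmod" and g h
  proof -
    interpret g: lhom A X Y g by (intro lhomI fg_lmodule X Y g)
    interpret h: lhom A "sub (scalar_module A id) I" Y h by (intro lhomI fg_lmodule Y h I.lmodule_axioms)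
    obtain x where x: "x \<in> carrier X" "g x = h e"
    proof -
      have "h e \<in> g ` carrier X" using h.closed[of e] e(1) g(2) by simp
      then show thesis using that by auto
    qed
    have "(\<lambda>a. a \<odot>\<^bsub>X\<^esub> x) \<in> module_hom A (sub (scalar_module A id) I) X"
      by (rule hom_restrict[OF L.lmodule_axioms g.X.lmodule_axioms I g.X.orbit_hom[OF x(1)]])
    moreover have "\<forall>q\<in>I. g (q \<odot>\<^bsub>X\<^esub> x) = h q"
    proof
      fix q assume q: "q \<in> I"
      show "g (q \<odot>\<^bsub>X\<^esub> x) = h q"
        using h.smult[of q e] ae[OF q] x c q e by simp
    qed
    ultimately show ?thesis by (intro bexI[of _ "\<lambda>a. a \<odot>\<^bsub>X\<^esub> x"])
  qed
  then show ?thesis unfolding projective_module_def using fg by simp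
qed

context left_artinian
begin

text \<open>This works because the regular module is a finite sum of indecomposable left ideals.\<close>

lemma module_induct:
  fixes W :: "('a, 'w) module"
  assumes fg: "fg_module A W"
    and bot: "Q {\<zero>\<^bsub>W\<^esub>}"
    and img: "\<And>(Y :: 'a fgmod) f. projective_module A Y \<Longrightarrow> indecomposable A Y \<Longrightarrow>
      f \<in> module_hom A Y W \<Longrightarrow> Q (f ` carrier Y)"
    and sum: "\<And>X Y. submodule X A W \<Longrightarrow> submodule Y A W \<Longrightarrow> Q X \<Longrightarrow> Q Y \<Longrightarrow> Q (X <+>\<^bsub>W\<^esub> Y)"
  shows "Q (carrier W)"
proof -
  let ?A = "scalar_module A id"
  interpret R: lmodule A ?A by (rule regular_lmodule) (rule ring_axioms)
  interpret W: lmodule A W using fg by (rule fg_lmodule)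
  show ?thesis
  proof (rule W.fg_induct[OF fg bot _ sum])
    fix w assume w: "w \<in> carrier W"
    interpret o: lhom A ?A W "\<lambda>a. a \<odot>\<^bsub>W\<^esub> w" by (rule W.orbit_lhom[OF w])
    \<comment> \<open>The induction runs over left ideals, but the claim is restricted to direct
      summands of \<open>A\<close>, for which \<open>summand_projective\<close> is
      available.\<close>
    have "(\<exists>K. direct_decomp A ?A (carrier A) I K) \<longrightarrow> Q ((\<lambda>a. a \<odot>\<^bsub>W\<^esub> w) ` I)"
      if "submodule I A ?A" "I \<subseteq> carrier A" for I
      using dcc that
    proof (induction I rule: R.dcc_induct)
      case (less I)
      show ?case
      proof (intro impI, elim exE)
        fix K assume K: "direct_decomp A ?A (carrier A) I K"
        note I = less(1)
        have Ks: "submodule K A ?A" "I \<inter> K = {\<zero>\<^bsub>A\<^esub>}" "carrier A = I <+>\<^bsub>?A\<^esub> K"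
          using K by (auto simp: direct_decomp_def)
        interpret I: lmodule A "sub ?A I" by (rule R.sub_lmodule[OF I])
        consider "I = {\<zero>\<^bsub>A\<^esub>}" | "indecomposable A (sub ?A I)" | "I \<noteq> {\<zero>\<^bsub>A\<^esub>}" "\<not> indecomposable A (sub ?A I)"
          by blast
        then show "Q ((\<lambda>a. a \<odot>\<^bsub>W\<^esub> w) ` I)"
        proof cases
          case 1
          then show ?thesis using bot o.zero by simp
        next
          case 2
          have pr: "projective_module A (sub ?A I)" by (rule summand_projective[OF ring_axioms K])
          then have fgI: "fg_module A (sub ?A I)" by (simp add: projective_module_def)
          obtain Y :: "'a fgmod" and f where Y: "fg_module A Y" "f \<in> module_hom A (sub ?A I) Y"
            "bij_betw f (carrier (sub ?A I)) (carrier Y)"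
            using fg_module_representative[OF fgI] by blast
          have lh: "lhom A (sub ?A I) Y f" by (intro lhomI I.lmodule_axioms fg_lmodule Y)
          obtain h where h: "h \<in> module_hom A Y (sub ?A I)" "bij_betw h (carrier Y) (carrier (sub ?A I))"
            by (rule hom_inverse[OF I.lmodule_axioms fg_lmodule[OF Y(1)] Y(2,3)])
          have "(\<lambda>a. a \<odot>\<^bsub>W\<^esub> w) \<in> module_hom A (sub ?A I) W"
            by (rule hom_restrict[OF R.lmodule_axioms W.lmodule_axioms I o.f])
          from img[OF projective_iso[OF lh Y(3) pr] indecomposable_iso[OF lh Y(3) 2] hom_comp[OF h(1) this]]
          have "Q ((\<lambda>y. h y \<odot>\<^bsub>W\<^esub> w) ` carrier Y)" .
          also have "(\<lambda>y. h y \<odot>\<^bsub>W\<^esub> w) ` carrier Y = (\<lambda>a. a \<odot>\<^bsub>W\<^esub> w) ` h ` carrier Y"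
            by (simp add: image_image)
          also have "h ` carrier Y = I" using h(2) by (simp add: bij_betw_def)
          finally show ?thesis .
        next
          case 3
          then obtain N L where NL: "direct_decomp A (sub ?A I) I N L" "N \<noteq> {\<zero>\<^bsub>A\<^esub>}" "L \<noteq> {\<zero>\<^bsub>A\<^esub>}"
            using I.lmodule_axioms by (auto simp: indecomposable_def)
          then have NL': "submodule N A ?A" "N \<subseteq> I" "submodule L A ?A" "L \<subseteq> I" "N \<inter> L = {\<zero>\<^bsub>A\<^esub>}" "I = N <+>\<^bsub>?A\<^esub> L"
            by (auto simp: direct_decomp_def submodule_sub_iff[OF R.lmodule_axioms I])
          \<comment> \<open>A direct summand of a summand is again a summand of \<open>A\<close>:
            the complement of \<open>N\<close> is \<open>L + K\<close>. It is a proper part of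
            \<open>I\<close> because \<open>L\<close> is nonzero.\<close>
          have part: "\<exists>K'. direct_decomp A ?A (carrier A) N K'" "N \<subset> I"
            if "submodule N A ?A" "N \<subseteq> I" "submodule L A ?A" "L \<subseteq> I" "N \<inter> L = {\<zero>\<^bsub>A\<^esub>}" "I = N <+>\<^bsub>?A\<^esub> L"
              "L \<noteq> {\<zero>\<^bsub>A\<^esub>}" for N L
          proof -
            have LK: "submodule (L <+>\<^bsub>?A\<^esub> K) A ?A" by (rule R.lsub_sum[OF that(3) Ks(1)])
            have "N \<inter> (L <+>\<^bsub>?A\<^esub> K) \<subseteq> {\<zero>\<^bsub>A\<^esub>}"
            proof
              fix x assume "x \<in> N \<inter> (L <+>\<^bsub>?A\<^esub> K)"
              then obtain l c where *: "x \<in> N" "l \<in> L" "c \<in> K" "x = l \<oplus>\<^bsub>?A\<^esub> c" unfolding Int_iff mem_set_add by blast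
              then have cc: "x \<in> carrier ?A" "l \<in> carrier ?A" "c \<in> carrier ?A"
                using that Ks(1) R.lsub_carrier by blast+
              have "c = x \<ominus>\<^bsub>?A\<^esub> l" using *(4) cc R.M.minus_add_cancel(4) by metis
              moreover have "x \<in> I" "l \<in> I" using that(2,4) * by auto
              ultimately have "c \<in> I" using R.lsub_minus[OF I] by metis
              then have "c = \<zero>\<^bsub>A\<^esub>" using * Ks(2) by auto
              then have "x = l" using *(4) cc R.M.r_zero by simp
              then show "x \<in> {\<zero>\<^bsub>A\<^esub>}" using * that(5) by auto
            qed
            then have "N \<inter> (L <+>\<^bsub>?A\<^esub> K) = {\<zero>\<^bsub>A\<^esub>}" using R.lsub_zero[OF that(1)] R.lsub_zero[OF LK] by auto
            moreover have "carrier A = N <+>\<^bsub>?A\<^esub> (L <+>\<^bsub>?A\<^esub> K)"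
            proof -
              have s: "submodule (N <+>\<^bsub>?A\<^esub> (L <+>\<^bsub>?A\<^esub> K)) A ?A" by (rule R.lsub_sum[OF that(1) LK])
              have "I <+>\<^bsub>?A\<^esub> K \<subseteq> N <+>\<^bsub>?A\<^esub> (L <+>\<^bsub>?A\<^esub> K)"
                unfolding that(6)
                using R.lsum_upper1[OF that(1) LK] R.lsum_upper2[OF that(1) LK]
                  R.lsum_upper1[OF that(3) Ks(1)] R.lsum_upper2[OF that(3) Ks(1)]
                by (intro R.lsum_least s) auto
              then show ?thesis using Ks(3) R.lsub_subset[OF s] by auto
            qed
            ultimately show "\<exists>K'. direct_decomp A ?A (carrier A) N K'"
              using that(1) LK by (auto simp: direct_decomp_def)
            show "N \<subset> I" using that R.lsub_zero[OF that(3)] by auto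
          qed
          have LN: "L \<inter> N = {\<zero>\<^bsub>A\<^esub>}" "I = L <+>\<^bsub>?A\<^esub> N"
            using NL'(5,6) R.lsub_carrier[OF NL'(1)] R.lsub_carrier[OF NL'(3)] R.M.a_comm
            by (auto simp: set_eq_iff mem_set_add) metis+
          have "Q ((\<lambda>a. a \<odot>\<^bsub>W\<^esub> w) ` N)"
            using less(3)[OF NL'(1)] part[OF NL' NL(3)] by blast
          moreover have "Q ((\<lambda>a. a \<odot>\<^bsub>W\<^esub> w) ` L)"
            using less(3)[OF NL'(3)] part[OF NL'(3,4,1,2) LN NL(2)] by blast
          ultimately have "Q ((\<lambda>a. a \<odot>\<^bsub>W\<^esub> w) ` N <+>\<^bsub>W\<^esub> (\<lambda>a. a \<odot>\<^bsub>W\<^esub> w) ` L)"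
            by (intro sum o.image_submodule NL')
          then show ?thesis
            using o.image_sum[of N L] R.lsub_subset[OF NL'(1)] R.lsub_subset[OF NL'(3)] NL'(6) by simp
        qed
      qed
    qed
    moreover have "direct_decomp A ?A (carrier A) (carrier A) {\<zero>\<^bsub>A\<^esub>}"
      using R.lsub_top R.lsub_bot by (auto simp: direct_decomp_def mem_set_add)
    ultimately show "Q ((\<lambda>a. a \<odot>\<^bsub>W\<^esub> w) ` carrier A)"
      using R.lsub_top by auto
  qed
qed

end

section \<open>Composition series and ranks\<close>

lemma simple_quot_iff:
  assumes "lmodule A W" "submodule C A W" "submodule X A W" "C \<subseteq> X"
  shows "simple_module A (quot (sub W X) C) \<longleftrightarrow> covered A W C X"
proof -
  interpret W: lmodule A W by fact
  interpret X: lmodule A "sub W X" by (rule W.sub_lmodule) fact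
  have C: "submodule C A (sub W X)" using assms by (simp add: submodule_sub_iff)
  let ?q = "quot (sub W X) C" and ?p = "\<lambda>x. C +>\<^bsub>sub W X\<^esub> x"
  interpret p: lhom A "sub W X" ?q ?p
    by (intro lhomI X.lmodule_axioms quot_lmodule quot_hom C)
  have ker: "?p x = C \<longleftrightarrow> x \<in> C" if "x \<in> X" for x
    using quot_kernel[OF X.lmodule_axioms C, of x] that by simp
  have eqi: "?p x = ?p y \<longleftrightarrow> x \<ominus>\<^bsub>sub W X\<^esub> y \<in> C" if "x \<in> X" "y \<in> X" for x y
    using coset_eq_iff[OF X.lmodule_axioms C] that by simp
  show ?thesis
  proof
    assume s: "simple_module A ?q"
    have "C \<noteq> X"
    proof
      assume "C = X"
      then have "?p ` X \<subseteq> {C}" using ker by auto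
      moreover have "C \<in> ?p ` X" using ker W.lsub_zero[OF assms(2)] assms(4) by (metis image_eqI subsetD)
      ultimately show False using s by (auto simp: simple_module_def)
    qed
    moreover have "D = C \<or> D = X" if D: "submodule D A W" "C \<subseteq> D" "D \<subseteq> X" for D
    proof -
      have D': "submodule D A (sub W X)" using D assms by (simp add: submodule_sub_iff)
      then have "?p ` D = {C} \<or> ?p ` D = ?p ` X"
        using s p.image_submodule[OF D'] by (auto simp: simple_module_def)
      then show ?thesis
      proof
        assume e: "?p ` D = {C}"
        have "d \<in> C" if "d \<in> D" for d
          using ker[of d] imageI[OF that, of ?p, unfolded e] that D(3) by auto
        then show ?thesis using D by auto
      next
        assume e: "?p ` D = ?p ` X"
        have "x \<in> D" if x: "x \<in> X" for x
        proof -
          obtain d where d: "d \<in> D" "?p x = ?p d" using e x by (metis imageE image_eqI)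
          then have "x \<ominus>\<^bsub>sub W X\<^esub> d \<in> D" using eqi x D by blast
          then have "(x \<ominus>\<^bsub>sub W X\<^esub> d) \<oplus>\<^bsub>sub W X\<^esub> d \<in> D" using X.lsub_add[OF D'] d by blast
          moreover have "(x \<ominus>\<^bsub>sub W X\<^esub> d) \<oplus>\<^bsub>sub W X\<^esub> d = x"
            using x d D(3) by (intro X.M.minus_add_cancel) auto
          ultimately show ?thesis by simp
        qed
        then show ?thesis using D by auto
      qed
    qed
    ultimately show "covered A W C X" using assms by (auto simp: covered_def)
  next
    assume cov: "covered A W C X"
    then obtain x where x: "x \<in> X" "x \<notin> C" by (auto simp: covered_def)
    then have "carrier ?q \<noteq> {C}" using ker by auto
    moreover have "N = {C} \<or> N = ?p ` X" if N: "submodule N A ?q" for N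
    proof -
      let ?D = "{x \<in> X. ?p x \<in> N}"
      have "submodule ?D A (sub W X)" using p.preimage_submodule[OF N] by simp
      then have "submodule ?D A W" using assms by (simp add: submodule_sub_iff)
      moreover have "C \<subseteq> ?D"
      proof
        fix x assume x: "x \<in> C"
        then have "x \<in> X" using assms(4) by auto
        then show "x \<in> ?D" using x ker[of x] p.Y.lsub_zero[OF N] by simp
      qed
      ultimately consider "?D = C" | "?D = X" using cov by (auto simp: covered_def)
      then show ?thesis
      proof cases
        case 1
        have "n = C" if n: "n \<in> N" for n
        proof -
          obtain x where x: "x \<in> X" "n = ?p x" using p.Y.lsub_carrier[OF N n] by auto
          then have "x \<in> C" using 1 n by blast
          then show ?thesis using x ker[of x] by simp
        qed
        then have "N \<subseteq> {C}" by auto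
        then show ?thesis using p.Y.lsub_zero[OF N] by auto
      next
        case 2
        have "?p ` X \<subseteq> N" using 2 by blast
        then show ?thesis using p.Y.lsub_subset[OF N] by auto
      qed
    qed
    ultimately show "simple_module A ?q"
      by (auto simp: simple_module_def p.Y.lmodule_axioms)
  qed
qed

text \<open>Removes the quotients from composition series, so that these can be carried along
  isomorphisms and into ambient modules.\<close>

lemma has_length_iff:
  "has_length A X n \<longleftrightarrow> lmodule A X \<and>
     (\<exists>C. C 0 = {\<zero>\<^bsub>X\<^esub>} \<and> C n = carrier X \<and> (\<forall>i\<le>n. submodule (C i) A X) \<and> (\<forall>i<n. covered A X (C i) (C (Suc i))))"
proof -
  have *: "(\<forall>i<n. C i \<subseteq> C (Suc i) \<and> simple_module A (quot (sub X (C (Suc i))) (C i))) \<longleftrightarrow>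
      (\<forall>i<n. covered A X (C i) (C (Suc i)))" if "lmodule A X" "\<forall>i\<le>n. submodule (C i) A X" for C
  proof -
    have "C i \<subseteq> C (Suc i) \<and> simple_module A (quot (sub X (C (Suc i))) (C i)) \<longleftrightarrow> covered A X (C i) (C (Suc i))"
      if "i < n" for i
    proof (cases "C i \<subseteq> C (Suc i)")
      case True
      then show ?thesis
        using simple_quot_iff[OF \<open>lmodule A X\<close>, of "C i" "C (Suc i)"] that \<open>\<forall>i\<le>n. submodule (C i) A X\<close> by simp
    next
      case False
      then show ?thesis by (auto simp: covered_def)
    qed
    then show ?thesis by simp
  qed
  show ?thesis unfolding has_length_def by (intro conj_cong refl ex_cong1) (rule *)
qed

text \<open>The rank of \<open>D\<close> counts the composition factors met by \<open>D\<close>,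
  that is the \<open>i\<close> for which \<open>D \<inter> K (Suc i)\<close> is not inside
  \<open>K i\<close>. A submodule of \<open>D\<close> meeting the same factors equals
  \<open>D\<close>, as is seen by climbing the series. The bound by \<open>n\<close> is what later
  limits chains in projectives to four steps.\<close>

lemma length_rank:
  assumes "has_length A X n"
  obtains l :: "'b set \<Rightarrow> nat" where
    "\<And>C D. submodule C A X \<Longrightarrow> submodule D A X \<Longrightarrow> C \<subset> D \<Longrightarrow> l C < l D" "\<And>D. l D \<le> n"
proof -
  interpret X: lmodule A X using assms by (simp add: has_length_def)
  obtain K where K: "K 0 = {\<zero>\<^bsub>X\<^esub>}" "K n = carrier X" "\<And>i. i \<le> n \<Longrightarrow> submodule (K i) A X"
    "\<And>i. i < n \<Longrightarrow> covered A X (K i) (K (Suc i))"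
    using assms by (auto simp: has_length_iff)
  define S where "S D = {i. i < n \<and> \<not> D \<inter> K (Suc i) \<subseteq> K i}" for D
  have fin: "finite (S D)" for D by (simp add: S_def)
  have "card (S C) < card (S D)" if CD: "submodule C A X" "submodule D A X" "C \<subset> D" for C D
  proof (rule psubset_card_mono[OF fin])
    have sub: "S C \<subseteq> S D" using CD(3) by (auto simp: S_def)
    have "S C \<noteq> S D"
    proof
      assume eq: "S C = S D"
      have "D \<inter> K i \<subseteq> C" if "i \<le> n" for i
        using that
      proof (induction i)
        case 0
        then show ?case using K(1) X.lsub_zero[OF CD(1)] by auto
      next
        case (Suc i)
        show ?case
        proof (cases "i \<in> S C")
          case True
          then obtain c where c: "c \<in> C" "c \<in> K (Suc i)" "c \<notin> K i" by (auto simp: S_def)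
          have Ki: "submodule (K i) A X" "submodule (K (Suc i)) A X" "K i \<subseteq> K (Suc i)"
            using K(3)[of i] K(3)[of "Suc i"] K(4)[of i] Suc.prems by (auto simp: covered_def)
          have CK: "submodule (C \<inter> K (Suc i)) A X" by (rule X.lsub_inter[OF CD(1) Ki(2)])
          note s = X.lsub_sum[OF CK Ki(1)] X.lsum_upper1[OF CK Ki(1)] X.lsum_upper2[OF CK Ki(1)]
          have "(C \<inter> K (Suc i)) <+>\<^bsub>X\<^esub> K i \<subseteq> K (Suc i)" using Ki by (intro X.lsum_least) auto
          \<comment> \<open>If \<open>C\<close> meets this factor it fills it, so an element of
            \<open>D\<close> at this level differs from one of \<open>C\<close> by an element of
            \<open>D \<inter> K i\<close>, which is covered by the induction hypothesis.\<close>
          then have full: "(C \<inter> K (Suc i)) <+>\<^bsub>X\<^esub> K i = K (Suc i)"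
            using K(4)[of i] Suc.prems s c unfolding covered_def by (metis IntI Suc_le_eq subsetD)
          show ?thesis
          proof
            fix d assume d: "d \<in> D \<inter> K (Suc i)"
            then obtain u v where uv: "u \<in> C \<inter> K (Suc i)" "v \<in> K i" "d = u \<oplus>\<^bsub>X\<^esub> v"
              using full by (metis IntD2 mem_set_add)
            have cc: "u \<in> carrier X" "v \<in> carrier X" using uv Ki CD X.lsub_carrier by blast+
            have "v = d \<ominus>\<^bsub>X\<^esub> u" using uv cc by simp
            moreover have "u \<in> D" "d \<in> D" using uv d CD(3) by auto
            ultimately have "v \<in> D" using X.lsub_minus[OF CD(2)] by metis
            then have "v \<in> C" using Suc uv by auto
            then show "d \<in> C" using uv X.lsub_add[OF CD(1)] by auto
          qed
        next
          case False
          then have "D \<inter> K (Suc i) \<subseteq> K i" using eq Suc.prems by (auto simp: S_def)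
          then show ?thesis using Suc by auto
        qed
      qed
      from this[of n] have "D \<subseteq> C" using K(2) X.lsub_subset[OF CD(2)] by auto
      then show False using CD(3) by auto
    qed
    then show "S C \<subset> S D" using sub by auto
  qed
  moreover have "card (S D) \<le> n" for D
    using card_mono[of "{..<n}" "S D"] by (auto simp: S_def)
  ultimately show ?thesis by (intro that[of "\<lambda>D. card (S D)"])
qed

lemma has_length_fin_len:
  fixes X :: "('a, 'b) module"
  assumes "has_length A X n" shows "fin_len A X (carrier X)"
proof (rule length_rank[OF assms])
  fix l :: "'b set \<Rightarrow> nat"
  assume "\<And>C D. submodule C A X \<Longrightarrow> submodule D A X \<Longrightarrow> C \<subset> D \<Longrightarrow> l C < l D"
  then show "fin_len A X (carrier X)" unfolding fin_len_def by (intro exI[of _ l]) simp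
qed

section \<open>Rings of finite length and almost split maps\<close>

lemma (in lmodule) fin_len_dcc:
  assumes "fin_len R M V" shows "dcc R M V"
proof -
  obtain l :: "'b set \<Rightarrow> nat" where
    l: "\<And>C D. submodule C R M \<Longrightarrow> submodule D R M \<Longrightarrow> C \<subset> D \<Longrightarrow> D \<subseteq> V \<Longrightarrow> l C < l D"
    using assms unfolding fin_len_def by blast
  show ?thesis
    by (rule dcc_by_wf[OF wf_measure[of l], of R M V "\<lambda>C. C"]) (simp add: l)
qed

locale finite_length_ring = left_artinian +
  assumes fin_len_regular: "fin_len A (scalar_module A id) (carrier A)"
begin

lemma fg_fin_len:
  assumes "fg_module A W" shows "fin_len A W (carrier W)"
proof -
  interpret W: lmodule A W using assms by (rule fg_lmodule)
  show ?thesis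
  proof (rule W.fg_induct[OF assms])
    show "fin_len A W {\<zero>\<^bsub>W\<^esub>}" by (rule W.fin_len_bot)
    show "fin_len A W ((\<lambda>a. a \<odot>\<^bsub>W\<^esub> w) ` carrier A)" if "w \<in> carrier W" for w
      using fin_len_image[OF W.orbit_lhom[OF that]] fin_len_regular by simp
  qed (rule W.fin_len_sum)
qed

lemma fg_dcc:
  assumes "fg_module A W" shows "dcc A W (carrier W)"
  by (rule lmodule.fin_len_dcc[OF fg_lmodule[OF assms] fg_fin_len[OF assms]])

lemma length_function:
  assumes "fg_module A W"
  obtains l :: "'w set \<Rightarrow> nat" where
    "\<And>C D. submodule C A (W :: ('a, 'w) module) \<Longrightarrow> submodule D A W \<Longrightarrow> C \<subset> D \<Longrightarrow> l C < l D"
    "\<And>D. submodule D A W \<Longrightarrow> l D \<le> l (carrier W)"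
proof -
  interpret W: lmodule A W using assms by (rule fg_lmodule)
  obtain l :: "'w set \<Rightarrow> nat" where
    l: "\<And>C D. submodule C A W \<Longrightarrow> submodule D A W \<Longrightarrow> C \<subset> D \<Longrightarrow> D \<subseteq> carrier W \<Longrightarrow> l C < l D"
    using fg_fin_len[OF assms] unfolding fin_len_def by blast
  have "l D \<le> l (carrier W)" if "submodule D A W" for D
    using l[OF that W.lsub_top _ subset_refl] W.lsub_subset[OF that]
    by (cases "D = carrier W") (simp_all add: psubset_eq)
  moreover have "l C < l D" if "submodule C A W" "submodule D A W" "C \<subset> D" for C D
    using l[OF that] W.lsub_subset[OF that(2)] by blast
  ultimately show ?thesis by (rule that[rotated])
qed

text \<open>Ranks are bounded, so some finite subset of \<open>N\<close> has a span of largest rank;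
  adding a further element of \<open>N\<close> cannot enlarge that span.\<close>

lemma fg_submodule:
  assumes "fg_module A W" "submodule N A W" shows "fg_module A (sub W N)"
proof -
  interpret W: lmodule A W using assms(1) by (rule fg_lmodule)
  show ?thesis
  proof (rule length_function[OF assms(1)])
    fix l :: "_ set \<Rightarrow> nat"
    assume l: "\<And>C D. submodule C A W \<Longrightarrow> submodule D A W \<Longrightarrow> C \<subset> D \<Longrightarrow> l C < l D"
      and bd: "\<And>D. submodule D A W \<Longrightarrow> l D \<le> l (carrier W)"
    let ?P = "\<lambda>F. finite F \<and> F \<subseteq> N"
    have sp: "submodule (submodule_span A W F) A W" if "?P F" for F
      using that W.lsub_subset[OF assms(2)] by (intro W.span_submodule) auto
    have "?P {}" by simp
    moreover have "\<forall>F. ?P F \<longrightarrow> l (submodule_span A W F) < Suc (l (carrier W))"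
      using bd[OF sp] by (auto simp: less_Suc_eq_le)
    ultimately obtain F where F: "?P F" and max: "\<And>G. ?P G \<Longrightarrow> l (submodule_span A W G) \<le> l (submodule_span A W F)"
      using ex_has_greatest_nat[of ?P "{}" "\<lambda>F. l (submodule_span A W F)" "Suc (l (carrier W))"] by blast
    have "N \<subseteq> submodule_span A W F"
    proof
      fix x assume x: "x \<in> N"
      let ?G = "insert x F"
      have G: "?P ?G" using F x by auto
      have le: "submodule_span A W F \<subseteq> submodule_span A W ?G"
        using W.span_upper[of ?G] by (intro W.span_least sp[OF G]) auto
      have "\<not> submodule_span A W F \<subset> submodule_span A W ?G"
        using l[OF sp[OF F] sp[OF G]] max[OF G] by force
      then show "x \<in> submodule_span A W F" using le W.span_upper[of ?G] by auto
    qed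
    moreover have "submodule_span A W F \<subseteq> N" using F by (intro W.span_least assms) auto
    ultimately show ?thesis
      using F unfolding fg_sub_iff[OF W.lmodule_axioms assms(2)] by blast
  qed
qed

text \<open>A proper submodule \<open>C\<close> of \<open>X\<close> of largest rank is maximal in
  \<open>X\<close>, and the radical of \<open>X\<close> lies in every such \<open>C\<close>.\<close>

lemma rd_proper:
  assumes "fg_module A W" "submodule X A W" "X \<noteq> {\<zero>\<^bsub>W\<^esub>}" shows "rd A W X \<noteq> X"
proof -
  interpret W: lmodule A W using assms(1) by (rule fg_lmodule)
  show ?thesis
  proof (rule length_function[OF assms(1)])
    fix l :: "_ set \<Rightarrow> nat"
    assume l: "\<And>C D. submodule C A W \<Longrightarrow> submodule D A W \<Longrightarrow> C \<subset> D \<Longrightarrow> l C < l D"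
      and bd: "\<And>D. submodule D A W \<Longrightarrow> l D \<le> l (carrier W)"
    let ?P = "\<lambda>C. submodule C A W \<and> C \<subset> X"
    have "?P {\<zero>\<^bsub>W\<^esub>}" using assms(2,3) W.lsub_bot W.lsub_zero by auto
    moreover have "\<forall>C. ?P C \<longrightarrow> l C < Suc (l (carrier W))"
      using bd by (auto simp: less_Suc_eq_le)
    ultimately obtain C where C: "?P C" and max: "\<And>D. ?P D \<Longrightarrow> l D \<le> l C"
      using ex_has_greatest_nat[of ?P "{\<zero>\<^bsub>W\<^esub>}" l "Suc (l (carrier W))"] by blast
    have "D = C \<or> D = X" if D: "submodule D A W" "C \<subseteq> D" "D \<subseteq> X" for D
    proof (rule ccontr)
      assume "\<not> (D = C \<or> D = X)"
      then have "?P D" "C \<subset> D" using D by auto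
      then show False using l[of C D] max[of D] C D by force
    qed
    then have "covered A W C X" using C assms(2) by (simp add: covered_def)
    then show ?thesis using W.rd_covered C by blast
  qed
qed

text \<open>\<open>C n\<close> is the kernel of the n-th power of \<open>f\<close>. If
  \<open>f\<close> is onto but not injective, these kernels grow strictly, so the rank of
  \<open>C n\<close> is at least \<open>n\<close>, against the bound by the rank of the whole
  module.\<close>

lemma surj_endo_inj:
  assumes "fg_module A X" "f \<in> module_hom A X X" "f ` carrier X = carrier X"
  shows "inj_on f (carrier X)"
proof (rule ccontr)
  assume ninj: "\<not> inj_on f (carrier X)"
  interpret lhom A X X f by (intro lhomI fg_lmodule assms)
  show False
  proof (rule length_function[OF assms(1)])
    fix l :: "_ set \<Rightarrow> nat"
    assume l: "\<And>C D. submodule C A X \<Longrightarrow> submodule D A X \<Longrightarrow> C \<subset> D \<Longrightarrow> l C < l D"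
      and bd: "\<And>D. submodule D A X \<Longrightarrow> l D \<le> l (carrier X)"
    define C where "C n = ((\<lambda>D. {x \<in> carrier X. f x \<in> D}) ^^ n) {\<zero>\<^bsub>X\<^esub>}" for n
    have C0: "C 0 = {\<zero>\<^bsub>X\<^esub>}" and CS: "C (Suc n) = {x \<in> carrier X. f x \<in> C n}" for n
      by (simp_all add: C_def)
    have Cs: "submodule (C n) A X" for n
      by (induction n) (auto simp: C0 CS X.lsub_bot intro: preimage_submodule)
    have lt: "C n \<subset> C (Suc n)" for n
    proof (induction n)
      case 0
      obtain x where "x \<in> carrier X" "f x = \<zero>\<^bsub>X\<^esub>" "x \<noteq> \<zero>\<^bsub>X\<^esub>" using ninj inj_iff by blast
      then have "x \<in> C (Suc 0)" "x \<notin> C 0" "C 0 \<subseteq> C (Suc 0)" by (auto simp: C0 CS)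
      then show ?case by blast
    next
      case (Suc n)
      then obtain y where y: "y \<in> C (Suc n)" "y \<notin> C n" by blast
      then obtain x where x: "x \<in> carrier X" "f x = y"
        using assms(3) X.lsub_carrier[OF Cs] by (metis imageE)
      have "x \<in> C (Suc (Suc n))" "x \<notin> C (Suc n)" using x y CS by auto
      moreover have "C (Suc n) \<subseteq> C (Suc (Suc n))" using Suc CS by auto
      ultimately show ?case by blast
    qed
    have "n \<le> l (C n)" for n
    proof (induction n)
      case (Suc n)
      then show ?case using l[OF Cs Cs lt[of n]] by simp
    qed simp
    from this[of "Suc (l (carrier X))"] show False using bd[OF Cs[of "Suc (l (carrier X))"]] by simp
  qed
qed

end

text \<open>Given \<open>h : W \<rightarrow> Z\<close>, apply the left almost split property to \<open>X \<rightarrow> Y \<times>\<^sub>Z W\<close>. If this map splits, then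
  \<open>h\<close> lifts to \<open>Y\<close>; if not, it extends to \<open>Y\<close>, which yields an endomorphism of \<open>Z\<close> factoring through \<open>h\<close>.\<close>

lemma left_almost_split_imp_right:
  assumes X: "fg_module A X" and Y: "fg_module A Y" and Z: "fg_module A Z"
    and f: "f \<in> module_hom A X Y" and g: "g \<in> module_hom A Y Z"
    and inj: "inj_on f (carrier X)" and ex: "f ` carrier X = {y \<in> carrier Y. g y = \<zero>\<^bsub>Z\<^esub>}"
    and onto: "g ` carrier Y = carrier Z" and las: "left_almost_split A X Y f"
    and endo: "\<And>v. v \<in> module_hom A Z Z \<Longrightarrow>
      bij_betw v (carrier Z) (carrier Z) \<or> (\<forall>z\<in>carrier Z. v (v z) = \<zero>\<^bsub>Z\<^esub>)"
  shows "right_almost_split A Y Z g"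
proof -
  interpret f: lhom A X Y f by (intro lhomI fg_lmodule assms)
  interpret g: lhom A Y Z g by (intro lhomI fg_lmodule assms)
  have ns: "\<not> split_mono A X Y f" using las by (simp add: left_almost_split_def)
  have gf: "g (f x) = \<zero>\<^bsub>Z\<^esub>" if "x \<in> carrier X" for x
    using ex that by blast
  let ?K = "sub Y (f ` carrier X)"
  have Ks: "submodule (f ` carrier X) A Y" by (rule f.image_submodule[OF f.X.lsub_top])
  have Kl: "lmodule A ?K" by (rule f.Y.sub_lmodule[OF Ks])
  have fK: "f \<in> module_hom A X ?K" by (rule hom_into_sub[OF f subset_refl])
  have bK: "bij_betw f (carrier X) (carrier ?K)" using inj by (simp add: bij_betw_def)
  obtain i where i: "i \<in> module_hom A ?K X" "\<And>x. x \<in> carrier X \<Longrightarrow> i (f x) = x"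
    by (rule hom_inverse[OF f.X.lmodule_axioms Kl fK bK]) simp
  \<comment> \<open>Such an \<open>r\<close> maps \<open>Y\<close> into the kernel of
    \<open>g\<close>, that is into \<open>f X\<close>, and fixes \<open>f X\<close>; followed by the
    inverse of \<open>f\<close> it is a retraction of \<open>f\<close>. Both a section of
    \<open>g\<close> and a square-zero endomorphism of \<open>Z\<close> are reduced to this.\<close>
  have retract: False if r: "r \<in> module_hom A Y Y" "\<And>y. y \<in> carrier Y \<Longrightarrow> g (r y) = \<zero>\<^bsub>Z\<^esub>"
    "\<And>x. x \<in> carrier X \<Longrightarrow> r (f x) = f x" for r
  proof -
    have "r y \<in> carrier Y" if "y \<in> carrier Y" for y using r(1) that by (simp add: module_hom_iff)
    then have "r ` carrier Y \<subseteq> f ` carrier X" using r(2) unfolding ex by blast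
    then have rK: "r \<in> module_hom A Y ?K" by (rule hom_into_sub[OF r(1)])
    have "\<forall>x\<in>carrier X. i (r (f x)) = x" using r(3) i(2) by simp
    then have "split_mono A X Y f"
      unfolding split_mono_def by (intro bexI[OF _ hom_comp[OF rK i(1)]])
    then show False using ns by simp
  qed
  have nse: "\<not> split_epi A Y Z g"
  proof
    assume "split_epi A Y Z g"
    then obtain s where s: "s \<in> module_hom A Z Y" "\<And>z. z \<in> carrier Z \<Longrightarrow> g (s z) = z"
      by (auto simp: split_epi_def)
    interpret s: lhom A Z Y s by (intro lhomI f.Y.lmodule_axioms g.Y.lmodule_axioms s)
    show False
    proof (rule retract[OF hom_minus[OF f.Y.lmodule_axioms hom_id hom_comp[OF g s(1)]]])
      fix y assume "y \<in> carrier Y"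
      then show "g (y \<ominus>\<^bsub>Y\<^esub> s (g y)) = \<zero>\<^bsub>Z\<^esub>" using s(2) by simp
    next
      fix x assume x: "x \<in> carrier X"
      then show "f x \<ominus>\<^bsub>Y\<^esub> s (g (f x)) = f x"
        using f.Y.M.minus_add_cancel(3)[of "f x" "\<zero>\<^bsub>Y\<^esub>"] gf by simp
    qed
  qed
  have "\<exists>t\<in>module_hom A W Y. \<forall>w\<in>carrier W. g (t w) = h w"
    if W: "fg_module A W" and h: "h \<in> module_hom A W Z" and nsh: "\<not> split_epi A W Z h" for W :: "'a fgmod" and h
  proof -
    interpret h: lhom A W Z h by (intro lhomI fg_lmodule assms W h)
    let ?D = "dsum Y W"
    note lYW = f.Y.lmodule_axioms h.X.lmodule_axioms
    have D: "lmodule A ?D" by (rule dsum_lmodule[OF lYW])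
    interpret k: lhom A ?D Z "\<lambda>p. g (fst p) \<ominus>\<^bsub>Z\<^esub> h (snd p)"
      by (intro lhomI D g.Y.lmodule_axioms hom_minus hom_comp[OF dsum_homs(1)[OF lYW] g] hom_comp[OF dsum_homs(2)[OF lYW] h])
    \<comment> \<open>\<open>E\<close> is the pullback of \<open>g\<close> and \<open>h\<close>; it
      is an extension of \<open>W\<close> by \<open>X\<close>.\<close>
    define E where "E = {p \<in> carrier ?D. g (fst p) = h (snd p)}"
    have "E = {p \<in> carrier ?D. g (fst p) \<ominus>\<^bsub>Z\<^esub> h (snd p) = \<zero>\<^bsub>Z\<^esub>}"
      unfolding E_def by auto
    then have Es: "submodule E A ?D" using k.kernel_submodule by simp
    interpret E: lmodule A "sub ?D E" by (rule k.X.sub_lmodule[OF Es])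
    have E_iff: "(y, w) \<in> E \<longleftrightarrow> y \<in> carrier Y \<and> w \<in> carrier W \<and> g y = h w" for y w
      by (simp add: E_def)
    have fstE: "fst \<in> module_hom A (sub ?D E) Y" and sndE: "snd \<in> module_hom A (sub ?D E) W"
      using hom_restrict[OF D lYW(1) Es dsum_homs(1)[OF lYW]] hom_restrict[OF D lYW(2) Es dsum_homs(2)[OF lYW]] by auto
    have fE: "(\<lambda>x. (f x, \<zero>\<^bsub>W\<^esub>)) \<in> module_hom A X (sub ?D E)"
      using gf by (intro hom_into_sub hom_comp[OF f dsum_homs(3)[OF lYW]]) (auto simp: E_iff)
    have sndonto: "snd ` carrier (sub ?D E) = carrier W"
    proof
      show "snd ` carrier (sub ?D E) \<subseteq> carrier W" by (auto simp: E_def)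
      show "carrier W \<subseteq> snd ` carrier (sub ?D E)"
      proof
        fix w assume w: "w \<in> carrier W"
        then have "h w \<in> g ` carrier Y" using onto by simp
        then obtain y where "y \<in> carrier Y" "h w = g y" by auto
        then have "(y, w) \<in> E" using w by (simp add: E_iff)
        then show "w \<in> snd ` carrier (sub ?D E)" by (force simp: image_iff)
      qed
    qed
    have ker: "\<exists>x\<in>carrier X. p = (f x, \<zero>\<^bsub>W\<^esub>)" if "p \<in> E" "snd p = \<zero>\<^bsub>W\<^esub>" for p
    proof -
      have "fst p \<in> f ` carrier X" using that unfolding ex by (auto simp: E_def)
      then show ?thesis using that by (metis imageE prod.collapse)
    qed
    have fgE: "fg_module A (sub ?D E)"
      using ker by (intro fg_extension[OF X E.lmodule_axioms W fE sndE sndonto]) (auto simp: image_iff)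
    \<comment> \<open>The left almost split property tests only modules with the fixed carrier type,
      so the pullback is replaced by a representative.\<close>
    obtain E' :: "'a fgmod" and e where E': "fg_module A E'" "e \<in> module_hom A (sub ?D E) E'"
      "bij_betw e (carrier (sub ?D E)) (carrier E')"
      using fg_module_representative[OF fgE] by blast
    obtain d where d: "d \<in> module_hom A E' (sub ?D E)" "\<And>p. p \<in> E \<Longrightarrow> d (e p) = p"
      by (rule hom_inverse[OF E.lmodule_axioms fg_lmodule[OF E'(1)] E'(2,3)]) simp
    have iota: "(\<lambda>x. e (f x, \<zero>\<^bsub>W\<^esub>)) \<in> module_hom A X E'" by (rule hom_comp[OF fE E'(2)])
    show ?thesis
    proof (cases "split_mono A X E' (\<lambda>x. e (f x, \<zero>\<^bsub>W\<^esub>))")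
      case True
      then obtain r where r: "r \<in> module_hom A E' X" "\<And>x. x \<in> carrier X \<Longrightarrow> r (e (f x, \<zero>\<^bsub>W\<^esub>)) = x"
        by (auto simp: split_mono_def)
      note re = hom_comp[OF E'(2) r(1)]
      \<comment> \<open>Subtracting the retraction removes the part of \<open>fst p\<close> that
        comes from \<open>X\<close>; the result vanishes on the kernel of \<open>snd\<close> and
        descends to \<open>W\<close>.\<close>
      have m: "(\<lambda>p. fst p \<ominus>\<^bsub>Y\<^esub> f (r (e p))) \<in> module_hom A (sub ?D E) Y"
        by (rule hom_minus[OF lYW(1) fstE hom_comp[OF re f]])
      obtain t where t: "t \<in> module_hom A W Y" "\<And>p. p \<in> E \<Longrightarrow> t (snd p) = fst p \<ominus>\<^bsub>Y\<^esub> f (r (e p))"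
      proof (rule hom_factor[OF E.lmodule_axioms lYW(2,1) sndE m sndonto])
        fix p assume p: "p \<in> carrier (sub ?D E)" "snd p = \<zero>\<^bsub>W\<^esub>"
        then obtain x where "x \<in> carrier X" "p = (f x, \<zero>\<^bsub>W\<^esub>)" using ker[of p] by auto
        then show "fst p \<ominus>\<^bsub>Y\<^esub> f (r (e p)) = \<zero>\<^bsub>Y\<^esub>" using r(2) by simp
      qed simp
      have "g (t w) = h w" if w: "w \<in> carrier W" for w
      proof -
        have "w \<in> snd ` E" using sndonto w by simp
        then obtain p where p: "p \<in> E" "w = snd p" by auto
        have c: "fst p \<in> carrier Y" "r (e p) \<in> carrier X" "g (fst p) = h w"
          using p re by (auto simp: E_def module_hom_iff)
        have "g (t w) = g (fst p) \<ominus>\<^bsub>Z\<^esub> g (f (r (e p)))" using t(2)[OF p(1)] p(2) c by simp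
        then show ?thesis using gf[OF c(2)] c(3) w g.Y.M.minus_add_cancel(3)[of "h w" "\<zero>\<^bsub>Z\<^esub>"] by simp
      qed
      then show ?thesis using t(1) by (intro bexI[of _ t]) simp_all
    next
      case False
      then obtain t where t: "t \<in> module_hom A Y E'" "\<And>x. x \<in> carrier X \<Longrightarrow> t (f x) = e (f x, \<zero>\<^bsub>W\<^esub>)"
        using las E'(1) iota unfolding left_almost_split_def by blast
      note dt = hom_comp[OF t(1) d(1)]
      note t1 = hom_comp[OF dt fstE] and t2 = hom_comp[OF dt sndE]
      have dtE: "d (t y) \<in> E" if "y \<in> carrier Y" for y using dt that by (simp add: module_hom_iff)
      have dtf: "d (t (f x)) = (f x, \<zero>\<^bsub>W\<^esub>)" if "x \<in> carrier X" for x
        using t(2)[OF that] d(2) that gf by (simp add: E_iff)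
      \<comment> \<open>The extension sends \<open>f X\<close> into the kernel of
        \<open>snd\<close>, so its second component induces \<open>s\<close> on \<open>Z\<close>;
        its first component is an endomorphism of \<open>Y\<close> lying over \<open>h\<close> after
        \<open>s\<close>.\<close>
      obtain s where s: "s \<in> module_hom A Z W" "\<And>y. y \<in> carrier Y \<Longrightarrow> s (g y) = snd (d (t y))"
      proof (rule hom_factor[OF lYW(1) g.Y.lmodule_axioms lYW(2) g t2 onto])
        fix y assume "y \<in> carrier Y" "g y = \<zero>\<^bsub>Z\<^esub>"
        then have "y \<in> f ` carrier X" unfolding ex by simp
        then show "snd (d (t y)) = \<zero>\<^bsub>W\<^esub>" using dtf by auto
      qed simp
      have v: "(\<lambda>z. h (s z)) \<in> module_hom A Z Z" by (rule hom_comp[OF s(1) h])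
      have gt: "g (fst (d (t y))) = h (s (g y))" if "y \<in> carrier Y" for y
        using dtE[OF that] s(2)[OF that] by (simp add: E_def)
      from endo[OF v] show ?thesis
      proof
        assume b: "bij_betw (\<lambda>z. h (s z)) (carrier Z) (carrier Z)"
        obtain u where u: "u \<in> module_hom A Z Z" "\<And>z. z \<in> carrier Z \<Longrightarrow> h (s (u z)) = z"
          by (rule hom_inverse[OF g.Y.lmodule_axioms g.Y.lmodule_axioms v b]) simp
        have "split_epi A W Z h"
          unfolding split_epi_def using u(2) by (intro bexI[OF _ hom_comp[OF u(1) s(1)]]) simp
        then show ?thesis using nsh by simp
      next
        assume v0: "\<forall>z\<in>carrier Z. h (s (h (s z))) = \<zero>\<^bsub>Z\<^esub>"
        \<comment> \<open>The first component fixes \<open>f X\<close>, and its square lies over the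
          square of the endomorphism \<open>h\<close> after \<open>s\<close>, which is zero
          here.\<close>
        have False
        proof (rule retract[OF hom_comp[OF t1 t1]])
          fix y assume y: "y \<in> carrier Y"
          then have "fst (d (t y)) \<in> carrier Y" using t1 by (simp add: module_hom_iff)
          then show "g (fst (d (t (fst (d (t y)))))) = \<zero>\<^bsub>Z\<^esub>" using gt y v0 by simp
        qed (simp add: dtf)
        then show ?thesis ..
      qed
    qed
  qed
  then show ?thesis unfolding right_almost_split_def using g nse by blast
qed

section \<open>Biserial projective modules of length four\<close>

text \<open>The addition map from the external sum onto \<open>N + K\<close> is injective because
  \<open>N\<close> and \<open>K\<close> meet in zero, so the map assembled from \<open>f\<close> and
  \<open>g\<close> factors through it.\<close>

lemma hom_on_sum:
  assumes "lmodule A W" "lmodule A Y" and N: "submodule N A W" and K: "submodule K A W"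
    and disj: "N \<inter> K = {\<zero>\<^bsub>W\<^esub>}"
    and f: "f \<in> module_hom A (sub W N) Y" and g: "g \<in> module_hom A (sub W K) Y"
  obtains h where "h \<in> module_hom A (sub W (N <+>\<^bsub>W\<^esub> K)) Y"
    "\<And>x. x \<in> N \<Longrightarrow> h x = f x" "\<And>x. x \<in> K \<Longrightarrow> h x = g x"
proof -
  interpret W: lmodule A W by fact
  interpret Y: lmodule A Y by fact
  note l = W.sub_lmodule[OF N] W.sub_lmodule[OF K]
  note s = W.lsub_sum[OF N K]
  interpret f: lhom A "sub W N" Y f by (intro lhomI l Y.lmodule_axioms f)
  interpret g: lhom A "sub W K" Y g by (intro lhomI l Y.lmodule_axioms g)
  note c = W.lsub_carrier[OF N] W.lsub_carrier[OF K]
  let ?D = "dsum (sub W N) (sub W K)"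
  have D: "lmodule A ?D" by (rule dsum_lmodule[OF l])
  have p: "(\<lambda>z. fst z \<oplus>\<^bsub>W\<^esub> snd z) \<in> module_hom A ?D W"
    by (intro hom_add W.lmodule_axioms hom_comp[OF dsum_homs(1)[OF l] hom_inclusion]
      hom_comp[OF dsum_homs(2)[OF l] hom_inclusion] N K)
  have po: "(\<lambda>z. fst z \<oplus>\<^bsub>W\<^esub> snd z) ` carrier ?D = N <+>\<^bsub>W\<^esub> K"
    by (auto simp: mem_set_add image_iff) blast+
  have p': "(\<lambda>z. fst z \<oplus>\<^bsub>W\<^esub> snd z) \<in> module_hom A ?D (sub W (N <+>\<^bsub>W\<^esub> K))"
    using po by (intro hom_into_sub p) simp
  have q: "(\<lambda>z. f (fst z) \<oplus>\<^bsub>Y\<^esub> g (snd z)) \<in> module_hom A ?D Y"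
    by (intro hom_add Y.lmodule_axioms hom_comp[OF dsum_homs(1)[OF l] f] hom_comp[OF dsum_homs(2)[OF l] g])
  have ker: "f (fst z) \<oplus>\<^bsub>Y\<^esub> g (snd z) = \<zero>\<^bsub>Y\<^esub>"
    if z: "z \<in> carrier ?D" "fst z \<oplus>\<^bsub>W\<^esub> snd z = \<zero>\<^bsub>sub W (N <+>\<^bsub>W\<^esub> K)\<^esub>" for z
  proof -
    have zz: "fst z \<in> N" "snd z \<in> K" using z(1) by auto
    have "fst z = \<ominus>\<^bsub>W\<^esub> snd z" using z(2) zz c by (simp add: W.M.minus_equality)
    then have "fst z \<in> N \<inter> K" using zz W.lsub_uminus[OF K] by auto
    then have e: "fst z = \<zero>\<^bsub>W\<^esub>" using disj by auto
    then have "snd z = \<zero>\<^bsub>W\<^esub>" using z(2) zz c by simp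
    then show ?thesis using e f.zero g.zero by simp
  qed
  obtain h where h: "h \<in> module_hom A (sub W (N <+>\<^bsub>W\<^esub> K)) Y"
    "\<And>z. z \<in> carrier ?D \<Longrightarrow> h (fst z \<oplus>\<^bsub>W\<^esub> snd z) = f (fst z) \<oplus>\<^bsub>Y\<^esub> g (snd z)"
    using hom_factor[OF D W.sub_lmodule[OF s] Y.lmodule_axioms p' q _ ker] po by auto
  have "h x = f x" if "x \<in> N" for x
    using h(2)[of "(x, \<zero>\<^bsub>W\<^esub>)"] that c g.zero f.closed[of x] W.lsub_zero[OF K] by simp
  moreover have "h x = g x" if "x \<in> K" for x
    using h(2)[of "(\<zero>\<^bsub>W\<^esub>, x)"] that c f.zero g.closed[of x] W.lsub_zero[OF N] by simp
  ultimately show ?thesis using that h(1) by blast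
qed

text \<open>\<open>ES\<close> and \<open>EN\<close> are injective envelopes of \<open>S\<close> and of \<open>N = top M\<close>; the map \<open>jM\<close> is the composition
  of \<open>M \<rightarrow> top M\<close> with the embedding of \<open>top M\<close>.\<close>

locale biserial_projective = finite_length_ring A
  for A :: "('a, 'r) ring_scheme" (structure) +
  fixes P :: "('a, 'b) module" and S M :: "'b set"
    and ES EN :: "'a fgmod" and jS jM :: "'b \<Rightarrow> (nat \<Rightarrow> 'a) set"
  assumes projP: "projective_module A P"
    and S: "submodule S A P" and M: "submodule M A P" and SM: "S \<inter> M = {\<zero>\<^bsub>P\<^esub>}"
    and rdP: "rd A P (carrier P) = S <+>\<^bsub>P\<^esub> M"
    and proper: "S <+>\<^bsub>P\<^esub> M \<noteq> carrier P"
    and local: "\<And>N. submodule N A P \<Longrightarrow> N \<noteq> carrier P \<Longrightarrow> N \<subseteq> S <+>\<^bsub>P\<^esub> M"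
    and simpleS: "covered A P {\<zero>\<^bsub>P\<^esub>} S"
    and simpleL: "covered A P {\<zero>\<^bsub>P\<^esub>} (rd A P M)"
    and subM: "\<And>N. submodule N A P \<Longrightarrow> N \<subseteq> M \<Longrightarrow> N = {\<zero>\<^bsub>P\<^esub>} \<or> N = rd A P M \<or> N = M"
    and LM: "rd A P M \<noteq> M"
    and injS: "injective_module A ES" and uniS: "uniserial A ES"
    and jS: "jS \<in> module_hom A (sub P S) ES" and jS_inj: "\<And>s. s \<in> S \<Longrightarrow> jS s = \<zero>\<^bsub>ES\<^esub> \<Longrightarrow> s = \<zero>\<^bsub>P\<^esub>"
    and injN: "injective_module A EN" and uniN: "uniserial A EN"
    and jM: "jM \<in> module_hom A (sub P M) EN" and jM_ker: "\<And>m. m \<in> M \<Longrightarrow> jM m = \<zero>\<^bsub>EN\<^esub> \<longleftrightarrow> m \<in> rd A P M"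
    and indec: "\<And>Y :: 'a fgmod. projective_module A Y \<Longrightarrow> indecomposable A Y \<Longrightarrow>
      (\<exists>n\<le>4. has_length A Y n) \<and> (uniserial A Y \<or> biserial_module A Y)"
begin

abbreviation L :: "'b set" where "L \<equiv> rd A P M"
abbreviation R :: "'b set" where "R \<equiv> S <+>\<^bsub>P\<^esub> M"

lemma fgP: "fg_module A P" using projP by (simp add: projective_module_def)

sublocale P: lmodule A P using fgP by (rule fg_lmodule)

lemma R: "submodule R A P" by (rule P.lsub_sum[OF S M])
lemma Lsub: "submodule L A P" using simpleL by (simp add: covered_def)
lemma L_le_M: "L \<subseteq> M" by (rule P.rd_subset[OF M])
lemma S_le_R: "S \<subseteq> R" by (rule P.lsum_upper1[OF S M])
lemma M_le_R: "M \<subseteq> R" by (rule P.lsum_upper2[OF S M])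
lemma SL: "submodule (S <+>\<^bsub>P\<^esub> L) A P" by (rule P.lsub_sum[OF S Lsub])

lemma rdS: "rd A P S = {\<zero>\<^bsub>P\<^esub>}"
  using P.rd_covered[OF simpleS] P.lsub_zero[OF P.rd_submodule[OF P.lsub_subset[OF S]]] by auto

lemma rdL: "rd A P L = {\<zero>\<^bsub>P\<^esub>}"
  using P.rd_covered[OF simpleL] P.lsub_zero[OF P.rd_submodule[OF P.lsub_subset[OF Lsub]]] by auto

text \<open>Since \<open>R\<close> is the radical of \<open>P\<close>, this makes \<open>L\<close>
  the second radical, so that \<open>P/L\<close> is the quotient of \<open>P\<close> by its second
  radical.\<close>

lemma rdR: "rd A P R = L"
proof -
  have "rd A P R = {\<zero>\<^bsub>P\<^esub>} <+>\<^bsub>P\<^esub> L" using P.rd_sum[OF S M] rdS by simp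
  also have "\<dots> = L" using P.lsub_carrier[OF Lsub] by (auto simp: mem_set_add)
  finally show ?thesis .
qed

lemma subS: "submodule N A P \<Longrightarrow> N \<subseteq> S \<Longrightarrow> N = {\<zero>\<^bsub>P\<^esub>} \<or> N = S"
  using simpleS P.lsub_zero unfolding covered_def by auto

lemma S_nz: "S \<noteq> {\<zero>\<^bsub>P\<^esub>}" using simpleS by (auto simp: covered_def)
lemma L_nz: "L \<noteq> {\<zero>\<^bsub>P\<^esub>}" using simpleL by (auto simp: covered_def)

text \<open>The radical is the direct sum of \<open>S\<close> and \<open>M\<close>, so a map can be
  prescribed on the two parts independently before it is extended to \<open>P\<close>. The maps from
  \<open>P\<close> to \<open>ES\<close> and \<open>EN\<close> below are built this way.\<close>

lemma extend_R:
  assumes "injective_module A E" "f \<in> module_hom A (sub P S) E" "g \<in> module_hom A (sub P M) E"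
  obtains u where "u \<in> module_hom A P E" "\<And>x. x \<in> S \<Longrightarrow> u x = f x" "\<And>x. x \<in> M \<Longrightarrow> u x = g x"
proof -
  have El: "lmodule A E" using assms(1) by (simp add: injective_module_def fg_lmodule)
  obtain h where h: "h \<in> module_hom A (sub P R) E"
    "\<And>x. x \<in> S \<Longrightarrow> h x = f x" "\<And>x. x \<in> M \<Longrightarrow> h x = g x"
    using hom_on_sum[OF P.lmodule_axioms El S M SM assms(2,3)] by blast
  obtain u where u: "u \<in> module_hom A P E" "\<And>x. x \<in> carrier (sub P R) \<Longrightarrow> u x = h x"
    using injective_extend[OF assms(1) fg_submodule[OF fgP R] fgP hom_inclusion[OF P.lmodule_axioms R] _ h(1)]
    by (auto simp: inj_on_def)
  show ?thesis
    using that[OF u(1)] u(2) h S_le_R M_le_R by (metis sub_simps(1) subsetD)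
qed

text \<open>By comparability it remains to treat \<open>X\<close> inside \<open>u P\<close>. Its
  preimage is then not inside \<open>R\<close>, the largest proper submodule, so it is all of
  \<open>P\<close>.\<close>

lemma covers_image:
  assumes E: "fg_module A E" "uniserial A E" and u: "u \<in> module_hom A P E"
    and X: "submodule X A E" "\<not> X \<subseteq> u ` R"
  shows "u ` carrier P \<subseteq> X"
proof -
  interpret u: lhom A P E u by (intro lhomI P.lmodule_axioms fg_lmodule E u)
  consider "u ` carrier P \<subseteq> X" | "X \<subseteq> u ` carrier P"
    using E(2) X(1) u.image_submodule[OF P.lsub_top] unfolding uniserial_def by blast
  then show ?thesis
  proof cases
    case 2
    let ?C = "{p \<in> carrier P. u p \<in> X}"
    have "?C = carrier P"
    proof (rule ccontr)
      assume "?C \<noteq> carrier P"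
      then have "?C \<subseteq> R" using local[OF u.preimage_submodule[OF X(1)]] by simp
      then have "X \<subseteq> u ` R" using 2 by blast
      then show False using X(2) by simp
    qed
    then show ?thesis by blast
  qed
qed

text \<open>If \<open>u P\<close> were inside \<open>u R\<close>, it would equal its own radical and
  so be zero by \<open>rd_proper\<close>.\<close>

lemma image_not_radical:
  assumes E: "fg_module A E" and u: "u \<in> module_hom A P E" and "x \<in> R" "u x \<noteq> \<zero>\<^bsub>E\<^esub>"
  shows "\<not> u ` carrier P \<subseteq> u ` R"
proof
  interpret u: lhom A P E u by (intro lhomI P.lmodule_axioms fg_lmodule E u)
  assume "u ` carrier P \<subseteq> u ` R"
  then have "u ` carrier P = u ` R" using P.lsub_subset[OF R] by blast
  then have "rd A E (u ` carrier P) = u ` carrier P"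
    using u.image_rd[OF subset_refl] rdP by simp
  then have "u ` carrier P = {\<zero>\<^bsub>E\<^esub>}"
    using rd_proper[OF E u.image_submodule[OF P.lsub_top]] by blast
  then show False using assms(3,4) P.lsub_carrier[OF R] by blast
qed

lemma kernel_le_R:
  assumes E: "lmodule A E" and u: "u \<in> module_hom A P E" and p: "p \<in> carrier P" "u p \<noteq> \<zero>\<^bsub>E\<^esub>"
    and x: "x \<in> carrier P" "u x = \<zero>\<^bsub>E\<^esub>"
  shows "x \<in> R"
proof -
  interpret u: lhom A P E u by (intro lhomI P.lmodule_axioms E u)
  have "{x \<in> carrier P. u x = \<zero>\<^bsub>E\<^esub>} \<noteq> carrier P"
    using p by (metis (mono_tags, lifting) mem_Collect_eq)
  then show ?thesis using local[OF u.kernel_submodule] x by blast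
qed

text \<open>This says that \<open>S\<close> and \<open>top M\<close> are not isomorphic. If they were, \<open>P/M\<close> and \<open>P/(S+L)\<close> would be the same
  submodule of the uniserial module \<open>I\<^sub>S\<close>, and an isomorphism between them would lift to an automorphism
  of \<open>P\<close> that embeds \<open>S+L\<close> into the uniserial module \<open>M\<close>.\<close>

lemma S_M_incomparable:
  assumes Y: "lmodule A Y" and al: "\<alpha> \<in> module_hom A (sub P M) Y" and be: "\<beta> \<in> module_hom A (sub P S) Y"
    and le: "\<alpha> ` M \<subseteq> \<beta> ` S" and m: "m \<in> M"
  shows "\<alpha> m = \<zero>\<^bsub>Y\<^esub>"
proof (rule ccontr)
  assume nz: "\<alpha> m \<noteq> \<zero>\<^bsub>Y\<^esub>"
  note Sl = P.sub_lmodule[OF S] and Ml = P.sub_lmodule[OF M]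
  interpret a: lhom A "sub P M" Y \<alpha> by (intro lhomI Ml Y al)
  interpret b: lhom A "sub P S" Y \<beta> by (intro lhomI Sl Y be)
  have E: "fg_module A ES" using injS by (simp add: injective_module_def)
  have "submodule {x \<in> S. \<beta> x = \<zero>\<^bsub>Y\<^esub>} A P"
    using b.kernel_submodule submodule_sub_iff[OF P.lmodule_axioms S] by simp
  then have "{x \<in> S. \<beta> x = \<zero>\<^bsub>Y\<^esub>} = {\<zero>\<^bsub>P\<^esub>} \<or> {x \<in> S. \<beta> x = \<zero>\<^bsub>Y\<^esub>} = S" by (rule subS) auto
  moreover have "{x \<in> S. \<beta> x = \<zero>\<^bsub>Y\<^esub>} \<noteq> S"
  proof
    assume e: "{x \<in> S. \<beta> x = \<zero>\<^bsub>Y\<^esub>} = S"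
    have "\<alpha> m \<in> \<beta> ` S" using le m by (rule subsetD[OF _ imageI])
    then obtain s where "s \<in> S" "\<alpha> m = \<beta> s" by (rule imageE)
    then show False using nz equalityD2[OF e] by auto
  qed
  ultimately have e: "{x \<in> S. \<beta> x = \<zero>\<^bsub>Y\<^esub>} = {\<zero>\<^bsub>P\<^esub>}" by simp
  have b0: "x = \<zero>\<^bsub>P\<^esub>" if "x \<in> S" "\<beta> x = \<zero>\<^bsub>Y\<^esub>" for x
    using subsetD[OF equalityD1[OF e], of x] that by simp
  have binj: "inj_on \<beta> S" using b.inj_iff b0 by simp
  let ?K = "sub Y (\<beta> ` S)"
  have Ks: "submodule (\<beta> ` S) A Y" using b.image_submodule[OF b.X.lsub_top] by simp
  have bK: "\<beta> \<in> module_hom A (sub P S) ?K" "bij_betw \<beta> (carrier (sub P S)) (carrier ?K)"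
    using binj by (auto simp: bij_betw_def intro: hom_into_sub[OF be])
  obtain i where i: "i \<in> module_hom A ?K (sub P S)" "\<And>x. x \<in> S \<Longrightarrow> i (\<beta> x) = x"
    by (rule hom_inverse[OF Sl lmodule.sub_lmodule[OF Y Ks] bK]) simp
  have aK: "\<alpha> \<in> module_hom A (sub P M) ?K" using le by (intro hom_into_sub al) simp
  have ga: "(\<lambda>x. i (\<alpha> x)) \<in> module_hom A (sub P M) (sub P S)" by (rule hom_comp[OF aK i(1)])
  \<comment> \<open>\<open>\<gamma>\<close> is \<open>\<alpha>\<close> followed by the inverse of
    \<open>\<beta>\<close>: a nonzero map from \<open>M\<close> to the simple module
    \<open>S\<close>, hence onto, with \<open>L\<close> in its kernel. This gives the isomorphism of
    top M with \<open>S\<close> that is to be refuted.\<close>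
  define \<gamma> where "\<gamma> = (\<lambda>x. i (\<alpha> x))"
  interpret g: lhom A "sub P M" "sub P S" \<gamma> using ga by (intro lhomI Ml Sl) (simp add: \<gamma>_def)
  have gm: "\<gamma> m \<noteq> \<zero>\<^bsub>P\<^esub>"
  proof
    assume "\<gamma> m = \<zero>\<^bsub>P\<^esub>"
    moreover obtain s where s: "s \<in> S" "\<alpha> m = \<beta> s" using le m by blast
    ultimately have "s = \<zero>\<^bsub>P\<^esub>" using i(2) by (simp add: \<gamma>_def)
    then show False using s nz b.zero by simp
  qed
  have gL: "\<gamma> x = \<zero>\<^bsub>P\<^esub>" if "x \<in> L" for x
  proof -
    have "\<gamma> ` rd A (sub P M) M = rd A (sub P S) (\<gamma> ` M)" using g.image_rd[of M] by simp
    also have "\<dots> = rd A P (\<gamma> ` M)" using g.closed by (intro rd_sub P.lmodule_axioms S) auto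
    also have "\<dots> \<subseteq> rd A P S" using g.closed by (intro P.rd_mono P.lsub_subset[OF S]) auto
    finally show ?thesis using that rdS rd_sub[OF P.lmodule_axioms M subset_refl] by auto
  qed
  have gonto: "\<gamma> ` M = S"
  proof -
    have "submodule (\<gamma> ` M) A P" "\<gamma> ` M \<subseteq> S"
      using g.image_submodule[OF lmodule.lsub_top[OF Ml]] submodule_sub_iff[OF P.lmodule_axioms S] by simp_all
    moreover have "\<gamma> ` M \<noteq> {\<zero>\<^bsub>P\<^esub>}" using gm m by blast
    ultimately show ?thesis using subS by blast
  qed
  have jl: "lmodule A ES" by (rule fg_lmodule[OF E])
  interpret j: lhom A "sub P S" ES jS by (intro lhomI Sl jl jS)
  note z = hom_zero[OF jl]
  \<comment> \<open>\<open>u1\<close> kills \<open>M\<close> and \<open>u2\<close> kills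
    \<open>S\<close>, yet both map \<open>R\<close> onto the same simple submodule
    \<open>jS S\<close>.\<close>
  obtain u1 where u1: "u1 \<in> module_hom A P ES" "\<And>x. x \<in> S \<Longrightarrow> u1 x = jS x" "\<And>x. x \<in> M \<Longrightarrow> u1 x = \<zero>\<^bsub>ES\<^esub>"
    using extend_R[OF injS jS z] by blast
  have "(\<lambda>x. jS (\<gamma> x)) \<in> module_hom A (sub P M) ES" by (rule hom_comp[OF g.f jS])
  then obtain u2 where u2: "u2 \<in> module_hom A P ES" "\<And>x. x \<in> S \<Longrightarrow> u2 x = \<zero>\<^bsub>ES\<^esub>" "\<And>x. x \<in> M \<Longrightarrow> u2 x = jS (\<gamma> x)"
    using extend_R[OF injS z] by blast
  interpret u1: lhom A P ES u1 by (intro lhomI P.lmodule_axioms jl u1)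
  interpret u2: lhom A P ES u2 by (intro lhomI P.lmodule_axioms jl u2)
  note c = P.lsub_subset[OF S] P.lsub_subset[OF M]
  have "u1 ` S = jS ` S" "u1 ` M = {\<zero>\<^bsub>ES\<^esub>}"
    using u1 P.lsub_zero[OF M] by (auto intro!: image_cong simp: image_iff)
  then have u1R: "u1 ` R = jS ` S"
    using u1.image_sum[OF c] j.closed by (auto simp: mem_set_add)
  have "u2 ` M = jS ` S" "u2 ` S = {\<zero>\<^bsub>ES\<^esub>}"
    using u2 P.lsub_zero[OF S] gonto by (auto simp: image_iff)
  then have u2R: "u2 ` R = jS ` S"
    using u2.image_sum[OF c] j.closed by (auto simp: mem_set_add)
  obtain s where s: "s \<in> S" "s \<noteq> \<zero>\<^bsub>P\<^esub>" using S_nz P.lsub_zero[OF S] by blast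
  have n1: "\<not> u1 ` carrier P \<subseteq> u1 ` R"
    by (rule image_not_radical[OF E u1(1) subsetD[OF S_le_R s(1)]]) (use s u1(2) jS_inj in auto)
  have n2: "\<not> u2 ` carrier P \<subseteq> u2 ` R"
    by (rule image_not_radical[OF E u2(1) subsetD[OF M_le_R m]])
      (use m u2(3) jS_inj[of "\<gamma> m"] gm g.closed[of m] in auto)
  have eq: "u1 ` carrier P = u2 ` carrier P"
    using covers_image[OF E uniS u1(1) u2.image_submodule[OF P.lsub_top]]
      covers_image[OF E uniS u2(1) u1.image_submodule[OF P.lsub_top]] n1 n2 u1R u2R by auto
  let ?I = "u1 ` carrier P"
  have I: "submodule ?I A ES" by (rule u1.image_submodule[OF P.lsub_top])
  \<comment> \<open>\<open>\<tau>\<close> lifts the comparison of the two equal images to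
    \<open>P\<close>. It is onto, since otherwise its image would lie in \<open>R\<close> and
    \<open>u2 P\<close> would lie in \<open>u1 R = u2 R\<close>.\<close>
  obtain \<tau> where tau: "\<tau> \<in> module_hom A P P" "\<And>x. x \<in> carrier P \<Longrightarrow> u1 (\<tau> x) = u2 x"
  proof (rule projective_lift[OF projP fgP fg_submodule[OF E I]])
    show "u1 \<in> module_hom A P (sub ES ?I)" by (rule hom_into_sub[OF u1(1) subset_refl])
    show "u2 \<in> module_hom A P (sub ES ?I)" using eq by (intro hom_into_sub u2) simp
  qed simp_all
  interpret t: lhom A P P \<tau> by (intro lhomI P.lmodule_axioms tau)
  have tonto: "\<tau> ` carrier P = carrier P"
  proof (rule ccontr)
    assume "\<tau> ` carrier P \<noteq> carrier P"
    then have "\<tau> ` carrier P \<subseteq> R" by (rule local[OF t.image_submodule[OF P.lsub_top]])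
    then have "u2 ` carrier P \<subseteq> u1 ` R" using tau(2) by (auto simp flip: tau(2))
    then show False using n2 u1R u2R by simp
  qed
  have tinj: "inj_on \<tau> (carrier P)" by (rule surj_endo_inj[OF fgP tau(1) tonto])
  have ker1: "x \<in> M" if x: "x \<in> carrier P" "u1 x = \<zero>\<^bsub>ES\<^esub>" for x
  proof -
    have "u1 s \<noteq> \<zero>\<^bsub>ES\<^esub>" "s \<in> carrier P" using s u1(2) jS_inj c by auto
    then have "x \<in> R" using kernel_le_R[OF jl u1(1) _ _ x] by blast
    then obtain a b where ab: "a \<in> S" "b \<in> M" "x = a \<oplus>\<^bsub>P\<^esub> b" unfolding mem_set_add by blast
    then have "u1 x = jS a" using u1 c j.closed[of a] by (auto simp: subset_iff)
    then have "a = \<zero>\<^bsub>P\<^esub>" using x jS_inj ab by simp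
    then show ?thesis using ab c by (auto simp: subset_iff)
  qed
  \<comment> \<open>A nonzero \<open>K\<close> with zero radical in the kernel of \<open>u2\<close>
    is moved by \<open>\<tau>\<close> into the kernel of \<open>u1\<close>, hence into
    \<open>M\<close>, where only \<open>L\<close> is nonzero with zero radical. Applied to
    \<open>S\<close> and to \<open>L\<close>, this forces \<open>S = L\<close>.\<close>
  have tL: "\<tau> ` K = L" if K: "submodule K A P" "K \<noteq> {\<zero>\<^bsub>P\<^esub>}" "rd A P K = {\<zero>\<^bsub>P\<^esub>}"
    and k: "\<And>x. x \<in> K \<Longrightarrow> u2 x = \<zero>\<^bsub>ES\<^esub>" for K
  proof -
    note Kc = P.lsub_subset[OF K(1)]
    have tK: "submodule (\<tau> ` K) A P" by (rule t.image_submodule[OF K(1)])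
    have "\<tau> ` K \<subseteq> M"
    proof
      fix y assume "y \<in> \<tau> ` K"
      then obtain x where "x \<in> K" "y = \<tau> x" by auto
      then show "y \<in> M" using ker1[of y] tau(2)[of x] k[of x] Kc t.closed[of x] by (auto simp: subset_iff)
    qed
    moreover have "\<tau> ` K \<noteq> {\<zero>\<^bsub>P\<^esub>}"
    proof
      assume "\<tau> ` K = {\<zero>\<^bsub>P\<^esub>}"
      then have "K \<subseteq> {\<zero>\<^bsub>P\<^esub>}" using tinj t.inj_iff Kc by blast
      then show False using K(2) P.lsub_zero[OF K(1)] by auto
    qed
    moreover have "\<tau> ` K \<noteq> M"
      using t.image_rd[OF Kc] K(3) L_nz t.zero by auto
    ultimately show ?thesis using subM[OF tK] by blast
  qed
  have "\<tau> ` S = \<tau> ` L"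
    using tL[OF S S_nz rdS u2(2)] tL[OF Lsub L_nz rdL] u2(3) gL L_le_M j.zero by (simp add: subset_iff)
  then have "S = L" using inj_on_image_eq_iff[OF tinj c(1) P.lsub_subset[OF Lsub]] by simp
  then show False using SM L_le_M S_nz by auto
qed

text \<open>The preimage of \<open>\<beta> S\<close> in \<open>M\<close> contains an element with
  nonzero image, hence one outside \<open>L\<close>, so it is all of \<open>M\<close> and
  \<open>S_M_incomparable\<close> applies. Vanishing on \<open>L\<close> excludes that
  \<open>S\<close> is mapped onto the image of \<open>L\<close>, a case that
  \<open>kill_M_projective\<close> has to treat.\<close>

lemma M_S_incomparable:
  assumes Y: "lmodule A Y" and al: "\<alpha> \<in> module_hom A (sub P M) Y" and be: "\<beta> \<in> module_hom A (sub P S) Y"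
    and le: "\<beta> ` S \<subseteq> \<alpha> ` M" and aL: "\<And>x. x \<in> L \<Longrightarrow> \<alpha> x = \<zero>\<^bsub>Y\<^esub>" and s: "s \<in> S"
  shows "\<beta> s = \<zero>\<^bsub>Y\<^esub>"
proof (rule ccontr)
  assume nz: "\<beta> s \<noteq> \<zero>\<^bsub>Y\<^esub>"
  interpret a: lhom A "sub P M" Y \<alpha> by (intro lhomI P.sub_lmodule Y al M)
  interpret b: lhom A "sub P S" Y \<beta> by (intro lhomI P.sub_lmodule Y be S)
  let ?N = "{m \<in> M. \<alpha> m \<in> \<beta> ` S}"
  have bS: "submodule (\<beta> ` S) A Y" using b.image_submodule[OF b.X.lsub_top] by simp
  then have N: "submodule ?N A P"
    using a.preimage_submodule submodule_sub_iff[OF P.lmodule_axioms M] by simp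
  obtain m where m: "m \<in> M" "\<alpha> m = \<beta> s" using le s by (metis imageE imageI subsetD)
  have "m \<in> ?N" using m s by simp
  moreover have "m \<notin> L" "m \<noteq> \<zero>\<^bsub>P\<^esub>" using aL m nz a.zero by auto
  ultimately have "?N = M" using subM[OF N] by blast
  then have "\<alpha> ` M \<subseteq> \<beta> ` S" by blast
  then show False using S_M_incomparable[OF Y al be _ m(1)] m nz by simp
qed

end

section \<open>Maximal submodules and Nakayama's lemma\<close>

lemma (in finite_length_ring) maximal_above:
  assumes "fg_module A W" "submodule X A W" "X \<noteq> carrier W"
  obtains C where "covered A W C (carrier W)" "X \<subseteq> C"
proof -
  interpret W: lmodule A W using assms(1) by (rule fg_lmodule)
  show ?thesis
  proof (rule length_function[OF assms(1)])
    fix l :: "_ set \<Rightarrow> nat"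
    assume l: "\<And>C D. submodule C A W \<Longrightarrow> submodule D A W \<Longrightarrow> C \<subset> D \<Longrightarrow> l C < l D"
      and bd: "\<And>D. submodule D A W \<Longrightarrow> l D \<le> l (carrier W)"
    let ?P = "\<lambda>C. submodule C A W \<and> X \<subseteq> C \<and> C \<noteq> carrier W"
    have "?P X" using assms by simp
    moreover have "\<forall>C. ?P C \<longrightarrow> l C < Suc (l (carrier W))"
      using bd by (auto simp: less_Suc_eq_le)
    ultimately obtain C where C: "?P C" and max: "\<And>D. ?P D \<Longrightarrow> l D \<le> l C"
      using ex_has_greatest_nat[of ?P X l "Suc (l (carrier W))"] by blast
    have "D = C \<or> D = carrier W" if D: "submodule D A W" "C \<subseteq> D" for D
    proof (rule ccontr)
      assume "\<not> (D = C \<or> D = carrier W)"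
      then have "?P D" "C \<subset> D" using D C by auto
      then show False using l[of C D] max[of D] C D by force
    qed
    then have "covered A W C (carrier W)"
      using C W.lsub_top W.lsub_subset[of C] unfolding covered_def by blast
    then show ?thesis using that C by blast
  qed
qed

text \<open>A proper \<open>X\<close> lies in a maximal submodule, which contains the radical as
  well.\<close>

lemma (in finite_length_ring) nakayama:
  assumes "fg_module A W" "submodule X A W" "carrier W \<subseteq> X <+>\<^bsub>W\<^esub> rd A W (carrier W)"
  shows "X = carrier W"
proof (rule ccontr)
  interpret W: lmodule A W using assms(1) by (rule fg_lmodule)
  assume "X \<noteq> carrier W"
  then obtain C where C: "covered A W C (carrier W)" "X \<subseteq> C"
    using maximal_above[OF assms(1,2)] by blast
  have "X <+>\<^bsub>W\<^esub> rd A W (carrier W) \<subseteq> C"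
    using C W.rd_covered[OF C(1)] by (intro W.lsum_least) (auto simp: covered_def)
  then show False using C(1) assms(3) by (auto simp: covered_def)
qed

section \<open>Extension of radical maps from S and M to P\<close>

context biserial_projective
begin

text \<open>This embeds \<open>P/M\<close> into the envelope of \<open>S\<close>: prescribe the
  embedding on \<open>S\<close> and zero on \<open>M\<close>. The kernel is proper, so it lies in
  \<open>R\<close>, where it can be read off.\<close>

lemma S_map:
  obtains u where "u \<in> module_hom A P ES" "\<And>p. p \<in> carrier P \<Longrightarrow> u p = \<zero>\<^bsub>ES\<^esub> \<longleftrightarrow> p \<in> M"
proof -
  have El: "lmodule A ES" using injS by (simp add: injective_module_def fg_lmodule)
  interpret j: lhom A "sub P S" ES jS by (intro lhomI P.sub_lmodule S El jS)
  obtain u where u: "u \<in> module_hom A P ES" "\<And>x. x \<in> S \<Longrightarrow> u x = jS x" "\<And>x. x \<in> M \<Longrightarrow> u x = \<zero>\<^bsub>ES\<^esub>"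
    using extend_R[OF injS jS hom_zero[OF El]] by blast
  interpret u: lhom A P ES u by (intro lhomI P.lmodule_axioms El u)
  note c = P.lsub_carrier[OF S] P.lsub_carrier[OF M]
  obtain s where "s \<in> S" "s \<noteq> \<zero>\<^bsub>P\<^esub>" using S_nz P.lsub_zero[OF S] by blast
  then have s: "s \<in> carrier P" "u s \<noteq> \<zero>\<^bsub>ES\<^esub>" using u(2) jS_inj c by auto
  have "p \<in> M" if p: "p \<in> carrier P" "u p = \<zero>\<^bsub>ES\<^esub>" for p
  proof -
    have "p \<in> R" by (rule kernel_le_R[OF El u(1) s p])
    then obtain a b where ab: "a \<in> S" "b \<in> M" "p = a \<oplus>\<^bsub>P\<^esub> b" unfolding mem_set_add by blast
    then have "u p = jS a" using u c j.closed[of a] by simp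
    then have "a = \<zero>\<^bsub>P\<^esub>" using p jS_inj ab by simp
    then show ?thesis using ab c by simp
  qed
  then show ?thesis using that[OF u(1)] u(3) by blast
qed

text \<open>In the same way \<open>P/(S + L)\<close> embeds into the envelope of top M, because
  \<open>jM\<close> has kernel \<open>L\<close> on \<open>M\<close>.\<close>

lemma M_map:
  obtains u where "u \<in> module_hom A P EN" "\<And>p. p \<in> carrier P \<Longrightarrow> u p = \<zero>\<^bsub>EN\<^esub> \<longleftrightarrow> p \<in> S <+>\<^bsub>P\<^esub> L"
proof -
  have El: "lmodule A EN" using injN by (simp add: injective_module_def fg_lmodule)
  interpret j: lhom A "sub P M" EN jM by (intro lhomI P.sub_lmodule M El jM)
  obtain u where u: "u \<in> module_hom A P EN" "\<And>x. x \<in> S \<Longrightarrow> u x = \<zero>\<^bsub>EN\<^esub>" "\<And>x. x \<in> M \<Longrightarrow> u x = jM x"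
    using extend_R[OF injN hom_zero[OF El] jM] by blast
  interpret u: lhom A P EN u by (intro lhomI P.lmodule_axioms El u)
  note c = P.lsub_carrier[OF S] P.lsub_carrier[OF M]
  obtain m where "m \<in> M" "m \<notin> L" using LM L_le_M by blast
  then have m: "m \<in> carrier P" "u m \<noteq> \<zero>\<^bsub>EN\<^esub>" using u(3) jM_ker c by auto
  have "u p = \<zero>\<^bsub>EN\<^esub> \<longleftrightarrow> p \<in> S <+>\<^bsub>P\<^esub> L" if p: "p \<in> carrier P" for p
  proof
    assume "u p = \<zero>\<^bsub>EN\<^esub>"
    then have "p \<in> R" by (rule kernel_le_R[OF El u(1) m p])
    then obtain a b where ab: "a \<in> S" "b \<in> M" "p = a \<oplus>\<^bsub>P\<^esub> b" unfolding mem_set_add by blast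
    then have "u p = jM b" using u c j.closed[of b] by simp
    then have "b \<in> L" using \<open>u p = \<zero>\<^bsub>EN\<^esub>\<close> jM_ker ab by simp
    then show "p \<in> S <+>\<^bsub>P\<^esub> L" using ab unfolding mem_set_add by blast
  next
    assume "p \<in> S <+>\<^bsub>P\<^esub> L"
    then obtain a b where ab: "a \<in> S" "b \<in> L" "p = a \<oplus>\<^bsub>P\<^esub> b" unfolding mem_set_add by blast
    moreover have "b \<in> M" using ab L_le_M by blast
    ultimately show "u p = \<zero>\<^bsub>EN\<^esub>" using u c jM_ker by simp
  qed
  then show ?thesis using that[OF u(1)] by blast
qed

text \<open>The two pairs allow the extension argument to be run once for both \<open>S\<close> and
  \<open>M\<close>: \<open>B\<close> is the submodule from which maps are extended, and
  \<open>D\<close> is the kernel of a map from \<open>P\<close> to the uniserial injective module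
  containing the simple module \<open>B/(B \<inter> D)\<close>.\<close>

definition complementary :: "'b set \<Rightarrow> 'b set \<Rightarrow> bool" where
  "complementary B D \<longleftrightarrow> B = S \<and> D = M \<or> B = M \<and> D = S <+>\<^bsub>P\<^esub> L"

lemma complementary_map:
  assumes "complementary B D"
  obtains E :: "'a fgmod" and u where "injective_module A E" "uniserial A E" "u \<in> module_hom A P E"
    "\<And>p. p \<in> carrier P \<Longrightarrow> u p = \<zero>\<^bsub>E\<^esub> \<longleftrightarrow> p \<in> D"
proof -
  consider "B = S" "D = M" | "B = M" "D = S <+>\<^bsub>P\<^esub> L" using assms by (auto simp: complementary_def)
  then show ?thesis
  proof cases
    case 1
    show ?thesis by (rule S_map) (use that[OF injS uniS] 1 in blast)
  next
    case 2
    show ?thesis by (rule M_map) (use that[OF injN uniN] 2 in blast)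
  qed
qed

lemma S_not_le_M: "\<not> S \<subseteq> M"
  using SM S_nz by blast

lemma M_not_le_SL: "\<not> M \<subseteq> S <+>\<^bsub>P\<^esub> L"
proof
  assume le: "M \<subseteq> S <+>\<^bsub>P\<^esub> L"
  have "M \<subseteq> L"
  proof
    fix m assume m: "m \<in> M"
    then obtain s l where sl: "s \<in> S" "l \<in> L" "m = s \<oplus>\<^bsub>P\<^esub> l" using subsetD[OF le m] unfolding mem_set_add by blast
    have c: "s \<in> carrier P" "l \<in> carrier P" "l \<in> M" using sl P.lsub_carrier[OF S] P.lsub_carrier[OF Lsub] L_le_M by auto
    have "s = m \<ominus>\<^bsub>P\<^esub> l" using sl c by simp
    then have "s \<in> M" using P.lsub_minus[OF M m c(3)] by metis
    then have "s = \<zero>\<^bsub>P\<^esub>" using SM sl by blast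
    then show "m \<in> L" using sl c by simp
  qed
  then show False using LM L_le_M by blast
qed

text \<open>The last two clauses together identify \<open>B \<inter> D\<close> as the largest proper
  submodule of \<open>B\<close>.\<close>

lemma complementary_submodules:
  assumes "complementary B D"
  shows "submodule B A P" "submodule D A P" "B \<subseteq> R" "D \<subseteq> R" "L \<subseteq> D" "\<not> B \<subseteq> D"
    "submodule N A P \<Longrightarrow> N \<subseteq> B \<Longrightarrow> N = B \<or> N \<subseteq> D"
proof -
  have SLR: "S <+>\<^bsub>P\<^esub> L \<subseteq> R" using S_le_R M_le_R L_le_M by (intro P.lsum_least R) auto
  have LSL: "L \<subseteq> S <+>\<^bsub>P\<^esub> L" by (rule P.lsum_upper2[OF S Lsub])
  show "submodule B A P" "submodule D A P" "B \<subseteq> R" "D \<subseteq> R" "L \<subseteq> D" "\<not> B \<subseteq> D"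
    using assms S M SL S_le_R M_le_R SLR LSL L_le_M S_not_le_M M_not_le_SL unfolding complementary_def by auto
  show "N = B \<or> N \<subseteq> D" if "submodule N A P" "N \<subseteq> B"
    using assms that subS[OF that(1)] subM[OF that(1)] LSL P.lsub_zero[OF M] P.lsub_zero[OF SL]
    unfolding complementary_def by auto
qed

text \<open>Unites the two incomparability lemmas. If \<open>D\<close> is \<open>S + L\<close>, the
  image of \<open>D\<close> is just that of \<open>S\<close>, because \<open>L\<close> is
  killed.\<close>

lemma complementary_incomparable:
  assumes "complementary B D" and Y: "lmodule A Y" and al: "\<alpha> \<in> module_hom A (sub P B) Y" and de: "\<delta> \<in> module_hom A P Y"
    and L0: "\<And>x. x \<in> L \<Longrightarrow> \<delta> x = \<zero>\<^bsub>Y\<^esub>" and le: "\<alpha> ` B \<subseteq> \<delta> ` D" and b: "b \<in> B"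
  shows "\<alpha> b = \<zero>\<^bsub>Y\<^esub>"
proof -
  interpret d: lhom A P Y \<delta> by (intro lhomI P.lmodule_axioms Y de)
  note dS = hom_restrict[OF P.lmodule_axioms Y S de] and dM = hom_restrict[OF P.lmodule_axioms Y M de]
  consider "B = S" "D = M" | "B = M" "D = S <+>\<^bsub>P\<^esub> L" using assms(1) by (auto simp: complementary_def)
  then show ?thesis
  proof cases
    case 1
    show ?thesis by (rule M_S_incomparable[OF Y dM al[unfolded 1] le[unfolded 1] L0 b[unfolded 1]])
  next
    case 2
    have "\<delta> ` (S <+>\<^bsub>P\<^esub> L) \<subseteq> \<delta> ` S"
    proof
      fix y assume "y \<in> \<delta> ` (S <+>\<^bsub>P\<^esub> L)"
      then obtain z where z: "z \<in> S <+>\<^bsub>P\<^esub> L" "y = \<delta> z" by blast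
      then obtain s l where "s \<in> S" "l \<in> L" "z = s \<oplus>\<^bsub>P\<^esub> l" unfolding mem_set_add by blast
      then show "y \<in> \<delta> ` S" using z(2) L0 P.lsub_carrier[OF S] P.lsub_carrier[OF Lsub] by simp
    qed
    with le[unfolded 2] have "\<alpha> ` M \<subseteq> \<delta> ` S" by (rule order_trans)
    then show ?thesis by (rule S_M_incomparable[OF Y al[unfolded 2] dS _ b[unfolded 2]])
  qed
qed

text \<open>Both \<open>Y\<close> and \<open>u P\<close> have zero second radical, and
  \<open>u b\<close> is a nonzero element of both radicals, so neither module lies in the radical of
  the other. Hence \<open>u P\<close> is inside \<open>Y\<close> by \<open>covers_image\<close> and
  contains the radical of \<open>Y\<close>. A complement of \<open>u P\<close> in \<open>Y\<close>
  modulo the radical is comparable with \<open>u P\<close> and cannot contain it, which leaves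
  \<open>Y = u P\<close>.\<close>

lemma rd_square_zero_image:
  assumes E: "fg_module A E" "uniserial A E" and u: "u \<in> module_hom A P E"
    and uL: "\<And>x. x \<in> L \<Longrightarrow> u x = \<zero>\<^bsub>E\<^esub>"
    and Y: "submodule Y A E" "rd A E (rd A E Y) = {\<zero>\<^bsub>E\<^esub>}"
    and b: "b \<in> R" "u b \<noteq> \<zero>\<^bsub>E\<^esub>" "u b \<in> rd A E Y"
  shows "Y = u ` carrier P"
proof
  interpret u: lhom A P E u by (intro lhomI P.lmodule_axioms fg_lmodule E u)
  note Yc = u.Y.lsub_subset[OF Y(1)]
  have uP: "submodule (u ` carrier P) A E" by (rule u.image_submodule[OF P.lsub_top])
  have rY: "submodule (rd A E Y) A E" by (rule u.Y.rd_submodule[OF Yc])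
  have rduP: "rd A E (u ` carrier P) = u ` R" using u.image_rd[OF subset_refl] rdP by simp
  have "\<not> Y \<subseteq> u ` R"
  proof
    assume "Y \<subseteq> u ` R"
    then have "rd A E Y \<subseteq> rd A E (u ` R)"
      using u.Y.lsub_subset[OF u.image_submodule[OF R]] by (rule u.Y.rd_mono)
    also have "\<dots> = u ` L" using u.image_rd[OF P.lsub_subset[OF R]] rdR by simp
    finally show False using b uL by auto
  qed
  then show le: "u ` carrier P \<subseteq> Y" by (rule covers_image[OF E u Y(1)])
  have nle: "\<not> u ` carrier P \<subseteq> rd A E Y"
  proof
    assume "u ` carrier P \<subseteq> rd A E Y"
    then have "rd A E (u ` carrier P) \<subseteq> rd A E (rd A E Y)"
      using u.Y.lsub_subset[OF rY] by (rule u.Y.rd_mono)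
    then show False using b rduP Y(2) by blast
  qed
  have comp: "N \<subseteq> K \<or> K \<subseteq> N" if "submodule N A E" "submodule K A E" for N K
    using E(2) that unfolding uniserial_def by blast
  have "rd A E Y \<subseteq> u ` carrier P" using comp[OF rY uP] nle by blast
  then have "rd A (sub E Y) (carrier (sub E Y)) \<subseteq> u ` carrier P"
    using rd_sub[OF u.Y.lmodule_axioms Y(1) subset_refl] by simp
  moreover have "submodule (u ` carrier P) A (sub E Y)"
    using uP le by (simp add: submodule_sub_iff[OF u.Y.lmodule_axioms Y(1)])
  ultimately obtain C where C: "submodule C A (sub E Y)" "u ` carrier P <+>\<^bsub>sub E Y\<^esub> C = carrier (sub E Y)"
    "u ` carrier P \<inter> C \<subseteq> rd A (sub E Y) (carrier (sub E Y))"
    using complement_mod_rd[OF fg_submodule[OF E(1) Y(1)]] by metis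
  have Cs: "submodule C A E" using C(1) by (simp add: submodule_sub_iff[OF u.Y.lmodule_axioms Y(1)])
  have "\<not> u ` carrier P \<subseteq> C"
    using C(3) nle rd_sub[OF u.Y.lmodule_axioms Y(1) subset_refl] by auto
  then have "C \<subseteq> u ` carrier P" using comp[OF uP Cs] by blast
  then have "u ` carrier P <+>\<^bsub>E\<^esub> C \<subseteq> u ` carrier P" by (intro u.Y.lsum_least uP) auto
  then show "Y \<subseteq> u ` carrier P" using C(2) by simp
qed

text \<open>The case of zero second radical. Injectivity of \<open>E\<close> gives a map
  \<open>\<mu>\<close> on \<open>W\<close> that turns \<open>\<phi>\<close> into \<open>u\<close>;
  it satisfies \<open>\<mu> V = u P\<close>, and projectivity lifts \<open>u\<close> to a map
  \<open>q0\<close> from \<open>P\<close> to \<open>V\<close>. On \<open>B\<close> the difference of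
  \<open>\<phi>\<close> and \<open>q0\<close> is a problem of the same kind for the kernel of
  \<open>\<mu>\<close> on \<open>V\<close>, which is strictly smaller.\<close>

lemma extend_step:
  assumes comp: "complementary B D" and W: "fg_module A W"
    and V: "submodule V A W" "rd A W (rd A W V) = {\<zero>\<^bsub>W\<^esub>}"
    and phi: "\<phi> \<in> module_hom A (sub P B) W" "\<phi> ` B \<subseteq> rd A W V"
  shows "\<exists>q\<in>module_hom A P W. q ` carrier P \<subseteq> V \<and> (\<forall>b\<in>B. q b = \<phi> b)"
proof -
  interpret W: lmodule A W by (rule fg_lmodule[OF W])
  note facts = complementary_submodules[OF comp]
  obtain E :: "'a fgmod" and u where E: "injective_module A E" "uniserial A E" and u: "u \<in> module_hom A P E"
    and ker: "\<And>p. p \<in> carrier P \<Longrightarrow> u p = \<zero>\<^bsub>E\<^esub> \<longleftrightarrow> p \<in> D"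
    using complementary_map[OF comp] by blast
  have fgE: "fg_module A E" using E by (simp add: injective_module_def)
  interpret u: lhom A P E u by (intro lhomI P.lmodule_axioms fg_lmodule fgE u)
  note Bl = P.sub_lmodule[OF facts(1)]
  obtain b1 where b1: "b1 \<in> B" "b1 \<notin> D" using facts(6) by blast
  have Bc: "B \<subseteq> carrier P" and Dc: "D \<subseteq> carrier P" using P.lsub_subset facts by blast+
  have "\<forall>\<phi>. rd A W (rd A W V) = {\<zero>\<^bsub>W\<^esub>} \<longrightarrow> \<phi> \<in> module_hom A (sub P B) W \<longrightarrow> \<phi> ` B \<subseteq> rd A W V \<longrightarrow>
    (\<exists>q\<in>module_hom A P W. q ` carrier P \<subseteq> V \<and> (\<forall>b\<in>B. q b = \<phi> b))"
    using fg_dcc[OF W] V(1) W.lsub_subset[OF V(1)]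
  proof (induction V rule: W.dcc_induct)
    case (less V)
    note V = less(1)
    show ?case
    proof (intro allI impI)
      fix \<phi> assume rr: "rd A W (rd A W V) = {\<zero>\<^bsub>W\<^esub>}" and phi: "\<phi> \<in> module_hom A (sub P B) W"
        and im: "\<phi> ` B \<subseteq> rd A W V"
      interpret phi: lhom A "sub P B" W \<phi> by (intro lhomI Bl W.lmodule_axioms phi)
      note Vc = W.lsub_subset[OF V]
      have rV: "submodule (rd A W V) A W" "rd A W V \<subseteq> V" using W.rd_submodule[OF Vc] W.rd_subset[OF V] by auto
      let ?N = "{b \<in> B. \<phi> b = \<zero>\<^bsub>W\<^esub>}"
      have N: "submodule ?N A P" "?N \<subseteq> B"
        using phi.kernel_submodule by (simp_all add: submodule_sub_iff[OF P.lmodule_axioms facts(1)])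
      show "\<exists>q\<in>module_hom A P W. q ` carrier P \<subseteq> V \<and> (\<forall>b\<in>B. q b = \<phi> b)"
      proof (cases "?N = B")
        case True
        then have "\<forall>b\<in>B. \<zero>\<^bsub>W\<^esub> = \<phi> b" by (metis (mono_tags, lifting) mem_Collect_eq)
        then show ?thesis using W.lsub_zero[OF V] by (intro bexI[OF _ hom_zero[OF W.lmodule_axioms]]) auto
      next
        case False
        then have ND: "b \<in> D" if "b \<in> B" "\<phi> b = \<zero>\<^bsub>W\<^esub>" for b using facts(7)[OF N] that by blast
        have phB: "submodule (\<phi> ` B) A W" using phi.image_submodule[OF lmodule.lsub_top[OF Bl]] by simp
        have phi': "\<phi> \<in> module_hom A (sub P B) (sub W (\<phi> ` B))" by (rule hom_into_sub[OF phi]) simp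
        \<comment> \<open>The kernel of \<open>\<phi>\<close> is a proper submodule of
          \<open>B\<close>, so it lies in \<open>D\<close>, where \<open>u\<close> vanishes; hence
          \<open>u\<close> on \<open>B\<close> factors through \<open>\<phi>\<close>.\<close>
        obtain f0 where f0: "f0 \<in> module_hom A (sub W (\<phi> ` B)) E" "\<And>b. b \<in> B \<Longrightarrow> f0 (\<phi> b) = u b"
        proof (rule hom_factor[OF Bl W.sub_lmodule[OF phB] u.Y.lmodule_axioms phi'
              hom_restrict[OF P.lmodule_axioms u.Y.lmodule_axioms facts(1) u]])
          show "u b = \<zero>\<^bsub>E\<^esub>" if "b \<in> carrier (sub P B)" "\<phi> b = \<zero>\<^bsub>sub W (\<phi> ` B)\<^esub>" for b
            using that ND ker Bc by auto
        qed simp_all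
        obtain \<mu> where la0: "\<mu> \<in> module_hom A W E" "\<And>x. x \<in> \<phi> ` B \<Longrightarrow> \<mu> x = f0 x"
          by (rule injective_extend[OF E(1) fg_submodule[OF W phB] W hom_inclusion[OF W.lmodule_axioms phB] _ f0(1)])
            (simp_all add: inj_on_def)
        then have la: "\<mu> (\<phi> b) = u b" if "b \<in> B" for b using f0(2) that by simp
        interpret la: lhom A W E \<mu> by (intro lhomI W.lmodule_axioms u.Y.lmodule_axioms la0)
        have Ys: "submodule (\<mu> ` V) A E" by (rule la.image_submodule[OF V])
        have rY: "rd A E (\<mu> ` V) = \<mu> ` rd A W V" using la.image_rd[OF Vc] by simp
        have rrY: "rd A E (rd A E (\<mu> ` V)) = {\<zero>\<^bsub>E\<^esub>}"
          using la.image_rd[OF W.lsub_subset[OF rV(1)]] rr rY by simp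
        have "\<phi> b1 \<in> rd A W V" using im b1 by blast
        from imageI[OF this, of \<mu>] have "u b1 \<in> rd A E (\<mu> ` V)" using la[OF b1(1)] rY by simp
        then have ub1: "u b1 \<noteq> \<zero>\<^bsub>E\<^esub>" "u b1 \<in> rd A E (\<mu> ` V)" using ker b1 Bc by auto
        \<comment> \<open>\<open>b1\<close> lies in \<open>B\<close> and is not killed by
          \<open>u\<close>, so its image is the nonzero element of the radical of
          \<open>\<mu> V\<close> that the lemma asks for.\<close>
        have Yeq: "\<mu> ` V = u ` carrier P"
          using ker facts(5) Dc facts(3) b1
          by (intro rd_square_zero_image[OF fgE E(2) u _ Ys rrY _ ub1]) auto
        obtain q0 where q0: "q0 \<in> module_hom A P (sub W V)" "\<And>p. p \<in> carrier P \<Longrightarrow> \<mu> (q0 p) = u p"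
        proof (rule projective_lift[OF projP fg_submodule[OF W V] fg_submodule[OF fgE Ys]])
          show "\<mu> \<in> module_hom A (sub W V) (sub E (\<mu> ` V))"
            by (rule hom_into_sub[OF hom_restrict[OF W.lmodule_axioms u.Y.lmodule_axioms V la0(1)]]) simp
          show "u \<in> module_hom A P (sub E (\<mu> ` V))" using Yeq by (intro hom_into_sub[OF u]) simp
        qed simp_all
        have q0W: "q0 \<in> module_hom A P W" by (rule hom_from_into_sub[OF W.lmodule_axioms V q0(1)])
        interpret q0: lhom A P W q0 by (intro lhomI P.lmodule_axioms W.lmodule_axioms q0W)
        have q0V: "q0 p \<in> V" if "p \<in> carrier P" for p using q0(1) that by (simp add: module_hom_iff)
        have q0P: "submodule (q0 ` carrier P) A W" by (rule q0.image_submodule[OF P.lsub_top])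
        define V' where "V' = {x \<in> carrier W. \<mu> x = \<zero>\<^bsub>E\<^esub>} \<inter> V"
        have V's: "submodule V' A W" unfolding V'_def by (rule W.lsub_inter[OF la.kernel_submodule V])
        have V'lt: "V' \<subset> V"
        proof -
          have "\<phi> b1 \<in> V" "\<phi> b1 \<notin> V'" using b1 im rV ub1 la by (auto simp: V'_def)
          then show ?thesis unfolding V'_def by blast
        qed
        have sV: "V = q0 ` carrier P <+>\<^bsub>W\<^esub> V'"
        proof
          show "q0 ` carrier P <+>\<^bsub>W\<^esub> V' \<subseteq> V" using q0V V'lt by (intro W.lsum_least V) auto
          show "V \<subseteq> q0 ` carrier P <+>\<^bsub>W\<^esub> V'"
          proof
            fix v assume v: "v \<in> V"
            then have "\<mu> v \<in> u ` carrier P" unfolding Yeq[symmetric] by simp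
            then obtain p where p: "p \<in> carrier P" "\<mu> v = u p" by blast
            have vc: "v \<in> carrier W" using v Vc by blast
            have "v \<ominus>\<^bsub>W\<^esub> q0 p \<in> V'"
              using p q0(2)[OF p(1)] vc W.lsub_minus[OF V v q0V[OF p(1)]] q0.closed[OF p(1)] by (simp add: V'_def)
            moreover have "v = q0 p \<oplus>\<^bsub>W\<^esub> (v \<ominus>\<^bsub>W\<^esub> q0 p)" using vc q0.closed[OF p(1)] by simp
            ultimately show "v \<in> q0 ` carrier P <+>\<^bsub>W\<^esub> V'" using p(1) unfolding mem_set_add by blast
          qed
        qed
        have rdq: "rd A W (q0 ` carrier P) = q0 ` R" using q0.image_rd[OF subset_refl] rdP by simp
        have rdV: "rd A W V = q0 ` R <+>\<^bsub>W\<^esub> rd A W V'"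
          using W.rd_sum[OF q0P V's] rdq sV by simp
        have rV': "submodule (rd A W V') A W" "rd A W V' \<subseteq> V'"
          using W.rd_submodule[OF W.lsub_subset[OF V's]] W.rd_subset[OF V's] by auto
        have q0R: "q0 ` R \<subseteq> rd A W V"
          using W.lsum_upper1[OF q0.image_submodule[OF R] rV'(1)] rdV by simp
        have q0L: "q0 x = \<zero>\<^bsub>W\<^esub>" if "x \<in> L" for x
        proof -
          have "q0 ` L = rd A W (q0 ` R)" using q0.image_rd[OF P.lsub_subset[OF R]] rdR by simp
          also have "\<dots> \<subseteq> {\<zero>\<^bsub>W\<^esub>}" using W.rd_mono[OF q0R W.lsub_subset[OF rV(1)]] rr by simp
          finally show ?thesis using that by blast
        qed
        have om: "(\<lambda>b. \<phi> b \<ominus>\<^bsub>W\<^esub> q0 b) \<in> module_hom A (sub P B) W"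
          by (rule hom_minus[OF W.lmodule_axioms phi hom_restrict[OF P.lmodule_axioms W.lmodule_axioms facts(1) q0W]])
        \<comment> \<open>The difference lies in the radical of \<open>V\<close>, which is
          \<open>q0 R\<close> plus the radical of \<open>V'\<close>. Both the difference and the
          second part are killed by \<open>\<mu>\<close>, and \<open>\<mu>\<close> after
          \<open>q0\<close> is \<open>u\<close>, so the element of \<open>R\<close> involved lies in
          the kernel \<open>D\<close> of \<open>u\<close>.\<close>
        have dec: "\<exists>d\<in>D. \<exists>w\<in>rd A W V'. \<phi> b \<ominus>\<^bsub>W\<^esub> q0 b = q0 d \<oplus>\<^bsub>W\<^esub> w" if b: "b \<in> B" for b
        proof -
          have bP: "b \<in> carrier P" "b \<in> R" using b Bc facts(3) by auto
          have "\<phi> b \<ominus>\<^bsub>W\<^esub> q0 b \<in> rd A W V" using im q0R b bP by (intro W.lsub_minus[OF rV(1)]) auto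
          then have "\<phi> b \<ominus>\<^bsub>W\<^esub> q0 b \<in> q0 ` R <+>\<^bsub>W\<^esub> rd A W V'" using rdV by simp
          then obtain y w where "y \<in> q0 ` R" and w: "w \<in> rd A W V'" and eq: "\<phi> b \<ominus>\<^bsub>W\<^esub> q0 b = y \<oplus>\<^bsub>W\<^esub> w"
            by (subst (asm) mem_set_add) blast
          then obtain x where "x \<in> R" "y = q0 x" by blast
          with w eq have xw: "x \<in> R" "w \<in> rd A W V'" "\<phi> b \<ominus>\<^bsub>W\<^esub> q0 b = q0 x \<oplus>\<^bsub>W\<^esub> w" by simp_all
          have xP: "x \<in> carrier P" using xw P.lsub_carrier[OF R] by blast
          have w: "w \<in> carrier W" "\<mu> w = \<zero>\<^bsub>E\<^esub>" using xw(2) rV'(2) by (auto simp: V'_def)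
          have "\<mu> (\<phi> b \<ominus>\<^bsub>W\<^esub> q0 b) = \<zero>\<^bsub>E\<^esub>" using la[OF b] q0(2)[OF bP(1)] phi.closed[of b] b bP by simp
          then have "u x = \<zero>\<^bsub>E\<^esub>" using xw(3) q0(2)[OF xP] w xP by simp
          then show ?thesis using ker[OF xP] xw by blast
        qed
        let ?Q = "quot W (rd A W V')" and ?pi = "\<lambda>x. rd A W V' +>\<^bsub>W\<^esub> x"
        have Ql: "lmodule A ?Q" by (rule quot_lmodule[OF W.lmodule_axioms rV'(1)])
        note pi = quot_hom[OF W.lmodule_axioms rV'(1)]
        interpret pi: lhom A W ?Q ?pi by (intro lhomI W.lmodule_axioms Ql pi)
        note pk = quot_kernel[OF W.lmodule_axioms rV'(1)]
        \<comment> \<open>Modulo the radical of \<open>V'\<close> the difference maps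
          \<open>B\<close> into \<open>q0 D\<close>; by \<open>complementary_incomparable\<close> it
          must then be zero.\<close>
        have omV': "\<phi> b \<ominus>\<^bsub>W\<^esub> q0 b \<in> rd A W V'" if b: "b \<in> B" for b
        proof -
          have "?pi (\<phi> b \<ominus>\<^bsub>W\<^esub> q0 b) = \<zero>\<^bsub>?Q\<^esub>"
          proof (rule complementary_incomparable[OF comp Ql hom_comp[OF om pi] hom_comp[OF q0W pi] _ _ b])
            show "?pi (q0 x) = \<zero>\<^bsub>?Q\<^esub>" if "x \<in> L" for x using q0L[OF that] pi.zero by simp
            show "(\<lambda>b. ?pi (\<phi> b \<ominus>\<^bsub>W\<^esub> q0 b)) ` B \<subseteq> (\<lambda>x. ?pi (q0 x)) ` D"
            proof
              fix y assume "y \<in> (\<lambda>b. ?pi (\<phi> b \<ominus>\<^bsub>W\<^esub> q0 b)) ` B"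
              then obtain b where b: "b \<in> B" "y = ?pi (\<phi> b \<ominus>\<^bsub>W\<^esub> q0 b)" by blast
              obtain d w where dw: "d \<in> D" "w \<in> rd A W V'" "\<phi> b \<ominus>\<^bsub>W\<^esub> q0 b = q0 d \<oplus>\<^bsub>W\<^esub> w" using dec[OF b(1)] by blast
              have dc: "d \<in> carrier P" "w \<in> carrier W" using dw Dc W.lsub_carrier[OF rV'(1)] by auto
              have "y = ?pi (q0 d) \<oplus>\<^bsub>?Q\<^esub> ?pi w" using b(2) dw(3) pi.add[of "q0 d" w] dc by simp
              also have "?pi w = \<zero>\<^bsub>?Q\<^esub>" using pk[OF dc(2)] dw(2) by simp
              also have "?pi (q0 d) \<oplus>\<^bsub>?Q\<^esub> \<zero>\<^bsub>?Q\<^esub> = ?pi (q0 d)"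
                using pi.closed[of "q0 d"] dc by (intro pi.Y.M.r_zero) auto
              finally show "y \<in> (\<lambda>x. ?pi (q0 x)) ` D" using dw(1) by blast
            qed
          qed
          moreover have "\<phi> b \<ominus>\<^bsub>W\<^esub> q0 b \<in> carrier W" using om b by (simp add: module_hom_iff)
          ultimately show ?thesis using pk by blast
        qed
        have "rd A W (rd A W V') \<subseteq> rd A W (rd A W V)"
          using V'lt Vc W.lsub_subset[OF rV(1)] by (intro W.rd_mono) auto
        then have rr': "rd A W (rd A W V') = {\<zero>\<^bsub>W\<^esub>}"
          using rr W.lsub_zero[OF W.rd_submodule[OF W.lsub_subset[OF rV'(1)]]] by blast
        obtain q1 where q1: "q1 \<in> module_hom A P W" "q1 ` carrier P \<subseteq> V'" "\<And>b. b \<in> B \<Longrightarrow> q1 b = \<phi> b \<ominus>\<^bsub>W\<^esub> q0 b"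
          using less(3)[OF V's V'lt, rule_format, OF rr' om] omV' by blast
        show ?thesis
        proof (intro bexI[OF _ hom_add[OF W.lmodule_axioms q0W q1(1)]] conjI ballI subsetI)
          fix y assume "y \<in> (\<lambda>x. q0 x \<oplus>\<^bsub>W\<^esub> q1 x) ` carrier P"
          then show "y \<in> V" using q0V q1(2) V'lt W.lsub_add[OF V] by blast
        next
          fix b assume b: "b \<in> B"
          then show "q0 b \<oplus>\<^bsub>W\<^esub> q1 b = \<phi> b" using q1(3) phi.closed[of b] q0.closed[of b] Bc by auto
        qed
      qed
    qed
  qed
  then show ?thesis using V(2) phi by blast
qed

text \<open>This is the form in which uniseriality of \<open>I\<^sub>S\<close> and \<open>I\<^sub>N\<close> is used: the inclusions of \<open>S\<close> and \<open>M\<close> into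
  \<open>P\<close> generate all radical maps out of \<open>S\<close> and \<open>M\<close>.\<close>

lemma extend_radical:
  assumes comp: "complementary B D" and W: "fg_module A W" and X: "submodule X A W"
    and phi: "\<phi> \<in> module_hom A (sub P B) W" "\<phi> ` B \<subseteq> rd A W X"
  shows "\<exists>q\<in>module_hom A P W. q ` carrier P \<subseteq> X \<and> (\<forall>b\<in>B. q b = \<phi> b)"
proof -
  interpret W: lmodule A W by (rule fg_lmodule[OF W])
  note facts = complementary_submodules[OF comp]
  have Bc: "B \<subseteq> carrier P" using P.lsub_subset facts by blast
  have "\<forall>\<phi>. \<phi> \<in> module_hom A (sub P B) W \<longrightarrow> \<phi> ` B \<subseteq> rd A W X \<longrightarrow>
    (\<exists>q\<in>module_hom A P W. q ` carrier P \<subseteq> X \<and> (\<forall>b\<in>B. q b = \<phi> b))"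
    using fg_dcc[OF W] X W.lsub_subset[OF X]
  proof (induction X rule: W.dcc_induct)
    case (less X)
    note X = less(1)
    show ?case
    proof (intro allI impI)
      fix \<phi> assume phi: "\<phi> \<in> module_hom A (sub P B) W" and im: "\<phi> ` B \<subseteq> rd A W X"
      interpret phi: lhom A "sub P B" W \<phi> by (intro lhomI P.sub_lmodule facts W.lmodule_axioms phi)
      note Xc = W.lsub_subset[OF X]
      have rX: "submodule (rd A W X) A W" "rd A W X \<subseteq> X" using W.rd_submodule[OF Xc] W.rd_subset[OF X] by auto
      show "\<exists>q\<in>module_hom A P W. q ` carrier P \<subseteq> X \<and> (\<forall>b\<in>B. q b = \<phi> b)"
      proof (cases "X = {\<zero>\<^bsub>W\<^esub>}")
        case True
        have "\<zero>\<^bsub>W\<^esub> = \<phi> b" if "b \<in> B" for b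
        proof -
          have "\<phi> b \<in> X" using im rX(2) that by blast
          then show ?thesis using True by simp
        qed
        then have "\<forall>b\<in>B. \<zero>\<^bsub>W\<^esub> = \<phi> b" by simp
        then show ?thesis using W.lsub_zero[OF X] by (intro bexI[OF _ hom_zero[OF W.lmodule_axioms]]) auto
      next
        case False
        then have lt: "rd A W X \<subset> X" using rd_proper[OF W X] rX(2) by blast
        \<comment> \<open>Modulo \<open>N\<close> the image of \<open>X\<close> has zero second
          radical, so \<open>extend_step\<close> applies. The map it gives is lifted to
          \<open>W\<close>, and the error lands in the radical of \<open>rd A W X\<close>, where the
          induction hypothesis takes over.\<close>
        define N where "N = rd A W (rd A W X)"
        have N: "submodule N A W" "N \<subseteq> rd A W X"
          using W.rd_submodule[OF W.lsub_subset[OF rX(1)]] W.rd_subset[OF rX(1)] by (auto simp: N_def)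
        let ?Q = "quot W N" and ?pi = "\<lambda>x. N +>\<^bsub>W\<^esub> x"
        have fgQ: "fg_module A ?Q" by (rule fg_quot[OF W N(1)])
        note pi = quot_hom[OF W.lmodule_axioms N(1)]
        interpret pi: lhom A W ?Q ?pi by (intro lhomI W.lmodule_axioms fg_lmodule fgQ pi)
        note pk = quot_kernel[OF W.lmodule_axioms N(1)]
        have Xs: "submodule (?pi ` X) A ?Q" by (rule pi.image_submodule[OF X])
        have r1: "rd A ?Q (?pi ` X) = ?pi ` rd A W X" using pi.image_rd[OF Xc] by simp
        have "?pi ` N = {\<zero>\<^bsub>?Q\<^esub>}"
        proof -
          have "?pi x = \<zero>\<^bsub>?Q\<^esub>" if "x \<in> N" for x using pk[of x] that W.lsub_carrier[OF N(1)] by blast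
          then show ?thesis using W.lsub_zero[OF N(1)] by blast
        qed
        then have r2: "rd A ?Q (rd A ?Q (?pi ` X)) = {\<zero>\<^bsub>?Q\<^esub>}"
          using pi.image_rd[OF W.lsub_subset[OF rX(1)]] r1 by (simp add: N_def)
        have "(\<lambda>b. ?pi (\<phi> b)) ` B \<subseteq> rd A ?Q (?pi ` X)" using im unfolding r1 by blast
        from extend_step[OF comp fgQ Xs r2 hom_comp[OF phi pi] this]
        obtain q' where q'0: "q' \<in> module_hom A P ?Q" "q' ` carrier P \<subseteq> ?pi ` X \<and> (\<forall>b\<in>B. q' b = ?pi (\<phi> b))"
          by (rule bexE)
        note q' = q'0(1) conjunct1[OF q'0(2)] bspec[OF conjunct2[OF q'0(2)]]
        obtain q where q: "q \<in> module_hom A P W" "\<And>p. p \<in> carrier P \<Longrightarrow> ?pi (q p) = q' p"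
          by (rule projective_lift[OF projP W fgQ pi _ q'(1)]) simp_all
        interpret q: lhom A P W q by (intro lhomI P.lmodule_axioms W.lmodule_axioms q)
        have qX: "q p \<in> X" if p: "p \<in> carrier P" for p
        proof -
          have "q' p \<in> ?pi ` X" using q'(2) p by blast
          then obtain x where "x \<in> X" "q' p = ?pi x" by (rule imageE)
          then have x: "x \<in> X" "?pi (q p) = ?pi x" using q(2)[OF p] by simp_all
          then have "q p \<ominus>\<^bsub>W\<^esub> x \<in> N" using coset_eq_iff[OF W.lmodule_axioms N(1)] p Xc by auto
          then have "(q p \<ominus>\<^bsub>W\<^esub> x) \<oplus>\<^bsub>W\<^esub> x \<in> X" using x N(2) rX(2) by (intro W.lsub_add[OF X]) auto
          then show ?thesis using p x Xc by auto
        qed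
        have om: "(\<lambda>b. \<phi> b \<ominus>\<^bsub>W\<^esub> q b) \<in> module_hom A (sub P B) W"
          by (rule hom_minus[OF W.lmodule_axioms phi hom_restrict[OF P.lmodule_axioms W.lmodule_axioms facts(1) q(1)]])
        have "(\<lambda>b. \<phi> b \<ominus>\<^bsub>W\<^esub> q b) ` B \<subseteq> rd A W (rd A W X)"
        proof
          fix y assume "y \<in> (\<lambda>b. \<phi> b \<ominus>\<^bsub>W\<^esub> q b) ` B"
          then obtain b where b: "b \<in> B" "y = \<phi> b \<ominus>\<^bsub>W\<^esub> q b" by blast
          then have "?pi (\<phi> b) = ?pi (q b)" using q'(3) q(2) Bc by auto
          then show "y \<in> rd A W (rd A W X)"
            using coset_eq_iff[OF W.lmodule_axioms N(1), of "\<phi> b" "q b"] phi.closed[of b] q.closed[of b] b Bc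
            by (auto simp: N_def)
        qed
        then obtain q1 where q1: "q1 \<in> module_hom A P W" "q1 ` carrier P \<subseteq> rd A W X" "\<And>b. b \<in> B \<Longrightarrow> q1 b = \<phi> b \<ominus>\<^bsub>W\<^esub> q b"
          using less(3)[OF rX(1) lt, rule_format, OF om] by blast
        show ?thesis
        proof (intro bexI[OF _ hom_add[OF W.lmodule_axioms q(1) q1(1)]] conjI ballI subsetI)
          fix y assume "y \<in> (\<lambda>x. q x \<oplus>\<^bsub>W\<^esub> q1 x) ` carrier P"
          then show "y \<in> X" using qX q1(2) rX(2) W.lsub_add[OF X] by blast
        next
          fix b assume b: "b \<in> B"
          then show "q b \<oplus>\<^bsub>W\<^esub> q1 b = \<phi> b" using q1(3) phi.closed[of b] q.closed[of b] Bc by auto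
        qed
      qed
    qed
  qed
  then show ?thesis using phi by blast
qed

end

section \<open>Correcting radical maps so that they vanish on M\<close>

context biserial_projective
begin

text \<open>This is where the bound on the lengths and the biserial condition enter. If \<open>r\<close> vanishes neither on \<open>S\<close>
  nor on \<open>M\<close>, the bound forces \<open>r(P) = rad Y\<close>. As \<open>r(P)\<close> is local and \<open>Y\<close> is uniserial or biserial, \<open>rad Y\<close>
  is uniserial, hence \<open>r(S) = r(L)\<close>, and \<open>r\<close> can be composed with an endomorphism of \<open>P\<close> that kills \<open>M\<close>
  and maps \<open>S\<close> onto \<open>L\<close>.\<close>

lemma kill_M_projective:
  fixes Y :: "'a fgmod"
  assumes prY: "projective_module A Y" and inY: "indecomposable A Y"
    and r: "r \<in> module_hom A P Y" "r ` carrier P \<subseteq> rd A Y (carrier Y)"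
  shows "\<exists>t\<in>module_hom A P Y. (\<forall>s\<in>S. t s = r s) \<and> (\<forall>m\<in>M. t m = \<zero>\<^bsub>Y\<^esub>)"
proof -
  have fgY: "fg_module A Y" using prY by (simp add: projective_module_def)
  interpret r: lhom A P Y r by (intro lhomI P.lmodule_axioms fg_lmodule fgY r)
  note Yl = r.Y.lmodule_axioms
  note c = P.lsub_carrier[OF S] P.lsub_carrier[OF M] P.lsub_carrier[OF Lsub]
  note rS = hom_restrict[OF P.lmodule_axioms Yl S r(1)] and rM = hom_restrict[OF P.lmodule_axioms Yl M r(1)]
  consider "\<forall>s\<in>S. r s = \<zero>\<^bsub>Y\<^esub>" | "\<forall>m\<in>M. r m = \<zero>\<^bsub>Y\<^esub>"
    | "\<exists>s\<in>S. r s \<noteq> \<zero>\<^bsub>Y\<^esub>" "\<exists>m\<in>M. r m \<noteq> \<zero>\<^bsub>Y\<^esub>" by blast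
  then show ?thesis
  proof cases
    case 1
    then show ?thesis by (intro bexI[OF _ hom_zero[OF Yl]]) simp
  next
    case 2
    then show ?thesis by (intro bexI[OF _ r(1)]) simp
  next
    case 3
    then obtain s0 m0 where s0: "s0 \<in> S" "r s0 \<noteq> \<zero>\<^bsub>Y\<^esub>" and m0: "m0 \<in> M" "r m0 \<noteq> \<zero>\<^bsub>Y\<^esub>" by blast
    let ?J = "rd A Y (carrier Y)"
    have J: "submodule ?J A Y" by (rule r.Y.rd_submodule[OF subset_refl])
    note iS = r.image_submodule[OF S] and iM = r.image_submodule[OF M]
      and iR = r.image_submodule[OF R] and iP = r.image_submodule[OF P.lsub_top]
    have nMS: "\<not> r ` M \<subseteq> r ` S"
      using S_M_incomparable[OF Yl rM rS _ m0(1)] m0(2) by blast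
    have nPR: "\<not> r ` carrier P \<subseteq> r ` R"
      by (rule image_not_radical[OF fgY r(1) subsetD[OF S_le_R s0(1)] s0(2)])
    have Jlt: "?J \<subset> carrier Y"
    proof -
      have "carrier Y \<noteq> {\<zero>\<^bsub>Y\<^esub>}" using inY by (simp add: indecomposable_def)
      then show ?thesis using rd_proper[OF fgY r.Y.lsub_top] r.Y.lsub_subset[OF J] by blast
    qed
    \<comment> \<open>The chain from zero through \<open>r S\<close>, \<open>r R\<close> to
      \<open>r P\<close> has three strict steps, and the radical of \<open>Y\<close> is proper; with
      length at most four there is no room between \<open>r P\<close>, the radical of
      \<open>Y\<close> and \<open>Y\<close>.\<close>
    have c1: "{\<zero>\<^bsub>Y\<^esub>} \<subset> r ` S" using r.Y.lsub_zero[OF iS] s0 by blast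
    have c2: "r ` S \<subset> r ` R" using S_le_R M_le_R nMS by blast
    have c3: "r ` R \<subset> r ` carrier P" using P.lsub_subset[OF R] nPR by blast
    obtain n where n: "has_length A Y n" "n \<le> 4" using indec[OF prY inY] by blast
    have max: "D = ?J \<or> D = carrier Y" and Jeq: "?J = r ` carrier P" if D: "submodule D A Y" "?J \<subseteq> D" for D
    proof -
      have "?J = r ` carrier P \<and> (D = ?J \<or> D = carrier Y)"
      proof (rule length_rank[OF n(1)])
        fix l :: "(nat \<Rightarrow> 'a) set set \<Rightarrow> nat"
        assume l: "\<And>C D. submodule C A Y \<Longrightarrow> submodule D A Y \<Longrightarrow> C \<subset> D \<Longrightarrow> l C < l D" and b: "\<And>D. l D \<le> n"
        have l3: "3 \<le> l (r ` carrier P)"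
          using l[OF r.Y.lsub_bot iS c1] l[OF iS iR c2] l[OF iR iP c3] by simp
        have l4: "l (carrier Y) \<le> 4" using b[of "carrier Y"] n(2) by simp
        have "?J = r ` carrier P"
        proof (rule ccontr)
          assume "?J \<noteq> r ` carrier P"
          then have "r ` carrier P \<subset> ?J" using r(2) by blast
          then show False using l[OF iP J] l[OF J r.Y.lsub_top Jlt] l3 l4 by simp
        qed
        moreover have "D = ?J \<or> D = carrier Y"
        proof (rule ccontr)
          assume "\<not> (D = ?J \<or> D = carrier Y)"
          then have "?J \<subset> D" "D \<subset> carrier Y" using D r.Y.lsub_subset[OF D(1)] by blast+
          then show False using l[OF J D(1)] l[OF D(1) r.Y.lsub_top] l3 l4 calculation by simp
        qed
        ultimately show ?thesis by blast
      qed
      then show "D = ?J \<or> D = carrier Y" "?J = r ` carrier P" by blast+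
    qed
    have JP: "?J = r ` carrier P" by (rule Jeq[OF J subset_refl])
    \<comment> \<open>Nothing lies strictly between the radical and \<open>Y\<close>, so by
      Nakayama's lemma the radical is the largest proper submodule.\<close>
    have properJ: "X \<subseteq> ?J" if X: "submodule X A Y" "X \<noteq> carrier Y" for X
    proof -
      have s: "submodule (X <+>\<^bsub>Y\<^esub> ?J) A Y" by (rule r.Y.lsub_sum[OF X(1) J])
      have "X <+>\<^bsub>Y\<^esub> ?J \<noteq> carrier Y" using nakayama[OF fgY X(1)] X(2) by blast
      then have "X <+>\<^bsub>Y\<^esub> ?J = ?J" using max[OF s r.Y.lsum_upper2[OF X(1) J]] by blast
      then show ?thesis using r.Y.lsum_upper1[OF X(1) J] by blast
    qed
    have comp: "r ` S \<subseteq> r ` M \<or> r ` M \<subseteq> r ` S" if U: "submodule U A Y" "r ` carrier P \<subseteq> U" "uniserial A (sub Y U)" for U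
    proof -
      have "r ` S \<subseteq> U" "r ` M \<subseteq> U" using U(2) c by blast+
      then have "submodule (r ` S) A (sub Y U)" "submodule (r ` M) A (sub Y U)"
        using iS iM by (simp_all add: submodule_sub_iff[OF Yl U(1)])
      then show ?thesis using U(3) unfolding uniserial_def by blast
    qed
    have "r ` S \<subseteq> r ` M \<or> r ` M \<subseteq> r ` S"
    proof (cases "uniserial A Y")
      case True
      then show ?thesis using comp[OF r.Y.lsub_top] r.Y.lsub_subset[OF iP] by simp
    next
      case False
      then have "biserial_module A Y" using indec[OF prY inY] by blast
      then obtain X1 X2 where X: "submodule X1 A Y" "submodule X2 A Y"
        "uniserial A (sub Y X1)" "uniserial A (sub Y X2)" "\<not> X1 \<subseteq> X2" "\<not> X2 \<subseteq> X1"
        and sum: "X1 <+>\<^bsub>Y\<^esub> X2 = carrier Y \<or> (submodule (X1 <+>\<^bsub>Y\<^esub> X2) A Y \<and> X1 <+>\<^bsub>Y\<^esub> X2 \<noteq> carrier Y \<and>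
          (\<forall>N. submodule N A Y \<longrightarrow> N \<noteq> carrier Y \<longrightarrow> N \<subseteq> X1 <+>\<^bsub>Y\<^esub> X2))"
        unfolding biserial_module_def by (elim conjE exE) (rule that; assumption)
      have ne: "X1 \<noteq> carrier Y" "X2 \<noteq> carrier Y"
        using X(5,6) r.Y.lsub_subset[OF X(1)] r.Y.lsub_subset[OF X(2)] by auto
      note le = properJ[OF X(1) ne(1)] properJ[OF X(2) ne(2)]
      have sJ: "X1 <+>\<^bsub>Y\<^esub> X2 \<subseteq> ?J" by (intro r.Y.lsum_least J le)
      have "X1 <+>\<^bsub>Y\<^esub> X2 \<noteq> carrier Y" using sJ Jlt by auto
      with sum J Jlt have "?J \<subseteq> X1 <+>\<^bsub>Y\<^esub> X2" by (metis psubset_eq)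
      then have eq: "X1 <+>\<^bsub>Y\<^esub> X2 = r ` carrier P" using sJ JP by simp
      \<comment> \<open>\<open>r P\<close> is local with radical \<open>r R\<close>: a submodule of
        it that is not inside \<open>r R\<close> has a preimage not inside \<open>R\<close> and is
        therefore everything. One of \<open>X1\<close> and \<open>X2\<close> is of this kind,
        because their sum is \<open>r P\<close>.\<close>
      have big: "r ` carrier P \<subseteq> X" if Xi: "submodule X A Y" "X \<subseteq> ?J" "\<not> X \<subseteq> r ` R" for X
      proof -
        let ?C = "{p \<in> carrier P. r p \<in> X}"
        have XC: "X \<subseteq> r ` ?C"
        proof
          fix x assume x: "x \<in> X"
          then have "x \<in> r ` carrier P" using Xi(2) JP by auto
          then obtain p where "p \<in> carrier P" "x = r p" by (rule imageE)
          then show "x \<in> r ` ?C" using x by auto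
        qed
        have "?C = carrier P"
        proof (rule ccontr)
          assume "?C \<noteq> carrier P"
          then have "?C \<subseteq> R" by (rule local[OF r.preimage_submodule[OF Xi(1)]])
          then have "X \<subseteq> r ` R" using XC by (meson image_mono order_trans)
          then show False using Xi(3) by simp
        qed
        from equalityD2[OF this] show ?thesis by auto
      qed
      have "\<not> (X1 \<subseteq> r ` R \<and> X2 \<subseteq> r ` R)"
      proof
        assume "X1 \<subseteq> r ` R \<and> X2 \<subseteq> r ` R"
        then have "X1 <+>\<^bsub>Y\<^esub> X2 \<subseteq> r ` R" by (intro r.Y.lsum_least iR) auto
        then show False using eq nPR by simp
      qed
      then consider "\<not> X1 \<subseteq> r ` R" | "\<not> X2 \<subseteq> r ` R" by blast
      then show ?thesis
      proof cases
        case 1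
        show ?thesis by (rule comp[OF X(1) big[OF X(1) le(1) 1] X(3)])
      next
        case 2
        show ?thesis by (rule comp[OF X(2) big[OF X(2) le(2) 2] X(4)])
      qed
    qed
    then have rSM: "r ` S \<subseteq> r ` M" using nMS by blast
    \<comment> \<open>\<open>r S\<close> is a nonzero proper part of \<open>r M\<close>, so its
      preimage in \<open>M\<close> can only be the middle submodule \<open>L\<close>.\<close>
    have L_sub: "{m \<in> M. r m \<in> r ` S} = L"
    proof -
      let ?N = "{m \<in> M. r m \<in> r ` S}"
      have "?N = M \<inter> {p \<in> carrier P. r p \<in> r ` S}" using c by blast
      then have N: "submodule ?N A P" using P.lsub_inter[OF M r.preimage_submodule[OF iS]] by simp
      have "?N \<noteq> M"
      proof
        assume "?N = M"
        from equalityD2[OF this] have "r ` M \<subseteq> r ` S" by auto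
        then show False using nMS by simp
      qed
      moreover have "?N \<noteq> {\<zero>\<^bsub>P\<^esub>}"
      proof
        assume e: "?N = {\<zero>\<^bsub>P\<^esub>}"
        obtain m where "m \<in> M" "r s0 = r m" using rSM s0(1) by blast
        then have "m \<in> ?N" using s0(1) by auto
        from subsetD[OF equalityD1[OF e] this] have "m = \<zero>\<^bsub>P\<^esub>" by simp
        then show False using \<open>r s0 = r m\<close> s0(2) by simp
      qed
      moreover have le: "?N \<subseteq> M" by auto
      ultimately show ?thesis using subM[OF N le] by metis
    qed
    \<comment> \<open>\<open>r\<close> is injective on \<open>M\<close>: a kernel equal to
      \<open>M\<close> is excluded by \<open>m0\<close>, and a kernel equal to \<open>L\<close>
      would make \<open>r\<close> vanish on \<open>S\<close> by
      \<open>M_S_incomparable\<close>.\<close>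
    have rL: "x = \<zero>\<^bsub>P\<^esub>" if x: "x \<in> M" "r x = \<zero>\<^bsub>Y\<^esub>" for x
    proof -
      let ?N = "{m \<in> M. r m = \<zero>\<^bsub>Y\<^esub>}"
      have "?N = M \<inter> {p \<in> carrier P. r p = \<zero>\<^bsub>Y\<^esub>}" using c by blast
      then have N: "submodule ?N A P" using P.lsub_inter[OF M r.kernel_submodule] by simp
      have "?N \<noteq> M"
      proof
        assume "?N = M"
        from subsetD[OF equalityD2[OF this] m0(1)] show False using m0(2) by simp
      qed
      moreover have "?N \<noteq> L"
      proof
        assume e: "?N = L"
        have "r s0 = \<zero>\<^bsub>Y\<^esub>"
        proof (rule M_S_incomparable[OF Yl rM rS rSM _ s0(1)])
          show "r x = \<zero>\<^bsub>Y\<^esub>" if "x \<in> L" for x using subsetD[OF equalityD2[OF e] that] by simp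
        qed
        then show False using s0(2) by simp
      qed
      moreover have le: "?N \<subseteq> M" by auto
      ultimately have e: "?N = {\<zero>\<^bsub>P\<^esub>}" using subM[OF N le] by metis
      show ?thesis using subsetD[OF equalityD1[OF e], of x] x by simp
    qed
    note Ml = P.sub_lmodule[OF M]
    let ?I = "sub Y (r ` M)"
    interpret rm: lhom A "sub P M" Y r by (intro lhomI Ml Yl rM)
    have "inj_on r M" using rm.inj_iff rL by simp
    then have b: "r \<in> module_hom A (sub P M) ?I" "bij_betw r (carrier (sub P M)) (carrier ?I)"
      by (simp_all add: bij_betw_def hom_into_sub[OF rM])
    obtain i where i: "i \<in> module_hom A ?I (sub P M)" "\<And>m. m \<in> M \<Longrightarrow> i (r m) = m"
      by (rule hom_inverse[OF Ml r.Y.sub_lmodule[OF iM] b]) simp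
    have rSI: "r \<in> module_hom A (sub P S) ?I" using rSM by (intro hom_into_sub[OF rS]) simp
    \<comment> \<open>\<open>\<theta>\<close> maps \<open>S\<close> to \<open>L\<close> through the
      inverse of \<open>r\<close> on \<open>M\<close>, so \<open>r\<close> after
      \<open>\<theta>\<close> is \<open>r\<close> on \<open>S\<close>. As \<open>L\<close> is the
      radical of \<open>M\<close>, it extends to a map \<open>q\<close> from \<open>P\<close> to
      \<open>M\<close>.\<close>
    define \<theta> where "\<theta> = (\<lambda>s. i (r s))"
    have th: "\<theta> \<in> module_hom A (sub P S) P"
      unfolding \<theta>_def by (rule hom_from_into_sub[OF P.lmodule_axioms M hom_comp[OF rSI i(1)]])
    have th_L: "\<theta> s \<in> L" and r_th: "r (\<theta> s) = r s" if s: "s \<in> S" for s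
    proof -
      have "r s \<in> r ` M" using rSM s by blast
      then obtain m where m: "m \<in> M" "r s = r m" by (rule imageE)
      then have e: "\<theta> s = m" using i(2) by (simp add: \<theta>_def)
      have "m \<in> {m \<in> M. r m \<in> r ` S}" using m s by auto
      then show "\<theta> s \<in> L" "r (\<theta> s) = r s" unfolding L_sub using e m by simp_all
    qed
    have cSM: "complementary S M" by (simp add: complementary_def)
    have "\<theta> ` S \<subseteq> rd A P M" using th_L by blast
    from extend_radical[OF cSM fgP M th this]
    obtain q where q0: "q \<in> module_hom A P P" "q ` carrier P \<subseteq> M \<and> (\<forall>s\<in>S. q s = \<theta> s)" by (rule bexE)
    note q = q0(1) conjunct1[OF q0(2)] bspec[OF conjunct2[OF q0(2)]]
    interpret q: lhom A P P q by (intro lhomI P.lmodule_axioms q)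
    have qR: "q ` R \<subseteq> L"
    proof -
      have "q ` R = rd A P (q ` carrier P)" using q.image_rd[OF subset_refl] rdP by simp
      also have "\<dots> \<subseteq> L" by (rule P.rd_mono[OF q(2) P.lsub_subset[OF M]])
      finally show ?thesis .
    qed
    have qL: "q x = \<zero>\<^bsub>P\<^esub>" if "x \<in> L" for x
    proof -
      have "q ` L = rd A P (q ` R)" using q.image_rd[OF P.lsub_subset[OF R]] rdR by simp
      also have "\<dots> \<subseteq> {\<zero>\<^bsub>P\<^esub>}" using P.rd_mono[OF qR P.lsub_subset[OF Lsub]] rdL by simp
      finally show ?thesis using that by blast
    qed
    have thS: "q ` S = L"
    proof -
      have "q ` S \<subseteq> L" using qR S_le_R by blast
      moreover have "q ` S \<noteq> {\<zero>\<^bsub>P\<^esub>}"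
      proof
        assume e: "q ` S = {\<zero>\<^bsub>P\<^esub>}"
        from imageI[OF s0(1), of q] have "\<theta> s0 = \<zero>\<^bsub>P\<^esub>" unfolding e q(3)[OF s0(1)] by simp
        then show False using r_th[OF s0(1)] s0(2) by simp
      qed
      moreover have "{\<zero>\<^bsub>P\<^esub>} \<subseteq> q ` S" using P.lsub_zero[OF q.image_submodule[OF S]] by simp
      ultimately show ?thesis
        using simpleL q.image_submodule[OF S] unfolding covered_def by metis
    qed
    \<comment> \<open>\<open>q\<close> sends \<open>R\<close> into \<open>L\<close> and
      \<open>S\<close> onto \<open>L\<close>, so the image of \<open>M\<close> lies in that of
      \<open>S\<close>, which forces it to be zero. The map sought is \<open>r\<close> after
      \<open>q\<close>.\<close>
    have qM: "q m = \<zero>\<^bsub>P\<^esub>" if m: "m \<in> M" for m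
      by (rule S_M_incomparable[OF P.lmodule_axioms hom_restrict[OF P.lmodule_axioms P.lmodule_axioms M q(1)]
            hom_restrict[OF P.lmodule_axioms P.lmodule_axioms S q(1)] _ m]) (use thS qR M_le_R in blast)
    show ?thesis
      using q(3) r_th qM by (intro bexI[OF _ hom_comp[OF q(1) r(1)]]) simp
  qed
qed

text \<open>Induction over the images of indecomposable projectives that add up to \<open>W\<close>,
  for maps into the radical of a submodule. For an image of \<open>Y\<close> the map lifts to the
  radical of \<open>Y\<close>; for a sum it can be decomposed, since the radical of a sum is the sum
  of the radicals and \<open>P\<close> is projective.\<close>

lemma kill_M:
  assumes W: "fg_module A W" and r: "r \<in> module_hom A P W" "r ` carrier P \<subseteq> rd A W (carrier W)"
  shows "\<exists>t\<in>module_hom A P W. (\<forall>s\<in>S. t s = r s) \<and> (\<forall>m\<in>M. t m = \<zero>\<^bsub>W\<^esub>)"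
proof -
  interpret W: lmodule A W by (rule fg_lmodule[OF W])
  have "\<forall>r. r \<in> module_hom A P W \<longrightarrow> r ` carrier P \<subseteq> rd A W (carrier W) \<longrightarrow>
    (\<exists>t\<in>module_hom A P W. (\<forall>s\<in>S. t s = r s) \<and> (\<forall>m\<in>M. t m = \<zero>\<^bsub>W\<^esub>))"
  proof (rule module_induct[OF W, where Q = "\<lambda>V. \<forall>r. r \<in> module_hom A P W \<longrightarrow> r ` carrier P \<subseteq> rd A W V \<longrightarrow>
    (\<exists>t\<in>module_hom A P W. (\<forall>s\<in>S. t s = r s) \<and> (\<forall>m\<in>M. t m = \<zero>\<^bsub>W\<^esub>))"])
    show "\<forall>r. r \<in> module_hom A P W \<longrightarrow> r ` carrier P \<subseteq> rd A W {\<zero>\<^bsub>W\<^esub>} \<longrightarrow>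
      (\<exists>t\<in>module_hom A P W. (\<forall>s\<in>S. t s = r s) \<and> (\<forall>m\<in>M. t m = \<zero>\<^bsub>W\<^esub>))"
    proof (intro allI impI)
      fix r assume r: "r \<in> module_hom A P W" "r ` carrier P \<subseteq> rd A W {\<zero>\<^bsub>W\<^esub>}"
      have "r p = \<zero>\<^bsub>W\<^esub>" if "p \<in> carrier P" for p
        using r(2) W.rd_subset[OF W.lsub_bot] that by blast
      then show "\<exists>t\<in>module_hom A P W. (\<forall>s\<in>S. t s = r s) \<and> (\<forall>m\<in>M. t m = \<zero>\<^bsub>W\<^esub>)"
        using P.lsub_carrier[OF M] by (intro bexI[OF _ r(1)]) simp
    qed
  next
    fix Y :: "'a fgmod" and f
    assume prY: "projective_module A Y" and inY: "indecomposable A Y" and f: "f \<in> module_hom A Y W"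
    have fgY: "fg_module A Y" using prY by (simp add: projective_module_def)
    interpret f: lhom A Y W f by (intro lhomI W.lmodule_axioms fg_lmodule fgY f)
    show "\<forall>r. r \<in> module_hom A P W \<longrightarrow> r ` carrier P \<subseteq> rd A W (f ` carrier Y) \<longrightarrow>
      (\<exists>t\<in>module_hom A P W. (\<forall>s\<in>S. t s = r s) \<and> (\<forall>m\<in>M. t m = \<zero>\<^bsub>W\<^esub>))"
    proof (intro allI impI)
      fix r assume r: "r \<in> module_hom A P W" "r ` carrier P \<subseteq> rd A W (f ` carrier Y)"
      let ?J = "rd A Y (carrier Y)"
      have J: "submodule ?J A Y" by (rule f.X.rd_submodule[OF subset_refl])
      have eq: "f ` ?J = rd A W (f ` carrier Y)" by (rule f.image_rd[OF subset_refl])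
      have fJ: "submodule (f ` ?J) A W" by (rule f.image_submodule[OF J])
      obtain r' where r': "r' \<in> module_hom A P (sub Y ?J)" "\<And>p. p \<in> carrier P \<Longrightarrow> f (r' p) = r p"
      proof (rule projective_lift[OF projP fg_submodule[OF fgY J] fg_submodule[OF W fJ]])
        show "f \<in> module_hom A (sub Y ?J) (sub W (f ` ?J))"
          by (rule hom_into_sub[OF hom_restrict[OF f.X.lmodule_axioms W.lmodule_axioms J f]]) simp
        show "r \<in> module_hom A P (sub W (f ` ?J))" using r(2) eq by (intro hom_into_sub[OF r(1)]) simp
      qed simp_all
      have r'Y: "r' \<in> module_hom A P Y" by (rule hom_from_into_sub[OF f.X.lmodule_axioms J r'(1)])
      have "r' ` carrier P \<subseteq> ?J" using r'(1) by (auto simp: module_hom_iff)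
      from kill_M_projective[OF prY inY r'Y this]
      obtain t where t0: "t \<in> module_hom A P Y" "(\<forall>s\<in>S. t s = r' s) \<and> (\<forall>m\<in>M. t m = \<zero>\<^bsub>Y\<^esub>)" by (rule bexE)
      then show "\<exists>t\<in>module_hom A P W. (\<forall>s\<in>S. t s = r s) \<and> (\<forall>m\<in>M. t m = \<zero>\<^bsub>W\<^esub>)"
        using r'(2) P.lsub_carrier[OF S] by (intro bexI[OF _ hom_comp[OF t0(1) f]]) simp
    qed
  next
    fix X Y assume X: "submodule X A W" and Y: "submodule Y A W"
      and QX: "\<forall>r. r \<in> module_hom A P W \<longrightarrow> r ` carrier P \<subseteq> rd A W X \<longrightarrow>
        (\<exists>t\<in>module_hom A P W. (\<forall>s\<in>S. t s = r s) \<and> (\<forall>m\<in>M. t m = \<zero>\<^bsub>W\<^esub>))"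
      and QY: "\<forall>r. r \<in> module_hom A P W \<longrightarrow> r ` carrier P \<subseteq> rd A W Y \<longrightarrow>
        (\<exists>t\<in>module_hom A P W. (\<forall>s\<in>S. t s = r s) \<and> (\<forall>m\<in>M. t m = \<zero>\<^bsub>W\<^esub>))"
    show "\<forall>r. r \<in> module_hom A P W \<longrightarrow> r ` carrier P \<subseteq> rd A W (X <+>\<^bsub>W\<^esub> Y) \<longrightarrow>
        (\<exists>t\<in>module_hom A P W. (\<forall>s\<in>S. t s = r s) \<and> (\<forall>m\<in>M. t m = \<zero>\<^bsub>W\<^esub>))"
    proof (intro allI impI)
      fix r assume r: "r \<in> module_hom A P W" "r ` carrier P \<subseteq> rd A W (X <+>\<^bsub>W\<^esub> Y)"
      have s: "submodule (rd A W X) A W" "submodule (rd A W Y) A W"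
        using X Y by (simp_all add: W.rd_submodule W.lsub_subset)
      note ss = W.lsub_sum[OF s]
      note l = W.sub_lmodule[OF s(1)] W.sub_lmodule[OF s(2)]
      let ?D = "dsum (sub W (rd A W X)) (sub W (rd A W Y))"
      have fgD: "fg_module A ?D" by (intro fg_dsum fg_submodule W s)
      have D: "lmodule A ?D" by (rule fg_lmodule[OF fgD])
      note f1 = hom_from_into_sub[OF W.lmodule_axioms s(1) dsum_homs(1)[OF l]]
      note f2 = hom_from_into_sub[OF W.lmodule_axioms s(2) dsum_homs(2)[OF l]]
      note p = hom_add[OF W.lmodule_axioms f1 f2]
      have po: "(\<lambda>z. fst z \<oplus>\<^bsub>W\<^esub> snd z) ` carrier ?D = rd A W X <+>\<^bsub>W\<^esub> rd A W Y"
        by (auto simp: mem_set_add image_iff) blast+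
      have p': "(\<lambda>z. fst z \<oplus>\<^bsub>W\<^esub> snd z) \<in> module_hom A ?D (sub W (rd A W X <+>\<^bsub>W\<^esub> rd A W Y))"
        using po by (intro hom_into_sub p) simp
      have rr: "r \<in> module_hom A P (sub W (rd A W X <+>\<^bsub>W\<^esub> rd A W Y))"
        using r(2) W.rd_sum[OF X Y] by (intro hom_into_sub r) simp
      have po': "(\<lambda>z. fst z \<oplus>\<^bsub>W\<^esub> snd z) ` carrier ?D = carrier (sub W (rd A W X <+>\<^bsub>W\<^esub> rd A W Y))"
        using po by simp
      obtain t where t: "t \<in> module_hom A P ?D" "\<And>x. x \<in> carrier P \<Longrightarrow> fst (t x) \<oplus>\<^bsub>W\<^esub> snd (t x) = r x"
        by (rule projective_lift[OF projP fgD fg_submodule[OF W ss] p' po' rr]) simp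
      have tc: "t x \<in> rd A W X \<times> rd A W Y" if "x \<in> carrier P" for x
        using t(1) that by (simp add: module_hom_iff)
      note t1 = hom_comp[OF t(1) f1] and t2 = hom_comp[OF t(1) f2]
      have i1: "(\<lambda>x. fst (t x)) ` carrier P \<subseteq> rd A W X" and i2: "(\<lambda>x. snd (t x)) ` carrier P \<subseteq> rd A W Y"
        using tc by (force simp: mem_Times_iff)+
      obtain a where a: "a \<in> module_hom A P W" "(\<forall>s\<in>S. a s = fst (t s)) \<and> (\<forall>m\<in>M. a m = \<zero>\<^bsub>W\<^esub>)"
        using QX[rule_format, OF t1 i1] by (rule bexE)
      obtain b where b: "b \<in> module_hom A P W" "(\<forall>s\<in>S. b s = snd (t s)) \<and> (\<forall>m\<in>M. b m = \<zero>\<^bsub>W\<^esub>)"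
        using QY[rule_format, OF t2 i2] by (rule bexE)
      from a b show "\<exists>t\<in>module_hom A P W. (\<forall>s\<in>S. t s = r s) \<and> (\<forall>m\<in>M. t m = \<zero>\<^bsub>W\<^esub>)"
        using t(2) P.lsub_carrier[OF S] by (intro bexI[OF _ hom_add[OF W.lmodule_axioms a(1) b(1)]]) simp
    qed
  qed
  then show ?thesis using r by blast
qed

end

section \<open>The almost split sequences\<close>

lemma quot_factor:
  assumes "lmodule A W" "submodule N A W" "lmodule A Y" and f: "f \<in> module_hom A W Y"
    and "\<And>x. x \<in> N \<Longrightarrow> f x = \<zero>\<^bsub>Y\<^esub>"
  obtains h where "h \<in> module_hom A (quot W N) Y" "\<And>x. x \<in> carrier W \<Longrightarrow> h (N +>\<^bsub>W\<^esub> x) = f x"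
proof (rule hom_factor[OF assms(1) quot_lmodule[OF assms(1,2)] assms(3) quot_hom[OF assms(1,2)] f])
  show "f x = \<zero>\<^bsub>Y\<^esub>" if "x \<in> carrier W" "N +>\<^bsub>W\<^esub> x = \<zero>\<^bsub>quot W N\<^esub>" for x
    using that assms(5) quot_kernel[OF assms(1,2)] by blast
qed (simp_all add: that)

section \<open>Local quotients of P and the first almost split sequence\<close>

context biserial_projective
begin

abbreviation proj :: "'b set \<Rightarrow> 'b \<Rightarrow> 'b set" where "proj D x \<equiv> D +>\<^bsub>P\<^esub> x"

lemma S_M_disjoint:
  assumes "x \<in> M" "x \<in> S" shows "x = \<zero>\<^bsub>P\<^esub>"
  using SM assms by blast

text \<open>\<open>P/D\<close> inherits a largest proper submodule from \<open>P\<close>: the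
  preimage of a proper submodule is proper and so lies in \<open>R\<close>.\<close>

lemma quot_proper:
  assumes D: "submodule D A P" "D \<subseteq> R" and N: "submodule N A (quot P D)" "N \<noteq> carrier (quot P D)"
  shows "N \<subseteq> proj D ` R"
proof -
  note pi = quot_hom[OF P.lmodule_axioms D(1)]
  interpret pi: lhom A P "quot P D" "proj D"
    by (intro lhomI P.lmodule_axioms quot_lmodule pi D)
  let ?C = "{p \<in> carrier P. proj D p \<in> N}"
  have NC: "n \<in> proj D ` ?C" if n: "n \<in> N" for n
  proof -
    have "n \<in> proj D ` carrier P" using pi.Y.lsub_carrier[OF N(1) n] by simp
    then obtain p where "p \<in> carrier P" "n = proj D p" by (rule imageE)
    then show ?thesis using n by auto
  qed
  have "?C \<noteq> carrier P"
  proof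
    assume "?C = carrier P"
    from equalityD2[OF this] have "carrier (quot P D) \<subseteq> N" by auto
    then show False using N(2) pi.Y.lsub_subset[OF N(1)] by auto
  qed
  then have "?C \<subseteq> R" by (rule local[OF pi.preimage_submodule[OF N(1)]])
  then have "proj D ` ?C \<subseteq> proj D ` R" by (rule image_mono)
  then show ?thesis using NC by blast
qed

lemma quot_rd:
  assumes D: "submodule D A P"
  shows "rd A (quot P D) (carrier (quot P D)) = proj D ` R"
proof -
  interpret pi: lhom A P "quot P D" "proj D"
    by (intro lhomI P.lmodule_axioms quot_lmodule quot_hom D)
  show ?thesis using pi.image_rd[OF subset_refl] rdP by simp
qed

text \<open>The map sends \<open>R/D\<close>, the radical of its source, into the second radical of
  \<open>Y\<close>.\<close>

lemma quot_R_zero: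
  assumes D: "submodule D A P" "L \<subseteq> D" and f: "f \<in> module_hom A (quot P D) Y" and Y: "lmodule A Y"
    and im: "f ` carrier (quot P D) \<subseteq> rd A Y (carrier Y)" "rd A Y (rd A Y (carrier Y)) = {\<zero>\<^bsub>Y\<^esub>}" and x: "x \<in> R"
  shows "f (proj D x) = \<zero>\<^bsub>Y\<^esub>"
proof -
  interpret f: lhom A "quot P D" Y f by (intro lhomI quot_lmodule P.lmodule_axioms D Y f)
  have "f ` proj D ` R = rd A Y (f ` carrier (quot P D))"
    using f.image_rd[OF subset_refl] quot_rd[OF D(1)] by simp
  also have "\<dots> \<subseteq> rd A Y (rd A Y (carrier Y))"
    by (rule f.Y.rd_mono[OF im(1) f.Y.lsub_subset[OF f.Y.rd_submodule[OF subset_refl]]])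
  finally have "f ` proj D ` R \<subseteq> {\<zero>\<^bsub>Y\<^esub>}" using im(2) by simp
  then show ?thesis using x by blast
qed

lemma quot_rd2:
  assumes D: "submodule D A P" "L \<subseteq> D"
  shows "rd A (quot P D) (rd A (quot P D) (carrier (quot P D))) = {\<zero>\<^bsub>quot P D\<^esub>}"
proof -
  interpret pi: lhom A P "quot P D" "proj D"
    by (intro lhomI P.lmodule_axioms quot_lmodule quot_hom D)
  have "rd A (quot P D) (rd A (quot P D) (carrier (quot P D))) = proj D ` L"
    using pi.image_rd[OF P.lsub_subset[OF R]] rdR quot_rd[OF D(1)] by simp
  also have "\<dots> \<subseteq> {\<zero>\<^bsub>quot P D\<^esub>}"
    using quot_kernel[OF P.lmodule_axioms D(1)] D(2) P.lsub_carrier[OF Lsub] by blast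
  finally show ?thesis
    using pi.Y.lsub_zero[OF pi.Y.rd_submodule[OF pi.Y.lsub_subset[OF pi.Y.rd_submodule[OF subset_refl]]]] by blast
qed

text \<open>\<open>P/D\<close> is local with zero second radical. A surjective endomorphism is
  bijective by finite length; any other one maps into the radical and kills the radical. This is the
  dichotomy required by \<open>left_almost_split_imp_right\<close>.\<close>

lemma quot_endo:
  assumes D: "submodule D A P" "L \<subseteq> D" "D \<subseteq> R" and v: "v \<in> module_hom A (quot P D) (quot P D)"
  shows "bij_betw v (carrier (quot P D)) (carrier (quot P D)) \<or>
    (\<forall>z\<in>carrier (quot P D). v (v z) = \<zero>\<^bsub>quot P D\<^esub>)"
proof -
  let ?Z = "quot P D"
  have fgZ: "fg_module A ?Z" by (rule fg_quot[OF fgP D(1)])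
  interpret v: lhom A ?Z ?Z v by (intro lhomI fg_lmodule fgZ v)
  note Zl = v.X.lmodule_axioms
  show ?thesis
  proof (cases "v ` carrier ?Z = carrier ?Z")
    case True
    then show ?thesis using surj_endo_inj[OF fgZ v True] by (simp add: bij_betw_def)
  next
    case False
    then have im: "v ` carrier ?Z \<subseteq> proj D ` R"
      by (rule quot_proper[OF D(1,3) v.image_submodule[OF v.X.lsub_top]])
    have "v (v z) = \<zero>\<^bsub>?Z\<^esub>" if z: "z \<in> carrier ?Z" for z
    proof -
      have "v z \<in> proj D ` R" using im z by (rule subsetD[OF _ imageI])
      then obtain x where x: "x \<in> R" "v z = proj D x" by (rule imageE)
      show ?thesis unfolding x(2)
        by (rule quot_R_zero[OF D(1,2) v Zl _ quot_rd2[OF D(1,2)] x(1)]) (use im quot_rd[OF D(1)] in simp)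
    qed
    then show ?thesis by blast
  qed
qed

lemma proj_step:
  assumes D: "submodule D A P" "submodule D' A P" "D \<subseteq> D'"
  obtains g where "g \<in> module_hom A (quot P D) (quot P D')" "\<And>x. x \<in> carrier P \<Longrightarrow> g (proj D x) = proj D' x"
proof (rule quot_factor[OF P.lmodule_axioms D(1) quot_lmodule[OF P.lmodule_axioms D(2)] quot_hom[OF P.lmodule_axioms D(2)]])
  show "proj D' x = \<zero>\<^bsub>quot P D'\<^esub>" if "x \<in> D" for x
    using quot_kernel[OF P.lmodule_axioms D(2)] that D(3) P.lsub_carrier[OF D(1)] by blast
qed (rule that)

lemma SL_le_R: "S <+>\<^bsub>P\<^esub> L \<subseteq> R"
  using S_le_R M_le_R L_le_M by (intro P.lsum_least R) auto

lemma L_le_SL: "L \<subseteq> S <+>\<^bsub>P\<^esub> L"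
  by (rule P.lsum_upper2[OF S Lsub])

lemma S_le_SL: "S \<subseteq> S <+>\<^bsub>P\<^esub> L"
  by (rule P.lsum_upper1[OF S Lsub])

text \<open>If the image of a test map \<open>h\<close> lies in the radical of \<open>W\<close>,
  then \<open>h\<close> extends to \<open>P\<close> by \<open>extend_radical\<close>. Otherwise its
  simple image meets the radical in zero and is a direct summand of \<open>W\<close>, so
  \<open>h\<close> splits. Taking \<open>g\<close> as given lets the second sequence use the lifting
  property of a known map.\<close>

lemma almost_split_1:
  assumes g: "g \<in> module_hom A (quot P L) (quot P M)" "\<And>x. x \<in> carrier P \<Longrightarrow> g (proj L x) = proj M x"
  shows "\<exists>f. almost_split_sequence A (quot (sub P M) L) (quot P L) (quot P M) f g"
proof -
  note Ml = P.sub_lmodule[OF M]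
  interpret M: lmodule A "sub P M" by (rule Ml)
  have LM': "submodule L A (sub P M)" using Lsub L_le_M by (simp add: submodule_sub_iff[OF P.lmodule_axioms M])
  let ?X = "quot (sub P M) L" and ?Y = "quot P L" and ?Z = "quot P M"
  let ?p = "\<lambda>x. L +>\<^bsub>sub P M\<^esub> x"
  have fgX: "fg_module A ?X" by (rule fg_quot[OF fg_submodule[OF fgP M] LM'])
  have fgY: "fg_module A ?Y" by (rule fg_quot[OF fgP Lsub])
  have fgZ: "fg_module A ?Z" by (rule fg_quot[OF fgP M])
  note p = quot_hom[OF Ml LM'] and pk = quot_kernel[OF Ml LM']
  note pL = quot_hom[OF P.lmodule_axioms Lsub] and pLk = quot_kernel[OF P.lmodule_axioms Lsub]
  note pMk = quot_kernel[OF P.lmodule_axioms M]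
  note Mc = P.lsub_carrier[OF M]
  interpret p: lhom A "sub P M" ?X ?p by (intro lhomI Ml fg_lmodule fgX p)
  interpret pL: lhom A P ?Y "proj L" by (intro lhomI P.lmodule_axioms fg_lmodule fgY pL)
  have pLM: "proj L \<in> module_hom A (sub P M) ?Y" by (rule hom_restrict[OF P.lmodule_axioms fg_lmodule[OF fgY] M pL])
  obtain f where f: "f \<in> module_hom A ?X ?Y" "\<And>x. x \<in> carrier (sub P M) \<Longrightarrow> f (?p x) = proj L x"
  proof (rule quot_factor[OF Ml LM' fg_lmodule[OF fgY] pLM])
    show "proj L x = \<zero>\<^bsub>?Y\<^esub>" if "x \<in> L" for x using pLk that P.lsub_carrier[OF Lsub] by blast
  qed (rule that)
  interpret f: lhom A ?X ?Y f by (intro lhomI fg_lmodule fgX fgY f)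
  have fp: "f (?p x) = proj L x" if "x \<in> M" for x using f(2) that by simp
  have Xcases: "\<exists>m\<in>M. x = ?p m" if "x \<in> carrier ?X" for x using that by auto
  have finj: "inj_on f (carrier ?X)"
    unfolding f.inj_iff
  proof (intro ballI impI)
    fix x assume x: "x \<in> carrier ?X" "f x = \<zero>\<^bsub>?Y\<^esub>"
    then obtain m where m: "m \<in> M" "x = ?p m" using Xcases by blast
    then have "m \<in> L" using x(2) fp[OF m(1)] pLk[OF Mc[OF m(1)]] by simp
    then show "x = \<zero>\<^bsub>?X\<^esub>" using m pk[of m] by simp
  qed
  have ex: "f ` carrier ?X = {y \<in> carrier ?Y. g y = \<zero>\<^bsub>?Z\<^esub>}"
  proof (intro equalityI subsetI)
    fix y assume "y \<in> f ` carrier ?X"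
    then obtain x where "x \<in> carrier ?X" "y = f x" by (rule imageE)
    then obtain m where m: "m \<in> M" "y = proj L m" using Xcases[of x] fp by auto
    then show "y \<in> {y \<in> carrier ?Y. g y = \<zero>\<^bsub>?Z\<^esub>}"
      using Mc[OF m(1)] g(2)[of m] pMk[of m] by simp
  next
    fix y assume y: "y \<in> {y \<in> carrier ?Y. g y = \<zero>\<^bsub>?Z\<^esub>}"
    then obtain x where x: "x \<in> carrier P" "y = proj L x" by auto
    then have "x \<in> M" using y g(2)[of x] pMk[of x] by simp
    then have "y = f (?p x)" "?p x \<in> carrier ?X" using x fp by simp_all
    then show "y \<in> f ` carrier ?X" by (rule image_eqI)
  qed
  have onto: "g ` carrier ?Y = carrier ?Z" using g(2) by (simp add: image_image)
  obtain m1 where m1: "m1 \<in> M" "m1 \<notin> L" using LM L_le_M by blast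
  have rdX: "rd A ?X (carrier ?X) = {\<zero>\<^bsub>?X\<^esub>}"
  proof -
    have "rd A ?X (carrier ?X) = ?p ` L"
      using p.image_rd[OF subset_refl] rd_sub[OF P.lmodule_axioms M subset_refl] by simp
    also have "\<dots> \<subseteq> {\<zero>\<^bsub>?X\<^esub>}"
    proof
      fix y assume "y \<in> ?p ` L"
      then obtain l where "l \<in> L" "y = ?p l" by (rule imageE)
      then show "y \<in> {\<zero>\<^bsub>?X\<^esub>}" using pk[of l] L_le_M by auto
    qed
    finally show ?thesis using p.Y.lsub_zero[OF p.Y.rd_submodule[OF subset_refl]] by blast
  qed
  \<comment> \<open>A retraction would send the radical of \<open>P/L\<close> into the radical of
    \<open>M/L\<close>, which is zero; but it fixes the nonzero class of \<open>m1\<close>.\<close>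
  have nsm: "\<not> split_mono A ?X ?Y f"
  proof
    assume "split_mono A ?X ?Y f"
    then obtain r where r: "r \<in> module_hom A ?Y ?X" "\<And>x. x \<in> carrier ?X \<Longrightarrow> r (f x) = x"
      unfolding split_mono_def by blast
    interpret h: lhom A P ?X "\<lambda>x. r (proj L x)"
      by (intro lhomI P.lmodule_axioms fg_lmodule fgX hom_comp[OF pL r(1)])
    have "(\<lambda>x. r (proj L x)) ` R = rd A ?X ((\<lambda>x. r (proj L x)) ` carrier P)"
      using h.image_rd[OF subset_refl] rdP by simp
    also have "\<dots> \<subseteq> rd A ?X (carrier ?X)" using h.closed by (intro p.Y.rd_mono subset_refl) blast
    finally have "(\<lambda>x. r (proj L x)) ` R \<subseteq> {\<zero>\<^bsub>?X\<^esub>}" using rdX by simp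
    then have "r (proj L m1) = \<zero>\<^bsub>?X\<^esub>" using m1 M_le_R by blast
    moreover have "r (proj L m1) = ?p m1" using r(2)[of "?p m1"] m1 fp by simp
    ultimately have "m1 \<in> L" using pk[of m1] m1 by simp
    then show False using m1 by simp
  qed
  have las: "left_almost_split A ?X ?Y f"
    unfolding left_almost_split_def
  proof (intro conjI allI impI f nsm)
    fix W :: "'a fgmod" and h
    assume W: "fg_module A W" and h: "h \<in> module_hom A ?X W" and nsh: "\<not> split_mono A ?X W h"
    interpret h: lhom A ?X W h by (intro lhomI fg_lmodule fgX W h)
    note Wl = h.Y.lmodule_axioms
    note hp = hom_comp[OF p h]
    interpret hp: lhom A "sub P M" W "\<lambda>x. h (?p x)" by (intro lhomI Ml Wl hp)
    have hpL: "h (?p x) = \<zero>\<^bsub>W\<^esub>" if "x \<in> L" for x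
      using pk[of x] that L_le_M h.zero by auto
    let ?J = "rd A W (carrier W)"
    have J: "submodule ?J A W" by (rule h.Y.rd_submodule[OF subset_refl])
    have cM: "complementary M (S <+>\<^bsub>P\<^esub> L)" by (simp add: complementary_def)
    show "\<exists>t\<in>module_hom A ?Y W. \<forall>x\<in>carrier ?X. t (f x) = h x"
    proof (cases "(\<lambda>x. h (?p x)) ` M \<subseteq> ?J")
      case True
      obtain q where q0: "q \<in> module_hom A P W" "q ` carrier P \<subseteq> carrier W \<and> (\<forall>m\<in>M. q m = h (?p m))"
        using extend_radical[OF cM W h.Y.lsub_top hp True] by (rule bexE)
      note qM = bspec[OF conjunct2[OF q0(2)]]
      obtain t where t: "t \<in> module_hom A ?Y W" "\<And>x. x \<in> carrier P \<Longrightarrow> t (proj L x) = q x"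
      proof (rule quot_factor[OF P.lmodule_axioms Lsub Wl q0(1)])
        show "q x = \<zero>\<^bsub>W\<^esub>" if "x \<in> L" for x using qM[of x] hpL[OF that] that L_le_M by auto
      qed (rule that)
      have "t (f x) = h x" if "x \<in> carrier ?X" for x
      proof -
        obtain m where "m \<in> M" "x = ?p m" using Xcases \<open>x \<in> carrier ?X\<close> by blast
        then show ?thesis using fp[of m] t(2)[of m] qM[of m] Mc[of m] by simp
      qed
      then show ?thesis using t(1) by (intro bexI[of _ t]) simp_all
    next
      case False
      then obtain m0 where m0: "m0 \<in> M" "h (?p m0) \<notin> ?J" by blast
      have "submodule {m \<in> M. h (?p m) \<in> ?J} A P"
        using hp.preimage_submodule[OF J] by (simp add: submodule_sub_iff[OF P.lmodule_axioms M])
      moreover have "{m \<in> M. h (?p m) \<in> ?J} \<subseteq> M" by auto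
      ultimately have sm: "{m \<in> M. h (?p m) \<in> ?J} = {\<zero>\<^bsub>P\<^esub>} \<or> {m \<in> M. h (?p m) \<in> ?J} = L \<or> {m \<in> M. h (?p m) \<in> ?J} = M"
        by (rule subM)
      \<comment> \<open>The elements sent into the radical form a submodule of \<open>M\<close>
        other than \<open>M\<close>, hence one inside \<open>L\<close>. So \<open>h\<close> is
        injective and its image meets the radical in zero.\<close>
      have inL: "m \<in> L" if m: "m \<in> M" "h (?p m) \<in> ?J" for m
      proof -
        have mm: "m \<in> {m \<in> M. h (?p m) \<in> ?J}" using m by simp
        have "m0 \<notin> {m \<in> M. h (?p m) \<in> ?J}" using m0 by simp
        then have "{m \<in> M. h (?p m) \<in> ?J} \<noteq> M" using m0(1) by metis
        with sm have "{m \<in> M. h (?p m) \<in> ?J} = {\<zero>\<^bsub>P\<^esub>} \<or> {m \<in> M. h (?p m) \<in> ?J} = L" by metis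
        then show ?thesis
        proof
          assume "{m \<in> M. h (?p m) \<in> ?J} = {\<zero>\<^bsub>P\<^esub>}"
          from subsetD[OF equalityD1[OF this] mm] show ?thesis using P.lsub_zero[OF Lsub] by simp
        next
          assume "{m \<in> M. h (?p m) \<in> ?J} = L"
          from subsetD[OF equalityD1[OF this] mm] show ?thesis .
        qed
      qed
      let ?H = "h ` carrier ?X"
      have H: "submodule ?H A W" by (rule h.image_submodule[OF p.Y.lsub_top])
      have HJ: "z = \<zero>\<^bsub>W\<^esub>" if z: "z \<in> ?H" "z \<in> ?J" for z
      proof -
        obtain x where x: "x \<in> carrier ?X" "z = h x" using z(1) by (rule imageE)
        then obtain m where "m \<in> M" "x = ?p m" using Xcases by blast
        then show ?thesis using inL[of m] hpL[of m] x z(2) by simp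
      qed
      have HJs: "submodule (?H <+>\<^bsub>W\<^esub> ?J) A W" by (rule h.Y.lsub_sum[OF H J])
      \<comment> \<open>A complement of \<open>?H + ?J\<close> modulo the radical, enlarged by the
        radical \<open>?J\<close>, becomes a genuine complement of \<open>?H\<close>.\<close>
      obtain C where C: "submodule C A W" "(?H <+>\<^bsub>W\<^esub> ?J) <+>\<^bsub>W\<^esub> C = carrier W" "(?H <+>\<^bsub>W\<^esub> ?J) \<inter> C \<subseteq> ?J"
        by (rule complement_mod_rd[OF W HJs h.Y.lsum_upper2[OF H J]])
      let ?C = "?J <+>\<^bsub>W\<^esub> C"
      have Cs: "submodule ?C A W" by (rule h.Y.lsub_sum[OF J C(1)])
      have HC: "?H \<inter> ?C = {\<zero>\<^bsub>W\<^esub>}"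
      proof -
        have "z = \<zero>\<^bsub>W\<^esub>" if z: "z \<in> ?H" "z \<in> ?C" for z
        proof -
          obtain j c where jc: "j \<in> ?J" "c \<in> C" "z = j \<oplus>\<^bsub>W\<^esub> c" using z(2) unfolding mem_set_add by blast
          have cc: "z \<in> carrier W" "j \<in> carrier W" "c \<in> carrier W"
            using z(1) jc h.Y.lsub_carrier[OF H] h.Y.lsub_carrier[OF J] h.Y.lsub_carrier[OF C(1)] by auto
          have "c = z \<ominus>\<^bsub>W\<^esub> j" using jc(3) cc by simp
          moreover have "z \<in> ?H <+>\<^bsub>W\<^esub> ?J" "j \<in> ?H <+>\<^bsub>W\<^esub> ?J"
            using subsetD[OF h.Y.lsum_upper1[OF H J] z(1)] subsetD[OF h.Y.lsum_upper2[OF H J] jc(1)] by auto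
          ultimately have "c \<in> ?H <+>\<^bsub>W\<^esub> ?J" using h.Y.lsub_minus[OF HJs] by metis
          then have "c \<in> ?J" using C(3) jc(2) by blast
          then have "z \<in> ?J" using jc h.Y.lsub_add[OF J] by simp
          then show ?thesis by (rule HJ[OF z(1)])
        qed
        then show ?thesis using h.Y.lsub_zero[OF H] h.Y.lsub_zero[OF Cs] by blast
      qed
      have all: "?H <+>\<^bsub>W\<^esub> ?C = carrier W"
      proof
        show "?H <+>\<^bsub>W\<^esub> ?C \<subseteq> carrier W" by (rule h.Y.lsub_subset[OF h.Y.lsub_sum[OF H Cs]])
        note s = h.Y.lsub_sum[OF H Cs] and u = h.Y.lsum_upper1[OF H Cs] h.Y.lsum_upper2[OF H Cs]
          h.Y.lsum_upper1[OF J C(1)] h.Y.lsum_upper2[OF J C(1)]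
        have "?H <+>\<^bsub>W\<^esub> ?J \<subseteq> ?H <+>\<^bsub>W\<^esub> ?C" using u by (intro h.Y.lsum_least s) auto
        moreover have "C \<subseteq> ?H <+>\<^bsub>W\<^esub> ?C" using u by auto
        ultimately have "(?H <+>\<^bsub>W\<^esub> ?J) <+>\<^bsub>W\<^esub> C \<subseteq> ?H <+>\<^bsub>W\<^esub> ?C" by (rule h.Y.lsum_least[OF s])
        then show "carrier W \<subseteq> ?H <+>\<^bsub>W\<^esub> ?C" using C(2) by simp
      qed
      have "inj_on h (carrier ?X)"
        unfolding h.inj_iff
      proof (intro ballI impI)
        fix x assume x: "x \<in> carrier ?X" "h x = \<zero>\<^bsub>W\<^esub>"
        then obtain m where m: "m \<in> M" "x = ?p m" using Xcases by blast
        then have "m \<in> L" using inL[of m] x h.Y.lsub_zero[OF J] by simp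
        then show "x = \<zero>\<^bsub>?X\<^esub>" using pk[of m] m by simp
      qed
      then have b: "h \<in> module_hom A ?X (sub W ?H)" "bij_betw h (carrier ?X) (carrier (sub W ?H))"
        by (simp_all add: hom_into_sub[OF h] bij_betw_def)
      obtain i where i: "i \<in> module_hom A (sub W ?H) ?X" "\<And>x. x \<in> carrier ?X \<Longrightarrow> i (h x) = x"
        by (rule hom_inverse[OF fg_lmodule[OF fgX] h.Y.sub_lmodule[OF H] b]) simp
      obtain r where r: "r \<in> module_hom A (sub W (?H <+>\<^bsub>W\<^esub> ?C)) ?X" "\<And>x. x \<in> ?H \<Longrightarrow> r x = i x"
        by (rule hom_on_sum[OF Wl fg_lmodule[OF fgX] H Cs HC i(1) hom_zero[OF fg_lmodule[OF fgX]]]) blast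
      have "r \<in> module_hom A W ?X" using r(1) unfolding all by simp
      moreover have "r (h x) = x" if "x \<in> carrier ?X" for x using r(2)[OF imageI[OF that]] i(2)[OF that] by simp
      ultimately have "split_mono A ?X W h" unfolding split_mono_def by (intro bexI[of _ r]) simp_all
      then show ?thesis using nsh by simp
    qed
  qed
  have ras: "right_almost_split A ?Y ?Z g"
    by (rule left_almost_split_imp_right[OF fgX fgY fgZ f(1) g(1) finj ex onto las quot_endo[OF M L_le_M M_le_R]])
  have "almost_split_sequence A ?X ?Y ?Z f g"
    unfolding almost_split_sequence_def by (intro conjI fgX fgY fgZ f(1) g(1) finj ex onto las ras)
  then show ?thesis by blast
qed

end

section \<open>The second almost split sequence\<close>

context biserial_projective
begin

text \<open>If \<open>h(S)\<close> lies in \<open>rad\<^sup>2 V\<close>, the claim follows from \<open>extend_radical\<close>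
  and \<open>kill_M\<close>. Otherwise \<open>h(S)\<close> is detected by a surjection of \<open>V\<close> onto \<open>P/M\<close>, a submodule of \<open>I\<^sub>S\<close>.
  If it lifts to \<open>P/L\<close>, the lift makes \<open>P/L \<rightarrow> V\<close> split; if it does not, it splits by the first
  sequence, and its kernel is a smaller direct summand of \<open>V\<close>.\<close>

lemma split_or_extend:
  fixes W :: "'a fgmod"
  assumes ras: "right_almost_split A (quot P L) (quot P M) g"
    and gp: "\<And>x. x \<in> carrier P \<Longrightarrow> g (proj L x) = proj M x"
    and W: "fg_module A W" and V: "submodule V A W"
    and h: "h \<in> module_hom A P W" "h ` carrier P \<subseteq> V" "\<And>x. x \<in> L \<Longrightarrow> h x = \<zero>\<^bsub>W\<^esub>"
  shows "(\<exists>\<rho>\<in>module_hom A (sub W V) (quot P L). \<forall>p\<in>carrier P. \<rho> (h p) = proj L p) \<or>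
    (\<exists>t\<in>module_hom A P W. t ` carrier P \<subseteq> V \<and> (\<forall>m\<in>M. t m = \<zero>\<^bsub>W\<^esub>) \<and> (\<forall>s\<in>S. t s = h s))"
proof -
  interpret W: lmodule A W by (rule fg_lmodule[OF W])
  have g: "g \<in> module_hom A (quot P L) (quot P M)" using ras by (simp add: right_almost_split_def)
  note pL = quot_hom[OF P.lmodule_axioms Lsub] and pM = quot_hom[OF P.lmodule_axioms M]
  note pLk = quot_kernel[OF P.lmodule_axioms Lsub] and pMk = quot_kernel[OF P.lmodule_axioms M]
  have fgYL: "fg_module A (quot P L)" by (rule fg_quot[OF fgP Lsub])
  have fgYM: "fg_module A (quot P M)" by (rule fg_quot[OF fgP M])
  interpret pL: lhom A P "quot P L" "proj L" by (intro lhomI P.lmodule_axioms fg_lmodule fgYL pL)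
  interpret pM: lhom A P "quot P M" "proj M" by (intro lhomI P.lmodule_axioms fg_lmodule fgYM pM)
  interpret g: lhom A "quot P L" "quot P M" g by (intro lhomI pL.Y.lmodule_axioms pM.Y.lmodule_axioms g)
  obtain u where u: "u \<in> module_hom A P ES" "\<And>p. p \<in> carrier P \<Longrightarrow> u p = \<zero>\<^bsub>ES\<^esub> \<longleftrightarrow> p \<in> M"
    using S_map by blast
  have fgE: "fg_module A ES" using injS by (simp add: injective_module_def)
  interpret u: lhom A P ES u by (intro lhomI P.lmodule_axioms fg_lmodule fgE u)
  note Sc = P.lsub_carrier[OF S] and Mc = P.lsub_carrier[OF M]
  have uP: "submodule (u ` carrier P) A ES" by (rule u.image_submodule[OF P.lsub_top])
  \<comment> \<open>\<open>u\<close> embeds \<open>P/M\<close> into the envelope of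
    \<open>S\<close>; \<open>i\<close> is the inverse of that embedding on its image.\<close>
  obtain i where i: "i \<in> module_hom A (sub ES (u ` carrier P)) (quot P M)"
    "\<And>p. p \<in> carrier P \<Longrightarrow> i (u p) = proj M p"
  proof (rule hom_factor[OF P.lmodule_axioms u.Y.sub_lmodule[OF uP] pM.Y.lmodule_axioms hom_into_sub[OF u(1) subset_refl] pM])
    show "proj M x = \<zero>\<^bsub>quot P M\<^esub>" if "x \<in> carrier P" "u x = \<zero>\<^bsub>sub ES (u ` carrier P)\<^esub>" for x
      using that u(2)[of x] pMk[of x] by simp
  qed simp_all
  obtain s1 where s1: "s1 \<in> S" "s1 \<noteq> \<zero>\<^bsub>P\<^esub>" using S_nz P.lsub_zero[OF S] by blast
  have cSM: "complementary S M" by (simp add: complementary_def)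
  have "\<forall>h. h \<in> module_hom A P W \<longrightarrow> h ` carrier P \<subseteq> V \<longrightarrow> (\<forall>x\<in>L. h x = \<zero>\<^bsub>W\<^esub>) \<longrightarrow>
    (\<exists>\<rho>\<in>module_hom A (sub W V) (quot P L). \<forall>p\<in>carrier P. \<rho> (h p) = proj L p) \<or>
    (\<exists>t\<in>module_hom A P W. t ` carrier P \<subseteq> V \<and> (\<forall>m\<in>M. t m = \<zero>\<^bsub>W\<^esub>) \<and> (\<forall>s\<in>S. t s = h s))"
    (is "?Q V")
    using fg_dcc[OF W] V W.lsub_subset[OF V]
  proof (induction V rule: W.dcc_induct)
    case (less V)
    note V = less(1)
    show "?Q V"
    proof (intro allI impI)
      fix h assume h: "h \<in> module_hom A P W" and hV: "h ` carrier P \<subseteq> V" and hL: "\<forall>x\<in>L. h x = \<zero>\<^bsub>W\<^esub>"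
      interpret h: lhom A P W h by (intro lhomI P.lmodule_axioms W.lmodule_axioms h)
      note Vc = W.lsub_subset[OF V] and Vl = W.sub_lmodule[OF V]
      have fgV: "fg_module A (sub W V)" by (rule fg_submodule[OF W V])
      have hVp: "h p \<in> V" if "p \<in> carrier P" for p using hV that by blast
      have rV: "submodule (rd A W V) A W" by (rule W.rd_submodule[OF Vc])
      let ?K = "rd A W (rd A W V)"
      have K: "submodule ?K A W" by (rule W.rd_submodule[OF W.lsub_subset[OF rV]])
      have hR: "h ` R \<subseteq> rd A W V"
      proof -
        have "h ` R = rd A W (h ` carrier P)" using h.image_rd[OF subset_refl] rdP by simp
        also have "\<dots> \<subseteq> rd A W V" by (rule W.rd_mono[OF hV Vc])
        finally show ?thesis .
      qed
      note hS = hom_restrict[OF P.lmodule_axioms W.lmodule_axioms S h]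
      interpret hS: lhom A "sub P S" W h by (intro lhomI P.sub_lmodule S W.lmodule_axioms hS)
      let ?goal = "(\<exists>\<rho>\<in>module_hom A (sub W V) (quot P L). \<forall>p\<in>carrier P. \<rho> (h p) = proj L p) \<or>
        (\<exists>t\<in>module_hom A P W. t ` carrier P \<subseteq> V \<and> (\<forall>m\<in>M. t m = \<zero>\<^bsub>W\<^esub>) \<and> (\<forall>s\<in>S. t s = h s))"
      show ?goal
      proof (cases "h ` S \<subseteq> ?K")
        case True
        obtain r where r0: "r \<in> module_hom A P W" "r ` carrier P \<subseteq> rd A W V \<and> (\<forall>s\<in>S. r s = h s)"
          using extend_radical[OF cSM W rV hS True] by (rule bexE)
        have rVs: "r \<in> module_hom A P (sub W V)"
          using r0 W.rd_subset[OF V] by (intro hom_into_sub[OF r0(1)]) auto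
        have "r ` carrier P \<subseteq> rd A (sub W V) (carrier (sub W V))"
          using r0(2) rd_sub[OF W.lmodule_axioms V subset_refl] by simp
        from kill_M[OF fgV rVs this]
        obtain t where t: "t \<in> module_hom A P (sub W V)" "(\<forall>s\<in>S. t s = r s) \<and> (\<forall>m\<in>M. t m = \<zero>\<^bsub>sub W V\<^esub>)"
          by (rule bexE)
        have "t ` carrier P \<subseteq> V" using t(1) by (auto simp: module_hom_iff)
        then have "t ` carrier P \<subseteq> V \<and> (\<forall>m\<in>M. t m = \<zero>\<^bsub>W\<^esub>) \<and> (\<forall>s\<in>S. t s = h s)" using t(2) r0(2) by simp
        then show ?goal
          by (intro disjI2 bexI[OF _ hom_from_into_sub[OF W.lmodule_axioms V t(1)]])
      next
        case False
        then obtain s2 where s2: "s2 \<in> S" "h s2 \<notin> ?K" by blast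
        have SK: "s = \<zero>\<^bsub>P\<^esub>" if s: "s \<in> S" "h s \<in> ?K" for s
        proof -
          let ?N = "{s \<in> S. h s \<in> ?K}"
          have "submodule ?N A P"
            using hS.preimage_submodule[OF K] by (simp add: submodule_sub_iff[OF P.lmodule_axioms S])
          moreover have "?N \<subseteq> S" by auto
          ultimately have d: "?N = {\<zero>\<^bsub>P\<^esub>} \<or> ?N = S" by (rule subS)
          have "s2 \<notin> ?N" using s2 by simp
          then have "?N \<noteq> S" using s2(1) by metis
          with d have e: "?N = {\<zero>\<^bsub>P\<^esub>}" by metis
          show ?thesis using subsetD[OF equalityD1[OF e], of s] s by simp
        qed
        note Sl = P.sub_lmodule[OF S]
        have hSs: "submodule (h ` S) A W" by (rule h.image_submodule[OF S])
        obtain f0 where f0: "f0 \<in> module_hom A (sub W (h ` S)) ES" "\<And>s. s \<in> S \<Longrightarrow> f0 (h s) = u s"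
        proof (rule hom_factor[OF Sl W.sub_lmodule[OF hSs] u.Y.lmodule_axioms _ hom_restrict[OF P.lmodule_axioms u.Y.lmodule_axioms S u(1)]])
          show "h \<in> module_hom A (sub P S) (sub W (h ` S))" by (rule hom_into_sub[OF hS]) simp
          show "u s = \<zero>\<^bsub>ES\<^esub>" if "s \<in> carrier (sub P S)" "h s = \<zero>\<^bsub>sub W (h ` S)\<^esub>" for s
            using that SK[of s] W.lsub_zero[OF K] u.zero by simp
        qed simp_all
        have disj: "h ` S \<inter> ?K = {\<zero>\<^bsub>W\<^esub>}"
        proof -
          have "z = \<zero>\<^bsub>W\<^esub>" if z: "z \<in> h ` S" "z \<in> ?K" for z
          proof -
            obtain s where "s \<in> S" "z = h s" using z(1) by (rule imageE)
            then show ?thesis using SK[of s] z(2) h.zero by simp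
          qed
          then show ?thesis using W.lsub_zero[OF hSs] W.lsub_zero[OF K] by blast
        qed
        note sK = W.lsub_sum[OF hSs K]
        \<comment> \<open>This map is \<open>u\<close> on \<open>h S\<close>, and it kills the
          second radical of \<open>V\<close> so that \<open>rd_square_zero_image\<close> becomes
          applicable to \<open>\<mu> V\<close>.\<close>
        obtain l0 where l0: "l0 \<in> module_hom A (sub W (h ` S <+>\<^bsub>W\<^esub> ?K)) ES"
          "\<And>x. x \<in> h ` S \<Longrightarrow> l0 x = f0 x" "\<And>x. x \<in> ?K \<Longrightarrow> l0 x = \<zero>\<^bsub>ES\<^esub>"
          by (rule hom_on_sum[OF W.lmodule_axioms u.Y.lmodule_axioms hSs K disj f0(1) hom_zero[OF u.Y.lmodule_axioms]]) blast
        obtain \<mu> where mu: "\<mu> \<in> module_hom A W ES" "\<And>x. x \<in> h ` S <+>\<^bsub>W\<^esub> ?K \<Longrightarrow> \<mu> x = l0 x"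
          by (rule injective_extend[OF injS fg_submodule[OF W sK] W hom_inclusion[OF W.lmodule_axioms sK] _ l0(1)])
            (simp_all add: inj_on_def)
        interpret mu: lhom A W ES \<mu> by (intro lhomI W.lmodule_axioms u.Y.lmodule_axioms mu)
        have muS: "\<mu> (h s) = u s" if s: "s \<in> S" for s
          using mu(2)[OF subsetD[OF W.lsum_upper1[OF hSs K] imageI[OF s]]] l0(2)[OF imageI[OF s]] f0(2)[OF s] by simp
        have muK: "\<mu> x = \<zero>\<^bsub>ES\<^esub>" if x: "x \<in> ?K" for x
          using mu(2)[OF subsetD[OF W.lsum_upper2[OF hSs K] x]] l0(3)[OF x] by simp
        have Ys: "submodule (\<mu> ` V) A ES" by (rule mu.image_submodule[OF V])
        have rY: "rd A ES (\<mu> ` V) = \<mu> ` rd A W V" using mu.image_rd[OF Vc] by simp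
        have rrY: "rd A ES (rd A ES (\<mu> ` V)) = {\<zero>\<^bsub>ES\<^esub>}"
        proof -
          have "rd A ES (rd A ES (\<mu> ` V)) = \<mu> ` ?K" using mu.image_rd[OF W.lsub_subset[OF rV]] rY by simp
          also have "\<dots> \<subseteq> {\<zero>\<^bsub>ES\<^esub>}" using muK by auto
          finally show ?thesis
            using u.Y.lsub_zero[OF u.Y.rd_submodule[OF u.Y.lsub_subset[OF u.Y.rd_submodule[OF u.Y.lsub_subset[OF Ys]]]]]
            by blast
        qed
        have us1: "u s1 \<noteq> \<zero>\<^bsub>ES\<^esub>" using u(2)[OF Sc[OF s1(1)]] S_M_disjoint[OF _ s1(1)] s1(2) by blast
        have "h s1 \<in> rd A W V" using hR S_le_R s1(1) by blast
        from imageI[OF this, of \<mu>] have us1r: "u s1 \<in> rd A ES (\<mu> ` V)" using muS[OF s1(1)] rY by simp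
        have Yeq: "\<mu> ` V = u ` carrier P"
        proof (rule rd_square_zero_image[OF fgE uniS u(1) _ Ys rrY _ us1 us1r])
          show "u x = \<zero>\<^bsub>ES\<^esub>" if "x \<in> L" for x
          proof -
            have "x \<in> M" using that L_le_M by blast
            then show ?thesis using u(2)[OF Mc] by simp
          qed
          show "s1 \<in> R" using s1(1) S_le_R by blast
        qed
        define \<nu> where "\<nu> = (\<lambda>v. i (\<mu> v))"
        have "\<mu> \<in> module_hom A (sub W V) (sub ES (u ` carrier P))"
          using Yeq by (intro hom_into_sub[OF hom_restrict[OF W.lmodule_axioms u.Y.lmodule_axioms V mu(1)]]) simp
        from hom_comp[OF this i(1)] have nu: "\<nu> \<in> module_hom A (sub W V) (quot P M)" by (simp add: \<nu>_def)
        interpret nu: lhom A "sub W V" "quot P M" \<nu> by (intro lhomI Vl pM.Y.lmodule_axioms nu)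
        have nuS: "\<nu> (h s) = proj M s" if "s \<in> S" for s using muS[OF that] i(2)[OF Sc[OF that]] by (simp add: \<nu>_def)
        have nus1: "\<nu> (h s1) \<noteq> \<zero>\<^bsub>quot P M\<^esub>"
          using nuS[OF s1(1)] pMk[OF Sc[OF s1(1)]] S_M_disjoint[OF _ s1(1)] s1(2) by auto
        have hVs: "h \<in> module_hom A P (sub W V)" by (rule hom_into_sub[OF h hV])
        note nh = hom_comp[OF hVs nu]
        interpret nh: lhom A P "quot P M" "\<lambda>p. \<nu> (h p)" by (intro lhomI P.lmodule_axioms pM.Y.lmodule_axioms nh)
        show ?goal
        proof (cases "split_epi A (sub W V) (quot P M) \<nu>")
          case False
          then have "\<exists>t\<in>module_hom A (sub W V) (quot P L). \<forall>w\<in>carrier (sub W V). g (t w) = \<nu> w"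
            using ras fgV nu unfolding right_almost_split_def by blast
          then obtain t where t: "t \<in> module_hom A (sub W V) (quot P L)" "\<forall>w\<in>carrier (sub W V). g (t w) = \<nu> w"
            by (rule bexE)
          have gt: "g (t v) = \<nu> v" if "v \<in> V" for v using t(2) that by simp
          note th = hom_comp[OF hVs t(1)]
          interpret th: lhom A P "quot P L" "\<lambda>p. t (h p)" by (intro lhomI P.lmodule_axioms pL.Y.lmodule_axioms th)
          interpret t: lhom A "sub W V" "quot P L" t by (intro lhomI Vl pL.Y.lmodule_axioms t)
          have ht0: "t (h x) = \<zero>\<^bsub>quot P L\<^esub>" if "x \<in> L" for x using hL that t.zero by simp
          \<comment> \<open>\<open>t\<close> after \<open>h\<close> induces an endomorphism of
            \<open>P/L\<close>. It is onto: otherwise it would kill the radical, while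
            \<open>\<nu>\<close> after \<open>h\<close> does not vanish on \<open>S\<close>. Its
            inverse turns \<open>t\<close> into the retraction \<open>\<rho>\<close>.\<close>
          obtain \<psi> where psi: "\<psi> \<in> module_hom A (quot P L) (quot P L)" "\<And>x. x \<in> carrier P \<Longrightarrow> \<psi> (proj L x) = t (h x)"
            by (rule quot_factor[OF P.lmodule_axioms Lsub pL.Y.lmodule_axioms th ht0]) (assumption, rule that)
          interpret psi: lhom A "quot P L" "quot P L" \<psi> by (intro lhomI pL.Y.lmodule_axioms psi)
          have psionto: "\<psi> ` carrier (quot P L) = carrier (quot P L)"
          proof (rule ccontr)
            assume "\<psi> ` carrier (quot P L) \<noteq> carrier (quot P L)"
            then have im: "\<psi> ` carrier (quot P L) \<subseteq> proj L ` R"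
              by (rule quot_proper[OF Lsub order_trans[OF L_le_M M_le_R] psi.image_submodule[OF pL.Y.lsub_top]])
            have "\<psi> (proj L s1) = \<zero>\<^bsub>quot P L\<^esub>"
              by (rule quot_R_zero[OF Lsub subset_refl psi(1) pL.Y.lmodule_axioms _ quot_rd2[OF Lsub subset_refl]])
                (use im quot_rd[OF Lsub] s1(1) S_le_R in auto)
            then have "t (h s1) = \<zero>\<^bsub>quot P L\<^esub>" using psi(2)[OF Sc[OF s1(1)]] by simp
            then have "\<nu> (h s1) = \<zero>\<^bsub>quot P M\<^esub>" using gt[OF hVp[OF Sc[OF s1(1)]]] g.zero by simp
            then show False using nus1 by simp
          qed
          have "bij_betw \<psi> (carrier (quot P L)) (carrier (quot P L))"
            using psionto surj_endo_inj[OF fgYL psi(1) psionto] by (simp add: bij_betw_def)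
          then obtain \<chi> where chi: "\<chi> \<in> module_hom A (quot P L) (quot P L)" "\<And>x. x \<in> carrier (quot P L) \<Longrightarrow> \<chi> (\<psi> x) = x"
            by (rule hom_inverse[OF pL.Y.lmodule_axioms pL.Y.lmodule_axioms psi(1)]) (rule that)
          have "\<forall>p\<in>carrier P. \<chi> (t (h p)) = proj L p"
            using chi(2)[OF pL.closed] psi(2) by simp
          then show ?goal by (intro disjI1 bexI[OF _ hom_comp[OF t(1) chi(1)]])
        next
          case True
          then obtain \<sigma> where sg: "\<sigma> \<in> module_hom A (quot P M) (sub W V)" "\<And>z. z \<in> carrier (quot P M) \<Longrightarrow> \<nu> (\<sigma> z) = z"
            unfolding split_epi_def by blast
          note sW = hom_from_into_sub[OF W.lmodule_axioms V sg(1)]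
          interpret sg: lhom A "quot P M" W \<sigma> by (intro lhomI pM.Y.lmodule_axioms W.lmodule_axioms sW)
          have sV: "\<sigma> z \<in> V" if "z \<in> carrier (quot P M)" for z
            using bspec[OF conjunct1[OF sg(1)[unfolded module_hom_iff]] that] by simp
          note th = hom_comp[OF nh sW]
          \<comment> \<open>\<open>\<nu>\<close> after \<open>h\<close> maps \<open>M\<close> into
            the radical of \<open>P/M\<close>, which is the image of \<open>S\<close>, so it
            vanishes on \<open>M\<close>. Hence the correction by \<open>\<sigma>\<close> after
            \<open>\<nu>\<close> and \<open>h\<close> disturbs neither the vanishing on
            \<open>L\<close> nor that on \<open>M\<close>.\<close>
          have nhM: "\<nu> (h m) = \<zero>\<^bsub>quot P M\<^esub>" if m: "m \<in> M" for m
          proof (rule S_M_incomparable[OF pM.Y.lmodule_axioms hom_restrict[OF P.lmodule_axioms pM.Y.lmodule_axioms M nh]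
                hom_restrict[OF P.lmodule_axioms pM.Y.lmodule_axioms S pM] _ m])
            have "(\<lambda>p. \<nu> (h p)) ` R = rd A (quot P M) ((\<lambda>p. \<nu> (h p)) ` carrier P)"
              using nh.image_rd[OF subset_refl] rdP by simp
            also have "\<dots> \<subseteq> rd A (quot P M) (carrier (quot P M))"
              using nh.closed by (intro pM.Y.rd_mono subset_refl) blast
            also have "\<dots> = proj M ` R" by (rule quot_rd[OF M])
            also have "\<dots> \<subseteq> proj M ` S"
            proof
              fix y assume "y \<in> proj M ` R"
              then obtain x where x: "x \<in> R" "y = proj M x" by (rule imageE)
              then obtain a b where ab: "a \<in> S" "b \<in> M" "x = a \<oplus>\<^bsub>P\<^esub> b" unfolding mem_set_add by blast
              have "proj M b = \<zero>\<^bsub>quot P M\<^esub>" using pMk[OF Mc[OF ab(2)]] ab(2) by simp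
              then have "proj M x = proj M a"
                using pM.add[OF Sc[OF ab(1)] Mc[OF ab(2)]] ab(3) pM.closed[OF Sc[OF ab(1)]]
                  pM.Y.M.r_zero[of "proj M a"] by metis
              then show "y \<in> proj M ` S" using x(2) ab(1) by blast
            qed
            finally show "(\<lambda>p. \<nu> (h p)) ` M \<subseteq> proj M ` S" using M_le_R by blast
          qed
          define V2 where "V2 = {v \<in> V. \<nu> v = \<zero>\<^bsub>quot P M\<^esub>}"
          have V2: "submodule V2 A W"
            using nu.kernel_submodule unfolding V2_def by (simp add: submodule_sub_iff[OF W.lmodule_axioms V])
          have V2lt: "V2 \<subset> V"
          proof -
            have "h s1 \<in> V" "h s1 \<notin> V2" using hVp[OF Sc[OF s1(1)]] nus1 by (simp_all add: V2_def)
            then show ?thesis unfolding V2_def by blast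
          qed
          \<comment> \<open>This is the component of \<open>h\<close> in the kernel of
            \<open>\<nu>\<close>, the summand to which the induction hypothesis is applied.\<close>
          have h2: "(\<lambda>p. h p \<ominus>\<^bsub>W\<^esub> \<sigma> (\<nu> (h p))) \<in> module_hom A P W"
            by (rule hom_minus[OF W.lmodule_axioms h th])
          have minV: "v \<ominus>\<^bsub>W\<^esub> \<sigma> (\<nu> v) \<in> V2" if v: "v \<in> V" for v
          proof -
            have nv: "\<nu> v \<in> carrier (quot P M)" using nu.closed v by simp
            have "\<ominus>\<^bsub>sub W V\<^esub> x = \<ominus>\<^bsub>W\<^esub> x" if "x \<in> V" for x
              using lmodule.smult_uminus_one[OF Vl, of x] W.smult_uminus_one[of x] that Vc by auto
            then have "v \<ominus>\<^bsub>sub W V\<^esub> \<sigma> (\<nu> v) = v \<ominus>\<^bsub>W\<^esub> \<sigma> (\<nu> v)" using sV[OF nv] by (simp add: a_minus_def)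
            then have "\<nu> (v \<ominus>\<^bsub>W\<^esub> \<sigma> (\<nu> v)) = \<nu> v \<ominus>\<^bsub>quot P M\<^esub> \<nu> (\<sigma> (\<nu> v))"
              using nu.minus[of v "\<sigma> (\<nu> v)"] v sV[OF nv] by simp
            then have "\<nu> (v \<ominus>\<^bsub>W\<^esub> \<sigma> (\<nu> v)) = \<zero>\<^bsub>quot P M\<^esub>"
              using sg(2)[OF nv] pM.Y.M.minus_eq_zero_iff[OF nv nv] by simp
            then show ?thesis using W.lsub_minus[OF V v sV[OF nv]] by (simp add: V2_def)
          qed
          have h2V: "(\<lambda>p. h p \<ominus>\<^bsub>W\<^esub> \<sigma> (\<nu> (h p))) ` carrier P \<subseteq> V2"
            using minV[OF hVp] by blast
          have h2L: "\<forall>x\<in>L. h x \<ominus>\<^bsub>W\<^esub> \<sigma> (\<nu> (h x)) = \<zero>\<^bsub>W\<^esub>"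
          proof
            fix x assume x: "x \<in> L"
            then have "\<nu> (h x) = \<zero>\<^bsub>quot P M\<^esub>" using nhM L_le_M by blast
            then have "\<sigma> (\<nu> (h x)) = \<zero>\<^bsub>W\<^esub>" using sg.zero by metis
            moreover have "h x = \<zero>\<^bsub>W\<^esub>" using hL x by blast
            ultimately show "h x \<ominus>\<^bsub>W\<^esub> \<sigma> (\<nu> (h x)) = \<zero>\<^bsub>W\<^esub>"
              using W.M.minus_eq_zero_iff[OF W.M.zero_closed W.M.zero_closed] by simp
          qed
          from less(3)[OF V2 V2lt, rule_format, OF h2 h2V] h2L
          have "(\<exists>\<rho>\<in>module_hom A (sub W V2) (quot P L). \<forall>p\<in>carrier P. \<rho> (h p \<ominus>\<^bsub>W\<^esub> \<sigma> (\<nu> (h p))) = proj L p) \<or>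
            (\<exists>t\<in>module_hom A P W. t ` carrier P \<subseteq> V2 \<and> (\<forall>m\<in>M. t m = \<zero>\<^bsub>W\<^esub>) \<and> (\<forall>s\<in>S. t s = h s \<ominus>\<^bsub>W\<^esub> \<sigma> (\<nu> (h s))))"
            by simp
          then show ?goal
          proof
            assume "\<exists>\<rho>\<in>module_hom A (sub W V2) (quot P L). \<forall>p\<in>carrier P. \<rho> (h p \<ominus>\<^bsub>W\<^esub> \<sigma> (\<nu> (h p))) = proj L p"
            then obtain \<rho> where rho: "\<rho> \<in> module_hom A (sub W V2) (quot P L)"
              "\<forall>p\<in>carrier P. \<rho> (h p \<ominus>\<^bsub>W\<^esub> \<sigma> (\<nu> (h p))) = proj L p" by (rule bexE)
            have m: "(\<lambda>v. v \<ominus>\<^bsub>W\<^esub> \<sigma> (\<nu> v)) \<in> module_hom A (sub W V) W"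
              by (rule hom_minus[OF W.lmodule_axioms hom_inclusion[OF W.lmodule_axioms V] hom_comp[OF nu sW]])
            have "(\<lambda>v. v \<ominus>\<^bsub>W\<^esub> \<sigma> (\<nu> v)) \<in> module_hom A (sub W V) (sub W V2)"
              using minV by (intro hom_into_sub[OF m]) auto
            from hom_comp[OF this rho(1)] rho(2) show ?goal by (intro disjI1 bexI)
          next
            assume "\<exists>t\<in>module_hom A P W. t ` carrier P \<subseteq> V2 \<and> (\<forall>m\<in>M. t m = \<zero>\<^bsub>W\<^esub>) \<and> (\<forall>s\<in>S. t s = h s \<ominus>\<^bsub>W\<^esub> \<sigma> (\<nu> (h s)))"
            then obtain t where t: "t \<in> module_hom A P W"
              "t ` carrier P \<subseteq> V2 \<and> (\<forall>m\<in>M. t m = \<zero>\<^bsub>W\<^esub>) \<and> (\<forall>s\<in>S. t s = h s \<ominus>\<^bsub>W\<^esub> \<sigma> (\<nu> (h s)))" by (rule bexE)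
            have "(\<lambda>p. t p \<oplus>\<^bsub>W\<^esub> \<sigma> (\<nu> (h p))) ` carrier P \<subseteq> V"
            proof
              fix y assume "y \<in> (\<lambda>p. t p \<oplus>\<^bsub>W\<^esub> \<sigma> (\<nu> (h p))) ` carrier P"
              then obtain p where p: "p \<in> carrier P" "y = t p \<oplus>\<^bsub>W\<^esub> \<sigma> (\<nu> (h p))" by (rule imageE)
              have "t p \<in> V" using t(2) p(1) V2lt by blast
              then show "y \<in> V" using p(2) W.lsub_add[OF V] sV[OF nh.closed[OF p(1)]] by simp
            qed
            moreover have "t m \<oplus>\<^bsub>W\<^esub> \<sigma> (\<nu> (h m)) = \<zero>\<^bsub>W\<^esub>" if "m \<in> M" for m
              using t(2) nhM[OF that] that sg.zero by simp
            moreover have "t s \<oplus>\<^bsub>W\<^esub> \<sigma> (\<nu> (h s)) = h s" if "s \<in> S" for s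
              using t(2) that h.closed[OF Sc[OF that]] sg.closed[OF nh.closed[OF Sc[OF that]]] by simp
            ultimately show ?goal
              by (intro disjI2 bexI[OF _ hom_add[OF W.lmodule_axioms t(1) th]]) simp
          qed
        qed
      qed
    qed
  qed
  then show ?thesis using h by simp
qed

end

context biserial_projective
begin

text \<open>For two submodules with intersection \<open>L\<close> and sum \<open>R\<close>, here
  \<open>S + L\<close> and \<open>M\<close>, there is the standard exact sequence from
  \<open>P/L\<close> through the sum of the two quotients to \<open>P/R\<close>. That it is left
  almost split follows from \<open>split_or_extend\<close> with the whole of \<open>W\<close> as
  \<open>V\<close>.\<close>

lemma almost_split_2:
  "\<exists>f g. almost_split_sequence A (quot P L) (dsum (quot P (S <+>\<^bsub>P\<^esub> L)) (quot P M)) (quot P R) f g"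
proof -
  let ?Q = "S <+>\<^bsub>P\<^esub> L"
  let ?X = "quot P L" and ?Y1 = "quot P ?Q" and ?Y2 = "quot P M" and ?Z = "quot P R"
  let ?Y = "dsum ?Y1 ?Y2"
  note fgX = fg_quot[OF fgP Lsub] and fgY1 = fg_quot[OF fgP SL] and fgY2 = fg_quot[OF fgP M] and fgZ = fg_quot[OF fgP R]
  have fgY: "fg_module A ?Y" by (rule fg_dsum[OF fgY1 fgY2])
  note pL = quot_hom[OF P.lmodule_axioms Lsub] and pQ = quot_hom[OF P.lmodule_axioms SL]
    and pM = quot_hom[OF P.lmodule_axioms M] and pR = quot_hom[OF P.lmodule_axioms R]
  note kL = quot_kernel[OF P.lmodule_axioms Lsub] and kQ = quot_kernel[OF P.lmodule_axioms SL]
    and kM = quot_kernel[OF P.lmodule_axioms M] and kR = quot_kernel[OF P.lmodule_axioms R]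
  interpret pL: lhom A P ?X "proj L" by (intro lhomI P.lmodule_axioms fg_lmodule fgX pL)
  interpret pQ: lhom A P ?Y1 "proj ?Q" by (intro lhomI P.lmodule_axioms fg_lmodule fgY1 pQ)
  interpret pM: lhom A P ?Y2 "proj M" by (intro lhomI P.lmodule_axioms fg_lmodule fgY2 pM)
  interpret pR: lhom A P ?Z "proj R" by (intro lhomI P.lmodule_axioms fg_lmodule fgZ pR)
  note Xl = pL.Y.lmodule_axioms and Y1l = pQ.Y.lmodule_axioms and Y2l = pM.Y.lmodule_axioms and Zl = pR.Y.lmodule_axioms
  interpret Y: lmodule A ?Y by (rule fg_lmodule[OF fgY])
  note Sc = P.lsub_carrier[OF S] and Mc = P.lsub_carrier[OF M] and Lc = P.lsub_carrier[OF Lsub]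
  have QM: "p \<in> L" if p: "p \<in> ?Q" "p \<in> M" for p
  proof -
    obtain s l where sl: "s \<in> S" "l \<in> L" "p = s \<oplus>\<^bsub>P\<^esub> l" using p(1) unfolding mem_set_add by blast
    have l: "l \<in> M" using sl L_le_M by blast
    have "s = p \<ominus>\<^bsub>P\<^esub> l" using sl(3) Sc[OF sl(1)] Lc[OF sl(2)] by simp
    then have "s \<in> M" using P.lsub_minus[OF M p(2) l] by metis
    then have "s = \<zero>\<^bsub>P\<^esub>" using S_M_disjoint sl(1) by blast
    then show ?thesis using sl Lc by simp
  qed
  obtain f where f: "f \<in> module_hom A ?X ?Y" "\<And>p. p \<in> carrier P \<Longrightarrow> f (proj L p) = (proj ?Q p, proj M p)"
  proof (rule quot_factor[OF P.lmodule_axioms Lsub Y.lmodule_axioms hom_pair[OF pQ pM]])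
    show "(proj ?Q x, proj M x) = \<zero>\<^bsub>?Y\<^esub>" if "x \<in> L" for x
      using kQ[OF Lc[OF that]] kM[OF Lc[OF that]] that L_le_M L_le_SL by auto
  qed (rule that)
  interpret f: lhom A ?X ?Y f by (intro lhomI Xl Y.lmodule_axioms f)
  obtain g1 where g1: "g1 \<in> module_hom A ?Y1 ?Z" "\<And>x. x \<in> carrier P \<Longrightarrow> g1 (proj ?Q x) = proj R x"
    by (rule proj_step[OF SL R SL_le_R]) (rule that)
  obtain g2 where g2: "g2 \<in> module_hom A ?Y2 ?Z" "\<And>x. x \<in> carrier P \<Longrightarrow> g2 (proj M x) = proj R x"
    by (rule proj_step[OF M R M_le_R]) (rule that)
  define g where "g = (\<lambda>y. g2 (snd y) \<ominus>\<^bsub>?Z\<^esub> g1 (fst y))"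
  have g: "g \<in> module_hom A ?Y ?Z"
    unfolding g_def by (rule hom_minus[OF Zl hom_comp[OF dsum_homs(2)[OF Y1l Y2l] g2(1)] hom_comp[OF dsum_homs(1)[OF Y1l Y2l] g1(1)]])
  have gp: "g (proj ?Q a, proj M b) = proj R b \<ominus>\<^bsub>?Z\<^esub> proj R a" if "a \<in> carrier P" "b \<in> carrier P" for a b
    using g1(2) g2(2) that by (simp add: g_def)
  have Ycases: "\<exists>a\<in>carrier P. \<exists>b\<in>carrier P. y = (proj ?Q a, proj M b)" if "y \<in> carrier ?Y" for y
    using that by (cases y) auto
  have Xcases: "\<exists>a\<in>carrier P. x = proj L a" if "x \<in> carrier ?X" for x
    using that by auto
  have finj: "inj_on f (carrier ?X)"
    unfolding f.inj_iff
  proof (intro ballI impI)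
    fix x assume x: "x \<in> carrier ?X" "f x = \<zero>\<^bsub>?Y\<^esub>"
    then obtain p where p: "p \<in> carrier P" "x = proj L p" using Xcases by blast
    then have "proj ?Q p = \<zero>\<^bsub>?Y1\<^esub>" "proj M p = \<zero>\<^bsub>?Y2\<^esub>" using f(2)[OF p(1)] x(2) by simp_all
    then have "p \<in> L" using kQ[OF p(1)] kM[OF p(1)] QM by blast
    then show "x = \<zero>\<^bsub>?X\<^esub>" using p(2) kL[OF p(1)] by blast
  qed
  have ex: "f ` carrier ?X = {y \<in> carrier ?Y. g y = \<zero>\<^bsub>?Z\<^esub>}"
  proof (intro equalityI subsetI)
    fix y assume "y \<in> f ` carrier ?X"
    then obtain x where x: "x \<in> carrier ?X" "y = f x" by (rule imageE)
    then obtain p where p: "p \<in> carrier P" "x = proj L p" using Xcases by blast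
    have "g y = \<zero>\<^bsub>?Z\<^esub>"
      using x(2) p f(2)[OF p(1)] gp[OF p(1) p(1)] pR.Y.M.minus_eq_zero_iff[OF pR.closed[OF p(1)] pR.closed[OF p(1)]] by simp
    then show "y \<in> {y \<in> carrier ?Y. g y = \<zero>\<^bsub>?Z\<^esub>}" using f.closed[OF x(1)] x(2) by blast
  next
    fix y assume y: "y \<in> {y \<in> carrier ?Y. g y = \<zero>\<^bsub>?Z\<^esub>}"
    then obtain a b where ab: "a \<in> carrier P" "b \<in> carrier P" "y = (proj ?Q a, proj M b)" using Ycases by blast
    have "proj R b \<ominus>\<^bsub>?Z\<^esub> proj R a = \<zero>\<^bsub>?Z\<^esub>" using y gp[OF ab(1,2)] ab(3) by simp
    then have "proj R (b \<ominus>\<^bsub>P\<^esub> a) = \<zero>\<^bsub>?Z\<^esub>" using pR.minus[OF ab(2,1)] by simp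
    then have "b \<ominus>\<^bsub>P\<^esub> a \<in> R" using kR ab by blast
    \<comment> \<open>Splitting \<open>b - a\<close> as \<open>s + m\<close> gives the common
      representative \<open>a + s\<close>: it agrees with \<open>a\<close> modulo
      \<open>S + L\<close> and with \<open>b\<close> modulo \<open>M\<close>.\<close>
    then obtain s m where sm: "s \<in> S" "m \<in> M" "b \<ominus>\<^bsub>P\<^esub> a = s \<oplus>\<^bsub>P\<^esub> m" unfolding mem_set_add by blast
    note c = Sc[OF sm(1)] Mc[OF sm(2)]
    have "b = (b \<ominus>\<^bsub>P\<^esub> a) \<oplus>\<^bsub>P\<^esub> a" using ab by simp
    then have b: "b = (a \<oplus>\<^bsub>P\<^esub> s) \<oplus>\<^bsub>P\<^esub> m" using sm(3) c ab by (simp add: P.M.add.m_ac)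
    have "(a \<oplus>\<^bsub>P\<^esub> s) \<ominus>\<^bsub>P\<^esub> a \<in> ?Q" using sm(1) S_le_SL ab c by auto
    then have e1: "proj ?Q (a \<oplus>\<^bsub>P\<^esub> s) = proj ?Q a"
      by (rule iffD2[OF coset_eq_iff[OF P.lmodule_axioms SL P.M.a_closed[OF ab(1) c(1)] ab(1)]])
    have "b \<ominus>\<^bsub>P\<^esub> (a \<oplus>\<^bsub>P\<^esub> s) \<in> M" using b sm(2) ab c by simp
    then have e2: "proj M b = proj M (a \<oplus>\<^bsub>P\<^esub> s)"
      by (rule iffD2[OF coset_eq_iff[OF P.lmodule_axioms M ab(2) P.M.a_closed[OF ab(1) c(1)]]])
    have "y = f (proj L (a \<oplus>\<^bsub>P\<^esub> s))" using f(2)[OF P.M.a_closed[OF ab(1) c(1)]] ab(3) e1 e2 by metis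
    moreover have "proj L (a \<oplus>\<^bsub>P\<^esub> s) \<in> carrier ?X" using pL.closed[of "a \<oplus>\<^bsub>P\<^esub> s"] ab c by blast
    ultimately show "y \<in> f ` carrier ?X" by (rule image_eqI)
  qed
  have onto: "g ` carrier ?Y = carrier ?Z"
  proof
    show "g ` carrier ?Y \<subseteq> carrier ?Z" using g by (auto simp: module_hom_iff)
    show "carrier ?Z \<subseteq> g ` carrier ?Y"
    proof
      fix z assume "z \<in> carrier ?Z"
      then obtain p where p: "p \<in> carrier P" "z = proj R p" by auto
      have "g (proj ?Q \<zero>\<^bsub>P\<^esub>, proj M p) = proj R p \<ominus>\<^bsub>?Z\<^esub> \<zero>\<^bsub>?Z\<^esub>" using gp[OF P.M.zero_closed p(1)] pR.zero by metis
      also have "\<dots> = proj R p"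
        using pR.Y.M.minus_add_cancel(3)[OF pR.closed[OF p(1)] pR.Y.M.zero_closed] pR.Y.M.r_zero[OF pR.closed[OF p(1)]] by metis
      finally have "z = g (proj ?Q \<zero>\<^bsub>P\<^esub>, proj M p)" using p(2) by simp
      moreover have "(proj ?Q \<zero>\<^bsub>P\<^esub>, proj M p) \<in> carrier ?Y"
        using pQ.closed[OF P.M.zero_closed] pM.closed[OF p(1)] by simp
      ultimately show "z \<in> g ` carrier ?Y" by (rule image_eqI)
    qed
  qed
  have RR: "submodule (proj L ` R) A ?X" by (rule pL.image_submodule[OF R])
  have LR: "L \<subseteq> R" using L_le_M M_le_R by blast
  \<comment> \<open>An endomorphism of \<open>P/L\<close> that does not land in the radical is onto
    and hence injective; stated for the composite from \<open>P\<close>, its kernel lies in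
    \<open>L\<close>.\<close>
  have inj_endo: "x \<in> L"
    if r: "r \<in> module_hom A P ?X" "\<And>l. l \<in> L \<Longrightarrow> r l = \<zero>\<^bsub>?X\<^esub>" "\<not> r ` carrier P \<subseteq> proj L ` R"
      and x: "x \<in> carrier P" "r x = \<zero>\<^bsub>?X\<^esub>" for r x
  proof -
    obtain v where v: "v \<in> module_hom A ?X ?X" "\<And>p. p \<in> carrier P \<Longrightarrow> v (proj L p) = r p"
      by (rule quot_factor[OF P.lmodule_axioms Lsub Xl r(1,2)]) (assumption, rule that)
    interpret v: lhom A ?X ?X v by (intro lhomI Xl v)
    have "v ` carrier ?X = r ` carrier P" using v(2) by (simp add: image_image)
    then have "v ` carrier ?X = carrier ?X"
      using quot_proper[OF Lsub LR v.image_submodule[OF pL.Y.lsub_top]] r(3) by metis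
    then have "inj_on v (carrier ?X)" by (rule surj_endo_inj[OF fgX v(1)])
    then have "proj L x = \<zero>\<^bsub>?X\<^esub>" using bspec[OF iffD1[OF v.inj_iff] pL.closed[OF x(1)]] v(2)[OF x(1)] x(2) by metis
    then show ?thesis using kL[OF x(1)] by blast
  qed
  have nsm: "\<not> split_mono A ?X ?Y f"
  proof
    assume "split_mono A ?X ?Y f"
    then obtain r where r: "r \<in> module_hom A ?Y ?X" "\<And>x. x \<in> carrier ?X \<Longrightarrow> r (f x) = x"
      unfolding split_mono_def by blast
    interpret r: lhom A ?Y ?X r by (intro lhomI Y.lmodule_axioms Xl r)
    have r1: "(\<lambda>p. r (proj ?Q p, \<zero>\<^bsub>?Y2\<^esub>)) \<in> module_hom A P ?X"
      by (rule hom_comp[OF hom_comp[OF pQ dsum_homs(3)[OF Y1l Y2l]] r(1)])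
    have r2: "(\<lambda>p. r (\<zero>\<^bsub>?Y1\<^esub>, proj M p)) \<in> module_hom A P ?X"
      by (rule hom_comp[OF hom_comp[OF pM dsum_homs(4)[OF Y1l Y2l]] r(1)])
    have sum: "r (proj ?Q p, \<zero>\<^bsub>?Y2\<^esub>) \<oplus>\<^bsub>?X\<^esub> r (\<zero>\<^bsub>?Y1\<^esub>, proj M p) = proj L p" if p: "p \<in> carrier P" for p
    proof -
      note c = pQ.closed[OF p] pM.closed[OF p] pQ.Y.M.zero_closed pM.Y.M.zero_closed
      have "r (proj ?Q p, \<zero>\<^bsub>?Y2\<^esub>) \<oplus>\<^bsub>?X\<^esub> r (\<zero>\<^bsub>?Y1\<^esub>, proj M p)
          = r ((proj ?Q p, \<zero>\<^bsub>?Y2\<^esub>) \<oplus>\<^bsub>?Y\<^esub> (\<zero>\<^bsub>?Y1\<^esub>, proj M p))"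
        using c by (intro r.add[symmetric]) (simp_all del: quot_simps)
      also have "(proj ?Q p, \<zero>\<^bsub>?Y2\<^esub>) \<oplus>\<^bsub>?Y\<^esub> (\<zero>\<^bsub>?Y1\<^esub>, proj M p) = (proj ?Q p, proj M p)"
        using c by (simp del: quot_simps)
      also have "\<dots> = f (proj L p)" using f(2)[OF p] by simp
      finally show ?thesis using r(2)[OF pL.closed[OF p]] by simp
    qed
    have zero: "r (\<zero>\<^bsub>?Y1\<^esub>, \<zero>\<^bsub>?Y2\<^esub>) = \<zero>\<^bsub>?X\<^esub>" using r.zero by simp
    \<comment> \<open>The two components of a retraction add up to the projection onto
      \<open>P/L\<close>. That module is local, so one component is not inside the radical, and by
      \<open>inj_endo\<close> its kernel lies in \<open>L\<close>; but the components kill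
      \<open>S\<close> and \<open>M\<close>, respectively.\<close>
    consider "\<not> (\<lambda>p. r (proj ?Q p, \<zero>\<^bsub>?Y2\<^esub>)) ` carrier P \<subseteq> proj L ` R"
      | "\<not> (\<lambda>p. r (\<zero>\<^bsub>?Y1\<^esub>, proj M p)) ` carrier P \<subseteq> proj L ` R"
    proof -
      have False if a: "(\<lambda>p. r (proj ?Q p, \<zero>\<^bsub>?Y2\<^esub>)) ` carrier P \<subseteq> proj L ` R"
        and b: "(\<lambda>p. r (\<zero>\<^bsub>?Y1\<^esub>, proj M p)) ` carrier P \<subseteq> proj L ` R"
      proof -
        have "p \<in> R" if p: "p \<in> carrier P" for p
        proof -
          have "proj L p \<in> proj L ` R"
            using pL.Y.lsub_add[OF RR subsetD[OF a imageI[OF p]] subsetD[OF b imageI[OF p]]] sum[OF p] by simp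
          then obtain x where x: "x \<in> R" "proj L p = proj L x" by (rule imageE)
          have xc: "x \<in> carrier P" using x(1) P.lsub_carrier[OF R] by blast
          have "p \<ominus>\<^bsub>P\<^esub> x \<in> L" using coset_eq_iff[OF P.lmodule_axioms Lsub p xc] x(2) by blast
          then have "(p \<ominus>\<^bsub>P\<^esub> x) \<oplus>\<^bsub>P\<^esub> x \<in> R" using LR x(1) by (intro P.lsub_add[OF R]) auto
          then show ?thesis using p xc by simp
        qed
        then show False using proper P.lsub_subset[OF R] by blast
      qed
      then show thesis using that by blast
    qed
    then show False
    proof cases
      case 1
      have k: "r (proj ?Q x, \<zero>\<^bsub>?Y2\<^esub>) = \<zero>\<^bsub>?X\<^esub>" if "x \<in> ?Q" for x
      proof -
        have "proj ?Q x = \<zero>\<^bsub>?Y1\<^esub>" using kQ[OF P.lsub_carrier[OF SL that]] that by blast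
        then show ?thesis using zero by metis
      qed
      have "s \<in> L" if "s \<in> S" for s
        by (rule inj_endo[OF r1 k 1 Sc[OF that] k]) (use that S_le_SL L_le_SL in auto)
      then show False using S_not_le_M L_le_M by blast
    next
      case 2
      have k: "r (\<zero>\<^bsub>?Y1\<^esub>, proj M x) = \<zero>\<^bsub>?X\<^esub>" if "x \<in> M" for x
      proof -
        have "proj M x = \<zero>\<^bsub>?Y2\<^esub>" using kM[OF Mc[OF that]] that by blast
        then show ?thesis using zero by metis
      qed
      have "m \<in> L" if "m \<in> M" for m
        by (rule inj_endo[OF r2 k 2 Mc[OF that] k]) (use that L_le_M in auto)
      then show False using LM L_le_M by blast
    qed
  qed
  obtain e where e: "e \<in> module_hom A ?X ?Y2" "\<And>x. x \<in> carrier P \<Longrightarrow> e (proj L x) = proj M x"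
    by (rule proj_step[OF Lsub M L_le_M]) (rule that)
  have rase: "right_almost_split A ?X ?Y2 e"
    using almost_split_1[OF e] unfolding almost_split_sequence_def by blast
  have las: "left_almost_split A ?X ?Y f"
    unfolding left_almost_split_def
  proof (intro conjI allI impI f nsm)
    fix W :: "'a fgmod" and h
    assume W: "fg_module A W" and h: "h \<in> module_hom A ?X W" and nsh: "\<not> split_mono A ?X W h"
    interpret h: lhom A ?X W h by (intro lhomI Xl fg_lmodule W h)
    note Wl = h.Y.lmodule_axioms
    note hp = hom_comp[OF pL h]
    interpret hp: lhom A P W "\<lambda>p. h (proj L p)" by (intro lhomI P.lmodule_axioms Wl hp)
    have hL: "h (proj L x) = \<zero>\<^bsub>W\<^esub>" if "x \<in> L" for x
    proof -
      have "proj L x = \<zero>\<^bsub>?X\<^esub>" using kL[OF Lc[OF that]] that by blast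
      then show ?thesis using h.zero by metis
    qed
    have im: "(\<lambda>p. h (proj L p)) ` carrier P \<subseteq> carrier W" using hp.closed by blast
    have "\<not> (\<exists>\<rho>\<in>module_hom A W ?X. \<forall>p\<in>carrier P. \<rho> (h (proj L p)) = proj L p)"
    proof
      assume "\<exists>\<rho>\<in>module_hom A W ?X. \<forall>p\<in>carrier P. \<rho> (h (proj L p)) = proj L p"
      then obtain \<rho> where "\<rho> \<in> module_hom A W ?X" "\<forall>p\<in>carrier P. \<rho> (h (proj L p)) = proj L p" by (rule bexE)
      then have "split_mono A ?X W h" unfolding split_mono_def by (intro bexI[of _ \<rho>]) auto
      then show False using nsh by simp
    qed
    with split_or_extend[OF rase e(2) W h.Y.lsub_top hp im hL]
    obtain t2 where t2: "t2 \<in> module_hom A P W"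
      "t2 ` carrier P \<subseteq> carrier W \<and> (\<forall>m\<in>M. t2 m = \<zero>\<^bsub>W\<^esub>) \<and> (\<forall>s\<in>S. t2 s = h (proj L s))"
      by (auto elim!: bexE)
    \<comment> \<open>The difference of \<open>h\<close> and \<open>t2\<close> kills
      \<open>S\<close> and \<open>L\<close>, while \<open>t2\<close> kills \<open>M\<close>; so the
      two parts of \<open>h\<close> factor through the two summands of the middle term.\<close>
    have t1: "(\<lambda>p. h (proj L p) \<ominus>\<^bsub>W\<^esub> t2 p) \<in> module_hom A P W" by (rule hom_minus[OF Wl hp t2(1)])
    interpret t1: lhom A P W "\<lambda>p. h (proj L p) \<ominus>\<^bsub>W\<^esub> t2 p" by (intro lhomI P.lmodule_axioms Wl t1)
    obtain T2 where T2: "T2 \<in> module_hom A ?Y2 W" "\<And>x. x \<in> carrier P \<Longrightarrow> T2 (proj M x) = t2 x"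
    proof (rule quot_factor[OF P.lmodule_axioms M Wl t2(1)])
      show "t2 x = \<zero>\<^bsub>W\<^esub>" if "x \<in> M" for x using t2(2) that by blast
    qed (rule that)
    have z1: "h (proj L x) \<ominus>\<^bsub>W\<^esub> t2 x = \<zero>\<^bsub>W\<^esub>" if "x \<in> S \<or> x \<in> L" for x
    proof -
      have "x \<in> carrier P" using that Sc Lc by blast
      moreover have "h (proj L x) = t2 x"
        using that t2(2) hL L_le_M by (metis subsetD)
      ultimately show ?thesis using hp.closed[of x] h.Y.M.minus_eq_zero_iff by metis
    qed
    obtain T1 where T1: "T1 \<in> module_hom A ?Y1 W" "\<And>x. x \<in> carrier P \<Longrightarrow> T1 (proj ?Q x) = h (proj L x) \<ominus>\<^bsub>W\<^esub> t2 x"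
    proof (rule quot_factor[OF P.lmodule_axioms SL Wl t1])
      show "h (proj L x) \<ominus>\<^bsub>W\<^esub> t2 x = \<zero>\<^bsub>W\<^esub>" if "x \<in> ?Q" for x
      proof -
        obtain s l where sl: "s \<in> S" "l \<in> L" "x = s \<oplus>\<^bsub>P\<^esub> l" using \<open>x \<in> ?Q\<close> unfolding mem_set_add by blast
        show ?thesis using t1.add[OF Sc[OF sl(1)] Lc[OF sl(2)]] z1[of s] z1[of l] sl by simp
      qed
    qed (rule that)
    note T = hom_add[OF Wl hom_comp[OF dsum_homs(1)[OF Y1l Y2l] T1(1)] hom_comp[OF dsum_homs(2)[OF Y1l Y2l] T2(1)]]
    have "T1 (fst (f x)) \<oplus>\<^bsub>W\<^esub> T2 (snd (f x)) = h x" if x: "x \<in> carrier ?X" for x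
    proof -
      obtain p where p: "p \<in> carrier P" "x = proj L p" using Xcases[OF x] by blast
      have "t2 p \<in> carrier W" using t2(2) p(1) by blast
      then show ?thesis using f(2)[OF p(1)] T1(2)[OF p(1)] T2(2)[OF p(1)] p(2) hp.closed[OF p(1)] by simp
    qed
    then show "\<exists>t\<in>module_hom A ?Y W. \<forall>x\<in>carrier ?X. t (f x) = h x"
      by (intro bexI[OF _ T]) simp
  qed
  have ras: "right_almost_split A ?Y ?Z g"
    by (rule left_almost_split_imp_right[OF fgX fgY fgZ f(1) g finj ex onto las quot_endo[OF R LR subset_refl]])
  have "almost_split_sequence A ?X ?Y ?Z f g"
    unfolding almost_split_sequence_def by (intro conjI fgX fgY fgZ f(1) g finj ex onto las ras)
  then show ?thesis by blast
qed

end

section \<open>Simple submodules and the socle of P\<close>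

lemma covered_sub_iff:
  assumes "lmodule A W" "submodule K A W"
  shows "covered A (sub W K) C D \<longleftrightarrow> covered A W C D \<and> D \<subseteq> K"
  unfolding covered_def submodule_sub_iff[OF assms] by blast

lemma simple_module_iff:
  "simple_module A X \<longleftrightarrow> lmodule A X \<and> covered A X {\<zero>\<^bsub>X\<^esub>} (carrier X)"
proof (cases "lmodule A X")
  case True
  interpret X: lmodule A X by (rule True)
  have "{\<zero>\<^bsub>X\<^esub>} \<subset> carrier X \<longleftrightarrow> carrier X \<noteq> {\<zero>\<^bsub>X\<^esub>}" by auto
  moreover have "{\<zero>\<^bsub>X\<^esub>} \<subseteq> N \<and> N \<subseteq> carrier X" if "submodule N A X" for N
    using X.lsub_zero[OF that] X.lsub_subset[OF that] by simp
  ultimately show ?thesis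
    unfolding simple_module_def covered_def using X.lsub_bot X.lsub_top True by metis
qed (simp add: simple_module_def)

lemma simple_sub_iff:
  assumes "lmodule A W" "submodule K A W"
  shows "simple_module A (sub W K) \<longleftrightarrow> covered A W {\<zero>\<^bsub>W\<^esub>} K"
  using lmodule.sub_lmodule[OF assms] by (simp add: simple_module_iff covered_sub_iff[OF assms])

text \<open>A simple submodule \<open>N\<close> lies in \<open>R\<close>. The sum
  \<open>N + S\<close> has zero radical and so cannot contain \<open>M\<close>; its intersection
  with \<open>M\<close> is thus inside \<open>L\<close>, which puts \<open>N\<close> inside
  \<open>S + L\<close>.\<close>

lemma (in biserial_projective) socle_eq: "socle A P = S <+>\<^bsub>P\<^esub> L"
proof
  have "N \<subseteq> S <+>\<^bsub>P\<^esub> L" if N: "submodule N A P" "simple_module A (sub P N)" for N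
  proof -
    have cov: "covered A P {\<zero>\<^bsub>P\<^esub>} N" using N simple_sub_iff[OF P.lmodule_axioms N(1)] by simp
    have "N \<noteq> carrier P"
    proof
      assume e: "N = carrier P"
      then have "S = N" using cov S P.lsub_zero[OF S] P.lsub_subset[OF S] S_nz unfolding covered_def by auto
      then show False using e proper S_le_R P.lsub_subset[OF R] by auto
    qed
    then have NR: "N \<subseteq> R" by (rule local[OF N(1)])
    note NS = P.lsub_sum[OF N(1) S]
    let ?N = "(N <+>\<^bsub>P\<^esub> S) \<inter> M"
    have "rd A P N = {\<zero>\<^bsub>P\<^esub>}"
      using P.rd_covered[OF cov] P.lsub_zero[OF P.rd_submodule[OF P.lsub_subset[OF N(1)]]] by auto
    then have "rd A P (N <+>\<^bsub>P\<^esub> S) = {\<zero>\<^bsub>P\<^esub>} <+>\<^bsub>P\<^esub> {\<zero>\<^bsub>P\<^esub>}" using P.rd_sum[OF N(1) S] rdS by simp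
    then have r0: "rd A P (N <+>\<^bsub>P\<^esub> S) \<subseteq> {\<zero>\<^bsub>P\<^esub>}" by (auto simp: mem_set_add)
    have sN: "submodule ?N A P" by (rule P.lsub_inter[OF NS M])
    have "?N \<noteq> M"
    proof
      assume "?N = M"
      then have "L \<subseteq> rd A P (N <+>\<^bsub>P\<^esub> S)" by (intro P.rd_mono P.lsub_subset[OF NS]) auto
      then show False using r0 L_nz P.lsub_zero[OF Lsub] by auto
    qed
    with subM[OF sN Int_lower2] have "?N = {\<zero>\<^bsub>P\<^esub>} \<or> ?N = L" by metis
    then have NL: "?N \<subseteq> L" using P.lsub_zero[OF Lsub] by (elim disjE) simp_all
    show ?thesis
    proof
      fix n assume n: "n \<in> N"
      then obtain s m where sm: "s \<in> S" "m \<in> M" "n = s \<oplus>\<^bsub>P\<^esub> m" using subsetD[OF NR] unfolding mem_set_add by blast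
      have c: "s \<in> carrier P" "m \<in> carrier P" using sm P.lsub_carrier[OF S] P.lsub_carrier[OF M] by auto
      have "m = n \<oplus>\<^bsub>P\<^esub> (\<ominus>\<^bsub>P\<^esub> s)" using sm(3) c P.M.minus_add_cancel(4)[OF c(2,1)] by (simp add: a_minus_def)
      then have "m \<in> N <+>\<^bsub>P\<^esub> S" using n P.lsub_uminus[OF S sm(1)] unfolding mem_set_add by blast
      then have "m \<in> L" using NL sm(2) by blast
      then show "n \<in> S <+>\<^bsub>P\<^esub> L" using sm unfolding mem_set_add by blast
    qed
  qed
  then show "socle A P \<subseteq> S <+>\<^bsub>P\<^esub> L"
    unfolding socle_def by (intro P.span_least SL) blast
  have U: "\<Union>{N. submodule N A P \<and> simple_module A (sub P N)} \<subseteq> carrier P" using P.lsub_subset by blast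
  have "N \<subseteq> socle A P" if "covered A P {\<zero>\<^bsub>P\<^esub>} N" for N
  proof -
    have "submodule N A P" using that by (simp add: covered_def)
    then have "N \<in> {N. submodule N A P \<and> simple_module A (sub P N)}"
      using that simple_sub_iff[OF P.lmodule_axioms] by simp
    then show ?thesis unfolding socle_def using P.span_upper by fast
  qed
  then show "S <+>\<^bsub>P\<^esub> L \<subseteq> socle A P"
    using simpleS simpleL P.span_submodule[OF U] unfolding socle_def by (intro P.lsum_least) auto
qed

section \<open>Quadri-biserial algebras\<close>

lemma image_preimage:
  assumes "f ` C = D" "N \<subseteq> D" shows "f ` {x \<in> C. f x \<in> N} = N"
proof (intro equalityI subsetI)
  fix n assume n: "n \<in> N"
  then have "n \<in> f ` C" using assms by blast
  then obtain x where "x \<in> C" "n = f x" by (rule imageE)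
  then show "n \<in> f ` {x \<in> C. f x \<in> N}" using n by auto
qed auto

lemma covered_image:
  assumes "lhom A X Y f" "bij_betw f (carrier X) (carrier Y)" "covered A X C D"
  shows "covered A Y (f ` C) (f ` D)"
proof -
  interpret lhom A X Y f by fact
  have inj: "inj_on f (carrier X)" and onto: "f ` carrier X = carrier Y" using assms(2) by (auto simp: bij_betw_def)
  have CD: "submodule C A X" "submodule D A X" "C \<subset> D"
    and max: "\<And>N. submodule N A X \<Longrightarrow> C \<subseteq> N \<Longrightarrow> N \<subseteq> D \<Longrightarrow> N = C \<or> N = D"
    using assms(3) by (auto simp: covered_def)
  note c = X.lsub_subset[OF CD(1)] X.lsub_subset[OF CD(2)]
  have "f ` C \<noteq> f ` D" using inj_on_image_eq_iff[OF inj c] CD(3) by blast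
  moreover have "N = f ` C \<or> N = f ` D" if N: "submodule N A Y" "f ` C \<subseteq> N" "N \<subseteq> f ` D" for N
  proof -
    let ?N = "{x \<in> carrier X. f x \<in> N}"
    have eq: "f ` ?N = N" by (rule image_preimage[OF onto Y.lsub_subset[OF N(1)]])
    have "C \<subseteq> ?N" using N(2) c by blast
    moreover have "?N \<subseteq> D"
    proof
      fix x assume x: "x \<in> ?N"
      then obtain d where "d \<in> D" "f x = f d" using N(3) by blast
      then show "x \<in> D" using inj_onD[OF inj, of x d] x c by auto
    qed
    ultimately have "?N = C \<or> ?N = D" by (rule max[OF preimage_submodule[OF N(1)]])
    then show ?thesis using eq by metis
  qed
  ultimately show ?thesis using CD by (auto simp: covered_def image_submodule)
qed

lemma uniserial_image:
  assumes "lhom A X Y f" "f ` carrier X = carrier Y" "uniserial A X" shows "uniserial A Y"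
  unfolding uniserial_def
proof (intro conjI allI impI)
  interpret lhom A X Y f by fact
  show "lmodule A Y" by (rule Y.lmodule_axioms)
  fix N K assume N: "submodule N A Y" and K: "submodule K A Y"
  have "{x \<in> carrier X. f x \<in> N} \<subseteq> {x \<in> carrier X. f x \<in> K} \<or> {x \<in> carrier X. f x \<in> K} \<subseteq> {x \<in> carrier X. f x \<in> N}"
    using assms(3) preimage_submodule[OF N] preimage_submodule[OF K] unfolding uniserial_def by blast
  then have "f ` {x \<in> carrier X. f x \<in> N} \<subseteq> f ` {x \<in> carrier X. f x \<in> K} \<or>
      f ` {x \<in> carrier X. f x \<in> K} \<subseteq> f ` {x \<in> carrier X. f x \<in> N}"
    by (elim disjE) (simp_all add: image_mono)
  then show "N \<subseteq> K \<or> K \<subseteq> N"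
    by (simp only: image_preimage[OF assms(2) Y.lsub_subset] N K)
qed

lemma has_length_iso:
  assumes "lhom A X Y f" "bij_betw f (carrier X) (carrier Y)" "has_length A X n" shows "has_length A Y n"
proof -
  interpret lhom A X Y f by fact
  obtain C where C: "C 0 = {\<zero>\<^bsub>X\<^esub>}" "C n = carrier X" "\<forall>i\<le>n. submodule (C i) A X" "\<forall>i<n. covered A X (C i) (C (Suc i))"
    using assms(3) unfolding has_length_iff by blast
  have "f ` carrier X = carrier Y" using assms(2) by (simp add: bij_betw_def)
  then show ?thesis
    unfolding has_length_iff using C covered_image[OF assms(1,2)] image_submodule Y.lmodule_axioms
    by (intro conjI exI[of _ "\<lambda>i. f ` C i"]) auto
qed

lemma (in lmodule) regular_fg: "fg_module R (scalar_module R id)"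
proof -
  interpret A: lmodule R "scalar_module R id" by (rule regular_lmodule[OF R.ring_axioms])
  have s: "submodule (submodule_span R (scalar_module R id) {\<one>}) R (scalar_module R id)"
    by (rule A.span_submodule) simp
  have "\<one> \<in> submodule_span R (scalar_module R id) {\<one>}" using A.span_upper[of "{\<one>}"] by simp
  then have "a \<in> submodule_span R (scalar_module R id) {\<one>}" if "a \<in> carrier R" for a
    using A.lsub_smult[OF s that] that by fastforce
  then have "submodule_span R (scalar_module R id) {\<one>} = carrier R" using A.lsub_subset[OF s] by auto
  then show ?thesis
    unfolding fg_module_def using A.lmodule_axioms by (intro conjI exI[of _ "{\<one>}"]) simp_all
qed

text \<open>The regular module is a finite sum of images of indecomposable projectives, so
  composition series for these are enough. This is where condition (a) makes \<open>A\<close> a ring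
  of finite length.\<close>

lemma (in left_artinian) finite_length_ringI:
  assumes "\<And>Y :: 'a fgmod. projective_module A Y \<Longrightarrow> indecomposable A Y \<Longrightarrow> \<exists>n. has_length A Y n"
  shows "finite_length_ring A"
proof -
  interpret R: lmodule A "scalar_module A id" by (rule regular_lmodule[OF ring_axioms])
  have "fin_len A (scalar_module A id) (carrier (scalar_module A id))"
  proof (rule module_induct[OF R.regular_fg R.fin_len_bot _ R.fin_len_sum])
    fix Y :: "'a fgmod" and f
    assume Y: "projective_module A Y" "indecomposable A Y" and f: "f \<in> module_hom A Y (scalar_module A id)"
    have "lmodule A Y" using Y(2) by (simp add: indecomposable_def)
    then have "lhom A Y (scalar_module A id) f" by (intro lhomI R.lmodule_axioms f)
    moreover have "fin_len A Y (carrier Y)" using assms[OF Y] has_length_fin_len by blast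
    ultimately show "fin_len A (scalar_module A id) (f ` carrier Y)" by (rule fin_len_image)
  qed
  then show ?thesis by unfold_locales simp
qed

text \<open>The intersection of \<open>X1\<close> and \<open>X2\<close> is zero, as a smallest
  nonzero submodule would lie in both \<open>S\<close> and \<open>M\<close>. Their sum is not
  \<open>P\<close>, by indecomposability, so it is the largest proper submodule. It equals the
  radical because a complement of it modulo the radical cannot be proper.\<close>

lemma (in left_artinian) biserial_radical:
  assumes P: "biserial_module A P"
    and dec: "direct_decomp A P (rad_pow A 1 P) S M" and nz: "S \<noteq> {\<zero>\<^bsub>P\<^esub>}" "M \<noteq> {\<zero>\<^bsub>P\<^esub>}"
  shows "rd A P (carrier P) = S <+>\<^bsub>P\<^esub> M" "S <+>\<^bsub>P\<^esub> M \<noteq> carrier P"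
    "submodule N A P \<Longrightarrow> N \<noteq> carrier P \<Longrightarrow> N \<subseteq> S <+>\<^bsub>P\<^esub> M"
proof -
  have fg: "fg_module A P" and ind: "indecomposable A P" using P by (auto simp: biserial_module_def)
  interpret P: lmodule A P by (rule fg_lmodule[OF fg])
  have S: "submodule S A P" and M: "submodule M A P" and SM: "S \<inter> M = {\<zero>\<^bsub>P\<^esub>}"
    and eq: "rd A P (carrier P) = S <+>\<^bsub>P\<^esub> M"
    using dec unfolding direct_decomp_def P.rad_pow_1 by auto
  obtain X1 X2 where X: "submodule X1 A P" "submodule X2 A P" "\<not> X1 \<subseteq> X2" "\<not> X2 \<subseteq> X1"
    and sum: "X1 <+>\<^bsub>P\<^esub> X2 = carrier P \<or>
       (submodule (X1 <+>\<^bsub>P\<^esub> X2) A P \<and> X1 <+>\<^bsub>P\<^esub> X2 \<noteq> carrier P \<and>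
        (\<forall>N. submodule N A P \<longrightarrow> N \<noteq> carrier P \<longrightarrow> N \<subseteq> X1 <+>\<^bsub>P\<^esub> X2))"
    and int: "X1 \<inter> X2 = {\<zero>\<^bsub>P\<^esub>} \<or>
       (submodule (X1 \<inter> X2) A P \<and> X1 \<inter> X2 \<noteq> {\<zero>\<^bsub>P\<^esub>} \<and>
        (\<forall>N. submodule N A P \<longrightarrow> N \<noteq> {\<zero>\<^bsub>P\<^esub>} \<longrightarrow> X1 \<inter> X2 \<subseteq> N))"
    using P unfolding biserial_module_def by (elim conjE exE) (rule that; assumption)
  have i0: "X1 \<inter> X2 = {\<zero>\<^bsub>P\<^esub>}"
  proof (rule ccontr)
    assume ne: "X1 \<inter> X2 \<noteq> {\<zero>\<^bsub>P\<^esub>}"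
    with int have "\<forall>N. submodule N A P \<longrightarrow> N \<noteq> {\<zero>\<^bsub>P\<^esub>} \<longrightarrow> X1 \<inter> X2 \<subseteq> N" by (elim disjE conjE) simp_all
    then have "X1 \<inter> X2 \<subseteq> S" "X1 \<inter> X2 \<subseteq> M" using S M nz by blast+
    then have "X1 \<inter> X2 \<subseteq> {\<zero>\<^bsub>P\<^esub>}" using SM by blast
    then show False using ne P.lsub_zero[OF P.lsub_inter[OF X(1,2)]] by blast
  qed
  have "X1 <+>\<^bsub>P\<^esub> X2 \<noteq> carrier P"
  proof
    assume "X1 <+>\<^bsub>P\<^esub> X2 = carrier P"
    then have "direct_decomp A P (carrier P) X1 X2" using X i0 by (simp add: direct_decomp_def)
    then have "X1 = {\<zero>\<^bsub>P\<^esub>} \<or> X2 = {\<zero>\<^bsub>P\<^esub>}" using ind by (simp add: indecomposable_def)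
    then show False using X P.lsub_zero[OF X(1)] P.lsub_zero[OF X(2)] by auto
  qed
  with sum have N0: "submodule (X1 <+>\<^bsub>P\<^esub> X2) A P" "X1 <+>\<^bsub>P\<^esub> X2 \<noteq> carrier P"
    and max: "\<And>N. submodule N A P \<Longrightarrow> N \<noteq> carrier P \<Longrightarrow> N \<subseteq> X1 <+>\<^bsub>P\<^esub> X2" by blast+
  let ?N = "X1 <+>\<^bsub>P\<^esub> X2"
  have "covered A P ?N (carrier P)"
    unfolding covered_def
  proof (intro conjI allI impI)
    show "?N \<subset> carrier P" using P.lsub_subset[OF N0(1)] N0(2) by blast
    show "D = ?N \<or> D = carrier P" if "submodule D A P" "?N \<subseteq> D" "D \<subseteq> carrier P" for D
      using max[OF that(1)] that(2) by blast
  qed (use N0 P.lsub_top in auto)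
  then have le: "rd A P (carrier P) \<subseteq> ?N" by (rule P.rd_covered)
  obtain Y where Y: "submodule Y A P" "?N <+>\<^bsub>P\<^esub> Y = carrier P" "?N \<inter> Y \<subseteq> rd A P (carrier P)"
    by (rule complement_mod_rd[OF fg N0(1) le])
  have "Y = carrier P"
  proof (rule ccontr)
    assume "Y \<noteq> carrier P"
    then have "?N <+>\<^bsub>P\<^esub> Y \<subseteq> ?N" by (intro P.lsum_least[OF N0(1) subset_refl] max Y(1))
    then show False using Y(2) N0 P.lsub_subset[OF N0(1)] by auto
  qed
  then have "?N = rd A P (carrier P)" using le Y(3) P.lsub_subset[OF N0(1)] by auto
  then show "rd A P (carrier P) = S <+>\<^bsub>P\<^esub> M" "S <+>\<^bsub>P\<^esub> M \<noteq> carrier P"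
    "submodule N A P \<Longrightarrow> N \<noteq> carrier P \<Longrightarrow> N \<subseteq> S <+>\<^bsub>P\<^esub> M"
    using eq N0 max by simp_all
qed

text \<open>Comparability makes zero, \<open>C 1\<close> and \<open>M\<close> the only submodules of
  \<open>M\<close>. The radical lies in \<open>C 1\<close> and is nonzero, since otherwise
  \<open>C 1\<close> would have a complement in \<open>M\<close>, which comparability
  forbids.\<close>

lemma (in left_artinian) uniserial_length_two:
  assumes W: "fg_module A (sub W M)" "lmodule A W" and M: "submodule M A W"
    and uni: "uniserial A (sub W M)" and len: "has_length A (sub W M) 2"
  shows "covered A W {\<zero>\<^bsub>W\<^esub>} (rd A W M)" "rd A W M \<noteq> M"
    "submodule N A W \<Longrightarrow> N \<subseteq> M \<Longrightarrow> N = {\<zero>\<^bsub>W\<^esub>} \<or> N = rd A W M \<or> N = M"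
proof -
  interpret W: lmodule A W by (rule W(2))
  obtain C where C: "C 0 = {\<zero>\<^bsub>W\<^esub>}" "C 2 = M" "\<forall>i<2. covered A (sub W M) (C i) (C (Suc i))"
    using len unfolding has_length_iff sub_simps by blast
  have "covered A (sub W M) (C 0) (C (Suc 0))" "covered A (sub W M) (C 1) (C (Suc 1))"
    using spec[OF C(3), of 0] spec[OF C(3), of 1] by simp_all
  then have c1: "covered A W {\<zero>\<^bsub>W\<^esub>} (C 1)" and c2: "covered A W (C 1) M"
    using C(1,2) by (simp_all add: covered_sub_iff[OF W(2) M] numeral_2_eq_2)
  have C1: "submodule (C 1) A W" "C 1 \<subset> M" using c2 by (auto simp: covered_def)
  have comp: "N \<subseteq> K \<or> K \<subseteq> N" if "submodule N A W" "N \<subseteq> M" "submodule K A W" "K \<subseteq> M" for N K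
    using uni that unfolding uniserial_def submodule_sub_iff[OF W(2) M] by blast
  have subs: "N = {\<zero>\<^bsub>W\<^esub>} \<or> N = C 1 \<or> N = M" if N: "submodule N A W" "N \<subseteq> M" for N
  proof -
    consider "N \<subseteq> C 1" | "C 1 \<subseteq> N" using comp[OF N C1(1)] C1(2) by blast
    then show ?thesis
    proof cases
      case 1
      then show ?thesis using c1 N(1) W.lsub_zero[OF N(1)] unfolding covered_def by (metis empty_subsetI insert_subset)
    next
      case 2
      then show ?thesis using c2 N unfolding covered_def by metis
    qed
  qed
  have Mc: "M \<subseteq> carrier W" by (rule W.lsub_subset[OF M])
  have rM: "submodule (rd A W M) A W" "rd A W M \<subseteq> M" using W.rd_submodule[OF Mc] W.rd_subset[OF M] by auto
  have le: "rd A W M \<subseteq> C 1" by (rule W.rd_covered[OF c2])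
  have ne: "rd A W M \<noteq> {\<zero>\<^bsub>W\<^esub>}"
  proof
    assume z: "rd A W M = {\<zero>\<^bsub>W\<^esub>}"
    have r: "rd A (sub W M) (carrier (sub W M)) = {\<zero>\<^bsub>W\<^esub>}" using rd_sub[OF W(2) M subset_refl] z by simp
    have C1': "submodule (C 1) A (sub W M)" using C1 by (simp add: submodule_sub_iff[OF W(2) M])
    have "rd A (sub W M) (carrier (sub W M)) \<subseteq> C 1" using r W.lsub_zero[OF C1(1)] by simp
    from complement_mod_rd[OF W(1) C1' this]
    obtain Y where Y: "submodule Y A (sub W M)" "C 1 <+>\<^bsub>sub W M\<^esub> Y = carrier (sub W M)"
      "C 1 \<inter> Y \<subseteq> rd A (sub W M) (carrier (sub W M))" by metis
    have Y': "submodule Y A W" "Y \<subseteq> M" using Y(1) by (simp_all add: submodule_sub_iff[OF W(2) M])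
    consider "C 1 \<subseteq> Y" | "Y \<subseteq> C 1" using comp[OF Y' C1(1)] C1(2) by blast
    then show False
    proof cases
      case 1
      then have "C 1 \<subseteq> {\<zero>\<^bsub>W\<^esub>}" using Y(3) r by blast
      then show False using c1 by (auto simp: covered_def)
    next
      case 2
      then have "C 1 <+>\<^bsub>W\<^esub> Y \<subseteq> C 1" by (intro W.lsum_least C1) auto
      then show False using Y(2) C1(2) by auto
    qed
  qed
  have rC: "rd A W M = C 1" using subs[OF rM] ne le C1(2) by auto
  show "covered A W {\<zero>\<^bsub>W\<^esub>} (rd A W M)" "rd A W M \<noteq> M" using rC c1 C1(2) by auto
  show "N = {\<zero>\<^bsub>W\<^esub>} \<or> N = rd A W M \<or> N = M" if "submodule N A W" "N \<subseteq> M"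
    unfolding rC by (rule subs[OF that])
qed

text \<open>Condition (c) speaks about modules on the fixed carrier type. It is applied to a
  representative of \<open>P\<close>, and the embedding of the simple summand into its envelope is
  carried back.\<close>

lemma quadri_biserial_envelope:
  fixes A :: "('a, 'r) ring_scheme" and P :: "('a, 'b) module"
  assumes qb: "quadri_biserial k \<phi> A" and pr: "projective_module A P" and ind: "indecomposable A P"
    and dec: "direct_decomp A P (rad_pow A 1 P) S M"
    and S: "simple_module A (sub P S)" and M: "uniserial A (sub P M)" "has_length A (sub P M) 2"
  obtains E :: "'a fgmod" and j where "injective_module A E" "uniserial A E" "j \<in> module_hom A (sub P S) E"
    "\<And>s. s \<in> S \<Longrightarrow> j s = \<zero>\<^bsub>E\<^esub> \<Longrightarrow> s = \<zero>\<^bsub>P\<^esub>"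
proof -
  have fg: "fg_module A P" using pr by (simp add: projective_module_def)
  interpret P: lmodule A P by (rule fg_lmodule[OF fg])
  obtain P' :: "'a fgmod" and f where P': "fg_module A P'" and f: "f \<in> module_hom A P P'"
    "bij_betw f (carrier P) (carrier P')"
    using fg_module_representative[OF fg] by blast
  interpret f: lhom A P P' f by (intro lhomI P.lmodule_axioms fg_lmodule P' f)
  note P'l = f.Y.lmodule_axioms
  have inj: "inj_on f (carrier P)" and onto: "f ` carrier P = carrier P'" using f(2) by (auto simp: bij_betw_def)
  have s: "submodule S A P" "submodule M A P" using dec by (auto simp: direct_decomp_def)
  note s' = f.image_submodule[OF s(1)] f.image_submodule[OF s(2)]
  have d: "direct_decomp A P' (rad_pow A 1 P') (f ` S) (f ` M)"
  proof -
    have "f ` rad_pow A 1 P = rad_pow A 1 P'"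
      unfolding P.rad_pow_1 f.Y.rad_pow_1 using f.image_rd[OF subset_refl] onto by simp
    then show ?thesis using direct_decomp_image[OF f.lhom_axioms inj dec] by metis
  qed
  have r: "lhom A (sub P K) (sub P' (f ` K)) f" "bij_betw f (carrier (sub P K)) (carrier (sub P' (f ` K)))"
    if K: "submodule K A P" for K
  proof -
    show "lhom A (sub P K) (sub P' (f ` K)) f"
      by (intro lhomI P.sub_lmodule f.Y.sub_lmodule K f.image_submodule
          hom_into_sub[OF hom_restrict[OF P.lmodule_axioms P'l K f(1)]]) simp
    show "bij_betw f (carrier (sub P K)) (carrier (sub P' (f ` K)))"
      using inj_on_subset[OF inj P.lsub_subset[OF K]] by (simp add: bij_betw_def)
  qed
  have "covered A P' (f ` {\<zero>\<^bsub>P\<^esub>}) (f ` S)"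
    using covered_image[OF f.lhom_axioms f(2)] S simple_sub_iff[OF P.lmodule_axioms s(1)] by blast
  then have S': "simple_module A (sub P' (f ` S))"
    using simple_sub_iff[OF P'l s'(1)] by simp
  have M': "uniserial A (sub P' (f ` M))"
    using uniserial_image[OF r(1)[OF s(2)] _ M(1)] by simp
  have l': "has_length A (sub P' (f ` M)) 2"
    by (rule has_length_iso[OF r(1)[OF s(2)] r(2)[OF s(2)] M(2)])
  have "uniserial_envelope A (sub P' (f ` S))"
    using qb projective_iso[OF f.lhom_axioms f(2) pr] indecomposable_iso[OF f.lhom_axioms f(2) ind] d S' M' l'
    unfolding quadri_biserial_def Let_def by blast
  then obtain E :: "'a fgmod" and e where E: "injective_envelope A (sub P' (f ` S)) E e" "uniserial A E"
    unfolding uniserial_envelope_def by blast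
  then have Ei: "injective_module A E" and e: "e \<in> module_hom A (sub P' (f ` S)) E" and ei: "inj_on e (f ` S)"
    by (auto simp: injective_envelope_def)
  have El: "lmodule A E" using Ei by (simp add: injective_module_def fg_lmodule)
  interpret fS: lhom A "sub P S" "sub P' (f ` S)" f by (rule r(1)[OF s(1)])
  interpret e: lhom A "sub P' (f ` S)" E e by (intro lhomI f.Y.sub_lmodule s' El e)
  show thesis
  proof (rule that[OF Ei E(2) hom_comp[OF fS.f e]])
    fix x assume x: "x \<in> S" "e (f x) = \<zero>\<^bsub>E\<^esub>"
    then have "f x = \<zero>\<^bsub>P'\<^esub>" using e.inj_iff ei by simp
    then show "x = \<zero>\<^bsub>P\<^esub>" using f.inj_iff inj x(1) P.lsub_carrier[OF s(1)] by blast
  qed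
qed

theorem proposition4p4p1:
  fixes k :: "('k, 's) ring_scheme" and \<phi> :: "'k \<Rightarrow> 'a" and A :: "('a, 'r) ring_scheme"
    and P :: "('a, 'b) module" and S M :: "'b set"
  assumes "quadri_biserial k \<phi> A"
    and "projective_module A P" and "biserial_module A P"
    and "direct_decomp A P (rad_pow A 1 P) S M"
    and "simple_module A (sub P S)"
    and "uniserial A (sub P M)" and "has_length A (sub P M) 2"
    and "uniserial_envelope A (top_pow A 1 (sub P M))"
  shows "(\<exists>f g. almost_split_sequence A (top_pow A 1 (sub P M)) (top_pow A 2 P) (quot P M) f g) \<and>
    (\<exists>f g. almost_split_sequence A (top_pow A 2 P)
       (dsum (quot P (socle A P)) (quot P M)) (top_pow A 1 P) f g)"
proof -
  have fgP: "fg_module A P" and ind: "indecomposable A P" using assms(3) by (auto simp: biserial_module_def)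
  interpret P: lmodule A P by (rule fg_lmodule[OF fgP])
  have bis: "biserial_algebra k \<phi> A" using assms(1) by (simp add: quadri_biserial_def)
  have art: "artin_algebra k \<phi> A" using bis by (simp add: biserial_algebra_def)
  interpret LA: left_artinian A by (rule artin_algebra_left_artinian[OF art])
  \<comment> \<open>Condition (a) and the biserial condition, both taken for \<open>A\<close> itself
    among the two rings of the definition.\<close>
  have indec: "(\<exists>n\<le>4. has_length A Y n) \<and> (uniserial A Y \<or> biserial_module A Y)"
    if "projective_module A Y" "indecomposable A Y" for Y :: "'a fgmod"
    using assms(1) bis that unfolding quadri_biserial_def biserial_algebra_def Let_def by blast
  interpret FL: finite_length_ring A
    by (rule LA.finite_length_ringI) (use indec in blast)
  have S: "submodule S A P" and M: "submodule M A P" and SM: "S \<inter> M = {\<zero>\<^bsub>P\<^esub>}"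
    using assms(4) by (auto simp: direct_decomp_def)
  have cS: "covered A P {\<zero>\<^bsub>P\<^esub>} S" using assms(5) simple_sub_iff[OF P.lmodule_axioms S] by simp
  note Mfacts = LA.uniserial_length_two[OF FL.fg_submodule[OF fgP M] P.lmodule_axioms M assms(6,7)]
  have nz: "S \<noteq> {\<zero>\<^bsub>P\<^esub>}" "M \<noteq> {\<zero>\<^bsub>P\<^esub>}"
    using cS Mfacts(1) P.rd_subset[OF M] P.lsub_zero[OF M] by (auto simp: covered_def)
  note rad = LA.biserial_radical[OF assms(3,4) nz]
  obtain ES :: "'a fgmod" and jS where ES: "injective_module A ES" "uniserial A ES" "jS \<in> module_hom A (sub P S) ES"
    "\<And>s. s \<in> S \<Longrightarrow> jS s = \<zero>\<^bsub>ES\<^esub> \<Longrightarrow> s = \<zero>\<^bsub>P\<^esub>"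
    using quadri_biserial_envelope[OF assms(1,2) ind assms(4-7)] by blast
  have Ml: "lmodule A (sub P M)" by (rule P.sub_lmodule[OF M])
  have topM: "top_pow A 1 (sub P M) = quot (sub P M) (rd A P M)"
    unfolding top_pow_def lmodule.rad_pow_1[OF Ml] using rd_sub[OF P.lmodule_axioms M subset_refl] by simp
  have LM: "submodule (rd A P M) A (sub P M)"
    using Mfacts(1) P.rd_subset[OF M] by (simp add: covered_def submodule_sub_iff[OF P.lmodule_axioms M])
  obtain EN :: "'a fgmod" and e where E: "injective_envelope A (quot (sub P M) (rd A P M)) EN e" "uniserial A EN"
    using assms(8) unfolding topM uniserial_envelope_def by blast
  then have EN: "injective_module A EN" and e: "e \<in> module_hom A (quot (sub P M) (rd A P M)) EN"
    and ei: "inj_on e (carrier (quot (sub P M) (rd A P M)))"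
    by (auto simp: injective_envelope_def)
  have ENl: "lmodule A EN" using EN by (simp add: injective_module_def fg_lmodule)
  interpret e: lhom A "quot (sub P M) (rd A P M)" EN e by (intro lhomI quot_lmodule Ml LM ENl e)
  \<comment> \<open>Composing the projection of \<open>M\<close> onto its top with the envelope
    gives a map whose kernel is exactly the radical of \<open>M\<close>.\<close>
  define jM where "jM = (\<lambda>x. e (rd A P M +>\<^bsub>sub P M\<^esub> x))"
  have jM: "jM \<in> module_hom A (sub P M) EN" unfolding jM_def by (rule hom_comp[OF quot_hom[OF Ml LM] e])
  have jMk: "jM m = \<zero>\<^bsub>EN\<^esub> \<longleftrightarrow> m \<in> rd A P M" if m: "m \<in> M" for m
  proof -
    have c: "rd A P M +>\<^bsub>sub P M\<^esub> m \<in> carrier (quot (sub P M) (rd A P M))" using m by simp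
    have "jM m = \<zero>\<^bsub>EN\<^esub> \<longleftrightarrow> rd A P M +>\<^bsub>sub P M\<^esub> m = \<zero>\<^bsub>quot (sub P M) (rd A P M)\<^esub>"
      unfolding jM_def using bspec[OF iffD1[OF e.inj_iff ei] c] e.zero by metis
    then show ?thesis using quot_kernel[OF Ml LM, of m] m by simp
  qed
  interpret B: biserial_projective A P S M ES EN jS jM
    by (rule biserial_projective.intro[OF FL.finite_length_ring_axioms], rule biserial_projective_axioms.intro;
        (fact assms(2) S M SM rad(1,2) cS Mfacts(1,2) ES(1-3) EN E(2) jM |
         (rule rad(3) Mfacts(3) ES(4) jMk indec; assumption)))
  have top2: "top_pow A 2 P = quot P B.L"
    unfolding top_pow_def P.rad_pow_2 B.rdP B.rdR ..
  have top1: "top_pow A 1 P = quot P B.R"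
    unfolding top_pow_def P.rad_pow_1 B.rdP ..
  obtain g where "g \<in> module_hom A (quot P B.L) (quot P M)" "\<And>x. x \<in> carrier P \<Longrightarrow> g (B.proj B.L x) = B.proj M x"
    by (rule B.proj_step[OF B.Lsub M B.L_le_M]) (rule that)
  then have "\<exists>f. almost_split_sequence A (quot (sub P M) B.L) (quot P B.L) (quot P M) f g"
    by (rule B.almost_split_1)
  then show ?thesis
    using B.almost_split_2 unfolding topM top2 top1 B.socle_eq by blast
qed

end
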